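(* Let $(X,\rho,\mu)$ be a space of homogeneous type and let $T$ be a Calderón–Zygmund operator on $X$. Then for any weight $w$ and any $r>1$, $$\|Tf\|_{L^{1,\infty}(w)}\le C\,\log(e+r')\,\|f\|_{L^1(M_rw)}$$ for all $f$, where $r'=r/(r-1)$ and $C$ is a constant depending only on $(X,\rho,\mu)$ and on $T$.
   Context: Space of homogeneous type: a triple $(X,\rho,\mu)$ where $\rho$ is a quasimetric ($\rho(x,y)=0$ iff $x=y$; symmetric; $\rho(x,z)\le\kappa(\rho(x,y)+\rho(y,z))$ for some constant $\kappa>0$) and $\mu$ is a positive doubling measure: $0<\mu(B(x_0,2r))\le D_\mu\,\mu(B(x_0,r))<\infty$ for all balls. $Mf(x)=\sup_{B\ni x}\frac1{\mu(B)}\int_B|f|\,d\mu$ is the Hardy–Littlewood maximal operator (sup over balls containing $x$) and $M_rw=(M(w^r))^{1/r}$. A weight is a locally integrable function on $X$ with values in $(0,\infty)$ a.e.; $\|f\|_{L^1(v)}=\int_X|f|v\,d\mu$ and $\|g\|_{L^{1,\infty}(w)}=\sup_{\lambda>0}\lambda\, w(\{x\in X:|g(x)|>\lambda\})$ with $w(E)=\int_E w\,d\mu$. Calderón–Zygmund kernel: $K:X\times X\setminus\{x=y\}\to\mathbb R$ such that for some $\eta>0$, $C_K<\infty$ and all $x_0\ne y$, $|K(x_0,y)|\le \frac{C_K}{\mu(B(x_0,\rho(x_0,y)))}$, and whenever $\rho(x_0,x)\le\eta\rho(x_0,y)$, both $|K(x,y)-K(x_0,y)|$ and $|K(y,x)-K(y,x_0)|$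 are at most $\left(\frac{\rho(x,x_0)}{\rho(x_0,y)}\right)^{\eta}\frac1{\mu(B(x_0,\rho(x_0,y)))}$. A Calderón–Zygmund operator is a linear operator $T$ bounded on $L^2(X,\mu)$ with $Tf(x)=\int_X K(x,y)f(y)\,d\mu(y)$ for $x$ outside the support of $f$. The inequality is understood for $f\in L^2(X,\mu)$, where $Tf$ is defined (the right side may be infinite).
   Formalization: The measure μ is additionally assumed to be Borel regular for the quasimetric topology (every measurable set lies in a Borel set of equal measure); for doubling measures on arbitrary larger σ-algebras the inequality fails, already for T the identity. *)

theory Defs
  imports "HOL-Analysis.Analysis"
begin

text \<open>
  The underlying set is \<open>space M\<close>, the measure is \<open>M\<close>, and only the values of
  \<open>\<rho>\<close> on \<open>space M\<close> matter.
\<close>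

definition quasimetric_on :: "'a set \<Rightarrow> ('a \<Rightarrow> 'a \<Rightarrow> real) \<Rightarrow> bool" where
  "quasimetric_on X \<rho> \<longleftrightarrow>
     (\<forall>x\<in>X. \<forall>y\<in>X. 0 \<le> \<rho> x y) \<and>
     (\<forall>x\<in>X. \<forall>y\<in>X. \<rho> x y = 0 \<longleftrightarrow> x = y) \<and>
     (\<forall>x\<in>X. \<forall>y\<in>X. \<rho> x y = \<rho> y x) \<and>
     (\<exists>\<kappa>>0. \<forall>x\<in>X. \<forall>y\<in>X. \<forall>z\<in>X. \<rho> x z \<le> \<kappa> * (\<rho> x y + \<rho> y z))"

definition qball :: "'a set \<Rightarrow> ('a \<Rightarrow> 'a \<Rightarrow> real) \<Rightarrow> 'a \<Rightarrow> real \<Rightarrow> 'a set" where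
  "qball X \<rho> x r = {y \<in> X. \<rho> x y < r}"

definition qballs :: "'a set \<Rightarrow> ('a \<Rightarrow> 'a \<Rightarrow> real) \<Rightarrow> 'a set set" where
  "qballs X \<rho> = {qball X \<rho> x r | x r. x \<in> X \<and> 0 < r}"

text \<open>The topology of a quasimetric; the balls themselves need not be open in it.\<close>

definition qopen :: "'a set \<Rightarrow> ('a \<Rightarrow> 'a \<Rightarrow> real) \<Rightarrow> 'a set \<Rightarrow> bool" where
  "qopen X \<rho> U \<longleftrightarrow> U \<subseteq> X \<and> (\<forall>x\<in>U. \<exists>r>0. qball X \<rho> x r \<subseteq> U)"

definition qborel_sets :: "'a set \<Rightarrow> ('a \<Rightarrow> 'a \<Rightarrow> real) \<Rightarrow> 'a set set" where
  "qborel_sets X \<rho> = sigma_sets X {U. qopen X \<rho> U}"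

text \<open>
  As usual for spaces of homogeneous type, the measure is tied to the topology: it is
  Borel regular. This covers both a measure on the Borel sets and its completion.
  (On an arbitrary larger sigma-algebra even Lebesgue's differentiation theorem fails.)
  Balls are required to be measurable separately since they need not be Borel.
\<close>

definition qborel_regular :: "'a measure \<Rightarrow> ('a \<Rightarrow> 'a \<Rightarrow> real) \<Rightarrow> bool" where
  "qborel_regular M \<rho> \<longleftrightarrow>
     qborel_sets (space M) \<rho> \<subseteq> sets M \<and>
     (\<forall>A\<in>sets M. \<exists>B\<in>qborel_sets (space M) \<rho>. A \<subseteq> B \<and> emeasure M B = emeasure M A)"

definition doubling_measure :: "'a measure \<Rightarrow> ('a \<Rightarrow> 'a \<Rightarrow> real) \<Rightarrow> bool" where
  "doubling_measure M \<rho> \<longleftrightarrow>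
     qballs (space M) \<rho> \<subseteq> sets M \<and>
     (\<exists>D::real. \<forall>x\<in>space M. \<forall>r>0.
        0 < emeasure M (qball (space M) \<rho> x (2 * r)) \<and>
        emeasure M (qball (space M) \<rho> x (2 * r))
          \<le> ennreal D * emeasure M (qball (space M) \<rho> x r) \<and>
        ennreal D * emeasure M (qball (space M) \<rho> x r) < \<infinity>)"

definition homogeneous_type_space :: "'a measure \<Rightarrow> ('a \<Rightarrow> 'a \<Rightarrow> real) \<Rightarrow> bool" where
  "homogeneous_type_space M \<rho> \<longleftrightarrow>
     quasimetric_on (space M) \<rho> \<and> qborel_regular M \<rho> \<and> doubling_measure M \<rho>"

definition weight :: "'a measure \<Rightarrow> ('a \<Rightarrow> 'a \<Rightarrow> real) \<Rightarrow> ('a \<Rightarrow> real) \<Rightarrow> bool" where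
  "weight M \<rho> w \<longleftrightarrow>
     w \<in> borel_measurable M \<and>
     (\<forall>B\<in>qballs (space M) \<rho>. set_integrable M B w) \<and>
     (AE x in M. 0 < w x)"

definition hl_maximal ::
    "'a measure \<Rightarrow> ('a \<Rightarrow> 'a \<Rightarrow> real) \<Rightarrow> ('a \<Rightarrow> real) \<Rightarrow> 'a \<Rightarrow> ennreal" where
  "hl_maximal M \<rho> f x =
     (SUP B\<in>{B \<in> qballs (space M) \<rho>. x \<in> B}.
        (\<integral>\<^sup>+y\<in>B. ennreal \<bar>f y\<bar> \<partial>M) / emeasure M B)"

text \<open>Powers of extended nonnegative reals, for exponents \<open>p > 0\<close>.\<close>

definition ennreal_powr :: "ennreal \<Rightarrow> real \<Rightarrow> ennreal" where
  "ennreal_powr a p = (if a = \<infinity> then \<infinity> else ennreal (enn2real a powr p))"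

definition hl_maximal_pow ::
    "'a measure \<Rightarrow> ('a \<Rightarrow> 'a \<Rightarrow> real) \<Rightarrow> real \<Rightarrow> ('a \<Rightarrow> real) \<Rightarrow> 'a \<Rightarrow> ennreal" where
  "hl_maximal_pow M \<rho> r w x = ennreal_powr (hl_maximal M \<rho> (\<lambda>y. w y powr r) x) (1 / r)"

text \<open>
  The convention \<open>0 * \<infinity> = 0\<close> of \<^typ>\<open>ennreal\<close> applies to \<open>\<bar>f x\<bar> * v x\<close>.
\<close>

definition weighted_L1_norm :: "'a measure \<Rightarrow> ('a \<Rightarrow> ennreal) \<Rightarrow> ('a \<Rightarrow> real) \<Rightarrow> ennreal" where
  "weighted_L1_norm M v f = (\<integral>\<^sup>+x. ennreal \<bar>f x\<bar> * v x \<partial>M)"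

definition weighted_weak_L1_norm ::
    "'a measure \<Rightarrow> ('a \<Rightarrow> real) \<Rightarrow> ('a \<Rightarrow> real) \<Rightarrow> ennreal" where
  "weighted_weak_L1_norm M w g =
     (SUP l\<in>{0<..}. ennreal l * (\<integral>\<^sup>+x\<in>{x \<in> space M. l < \<bar>g x\<bar>}. ennreal (w x) \<partial>M))"

definition L2_functions :: "'a measure \<Rightarrow> ('a \<Rightarrow> real) set" where
  "L2_functions M = {f \<in> borel_measurable M. integrable M (\<lambda>x. (f x)\<^sup>2)}"

definition L2_norm_of :: "'a measure \<Rightarrow> ('a \<Rightarrow> real) \<Rightarrow> real" where
  "L2_norm_of M f = sqrt (LINT x|M. (f x)\<^sup>2)"

text \<open>
  The support of a function that is given up to null sets: the complement of the
  points near which it vanishes almost everywhere.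
\<close>

definition ess_support ::
    "'a measure \<Rightarrow> ('a \<Rightarrow> 'a \<Rightarrow> real) \<Rightarrow> ('a \<Rightarrow> real) \<Rightarrow> 'a set" where
  "ess_support M \<rho> f =
     {x \<in> space M. \<not> (\<exists>r>0. AE y in M. y \<in> qball (space M) \<rho> x r \<longrightarrow> f y = 0)}"

text \<open>
  The kernel lives off the diagonal, so the diagonal values of \<open>K\<close> are never
  constrained (hence the guard \<open>x \<noteq> y\<close>, which matters only if \<open>\<eta> \<ge> 1\<close>).
\<close>

definition calderon_zygmund_kernel ::
    "'a measure \<Rightarrow> ('a \<Rightarrow> 'a \<Rightarrow> real) \<Rightarrow> ('a \<Rightarrow> 'a \<Rightarrow> real) \<Rightarrow> bool" where
  "calderon_zygmund_kernel M \<rho> K \<longleftrightarrow>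
     (\<exists>\<eta>>0. \<exists>C. \<forall>x0\<in>space M. \<forall>y\<in>space M. x0 \<noteq> y \<longrightarrow>
        \<bar>K x0 y\<bar> \<le> C / measure M (qball (space M) \<rho> x0 (\<rho> x0 y)) \<and>
        (\<forall>x\<in>space M. x \<noteq> y \<and> \<rho> x0 x \<le> \<eta> * \<rho> x0 y \<longrightarrow>
           \<bar>K x y - K x0 y\<bar> \<le>
             (\<rho> x x0 / \<rho> x0 y) powr \<eta> * (1 / measure M (qball (space M) \<rho> x0 (\<rho> x0 y))) \<and>
           \<bar>K y x - K y x0\<bar> \<le>
             (\<rho> x x0 / \<rho> x0 y) powr \<eta> * (1 / measure M (qball (space M) \<rho> x0 (\<rho> x0 y)))))"

text \<open>
  An operator on \<open>L\<^sup>2\<close> acts on representatives and its values are determined almost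
  everywhere; linearity and boundedness make it respect almost everywhere equality.
  In the representation by the kernel the integral converges absolutely: off the diagonal
  \<open>K\<close> is continuous, and the size condition with doubling bounds the tail.
\<close>

definition calderon_zygmund_operator ::
    "'a measure \<Rightarrow> ('a \<Rightarrow> 'a \<Rightarrow> real) \<Rightarrow> (('a \<Rightarrow> real) \<Rightarrow> 'a \<Rightarrow> real) \<Rightarrow> bool" where
  "calderon_zygmund_operator M \<rho> T \<longleftrightarrow>
     (\<forall>f\<in>L2_functions M. T f \<in> L2_functions M) \<and>
     (\<forall>f\<in>L2_functions M. \<forall>g\<in>L2_functions M. \<forall>a b.
        AE x in M. T (\<lambda>y. a * f y + b * g y) x = a * T f x + b * T g x) \<and>
     (\<exists>A. \<forall>f\<in>L2_functions M. L2_norm_of M (T f) \<le> A * L2_norm_of M f) \<and>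
     (\<exists>K. calderon_zygmund_kernel M \<rho> K \<and>
        (\<forall>f\<in>L2_functions M. AE x in M. x \<notin> ess_support M \<rho> f \<longrightarrow>
           T f x = (LINT y|M. K x y * f y)))"

end

theory Submission
  imports Defs
begin

text \<open>
  After averaging over the cells of a dyadic grid the bilinear form \<open>\<integral> T f \<cdot> v\<close> becomes a finite sum over
  pairs of cells. Subtracting from \<open>f\<close> and \<open>v\<close> their averages over the Whitney cubes of the set where
  these averages are large leaves errors controlled by the \<open>L\<^sup>2\<close> bound and the smoothness of the
  kernel; iterating inside the Whitney cubes dominates the form by a sum
  \<open>\<Sum> \<langle>v\<rangle> \<langle>f\<rangle> \<mu>(R)\<close> over a sparse family of cubes \<open>R\<close>.

  To bound the weight \<open>U\<close> of the part of \<open>{\<bar>T f\<bar> > 1}\<close> away from the cubes with \<open>\<langle>f\<rangle> > 1\<close>, take \<open>v\<close> to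
  be the sign of \<open>T f\<close> times \<open>w\<close> on this part, and split the sparse family according to
  \<open>\<langle>f\<rangle> \<approx> 2\<^bsup>-k\<^esup>\<close>. Each \<open>k\<close> contributes at most a constant times \<open>I = \<integral> \<bar>f\<bar> M\<^sub>r w\<close>. By the power mean
  inequality and the maximal theorem it also contributes at most \<open>2\<^bsup>-k/2\<^esup> (I + r' U)\<close>, up to a constant.
  Using the first bound for the first \<open>C log(e + r')\<close> values of \<open>k\<close> and the second one for the rest,
  the term in \<open>U\<close> is at most \<open>U/2\<close> and can be absorbed. The cubes with \<open>\<langle>f\<rangle> > 1\<close> are handled by the
  weighted maximal inequality, and the passage to the limit in the grids uses that the averages of
  an integrable function converge in \<open>L\<^sup>1\<close>, which is where the regularity of the measure enters.
\<close>

section \<open>Trees of cubes\<close>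

text \<open>When pairs of cells are handed to Whitney cubes, the kernel that remains must still be
  regular on these cubes in both variables. In the second variable this is automatic, since whether
  a pair is removed depends only on the Whitney cube of the second cell. In the first variable the
  kernel can jump; but Whitney cubes lie in the bad set together with their neighbourhoods, so it
  jumps only at distances comparable to the cube, where the size bound suffices. Letting
  \<open>f\<close> live on a cube and \<open>v\<close> on its neighbourhood keeps the interactions
  across cube boundaries without a second grid.

  The factor 2^(-k/2) comes from a geometric mean: half of the average of the weight is estimated by
  \<open>M_r w\<close>, the other half by the maximal theorem with exponent 2 - 1/r, whose constant
  is of order r'.

  Absorbing U/2 requires U to be finite, so the level set is first cut down to a part of a ball
  where the weight is bounded. All constants are functions of those of the space and of the
  operator, fixed before the centre and the size of the grid, so the space can be exhausted by
  balls.\<close>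

lemma sum_geometric_reverse_le:
  fixes th :: real
  assumes "0 < th" "th < 1"
  shows "(\<Sum>l\<in>{k..p}. th ^ (p - l)) \<le> 1 / (1 - th)"
proof -
  have "(\<Sum>l\<in>{k..p}. th ^ (p - l)) = (\<Sum>j\<in>(\<lambda>l. p - l) ` {k..p}. th ^ j)"
    by (subst sum.reindex) (auto simp: inj_on_def)
  also have "\<dots> \<le> (\<Sum>j<Suc p. th ^ j)"
    using assms by (intro sum_mono2) auto
  also have "\<dots> = (1 - th ^ Suc p) / (1 - th)"
    using assms sum_gp_strict[of th "Suc p"] by simp
  also have "\<dots> \<le> 1 / (1 - th)"
    using assms by (intro divide_right_mono) auto
  finally show ?thesis .
qed

text \<open>A finite model of nested dyadic cubes: \<open>Om\<close> consists of the cells of the finest level \<open>n\<close>,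
  \<open>anc m a\<close> names the cube of level \<open>m\<close> containing \<open>a\<close> (level \<open>0\<close> is the root), and \<open>nr m a b\<close>
  says that the cubes of level \<open>m\<close> containing \<open>a\<close> and \<open>b\<close> are close to each other.\<close>

locale cube_tree =
  fixes Om :: "'c set" and mu :: "'c \<Rightarrow> real" and n :: nat
    and anc :: "nat \<Rightarrow> 'c \<Rightarrow> 'd" and nr :: "nat \<Rightarrow> 'c \<Rightarrow> 'c \<Rightarrow> bool" and D :: real
  assumes finite_Om [simp]: "finite Om"
    and mu_pos: "a \<in> Om \<Longrightarrow> 0 < mu a"
    and D_ge_1: "1 \<le> D"
    and anc_inj: "a \<in> Om \<Longrightarrow> b \<in> Om \<Longrightarrow> anc n a = anc n b \<Longrightarrow> a = b"
    and anc_nest: "a \<in> Om \<Longrightarrow> b \<in> Om \<Longrightarrow> m < n \<Longrightarrow> anc (Suc m) a = anc (Suc m) b \<Longrightarrow> anc m a = anc m b"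
    and anc_root: "a \<in> Om \<Longrightarrow> b \<in> Om \<Longrightarrow> anc 0 a = anc 0 b"
    and nr_refl: "a \<in> Om \<Longrightarrow> m \<le> n \<Longrightarrow> nr m a a"
    and nr_sym: "a \<in> Om \<Longrightarrow> b \<in> Om \<Longrightarrow> m \<le> n \<Longrightarrow> nr m a b \<Longrightarrow> nr m b a"
    and nr_cong: "a \<in> Om \<Longrightarrow> a' \<in> Om \<Longrightarrow> b \<in> Om \<Longrightarrow> m \<le> n \<Longrightarrow> anc m a = anc m a' \<Longrightarrow> nr m a b \<Longrightarrow> nr m a' b"
    and nr_comp: "a \<in> Om \<Longrightarrow> b \<in> Om \<Longrightarrow> c \<in> Om \<Longrightarrow> m < n \<Longrightarrow> nr (Suc m) a b \<Longrightarrow> nr (Suc m) b c \<Longrightarrow> nr m a c"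
    and nbh_doubling: "a \<in> Om \<Longrightarrow> m \<le> n \<Longrightarrow>
      (\<Sum>b\<in>{b\<in>Om. nr m a b}. mu b) \<le> D * (\<Sum>b\<in>{b\<in>Om. anc m b = anc m a}. mu b)"
    and cube_doubling: "a \<in> Om \<Longrightarrow> m < n \<Longrightarrow>
      (\<Sum>b\<in>{b\<in>Om. anc m b = anc m a}. mu b) \<le> D * (\<Sum>b\<in>{b\<in>Om. anc (Suc m) b = anc (Suc m) a}. mu b)"
begin

definition cube :: "nat \<Rightarrow> 'c \<Rightarrow> 'c set" where
  "cube m a = {b\<in>Om. anc m b = anc m a}"

definition nbh :: "nat \<Rightarrow> 'c \<Rightarrow> 'c set" where
  "nbh m a = {b\<in>Om. nr m a b}"

definition mass :: "'c set \<Rightarrow> real" where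
  "mass A = (\<Sum>a\<in>A. mu a)"

text \<open>The level is part of a cube: one set of cells can be the cube of several levels, with a
  different neighbourhood \<open>cube_nbh\<close> at each.\<close>

definition cubes :: "(nat \<times> 'c set) set" where
  "cubes = {(l, cube l c) | l c. l \<le> n \<and> c \<in> Om}"

definition cube_nbh :: "nat \<times> 'c set \<Rightarrow> 'c set" where
  "cube_nbh R = {a\<in>Om. \<exists>b\<in>snd R. nr (fst R) a b}"

lemma cube_subset: "cube m a \<subseteq> Om" and nbh_subset: "nbh m a \<subseteq> Om"
  by (auto simp: cube_def nbh_def)

lemma finite_cube [simp]: "finite (cube m a)" and finite_nbh [simp]: "finite (nbh m a)"
  by (auto simp: cube_def nbh_def)

lemma self_in_cube: "a \<in> Om \<Longrightarrow> a \<in> cube m a"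
  by (simp add: cube_def)

lemma cube_eq: "b \<in> cube m a \<Longrightarrow> cube m b = cube m a"
  by (auto simp: cube_def)

lemma anc_le:
  assumes "a \<in> Om" "b \<in> Om" "l \<le> m" "m \<le> n" "anc m a = anc m b"
  shows "anc l a = anc l b"
  using assms(3-5)
proof (induction m)
  case 0 then show ?case by simp
next
  case (Suc m)
  then show ?case using anc_nest[OF assms(1,2), of m] by (cases "l = Suc m") auto
qed

lemma cube_mono: "a \<in> Om \<Longrightarrow> l \<le> m \<Longrightarrow> m \<le> n \<Longrightarrow> cube m a \<subseteq> cube l a"
  unfolding cube_def by (blast intro: anc_le)

lemma cube_top: "a \<in> Om \<Longrightarrow> cube 0 a = Om"
  unfolding cube_def by (blast intro: anc_root)

lemma cube_bot: "a \<in> Om \<Longrightarrow> cube n a = {a}"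
  unfolding cube_def by (blast intro: anc_inj)

lemma nr_le:
  assumes "a \<in> Om" "b \<in> Om" "l \<le> m" "m \<le> n" "nr m a b"
  shows "nr l a b"
  using assms(3-5)
proof (induction m)
  case 0 then show ?case by simp
next
  case (Suc m)
  then show ?case
    using nr_comp[OF assms(1,2,2), of m] nr_refl[OF assms(2), of "Suc m"] by (cases "l = Suc m") auto
qed

lemma nbh_mono: "a \<in> Om \<Longrightarrow> l \<le> m \<Longrightarrow> m \<le> n \<Longrightarrow> nbh m a \<subseteq> nbh l a"
  unfolding nbh_def by (blast intro: nr_le)

lemma nr_cong2:
  "a \<in> Om \<Longrightarrow> b \<in> Om \<Longrightarrow> b' \<in> Om \<Longrightarrow> m \<le> n \<Longrightarrow> anc m b = anc m b' \<Longrightarrow> nr m a b \<Longrightarrow> nr m a b'"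
  using nr_sym[of a b m] nr_cong[of b b' a m] nr_sym[of b' a m] by simp

lemma nbh_eq:
  assumes "a \<in> Om" "m \<le> n" "b \<in> cube m a"
  shows "nbh m b = nbh m a"
proof -
  have "b \<in> Om" "anc m b = anc m a" using assms(3) by (auto simp: cube_def)
  then have "nr m b x \<longleftrightarrow> nr m a x" if "x \<in> Om" for x
    using nr_cong[of a b x m] nr_cong[of b a x m] assms(1,2) that by auto
  then show ?thesis by (auto simp: nbh_def)
qed

lemma cube_nbh_eq:
  assumes "a \<in> Om" "m \<le> n"
  shows "cube_nbh (m, cube m a) = nbh m a"
proof -
  have "(\<exists>b\<in>cube m a. nr m x b) \<longleftrightarrow> nr m a x" if x: "x \<in> Om" for x
  proof
    assume "\<exists>b\<in>cube m a. nr m x b"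
    then obtain b where b: "b \<in> Om" "anc m b = anc m a" "nr m x b" by (auto simp: cube_def)
    show "nr m a x"
      using nr_cong[OF b(1) assms(1) x assms(2) b(2) nr_sym[OF x b(1) assms(2) b(3)]] .
  next
    assume "nr m a x"
    then show "\<exists>b\<in>cube m a. nr m x b"
      using nr_sym[OF assms(1) x assms(2)] self_in_cube[OF assms(1)] by blast
  qed
  then show ?thesis by (auto simp: cube_nbh_def nbh_def)
qed

lemma cube_subset_nbh: "a \<in> Om \<Longrightarrow> m \<le> n \<Longrightarrow> cube m a \<subseteq> nbh m a"
  using nr_cong2[of a a _ m] nr_refl[of a m] by (auto simp: cube_def nbh_def)

lemma mass_mono: "A \<subseteq> B \<Longrightarrow> B \<subseteq> Om \<Longrightarrow> mass A \<le> mass B"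
  unfolding mass_def using mu_pos finite_subset[OF _ finite_Om]
  by (intro sum_mono2) (auto intro: less_imp_le)

lemma mass_nonneg: "A \<subseteq> Om \<Longrightarrow> 0 \<le> mass A"
  unfolding mass_def using mu_pos by (intro sum_nonneg) (auto intro: less_imp_le)

lemma mass_cube_pos: "a \<in> Om \<Longrightarrow> 0 < mass (cube m a)"
  unfolding mass_def using mu_pos self_in_cube[of a m] cube_subset[of m a]
  by (intro sum_pos) auto

lemma mass_nbh_pos: "a \<in> Om \<Longrightarrow> m \<le> n \<Longrightarrow> 0 < mass (nbh m a)"
  using mass_cube_pos[of a m] mass_mono[OF cube_subset_nbh nbh_subset, of a m] by simp

lemma mass_nbh_le: "a \<in> Om \<Longrightarrow> m \<le> n \<Longrightarrow> mass (nbh m a) \<le> D * mass (cube m a)"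
  using nbh_doubling unfolding mass_def nbh_def cube_def .

lemma mass_cube_le: "a \<in> Om \<Longrightarrow> m < n \<Longrightarrow> mass (cube m a) \<le> D * mass (cube (Suc m) a)"
  using cube_doubling unfolding mass_def cube_def .

lemma mass_cube_nr_le:
  assumes "a \<in> Om" "b \<in> Om" "m \<le> n" "nr m a b"
  shows "mass (cube m b) \<le> D * mass (cube m a)"
proof -
  have "cube m b \<subseteq> nbh m a"
    using assms nr_cong2 by (fastforce simp: cube_def nbh_def)
  then show ?thesis
    using mass_mono[OF _ nbh_subset] mass_nbh_le[OF assms(1,3)] by (meson order_trans)
qed

text \<open>Both the maximal theorem and its weighted version: selecting the maximal large cubes
  amounts to letting each cell vote for the largest one containing it.\<close>

lemma large_cube_cover:
  assumes z: "\<And>a. a \<in> Om \<Longrightarrow> 0 \<le> z a" and u: "\<And>a. a \<in> Om \<Longrightarrow> 0 \<le> u a" and t: "0 < t"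
    and G: "\<And>a l. a \<in> Om \<Longrightarrow> l \<le> n \<Longrightarrow> (\<Sum>b\<in>nbh l a. u b * mu b) \<le> G a * mass (nbh l a)"
  shows "(\<Sum>b\<in>{b\<in>Om. \<exists>l\<le>n. \<exists>c\<in>Om. t * mass (cube l c) < (\<Sum>a\<in>cube l c. z a * mu a) \<and> nr l c b}. u b * mu b)
    \<le> D / t * (\<Sum>a\<in>Om. z a * mu a * G a)"
proof -
  define lg where "lg l a \<longleftrightarrow> l \<le> n \<and> t * mass (cube l a) < (\<Sum>a\<in>cube l a. z a * mu a)" for l a
  define L where "L a = (LEAST l. lg l a)" for a
  define Z where "Z = {a\<in>Om. \<exists>l. lg l a}"
  define H where "H = {b\<in>Om. \<exists>l\<le>n. \<exists>c\<in>Om. t * mass (cube l c) < (\<Sum>a\<in>cube l c. z a * mu a) \<and> nr l c b}"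
  \<comment> \<open>The vote of \<open>a\<close>, spread over the neighbourhood of its cube and
    normalised so that the votes of one selected cube sum to at least 1 there, which is what
    largeness of the cube says. After exchanging the sums, \<open>G\<close> bounds the weight of the
    neighbourhood and \<open>mass_nbh_le\<close> cancels the normalisation.\<close>
  define q where "q a b = (if nr (L a) a b then z a * mu a / (t * mass (cube (L a) a)) else 0)" for a b
  have Z_sub: "Z \<subseteq> Om" and finZ: "finite Z" and H_sub: "H \<subseteq> Om" and finH: "finite H"
    by (auto simp: Z_def H_def)
  have lgL: "lg (L a) a" if "a \<in> Z" for a
    using that unfolding Z_def L_def by (auto intro: LeastI)
  have q_nonneg: "0 \<le> q a b" if "a \<in> Z" for a b
    using that z mu_pos mass_cube_pos t Z_sub unfolding q_def by (auto simp: less_imp_le subset_iff)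
  have one: "1 \<le> (\<Sum>a\<in>Z. q a b)" if "b \<in> H" for b
  proof -
    from that obtain l c where lc: "l \<le> n" "c \<in> Om" "lg l c" "nr l c b" and b: "b \<in> Om"
      by (auto simp: H_def lg_def)
    have l0: "lg (L c) c" "L c \<le> l"
      using lc unfolding L_def by (auto intro: LeastI Least_le)
    have l0n: "L c \<le> n" using l0 lc by simp
    have nb: "nr (L c) c b" using nr_le[OF lc(2) b l0(2) lc(1,4)] .
    \<comment> \<open>Up to level \<open>L c\<close> the cubes around \<open>a\<close> and
      \<open>c\<close> coincide, so all cells of the selected cube vote for it.\<close>
    have La: "L a = L c" "a \<in> Z" "cube (L c) a = cube (L c) c" "nr (L c) a b" "a \<in> Om"
      if a: "a \<in> cube (L c) c" for a
    proof -
      have aO: "a \<in> Om" and anceq: "anc (L c) a = anc (L c) c" using a by (auto simp: cube_def)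
      have ceq: "cube j a = cube j c" if "j \<le> L c" for j
        using anc_le[OF aO lc(2) that l0n anceq] by (simp add: cube_def)
      have lgeq: "lg j a = lg j c" if "j \<le> L c" for j
        using ceq[OF that] by (simp add: lg_def)
      show "L a = L c"
        unfolding L_def[of a]
      proof (rule Least_equality)
        show "lg (L c) a" using lgeq l0 by simp
        fix y assume "lg y a"
        show "L c \<le> y"
        proof (rule ccontr)
          assume "\<not> L c \<le> y"
          then have "lg y c" using lgeq[of y] \<open>lg y a\<close> by simp
          then show False using \<open>\<not> L c \<le> y\<close> by (simp add: L_def Least_le)
        qed
      qed
      show "a \<in> Z" using lgeq[of "L c"] l0 aO by (auto simp: Z_def)
      show "cube (L c) a = cube (L c) c" using ceq by simp
      show "nr (L c) a b" using nr_cong[OF lc(2) aO b l0n anceq[symmetric] nb] .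
      show "a \<in> Om" by fact
    qed
    have tm: "0 < t * mass (cube (L c) c)" using t mass_cube_pos[OF lc(2)] by simp
    have "1 \<le> (\<Sum>a\<in>cube (L c) c. z a * mu a) / (t * mass (cube (L c) c))"
      using l0 tm by (simp add: lg_def)
    also have "\<dots> = (\<Sum>a\<in>cube (L c) c. q a b)"
      unfolding sum_divide_distrib
    proof (intro sum.cong refl)
      fix a assume a: "a \<in> cube (L c) c"
      show "z a * mu a / (t * mass (cube (L c) c)) = q a b"
        unfolding q_def La(1)[OF a] La(3)[OF a] using La(4)[OF a] by simp
    qed
    also have "\<dots> \<le> (\<Sum>a\<in>Z. q a b)"
      using La(2) q_nonneg by (intro sum_mono2 finZ) blast+
    finally show ?thesis .
  qed
  have "(\<Sum>b\<in>H. u b * mu b) \<le> (\<Sum>b\<in>H. u b * mu b * (\<Sum>a\<in>Z. q a b))"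
  proof (rule sum_mono)
    fix b assume b: "b \<in> H"
    then have "0 \<le> u b * mu b" using H_sub u mu_pos by (auto simp: less_imp_le subset_iff)
    then show "u b * mu b \<le> u b * mu b * (\<Sum>a\<in>Z. q a b)"
      using mult_left_mono[OF one[OF b]] by simp
  qed
  also have "\<dots> = (\<Sum>a\<in>Z. \<Sum>b\<in>H. u b * mu b * q a b)"
    by (simp add: sum_distrib_left sum.swap[of _ H])
  also have "\<dots> \<le> (\<Sum>a\<in>Z. D / t * (z a * mu a * G a))"
  proof (rule sum_mono)
    fix a assume a: "a \<in> Z"
    then have aO: "a \<in> Om" and Ln: "L a \<le> n" using Z_sub lgL[OF a] by (auto simp: lg_def)
    define w where "w = z a * mu a / (t * mass (cube (L a) a))"
    have w: "0 \<le> w" using z[OF aO] mu_pos[OF aO] t mass_cube_pos[OF aO, of "L a"] by (simp add: w_def)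
    have "(\<Sum>b\<in>H. u b * mu b * q a b) = (\<Sum>b\<in>H \<inter> nbh (L a) a. u b * mu b * w)"
      unfolding q_def w_def[symmetric] using H_sub finH
      by (intro sum.mono_neutral_cong_right) (auto simp: nbh_def)
    also have "\<dots> \<le> (\<Sum>b\<in>nbh (L a) a. u b * mu b * w)"
      using u mu_pos w nbh_subset[of "L a" a]
      by (intro sum_mono2) (auto simp: less_imp_le subset_iff)
    also have "\<dots> = w * (\<Sum>b\<in>nbh (L a) a. u b * mu b)"
      by (simp add: sum_distrib_left mult.commute)
    also have "\<dots> \<le> w * (G a * mass (nbh (L a) a))"
      by (intro mult_left_mono G aO Ln w)
    also have "\<dots> \<le> w * (G a * (D * mass (cube (L a) a)))"
    proof (intro mult_left_mono w mass_nbh_le aO Ln)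
      have "0 \<le> (\<Sum>b\<in>nbh (L a) a. u b * mu b)"
        using u mu_pos nbh_subset[of "L a" a] by (intro sum_nonneg) (auto simp: less_imp_le subset_iff)
      also note G[OF aO Ln]
      finally show "0 \<le> G a"
        using mass_nbh_pos[OF aO Ln] by (simp add: zero_le_mult_iff)
    qed
    also have "\<dots> = D / t * (z a * mu a * G a)"
      using t mass_cube_pos[OF aO, of "L a"] by (simp add: w_def field_simps)
    finally show "(\<Sum>b\<in>H. u b * mu b * q a b) \<le> D / t * (z a * mu a * G a)" .
  qed
  also have "\<dots> = D / t * (\<Sum>a\<in>Z. z a * mu a * G a)"
    by (simp add: sum_distrib_left)
  also have "\<dots> \<le> D / t * (\<Sum>a\<in>Om. z a * mu a * G a)"
  proof (intro mult_left_mono sum_mono2 finite_Om Z_sub)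
    fix a assume "a \<in> Om - Z"
    then have aO: "a \<in> Om" by simp
    have "0 \<le> (\<Sum>b\<in>nbh 0 a. u b * mu b)"
      using u mu_pos nbh_subset[of 0 a] by (intro sum_nonneg) (auto simp: less_imp_le subset_iff)
    also note G[OF aO, of 0]
    finally have "0 \<le> G a"
      using mass_nbh_pos[OF aO, of 0] by (simp add: zero_le_mult_iff)
    then show "0 \<le> z a * mu a * G a" using z[OF aO] mu_pos[OF aO] by simp
  qed (use t D_ge_1 in auto)
  finally show ?thesis by (simp add: H_def)
qed

lemma large_cube_cover_mass:
  assumes z: "\<And>a. a \<in> Om \<Longrightarrow> 0 \<le> z a" and t: "0 < t"
  shows "mass {b\<in>Om. \<exists>l\<le>n. \<exists>c\<in>Om. t * mass (cube l c) < (\<Sum>a\<in>cube l c. z a * mu a) \<and> nr l c b}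
    \<le> D / t * (\<Sum>a\<in>Om. z a * mu a)"
  using large_cube_cover[of z "\<lambda>_. 1" t "\<lambda>_. 1", OF z _ t] by (simp add: mass_def)

text \<open>The maximal cubes of \<open>F\<close>, found by taking the coarsest level
  \<open>L a\<close> at each cell, are disjoint and have the same union, so the bounds add
  up.\<close>

lemma cubes_union_le:
  assumes F: "F \<subseteq> cubes" and le: "\<And>R. R \<in> F \<Longrightarrow> (\<Sum>a\<in>snd R. g a) \<le> c * mass (snd R)"
  shows "(\<Sum>a\<in>(\<Union>R\<in>F. snd R). g a) \<le> c * mass (\<Union>R\<in>F. snd R)"
proof -
  define U where "U = (\<Union>R\<in>F. snd R)"
  define L where "L a = (LEAST l. (l, cube l a) \<in> F)" for a
  define K where "K = (\<lambda>a. cube (L a) a) ` U"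
  have F_D: "l \<le> n \<and> a \<in> Om \<and> B = cube l a" if "(l, B) \<in> F" "a \<in> B" for l a B
  proof -
    have "(l, B) \<in> cubes" using F that(1) by blast
    then obtain c where "l \<le> n" "c \<in> Om" "B = cube l c" unfolding cubes_def by auto
    then show ?thesis using that(2) by (auto simp: cube_def)
  qed
  have L: "(L a, cube (L a) a) \<in> F" "a \<in> Om" "L a \<le> n" if a: "a \<in> U" for a
  proof -
    obtain R where "R \<in> F" "a \<in> snd R" using a unfolding U_def by blast
    then have "(fst R, snd R) \<in> F" "a \<in> snd R" by simp_all
    with F_D[OF this] have *: "(fst R, cube (fst R) a) \<in> F" "a \<in> Om" by simp_all
    show 1: "(L a, cube (L a) a) \<in> F" unfolding L_def using *(1) by (rule LeastI)
    show 2: "a \<in> Om" by fact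
    show "L a \<le> n" using F_D[OF 1 self_in_cube[OF 2]] by simp
  qed
  have U_eq: "U = \<Union>K"
  proof
    show "U \<subseteq> \<Union>K" unfolding K_def using L(2) self_in_cube by blast
    show "\<Union>K \<subseteq> U"
    proof
      fix x assume "x \<in> \<Union>K"
      then obtain a where a: "a \<in> U" "x \<in> cube (L a) a" unfolding K_def by blast
      show "x \<in> U" unfolding U_def using L(1)[OF a(1)] a(2) by (metis UN_I snd_conv)
    qed
  qed
  have same: "cube (L a) a = cube (L b) b"
    if "a \<in> U" "b \<in> U" "x \<in> cube (L a) a" "x \<in> cube (L b) b" for a b x
  proof -
    have *: "cube (L a) a = cube (L b) b"
      if "a \<in> U" "b \<in> U" "x \<in> cube (L a) a" "x \<in> cube (L b) b" "L a \<le> L b" for a b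
    proof -
      have x: "x \<in> Om" using that cube_subset by blast
      have "b \<in> cube (L b) x" using that L[of b] self_in_cube cube_eq by metis
      then have "b \<in> cube (L a) x" using cube_mono[OF x that(5)] L[of b] that(2) by blast
      then have "cube (L a) b = cube (L a) a" using that(3) cube_eq by metis
      then have "L b \<le> L a" using L(1)[of a] that(1) unfolding L_def[of b] by (intro Least_le) metis
      then show ?thesis using that(5) \<open>cube (L a) b = cube (L a) a\<close> by simp
    qed
    show ?thesis using *[of a b] *[of b a] that by (cases "L a \<le> L b") auto
  qed
  have disj: "\<forall>A\<in>K. \<forall>B\<in>K. A \<noteq> B \<longrightarrow> A \<inter> B = {}"
  proof (intro ballI impI)
    fix A B assume "A \<in> K" "B \<in> K" "A \<noteq> B"
    then obtain a b where ab: "a \<in> U" "b \<in> U" "A = cube (L a) a" "B = cube (L b) b" unfolding K_def by blast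
    show "A \<inter> B = {}" using same[OF ab(1,2)] \<open>A \<noteq> B\<close> unfolding ab(3,4) by blast
  qed
  have fin: "\<forall>A\<in>K. finite A" by (auto simp: K_def)
  have "(\<Sum>a\<in>U. g a) = (\<Sum>A\<in>K. \<Sum>a\<in>A. g a)"
    unfolding U_eq using sum.Union_disjoint[OF fin disj, of g] by simp
  also have "\<dots> \<le> (\<Sum>A\<in>K. c * mass A)"
  proof (rule sum_mono)
    fix A assume "A \<in> K"
    then obtain a where a: "a \<in> U" "A = cube (L a) a" unfolding K_def by blast
    show "sum g A \<le> c * mass A" using le[OF L(1)[OF a(1)]] a(2) by simp
  qed
  also have "\<dots> = c * mass U"
    unfolding U_eq mass_def using sum.Union_disjoint[OF fin disj, of mu] by (simp add: sum_distrib_left)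
  finally show ?thesis by (simp add: U_def)
qed

end

section \<open>Sparse domination\<close>

context cube_tree
begin

lemma mass_Un_le:
  assumes "A \<subseteq> Om" "B \<subseteq> Om"
  shows "mass (A \<union> B) \<le> mass A + mass B"
proof -
  have "mass (A \<union> B) = mass A + mass (B - A)"
    unfolding mass_def using assms finite_subset[OF _ finite_Om]
    by (subst sum.union_disjoint[symmetric]) (auto intro!: sum.cong)
  also have "mass (B - A) \<le> mass B" using assms by (intro mass_mono) auto
  finally show ?thesis by simp
qed

text \<open>The level \<open>l\<close> stands for the logarithm of the distance of \<open>a\<close>
  and \<open>b\<close>; the bounds on \<open>tau\<close> are stated at exactly such a level.\<close>

lemma nr_separation_level:
  assumes "k < p" "nr k a b" "\<not> nr p a b"
  shows "\<exists>l. k \<le> l \<and> l < p \<and> nr l a b \<and> \<not> nr (Suc l) a b"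
  using assms
proof (induction p)
  case 0 then show ?case by simp
next
  case (Suc p)
  show ?case
  proof (cases "nr p a b")
    case True
    then show ?thesis using Suc.prems by (intro exI[of _ p]) auto
  next
    case False
    then have "k < p" using Suc.prems by (metis less_antisym)
    from Suc.IH[OF this Suc.prems(2) False] obtain l
      where "k \<le> l \<and> l < p \<and> nr l a b \<and> \<not> nr (Suc l) a b" by blast
    then show ?thesis by (intro exI[of _ l]) simp
  qed
qed

end

text \<open>The model of a kernel: \<open>tau a b\<close> is its average over the product of the cells \<open>a\<close> and \<open>b\<close>, and
  cells that are near at level \<open>m\<close> but not at level \<open>Suc m\<close> have distance comparable to the size of the
  cubes of level \<open>m\<close>. Cells near at the finest level interact only through the \<open>L\<^sup>2\<close> bound.\<close>

locale cz_matrix = cube_tree +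
  fixes tau :: "'a \<Rightarrow> 'a \<Rightarrow> real" and C th :: real
  assumes C_pos: "0 < C" and th_pos: "0 < th" and th_lt_1: "th < 1"
    and tau_size: "\<And>a b m. a \<in> Om \<Longrightarrow> b \<in> Om \<Longrightarrow> m < n \<Longrightarrow> nr m a b \<Longrightarrow> \<not> nr (Suc m) a b \<Longrightarrow>
      \<bar>tau a b\<bar> \<le> C / (\<Sum>x\<in>{x\<in>Om. anc m x = anc m a}. mu x)"
    and tau_smooth1: "\<And>a a' b m i. a \<in> Om \<Longrightarrow> a' \<in> Om \<Longrightarrow> b \<in> Om \<Longrightarrow> m < i \<Longrightarrow> i \<le> n \<Longrightarrow>
      nr m a b \<Longrightarrow> \<not> nr (Suc m) a b \<Longrightarrow> anc i a = anc i a' \<Longrightarrow>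
      \<bar>tau a b - tau a' b\<bar> \<le> C * th ^ (i - m) / (\<Sum>x\<in>{x\<in>Om. anc m x = anc m a}. mu x)"
    and tau_smooth2: "\<And>a b b' m i. a \<in> Om \<Longrightarrow> b \<in> Om \<Longrightarrow> b' \<in> Om \<Longrightarrow> m < i \<Longrightarrow> i \<le> n \<Longrightarrow>
      nr m a b \<Longrightarrow> \<not> nr (Suc m) a b \<Longrightarrow> anc i b = anc i b' \<Longrightarrow>
      \<bar>tau a b - tau a b'\<bar> \<le> C * th ^ (i - m) / (\<Sum>x\<in>{x\<in>Om. anc m x = anc m a}. mu x)"
    and tau_L2: "\<And>v f. \<bar>\<Sum>a\<in>Om. \<Sum>b\<in>Om. v a * f b * mu a * mu b * tau a b\<bar>
      \<le> C * sqrt (\<Sum>a\<in>Om. (v a)\<^sup>2 * mu a) * sqrt (\<Sum>b\<in>Om. (f b)\<^sup>2 * mu b)"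
begin

definition form :: "('a \<Rightarrow> real) \<Rightarrow> ('a \<Rightarrow> real) \<Rightarrow> real" where
  "form v f = (\<Sum>a\<in>Om. \<Sum>b\<in>Om. v a * f b * mu a * mu b * tau a b)"

definition res :: "'a set \<Rightarrow> ('a \<Rightarrow> real) \<Rightarrow> 'a \<Rightarrow> real" where
  "res B f a = (if a \<in> B then f a else 0)"

lemmas size = tau_size[folded cube_def mass_def]
lemmas smooth1 = tau_smooth1[folded cube_def mass_def]
lemmas smooth2 = tau_smooth2[folded cube_def mass_def]

text \<open>The L^2 bound enters the sparse domination only in this way: for bounded functions on
  sets of comparable mass it reads like an estimate by averages.\<close>

lemma form_bounded:
  assumes "A \<subseteq> Om" "B \<subseteq> Om" "\<And>a. a \<in> A \<Longrightarrow> \<bar>v a\<bar> \<le> s" "\<And>b. b \<in> B \<Longrightarrow> \<bar>f b\<bar> \<le> t" "0 \<le> s" "0 \<le> t"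
    and "mass A \<le> D * mass B"
  shows "\<bar>form (res A v) (res B f)\<bar> \<le> C * s * t * D * mass B"
proof -
  have est: "(\<Sum>a\<in>Om. (res A v a)\<^sup>2 * mu a) \<le> s\<^sup>2 * mass A"
    if "A \<subseteq> Om" "\<And>a. a \<in> A \<Longrightarrow> \<bar>v a\<bar> \<le> s" for A v s
  proof -
    have "(\<Sum>a\<in>Om. (res A v a)\<^sup>2 * mu a) = (\<Sum>a\<in>A. (v a)\<^sup>2 * mu a)"
      using that(1) by (intro sum.mono_neutral_cong_right) (auto simp: res_def)
    also have "\<dots> \<le> (\<Sum>a\<in>A. s\<^sup>2 * mu a)"
    proof (intro sum_mono mult_right_mono)
      fix a assume a: "a \<in> A"
      show "(v a)\<^sup>2 \<le> s\<^sup>2" using power_mono[OF that(2)[OF a] abs_ge_zero, of 2] by simp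
      show "0 \<le> mu a" using mu_pos a that(1) by (auto intro: less_imp_le)
    qed
    finally show ?thesis by (simp add: mass_def sum_distrib_left)
  qed
  have mB: "0 \<le> mass B" and mA: "0 \<le> mass A" using mass_nonneg assms by auto
  \<comment> \<open>\<open>D\<close> is weakened to its square so that the square root of the factor
    is \<open>D\<close> itself.\<close>
  have "mass A \<le> D\<^sup>2 * mass B"
    using assms(7) mult_right_mono[OF self_le_power[OF D_ge_1, of 2] mB] by simp
  then have "sqrt (s\<^sup>2 * mass A) \<le> sqrt (s\<^sup>2 * (D\<^sup>2 * mass B))"
    by (intro real_sqrt_le_mono mult_left_mono) auto
  also have "\<dots> = s * D * sqrt (mass B)"
    using assms(5) D_ge_1 by (simp add: real_sqrt_mult)
  finally have 1: "sqrt (\<Sum>a\<in>Om. (res A v a)\<^sup>2 * mu a) \<le> s * D * sqrt (mass B)"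
    using est[OF assms(1,3)] by (meson order_trans real_sqrt_le_mono)
  have "sqrt (t\<^sup>2 * mass B) = t * sqrt (mass B)" using assms(6) by (simp add: real_sqrt_mult)
  then have 2: "sqrt (\<Sum>b\<in>Om. (res B f b)\<^sup>2 * mu b) \<le> t * sqrt (mass B)"
    using real_sqrt_le_mono[OF est[OF assms(2,4)]] by simp
  have "\<bar>form (res A v) (res B f)\<bar> \<le> C * (s * D * sqrt (mass B)) * (t * sqrt (mass B))"
    unfolding form_def
  proof (rule order_trans[OF tau_L2], rule mult_mono)
    show "C * sqrt (\<Sum>a\<in>Om. (res A v a)\<^sup>2 * mu a) \<le> C * (s * D * sqrt (mass B))"
      using 1 C_pos by simp
    show "0 \<le> C * (s * D * sqrt (mass B))" using C_pos D_ge_1 assms(5) mB by simp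
    show "0 \<le> sqrt (\<Sum>b\<in>Om. (res B f b)\<^sup>2 * mu b)"
      by (intro real_sqrt_ge_zero sum_nonneg) (simp add: less_imp_le[OF mu_pos])
  qed (rule 2)
  also have "\<dots> = C * s * t * D * (sqrt (mass B) * sqrt (mass B))" by simp
  finally show ?thesis using mB by simp
qed

end

section \<open>One step of the stopping time construction\<close>

locale cz_step = cz_matrix +
  fixes k :: nat and a0 :: 'a and v f :: "'a \<Rightarrow> real"
  assumes k_less: "k < n" and a0: "a0 \<in> Om"
    and v_supp: "\<And>a. a \<notin> nbh k a0 \<Longrightarrow> v a = 0"
    and f_supp: "\<And>b. b \<notin> cube k a0 \<Longrightarrow> f b = 0"
    and v_pos: "0 < (\<Sum>a\<in>Om. \<bar>v a\<bar> * mu a)"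
    and f_pos: "0 < (\<Sum>a\<in>Om. \<bar>f a\<bar> * mu a)"
begin

definition QQ where "QQ = cube k a0"
definition NN where "NN = nbh k a0"
definition Fs where "Fs = (\<Sum>a\<in>Om. \<bar>f a\<bar> * mu a)"
definition Vs where "Vs = (\<Sum>a\<in>Om. \<bar>v a\<bar> * mu a)"
definition Lf where "Lf = Fs / mass QQ"
definition Lv where "Lv = Vs / mass NN"
text \<open>The weak type bound gives \<open>mass Bad\<close> at most
  \<open>D / AA * (mass QQ + mass NN)\<close>, hence at most
  \<open>2 * D ^ 2 / AA * mass QQ\<close>. The value of \<open>AA\<close> makes this
  \<open>mass QQ / (8 * D)\<close>: small enough for sparseness and, by the extra \<open>D\<close>,
  too small to contain a cube of level \<open>k\<close> inside \<open>NN\<close>.\<close>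

definition AA where "AA = 16 * D ^ 3"
text \<open>On Whitney cubes and their ancestors, averages exceed the stopping threshold by at most
  a factor \<open>D\<close> for each comparison with a neighbourhood or a parent; at most three such
  comparisons occur.\<close>

definition al where "al = D ^ 3 * AA"

text \<open>Neighbourhoods of the large cubes are included, so a cell outside \<open>Bad\<close>
  controls the averages of all cubes near it and not only of those that contain it
  (\<open>not_large\<close>).\<close>

definition Bad where
  "Bad = {b\<in>Om. \<exists>l c. k \<le> l \<and> l \<le> n \<and> c \<in> Om \<and> nr l c b \<and>
     (AA * Lf * mass (cube l c) < (\<Sum>a\<in>cube l c. \<bar>f a\<bar> * mu a) \<or>
      AA * Lv * mass (cube l c) < (\<Sum>a\<in>cube l c. \<bar>v a\<bar> * mu a))}"

text \<open>The cubes of level \<open>lev a\<close> around the cells \<open>a\<close> form a Whitney decomposition of \<open>Bad\<close>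
  down to the finest level.\<close>

definition lev where "lev a = (LEAST m. m = n \<or> nbh m a \<subseteq> Bad)"
text \<open>At the finest level the search for \<open>lev a\<close> stops in any case, so
  \<open>lev a = n\<close> alone does not tell whether a Whitney cube inside \<open>Bad\<close> was
  found.\<close>

definition proper where "proper a \<longleftrightarrow> nbh (lev a) a \<subseteq> Bad"
text \<open>These are the pairs handed to the next generation. The condition involves the Whitney
  cube of \<open>b\<close> only; \<open>phi\<close> is the kernel that is left.\<close>

definition near where "near a b \<longleftrightarrow> proper b \<and> nr (lev b) a b"
definition av where "av w b = (\<Sum>x\<in>cube (lev b) b. w x * mu x) / mass (cube (lev b) b)"
definition g where "g b = (if b \<in> QQ then av f b else 0)"
definition h where "h a = (if a \<in> NN then av v a else 0)"
definition phi where "phi a b = (if near a b then 0 else tau a b)"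
definition E where "E w p = (\<Sum>a\<in>NN. \<Sum>b\<in>QQ. w a * p b * mu a * mu b * phi a b)"
definition Ch where "Ch = {(lev b, cube (lev b) b) | b. b \<in> QQ \<and> proper b}"

lemma QQ_sub: "QQ \<subseteq> Om" and NN_sub: "NN \<subseteq> Om" and QQ_NN: "QQ \<subseteq> NN"
  using cube_subset nbh_subset cube_subset_nbh[OF a0, of k] k_less by (auto simp: QQ_def NN_def)

lemma finQ [simp]: "finite QQ" and finN [simp]: "finite NN"
  by (auto simp: QQ_def NN_def)

lemma massQ: "0 < mass QQ" and massN: "0 < mass NN" and massN_le: "mass NN \<le> D * mass QQ"
  using mass_cube_pos[OF a0] mass_nbh_pos[OF a0] mass_nbh_le[OF a0] k_less by (auto simp: QQ_def NN_def)

lemma Lf_pos: "0 < Lf" and Lv_pos: "0 < Lv"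
  using f_pos v_pos massQ massN by (auto simp: Lf_def Lv_def Fs_def Vs_def)

lemma AA_ge_1: "1 \<le> AA"
  using one_le_power[OF D_ge_1, of 3] by (simp add: AA_def)

lemma D_pos: "0 < D" using D_ge_1 by simp

lemma al_pos: "0 < al" using AA_ge_1 D_pos by (simp add: al_def)

lemma nr_NN_QQ: "a \<in> NN \<Longrightarrow> b \<in> QQ \<Longrightarrow> nr k a b"
  using nr_cong2[of a a0 b k] nr_sym[of a0 a k] a0 k_less by (auto simp: NN_def QQ_def nbh_def cube_def)

lemma cube_NN: "a \<in> NN \<Longrightarrow> b \<in> Om \<Longrightarrow> anc k b = anc k a \<Longrightarrow> b \<in> NN"
  using nr_cong2[of a0 a b k] a0 k_less by (auto simp: NN_def nbh_def)

lemma mass_QQ_le: "a \<in> NN \<Longrightarrow> mass QQ \<le> D * mass (cube k a)"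
  using mass_cube_nr_le[of a a0 k] nr_NN_QQ[of a a0] self_in_cube[OF a0] NN_sub a0 k_less
  by (auto simp: QQ_def)

lemma mass_Bad: "mass Bad \<le> mass QQ / (8 * D)"
proof -
  let ?H = "\<lambda>t z. {b\<in>Om. \<exists>l\<le>n. \<exists>c\<in>Om. t * mass (cube l c) < (\<Sum>a\<in>cube l c. z a * mu a) \<and> nr l c b}"
  have pos: "0 < AA * Lf" "0 < AA * Lv" using AA_ge_1 Lf_pos Lv_pos by auto
  have "Bad \<subseteq> ?H (AA * Lf) (\<lambda>a. \<bar>f a\<bar>) \<union> ?H (AA * Lv) (\<lambda>a. \<bar>v a\<bar>)"
    unfolding Bad_def by blast
  then have "mass Bad \<le> mass (?H (AA * Lf) (\<lambda>a. \<bar>f a\<bar>) \<union> ?H (AA * Lv) (\<lambda>a. \<bar>v a\<bar>))"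
    by (intro mass_mono) auto
  also have "\<dots> \<le> mass (?H (AA * Lf) (\<lambda>a. \<bar>f a\<bar>)) + mass (?H (AA * Lv) (\<lambda>a. \<bar>v a\<bar>))"
    by (intro mass_Un_le) auto
  also have "\<dots> \<le> D / (AA * Lf) * Fs + D / (AA * Lv) * Vs"
    unfolding Fs_def Vs_def by (intro add_mono large_cube_cover_mass pos) auto
  also have "\<dots> = D / AA * (mass QQ + mass NN)"
    using Lf_pos Lv_pos AA_ge_1 massQ massN unfolding Lf_def Lv_def by (simp add: field_simps)
  also have "\<dots> \<le> D / AA * (2 * D * mass QQ)"
  proof (rule mult_left_mono)
    have "mass QQ \<le> D * mass QQ" using mult_right_mono[OF D_ge_1, of "mass QQ"] massQ by simp
    then show "mass QQ + mass NN \<le> 2 * D * mass QQ" using massN_le by linarith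
  qed (use D_pos AA_ge_1 in auto)
  also have "\<dots> = mass QQ / (8 * D)"
    using D_pos by (simp add: AA_def power3_eq_cube)
  finally show ?thesis .
qed

lemma lev_le: "lev a \<le> n"
  unfolding lev_def by (intro Least_le) simp

lemma lev_prop: "lev a = n \<or> nbh (lev a) a \<subseteq> Bad"
  unfolding lev_def by (rule LeastI[of "\<lambda>m. m = n \<or> nbh m a \<subseteq> Bad" n]) simp

lemma proper_if: "lev a < n \<Longrightarrow> proper a"
  using lev_prop[of a] by (auto simp: proper_def)

lemma lev_least: "m < lev a \<Longrightarrow> \<not> nbh m a \<subseteq> Bad"
  unfolding lev_def using not_less_Least by blast

lemma Bad_sub: "Bad \<subseteq> Om" by (auto simp: Bad_def)

text \<open>Otherwise \<open>Bad\<close> would contain a cube of level \<open>k\<close> in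
  \<open>NN\<close>, whose mass is at least \<open>mass QQ / D\<close>. Hence the recursion really
  descends.\<close>

lemma k_lev:
  assumes "a \<in> NN"
  shows "k < lev a"
proof (rule ccontr)
  assume c: "\<not> k < lev a"
  have aO: "a \<in> Om" using assms NN_sub by blast
  have "nbh (lev a) a \<subseteq> Bad" using lev_prop[of a] c k_less by auto
  then have "cube k a \<subseteq> Bad"
    using cube_subset_nbh[OF aO, of k] nbh_mono[OF aO, of "lev a" k] c k_less by auto
  then have "mass (cube k a) \<le> mass Bad" using Bad_sub by (intro mass_mono)
  also note mass_Bad
  also have "mass QQ / (8 * D) \<le> D * mass (cube k a) / (8 * D)"
    using mass_QQ_le[OF assms] D_pos by (intro divide_right_mono) auto
  also have "\<dots> = mass (cube k a) / 8" using D_pos by simp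
  finally show False using mass_cube_pos[OF aO, of k] by simp
qed

lemma lev_cong:
  assumes a: "a \<in> Om" and b: "b \<in> cube (lev a) a"
  shows "lev b = lev a" "proper b \<longleftrightarrow> proper a" "cube (lev b) b = cube (lev a) a"
proof -
  have bO: "b \<in> Om" and e: "anc (lev a) b = anc (lev a) a" using b by (auto simp: cube_def)
  have nb: "nbh m b = nbh m a" if "m \<le> lev a" for m
    using nbh_eq[OF a, of m b] anc_le[OF bO a that lev_le e] that lev_le[of a] bO by (auto simp: cube_def)
  show l: "lev b = lev a"
    unfolding lev_def[of b]
  proof (rule Least_equality)
    show "lev a = n \<or> nbh (lev a) b \<subseteq> Bad" using lev_prop[of a] nb by simp
    fix y assume y: "y = n \<or> nbh y b \<subseteq> Bad"
    show "lev a \<le> y"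
    proof (rule ccontr)
      assume "\<not> lev a \<le> y"
      then have "y < lev a" by simp
      then show False using y nb[of y] lev_least[of y a] lev_le[of a] by auto
    qed
  qed
  show "proper b \<longleftrightarrow> proper a" using nb[of "lev a"] l by (simp add: proper_def)
  show "cube (lev b) b = cube (lev a) a" using cube_eq[OF b] l by simp
qed

text \<open>The Whitney property: by \<open>nr_comp\<close> the neighbourhood of \<open>b\<close> at
  level \<open>Suc (lev a)\<close> lies in that of \<open>a\<close> at level \<open>lev a\<close>,
  hence in \<open>Bad\<close>.\<close>

lemma lev_comparable:
  assumes a: "a \<in> Om" and b: "b \<in> Om" and "lev a < n" "nr (Suc (lev a)) a b"
  shows "lev b \<le> Suc (lev a)" "proper b"
proof -
  have *: "nbh (Suc (lev a)) b \<subseteq> Bad"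
  proof
    fix x assume x: "x \<in> nbh (Suc (lev a)) b"
    then have "x \<in> Om" "nr (Suc (lev a)) b x" by (auto simp: nbh_def)
    then have "x \<in> nbh (lev a) a" using nr_comp[OF a b _ assms(3,4)] by (auto simp: nbh_def)
    then show "x \<in> Bad" using lev_prop[of a] assms(3) by auto
  qed
  show l: "lev b \<le> Suc (lev a)"
    unfolding lev_def[of b] using * by (intro Least_le) simp
  show "proper b"
  proof (cases "lev b < n")
    case True then show ?thesis by (rule proper_if)
  next
    case False
    then have "lev b = Suc (lev a)" using l assms(3) lev_le[of b] by simp
    then show ?thesis using * by (simp add: proper_def)
  qed
qed

lemma not_large:
  assumes "c \<in> Om" "b \<in> Om" "b \<notin> Bad" "k \<le> l" "l \<le> n" "nr l c b"
  shows "(\<Sum>a\<in>cube l c. \<bar>f a\<bar> * mu a) \<le> AA * Lf * mass (cube l c)"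
    "(\<Sum>a\<in>cube l c. \<bar>v a\<bar> * mu a) \<le> AA * Lv * mass (cube l c)"
  using assms unfolding Bad_def by (auto simp: not_less)

lemma sum_f_le: "B \<subseteq> Om \<Longrightarrow> (\<Sum>a\<in>B. \<bar>f a\<bar> * mu a) \<le> Fs"
  unfolding Fs_def by (intro sum_mono2) (auto intro!: mult_nonneg_nonneg less_imp_le[OF mu_pos])

lemma sum_v_le: "B \<subseteq> Om \<Longrightarrow> (\<Sum>a\<in>B. \<bar>v a\<bar> * mu a) \<le> Vs"
  unfolding Vs_def by (intro sum_mono2) (auto intro!: mult_nonneg_nonneg less_imp_le[OF mu_pos])

lemma powD_mono: "i \<le> j \<Longrightarrow> D ^ i \<le> D ^ j"
  using D_ge_1 by (simp add: power_increasing)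

text \<open>Before the Whitney level is reached, the neighbourhood of \<open>a\<close> still
  contains a cell outside \<open>Bad\<close>, so the cube there is not large; passing from the
  parent to the cube costs one factor \<open>D\<close>. At \<open>l = k\<close> there is no parent
  to use and the total \<open>Fs\<close> does the job.\<close>

lemma f_avg:
  assumes a: "a \<in> NN" and l: "k \<le> l" "l \<le> lev a"
  shows "(\<Sum>x\<in>cube l a. \<bar>f x\<bar> * mu x) \<le> al * Lf * mass (cube l a)"
proof -
  have aO: "a \<in> Om" using a NN_sub by blast
  have m: "0 < mass (cube l a)" using mass_cube_pos[OF aO] .
  have D1: "D \<le> al"
    using mult_mono[OF powD_mono[of 1 3] AA_ge_1] D_pos by (simp add: al_def)
  have DA: "D * AA \<le> al"
    using mult_right_mono[OF powD_mono[of 1 3], of AA] AA_ge_1 by (simp add: al_def)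
  show ?thesis
  proof (cases "l = k")
    case True
    have "(\<Sum>x\<in>cube l a. \<bar>f x\<bar> * mu x) \<le> Lf * mass QQ"
      using sum_f_le[OF cube_subset] massQ by (simp add: Lf_def)
    also have "\<dots> \<le> Lf * (D * mass (cube l a))"
      using mass_QQ_le[OF a] Lf_pos True by (intro mult_left_mono) auto
    also have "\<dots> = D * (Lf * mass (cube l a))" by simp
    also have "\<dots> \<le> al * (Lf * mass (cube l a))"
      using D1 Lf_pos m by (intro mult_right_mono) auto
    finally show ?thesis by simp
  next
    case False
    then obtain j where j: "l = Suc j" "k \<le> j" using l by (cases l) auto
    have jn: "j < lev a" "j < n" using j l lev_le[of a] by auto
    obtain y where y: "y \<in> nbh j a" "y \<notin> Bad" using lev_least[OF jn(1)] by blast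
    have "(\<Sum>x\<in>cube l a. \<bar>f x\<bar> * mu x) \<le> (\<Sum>x\<in>cube j a. \<bar>f x\<bar> * mu x)"
      using cube_mono[OF aO, of j l] j jn cube_subset[of j a]
      by (intro sum_mono2) (auto intro!: mult_nonneg_nonneg less_imp_le[OF mu_pos])
    also have "\<dots> \<le> AA * Lf * mass (cube j a)"
      using y jn j by (intro not_large[OF aO]) (auto simp: nbh_def)
    also have "\<dots> \<le> AA * Lf * (D * mass (cube l a))"
      using mass_cube_le[OF aO jn(2)] j AA_ge_1 Lf_pos by (intro mult_left_mono) auto
    also have "\<dots> = D * AA * (Lf * mass (cube l a))" by simp
    also have "\<dots> \<le> al * (Lf * mass (cube l a))"
      using DA Lf_pos m by (intro mult_right_mono) auto
    finally show ?thesis by simp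
  qed
qed

text \<open>A neighbourhood is harder than a cube: at level \<open>l - 2\<close> the cubes around
  all cells of \<open>nbh l a\<close> have one and the same cell \<open>y\<close> outside
  \<open>Bad\<close> in their neighbourhoods, and their union has mass at most
  \<open>D ^ 3 * mass (cube l a)\<close>. At the levels \<open>k\<close> and \<open>Suc k\<close>
  the total \<open>Vs\<close> is used instead.\<close>

lemma v_avg:
  assumes a: "a \<in> NN" and l: "k \<le> l" "l \<le> lev a"
  shows "(\<Sum>x\<in>nbh l a. \<bar>v x\<bar> * mu x) \<le> al * Lv * mass (cube l a)"
proof -
  have aO: "a \<in> Om" using a NN_sub by blast
  have m: "0 < mass (cube l a)" using mass_cube_pos[OF aO] .
  have D2: "D ^ 2 \<le> al" "D ^ 3 \<le> al"
    using mult_mono[OF powD_mono[of 2 3] AA_ge_1] mult_mono[OF powD_mono[of 3 3] AA_ge_1] D_pos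
    by (simp_all add: al_def)
  have total: "(\<Sum>x\<in>nbh l a. \<bar>v x\<bar> * mu x) \<le> D ^ 2 * (Lv * mass (cube k a))"
  proof -
    have "(\<Sum>x\<in>nbh l a. \<bar>v x\<bar> * mu x) \<le> Lv * mass NN"
      using sum_v_le[OF nbh_subset] massN by (simp add: Lv_def)
    also have "\<dots> \<le> Lv * (D * (D * mass (cube k a)))"
      using order_trans[OF massN_le mult_left_mono[OF mass_QQ_le[OF a], of D]] Lv_pos D_pos
      by (intro mult_left_mono) auto
    finally show ?thesis by (simp add: power2_eq_square algebra_simps)
  qed
  consider "l = k" | "l = Suc k" | j where "l = Suc (Suc j)" "k \<le> j"
    using l(1) by (metis Suc_leI le_Suc_eq le_neq_implies_less Suc_le_D Suc_le_mono)
  then show ?thesis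
  proof cases
    case 1
    have "D ^ 2 * (Lv * mass (cube k a)) \<le> al * (Lv * mass (cube k a))"
      using D2 Lv_pos m 1 by (intro mult_right_mono) auto
    then show ?thesis using total 1 by simp
  next
    case 2
    have "D ^ 2 * (Lv * mass (cube k a)) \<le> D ^ 2 * (Lv * (D * mass (cube l a)))"
      using mass_cube_le[OF aO k_less] 2 Lv_pos by (intro mult_left_mono) auto
    also have "\<dots> = D ^ 3 * (Lv * mass (cube l a))" by (simp add: power2_eq_square power3_eq_cube)
    also have "\<dots> \<le> al * (Lv * mass (cube l a))"
      using D2 Lv_pos m by (intro mult_right_mono) auto
    finally show ?thesis using total by simp
  next
    case (3 j)
    have jn: "Suc j < lev a" "Suc j < n" using 3 l lev_le[of a] by auto
    obtain y where y: "y \<in> nbh (Suc j) a" "y \<notin> Bad" using lev_least[OF jn(1)] by blast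
    have yO: "y \<in> Om" "nr (Suc j) a y" using y by (auto simp: nbh_def)
    define F where "F = {(j, cube j c) | c. c \<in> nbh l a}"
    have cnr: "nr (Suc j) c a" "c \<in> Om" if "c \<in> nbh l a" for c
      using that aO nr_le[of c a "Suc j" l] nr_sym[OF aO _ _, of c l] 3 l lev_le[of a] by (auto simp: nbh_def)
    have U: "(\<Union>R\<in>F. snd R) \<subseteq> nbh j a"
    proof
      fix x assume "x \<in> (\<Union>R\<in>F. snd R)"
      then obtain c where c: "c \<in> nbh l a" "x \<in> cube j c" by (auto simp: F_def)
      have "nr j c a" using nr_le[of c a j "Suc j"] cnr[OF c(1)] aO jn by auto
      then show "x \<in> nbh j a"
        using nr_cong2[of a c x j] nr_sym[of c a j] c(2) cnr[OF c(1)] aO jn by (auto simp: nbh_def cube_def)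
    qed
    have "(\<Sum>x\<in>nbh l a. \<bar>v x\<bar> * mu x) \<le> (\<Sum>x\<in>(\<Union>R\<in>F. snd R). \<bar>v x\<bar> * mu x)"
    proof (intro sum_mono2)
      show "finite (\<Union>R\<in>F. snd R)" using finite_subset[OF U] by simp
      show "nbh l a \<subseteq> (\<Union>R\<in>F. snd R)"
      proof
        fix x assume x: "x \<in> nbh l a"
        have "(j, cube j x) \<in> F" using x by (auto simp: F_def)
        then show "x \<in> (\<Union>R\<in>F. snd R)" using self_in_cube[OF cnr(2)[OF x], of j] by force
      qed
      fix x assume "x \<in> (\<Union>R\<in>F. snd R) - nbh l a"
      then have "x \<in> Om" using U nbh_subset by blast
      then show "0 \<le> \<bar>v x\<bar> * mu x" using mu_pos[of x] by simp
    qed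
    also have "\<dots> \<le> AA * Lv * mass (\<Union>R\<in>F. snd R)"
    proof (rule cubes_union_le)
      show "F \<subseteq> cubes" using cnr(2) jn unfolding F_def cubes_def by fastforce
      fix R assume "R \<in> F"
      then obtain c where c: "R = (j, cube j c)" "c \<in> nbh l a" by (auto simp: F_def)
      have "nr j c y" using nr_comp[OF cnr(2)[OF c(2)] aO yO(1) _ cnr(1)[OF c(2)] yO(2)] jn by simp
      then show "(\<Sum>a\<in>snd R. \<bar>v a\<bar> * mu a) \<le> AA * Lv * mass (snd R)"
        using not_large(2)[OF cnr(2)[OF c(2)] yO(1) y(2) 3(2)] jn c(1) by simp
    qed
    also have "\<dots> \<le> AA * Lv * (D * (D * (D * mass (cube l a))))"
    proof (intro mult_left_mono)
      have "mass (\<Union>R\<in>F. snd R) \<le> mass (nbh j a)" by (intro mass_mono U nbh_subset)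
      also have "\<dots> \<le> D * mass (cube j a)" using mass_nbh_le[OF aO, of j] jn by simp
      also have "\<dots> \<le> D * (D * mass (cube (Suc j) a))"
        using mass_cube_le[OF aO, of j] jn D_pos by (intro mult_left_mono) auto
      also have "\<dots> \<le> D * (D * (D * mass (cube l a)))"
        using mass_cube_le[OF aO, of "Suc j"] jn D_pos 3 by (intro mult_left_mono) auto
      finally show "mass (\<Union>R\<in>F. snd R) \<le> D * (D * (D * mass (cube l a)))" .
    qed (use AA_ge_1 Lv_pos in auto)
    also have "\<dots> = al * Lv * mass (cube l a)"
      by (simp add: al_def power3_eq_cube)
    finally show ?thesis .
  qed
qed

end

section \<open>Replacing functions by their averages over Whitney cubes\<close>

context cz_step
begin

lemma levcube_QQ:
  assumes "b \<in> QQ" shows "cube (lev b) b \<subseteq> QQ"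
proof -
  have "b \<in> Om" "k \<le> lev b" using assms QQ_sub QQ_NN k_lev[of b] by auto
  then have "cube (lev b) b \<subseteq> cube k b" using cube_mono lev_le by blast
  then show ?thesis using assms cube_eq[of b k a0] by (simp add: QQ_def)
qed

lemma levcube_NN:
  assumes "b \<in> NN" shows "cube (lev b) b \<subseteq> NN"
proof -
  have "b \<in> Om" "k \<le> lev b" using assms NN_sub k_lev[of b] by auto
  then have "cube (lev b) b \<subseteq> cube k b" using cube_mono lev_le by blast
  then show ?thesis using assms cube_NN by (auto simp: cube_def)
qed

lemma levcube_sym: "a \<in> Om \<Longrightarrow> b \<in> Om \<Longrightarrow> b \<in> cube (lev a) a \<Longrightarrow> a \<in> cube (lev b) b"
  using lev_cong(3)[of a b] self_in_cube[of a "lev a"] by simp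

text \<open>Averaging over Whitney cubes is self-adjoint on a union of such cubes. This moves the
  difference of a function and its average onto the kernel.\<close>

lemma av_swap:
  assumes H: "H \<subseteq> Om" "\<And>a. a \<in> H \<Longrightarrow> cube (lev a) a \<subseteq> H"
  shows "(\<Sum>b\<in>H. av w b * p b * mu b) = (\<Sum>b\<in>H. w b * av p b * mu b)"
proof -
  define q where "q x b = (if x \<in> cube (lev b) b then w x * mu x * p b * mu b / mass (cube (lev b) b) else 0)" for x b
  have finH: "finite H" using finite_subset[OF H(1)] by simp
  have "(\<Sum>b\<in>H. av w b * p b * mu b) = (\<Sum>b\<in>H. \<Sum>x\<in>H. q x b)"
  proof (rule sum.cong[OF refl])
    fix b assume b: "b \<in> H"
    have "(\<Sum>x\<in>H. q x b) = (\<Sum>x\<in>cube (lev b) b. w x * mu x * p b * mu b / mass (cube (lev b) b))"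
      by (rule sum.mono_neutral_cong_right[OF finH H(2)[OF b]]) (simp_all add: q_def)
    also have "\<dots> = av w b * p b * mu b"
      unfolding av_def sum_divide_distrib sum_distrib_right
      by (intro sum.cong refl) simp
    finally show "av w b * p b * mu b = (\<Sum>x\<in>H. q x b)" by simp
  qed
  also have "\<dots> = (\<Sum>x\<in>H. \<Sum>b\<in>H. q x b)" by (rule sum.swap)
  also have "\<dots> = (\<Sum>x\<in>H. w x * av p x * mu x)"
  proof (rule sum.cong[OF refl])
    fix x assume x: "x \<in> H"
    have "(\<Sum>b\<in>H. q x b) = (\<Sum>b\<in>cube (lev x) x. w x * mu x * p b * mu b / mass (cube (lev x) x))"
    proof (rule sum.mono_neutral_cong_right[OF finH H(2)[OF x]])
      show "\<forall>b\<in>H - cube (lev x) x. q x b = 0"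
        using x H(1) levcube_sym unfolding q_def by (auto simp: subset_iff)
      fix b assume b: "b \<in> cube (lev x) x"
      then have "x \<in> cube (lev b) b" "cube (lev b) b = cube (lev x) x"
        using lev_cong(3)[of x b] x H(1) self_in_cube[of x "lev x"] by auto
      then show "q x b = w x * mu x * p b * mu b / mass (cube (lev x) x)" by (simp add: q_def)
    qed
    also have "\<dots> = w x * av p x * mu x"
      unfolding av_def sum_distrib_left sum_divide_distrib sum_distrib_right
      by (intro sum.cong refl) simp
    finally show "(\<Sum>b\<in>H. q x b) = w x * av p x * mu x" .
  qed
  finally show ?thesis .
qed

lemma av_diff:
  assumes b: "b \<in> Om" and e: "\<And>x. x \<in> cube (lev b) b \<Longrightarrow> \<bar>p b - p x\<bar> \<le> e"
  shows "\<bar>p b - av p b\<bar> \<le> e"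
proof -
  let ?B = "cube (lev b) b"
  have m: "0 < mass ?B" using mass_cube_pos[OF b] .
  have "p b - av p b = (\<Sum>x\<in>?B. (p b - p x) * mu x) / mass ?B"
    using m by (simp add: av_def left_diff_distrib sum_subtractf diff_divide_distrib mass_def
        flip: sum_distrib_left)
  then have "\<bar>p b - av p b\<bar> = \<bar>(\<Sum>x\<in>?B. (p b - p x) * mu x) / mass ?B\<bar>" by (simp only:)
  also have "\<dots> \<le> (\<Sum>x\<in>?B. e * mu x) / mass ?B"
  proof -
    have "\<bar>\<Sum>x\<in>?B. (p b - p x) * mu x\<bar> \<le> (\<Sum>x\<in>?B. e * mu x)"
    proof (rule order_trans[OF sum_abs sum_mono])
      fix x assume x: "x \<in> ?B"
      then have "0 < mu x" using mu_pos cube_subset by blast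
      then show "\<bar>(p b - p x) * mu x\<bar> \<le> e * mu x" using e[OF x] by (simp add: abs_mult)
    qed
    then show ?thesis using m by (simp add: divide_right_mono)
  qed
  also have "\<dots> = e * mass ?B / mass ?B" by (simp only: mass_def sum_distrib_left)
  also have "\<dots> = e" using m by simp
  finally show ?thesis .
qed

lemma mass_comparable: "a \<in> Om \<Longrightarrow> b \<in> Om \<Longrightarrow> l \<le> n \<Longrightarrow> nr l a b \<Longrightarrow>
    1 / mass (cube l a) \<le> D / mass (cube l b)"
  using mass_cube_nr_le[of a b l] mass_cube_pos[of a l] mass_cube_pos[of b l]
  by (simp add: field_simps)

lemma near_cong2:
  assumes "a \<in> Om" "b \<in> Om" "x \<in> cube (lev b) b"
  shows "near a x \<longleftrightarrow> near a b"
proof -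
  have x: "x \<in> Om" "anc (lev b) x = anc (lev b) b" using assms(3) by (auto simp: cube_def)
  show ?thesis
    using lev_cong[OF assms(2,3)] nr_cong2[OF assms(1) x(1) assms(2) lev_le x(2)]
      nr_cong2[OF assms(1,2) x(1) lev_le x(2)[symmetric]] by (auto simp: near_def)
qed

text \<open>Truncation does no harm in the second variable, since \<open>near a\<close> is constant
  on the Whitney cube of \<open>b\<close>. A pair that is not near separates at some level before
  \<open>lev b\<close>, where smoothness applies, unless the Whitney cube is a single cell and there
  is nothing to compare. As the level of separation varies with \<open>a\<close>, the bound is a sum
  over all levels, ready for summation over \<open>a\<close>.\<close>

lemma phi_osc2:
  assumes a: "a \<in> NN" and b: "b \<in> QQ" and x: "x \<in> cube (lev b) b"
  shows "\<bar>phi a b - phi a x\<bar>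
    \<le> (\<Sum>l\<in>{k..lev b}. if nr l a b then C * D * th ^ (lev b - l) / mass (cube l b) else 0)" (is "_ \<le> ?S")
proof -
  have aO: "a \<in> Om" and bO: "b \<in> Om" and xO: "x \<in> Om" and e: "anc (lev b) b = anc (lev b) x"
    using a b NN_sub QQ_sub x by (auto simp: cube_def)
  have nn: "0 \<le> (if nr l a b then C * D * th ^ (lev b - l) / mass (cube l b) else 0)" for l
    using C_pos D_pos th_pos mass_cube_pos[OF bO, of l] by simp
  then have S0: "0 \<le> ?S" by (intro sum_nonneg) auto
  show ?thesis
  proof (cases "near a b \<or> lev b = n")
    case True
    then show ?thesis
    proof
      assume "near a b"
      then show ?thesis using near_cong2[OF aO bO x] S0 by (simp add: phi_def)
    next
      assume "lev b = n"
      then have "x = b" using x cube_bot[OF bO] by simp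
      then show ?thesis using S0 by simp
    qed
  next
    case False
    then have "\<not> nr (lev b) a b" "lev b < n"
      using proper_if[of b] lev_le[of b] by (auto simp: near_def)
    moreover have "k < lev b" "nr k a b" using k_lev[of b] b QQ_NN nr_NN_QQ[OF a b] by auto
    ultimately obtain l where l: "k \<le> l" "l < lev b" "nr l a b" "\<not> nr (Suc l) a b"
      using nr_separation_level[of k "lev b" a b] by blast
    have "\<bar>phi a b - phi a x\<bar> = \<bar>tau a b - tau a x\<bar>"
      using False near_cong2[OF aO bO x] by (simp add: phi_def)
    also have "\<dots> \<le> C * th ^ (lev b - l) * (1 / mass (cube l a))"
      using smooth2[OF aO bO xO l(2) lev_le l(3,4) e] by simp
    also have "\<dots> \<le> C * th ^ (lev b - l) * (D / mass (cube l b))"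
      using mass_comparable[OF aO bO _ l(3)] l(2) lev_le[of b] C_pos th_pos
      by (intro mult_left_mono) auto
    also have "\<dots> = (if nr l a b then C * D * th ^ (lev b - l) / mass (cube l b) else 0)"
      using l(3) by simp
    also have "\<dots> \<le> ?S"
      using l nn by (intro member_le_sum) auto
    finally show ?thesis .
  qed
qed

lemma geo: "(\<Sum>l\<in>{k..p}. th ^ (p - l)) \<le> 1 / (1 - th)"
  by (rule sum_geometric_reverse_le[OF th_pos th_lt_1])

text \<open>By \<open>av_swap\<close> only the oscillation of \<open>phi a\<close> on Whitney cubes
  matters. At level \<open>l\<close> the sum over \<open>a\<close> is an average of \<open>v\<close>
  over a neighbourhood, bounded by \<open>v_avg\<close>, and the powers of \<open>th\<close> sum to
  at most \<open>1 / (1 - th)\<close>.\<close>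

lemma E1: "\<bar>E v (\<lambda>b. f b - g b)\<bar> \<le> C * D * al / (1 - th) * Lv * Fs"
proof -
  define psi where "psi a b = (\<Sum>l\<in>{k..lev b}. if nr l a b then C * D * th ^ (lev b - l) / mass (cube l b) else 0)" for a b
  have inner: "(\<Sum>b\<in>QQ. v a * (f b - g b) * mu a * mu b * phi a b)
      = (\<Sum>b\<in>QQ. v a * mu a * f b * mu b * (phi a b - av (phi a) b))" for a
  proof -
    have "(\<Sum>b\<in>QQ. v a * (f b - g b) * mu a * mu b * phi a b)
       = v a * mu a * ((\<Sum>b\<in>QQ. f b * phi a b * mu b) - (\<Sum>b\<in>QQ. av f b * phi a b * mu b))"
      unfolding sum_subtractf[symmetric] sum_distrib_left
      by (intro sum.cong refl) (simp add: g_def algebra_simps)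
    also have "\<dots> = v a * mu a * ((\<Sum>b\<in>QQ. f b * phi a b * mu b) - (\<Sum>b\<in>QQ. f b * av (phi a) b * mu b))"
      by (subst av_swap[OF QQ_sub levcube_QQ]) auto
    also have "\<dots> = (\<Sum>b\<in>QQ. v a * mu a * f b * mu b * (phi a b - av (phi a) b))"
      unfolding sum_subtractf[symmetric] sum_distrib_left
      by (intro sum.cong refl) (simp add: algebra_simps)
    finally show ?thesis .
  qed
  have "\<bar>E v (\<lambda>b. f b - g b)\<bar> \<le> (\<Sum>a\<in>NN. \<Sum>b\<in>QQ. \<bar>v a * mu a * f b * mu b * (phi a b - av (phi a) b)\<bar>)"
    unfolding E_def inner by (rule order_trans[OF sum_abs sum_mono[OF sum_abs]])
  also have "\<dots> \<le> (\<Sum>a\<in>NN. \<Sum>b\<in>QQ. \<bar>v a\<bar> * mu a * (\<bar>f b\<bar> * mu b) * psi a b)"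
  proof (intro sum_mono)
    fix a b assume a: "a \<in> NN" and b: "b \<in> QQ"
    then have O: "a \<in> Om" "b \<in> Om" using NN_sub QQ_sub by auto
    have "\<bar>phi a b - av (phi a) b\<bar> \<le> psi a b"
      unfolding psi_def using phi_osc2[OF a b] by (intro av_diff[OF O(2)])
    then have "\<bar>v a * mu a * f b * mu b\<bar> * \<bar>phi a b - av (phi a) b\<bar> \<le> \<bar>v a * mu a * f b * mu b\<bar> * psi a b"
      by (intro mult_left_mono) auto
    then show "\<bar>v a * mu a * f b * mu b * (phi a b - av (phi a) b)\<bar> \<le> \<bar>v a\<bar> * mu a * (\<bar>f b\<bar> * mu b) * psi a b"
      using mu_pos[OF O(1)] mu_pos[OF O(2)] by (simp add: abs_mult mult.assoc)
  qed
  also have "\<dots> = (\<Sum>b\<in>QQ. \<bar>f b\<bar> * mu b * (\<Sum>a\<in>NN. \<bar>v a\<bar> * mu a * psi a b))"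
    by (subst sum.swap) (simp add: sum_distrib_left mult.left_commute mult.assoc)
  also have "\<dots> \<le> (\<Sum>b\<in>QQ. \<bar>f b\<bar> * mu b * (C * D * al / (1 - th) * Lv))"
  proof (intro sum_mono mult_left_mono)
    fix b assume b: "b \<in> QQ"
    then have bO: "b \<in> Om" and bN: "b \<in> NN" using QQ_sub QQ_NN by auto
    have "(\<Sum>a\<in>NN. \<bar>v a\<bar> * mu a * psi a b)
       = (\<Sum>l\<in>{k..lev b}. C * D * th ^ (lev b - l) / mass (cube l b) * (\<Sum>a\<in>NN. if nr l a b then \<bar>v a\<bar> * mu a else 0))"
      unfolding psi_def sum_distrib_left by (subst sum.swap) (intro sum.cong refl, simp)
    also have "\<dots> \<le> (\<Sum>l\<in>{k..lev b}. C * D * th ^ (lev b - l) / mass (cube l b) * (al * Lv * mass (cube l b)))"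
    proof (intro sum_mono mult_left_mono)
      fix l assume l: "l \<in> {k..lev b}"
      have ln: "l \<le> n" using l lev_le[of b] by auto
      have "(\<Sum>a\<in>NN. if nr l a b then \<bar>v a\<bar> * mu a else 0) = (\<Sum>a\<in>{a\<in>NN. nr l a b}. \<bar>v a\<bar> * mu a)"
        by (simp add: sum.inter_filter)
      also have "\<dots> \<le> (\<Sum>a\<in>nbh l b. \<bar>v a\<bar> * mu a)"
        using NN_sub nr_sym[OF _ bO ln] mu_pos
        by (intro sum_mono2) (auto simp: nbh_def intro!: mult_nonneg_nonneg intro: less_imp_le)
      also have "\<dots> \<le> al * Lv * mass (cube l b)"
        using v_avg[OF bN] l by simp
      finally show "(\<Sum>a\<in>NN. if nr l a b then \<bar>v a\<bar> * mu a else 0) \<le> al * Lv * mass (cube l b)" .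
      show "0 \<le> C * D * th ^ (lev b - l) / mass (cube l b)"
        using C_pos D_pos th_pos mass_cube_pos[OF bO, of l] by simp
    qed
    also have "\<dots> = (\<Sum>l\<in>{k..lev b}. C * D * al * Lv * th ^ (lev b - l))"
    proof (intro sum.cong refl)
      fix l show "C * D * th ^ (lev b - l) / mass (cube l b) * (al * Lv * mass (cube l b)) = C * D * al * Lv * th ^ (lev b - l)"
        using mass_cube_pos[OF bO, of l] by simp
    qed
    also have "\<dots> = C * D * al * Lv * (\<Sum>l\<in>{k..lev b}. th ^ (lev b - l))"
      by (simp add: sum_distrib_left)
    also have "\<dots> \<le> C * D * al * Lv * (1 / (1 - th))"
      using C_pos D_pos al_pos Lv_pos by (intro mult_left_mono geo) auto
    finally show "(\<Sum>a\<in>NN. \<bar>v a\<bar> * mu a * psi a b) \<le> C * D * al / (1 - th) * Lv" by simp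
    show "0 \<le> \<bar>f b\<bar> * mu b" using mu_pos[OF bO] by simp
  qed
  also have "\<dots> = (\<Sum>b\<in>QQ. \<bar>f b\<bar> * mu b) * (C * D * al / (1 - th) * Lv)"
    by (simp only: sum_distrib_right)
  also have "\<dots> \<le> Fs * (C * D * al / (1 - th) * Lv)"
    using C_pos D_pos al_pos Lv_pos th_lt_1 by (intro mult_right_mono sum_f_le QQ_sub) auto
  finally show ?thesis by (simp only: mult_ac)
qed

lemma g_bound: "\<bar>g b\<bar> \<le> al * Lf"
proof (cases "b \<in> QQ")
  case True
  then have bO: "b \<in> Om" and bN: "b \<in> NN" using QQ_sub QQ_NN by auto
  have m: "0 < mass (cube (lev b) b)" using mass_cube_pos[OF bO] .
  have "\<bar>\<Sum>x\<in>cube (lev b) b. f x * mu x\<bar> \<le> (\<Sum>x\<in>cube (lev b) b. \<bar>f x\<bar> * mu x)"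
  proof (rule order_trans[OF sum_abs sum_mono])
    fix x assume "x \<in> cube (lev b) b"
    then have "0 < mu x" using mu_pos cube_subset by blast
    then show "\<bar>f x * mu x\<bar> \<le> \<bar>f x\<bar> * mu x" by (simp add: abs_mult)
  qed
  also have "\<dots> \<le> al * Lf * mass (cube (lev b) b)"
    using f_avg[OF bN] k_lev[OF bN] by simp
  finally show ?thesis using m True by (simp add: g_def av_def divide_le_eq)
qed (use al_pos Lf_pos in \<open>simp add: g_def\<close>)

lemma h_bound: "\<bar>h b\<bar> \<le> al * Lv"
proof (cases "b \<in> NN")
  case True
  then have bO: "b \<in> Om" using NN_sub by auto
  have m: "0 < mass (cube (lev b) b)" using mass_cube_pos[OF bO] .
  have "\<bar>\<Sum>x\<in>cube (lev b) b. v x * mu x\<bar> \<le> (\<Sum>x\<in>cube (lev b) b. \<bar>v x\<bar> * mu x)"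
  proof (rule order_trans[OF sum_abs sum_mono])
    fix x assume "x \<in> cube (lev b) b"
    then have "0 < mu x" using mu_pos cube_subset by blast
    then show "\<bar>v x * mu x\<bar> \<le> \<bar>v x\<bar> * mu x" by (simp add: abs_mult)
  qed
  also have "\<dots> \<le> (\<Sum>x\<in>nbh (lev b) b. \<bar>v x\<bar> * mu x)"
  proof (intro sum_mono2 cube_subset_nbh[OF bO lev_le])
    fix x assume "x \<in> nbh (lev b) b - cube (lev b) b"
    then have "0 < mu x" using mu_pos nbh_subset by blast
    then show "0 \<le> \<bar>v x\<bar> * mu x" by simp
  qed simp
  also have "\<dots> \<le> al * Lv * mass (cube (lev b) b)"
    using v_avg[OF True] k_lev[OF True] by simp
  finally show ?thesis using m True by (simp add: h_def av_def divide_le_eq)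
qed (use al_pos Lv_pos in \<open>simp add: h_def\<close>)

text \<open>The truncation follows the Whitney cube of \<open>b\<close>, so \<open>phi\<close> may
  jump inside that of \<open>a\<close>, but only if \<open>a\<close> and \<open>b\<close> are
  neighbours at level \<open>lev a\<close>. By \<open>lev_comparable\<close>, pairs that are still
  neighbours at the next level are near and removed; the others are at the distance of the cube, and
  the size bound gives the term \<open>l = lev a\<close>.\<close>

lemma phi_osc1:
  assumes a: "a \<in> NN" and b: "b \<in> QQ" and x: "x \<in> cube (lev a) a" and ln: "lev a < n"
  shows "\<bar>phi a b - phi x b\<bar>
    \<le> (\<Sum>l\<in>{k..lev a}. if nr l a b then 2 * C * th ^ (lev a - l) / mass (cube l a) else 0)" (is "_ \<le> ?S")
proof -
  have aO: "a \<in> Om" and bO: "b \<in> Om" and xO: "x \<in> Om" and e: "anc (lev a) a = anc (lev a) x"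
    using a b NN_sub QQ_sub x by (auto simp: cube_def)
  have nn: "0 \<le> (if nr l a b then 2 * C * th ^ (lev a - l) / mass (cube l a) else 0)" for l
    using C_pos th_pos mass_cube_pos[OF aO, of l] by simp
  have xc: "nr j x b \<longleftrightarrow> nr j a b" if "j \<le> lev a" for j
    using nr_cong[of x a b j] nr_cong[of a x b j] anc_le[OF aO xO that lev_le e] that lev_le[of a] aO bO xO
    by auto
  have lx: "lev x = lev a" using lev_cong[OF aO x] by simp
  have kl: "k < lev a" using k_lev[OF a] .
  have mono: "nr i y b" if "nr j y b" "i \<le> j" "j \<le> n" "y \<in> Om" for i j y
    using nr_le[OF that(4) bO that(2,3,1)] .
  have single: "\<bar>phi a b - phi x b\<bar> \<le> ?S"
    if "k \<le> l" "l \<le> lev a" "nr l a b" "\<bar>phi a b - phi x b\<bar> \<le> 2 * C * th ^ (lev a - l) / mass (cube l a)" for l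
  proof -
    have "\<bar>phi a b - phi x b\<bar> \<le> (if nr l a b then 2 * C * th ^ (lev a - l) / mass (cube l a) else 0)"
      using that by simp
    also have "\<dots> \<le> ?S" by (rule member_le_sum) (use that(1,2) nn in simp_all)
    finally show ?thesis .
  qed
  show ?thesis
  proof (cases "nr (lev a) a b")
    case True
    have sz: "\<bar>phi y b\<bar> \<le> C / mass (cube (lev a) a)" if y: "y \<in> Om" "y \<in> cube (lev a) a" "nr (lev a) y b" for y
    proof (cases "near y b")
      case True
      then show ?thesis using C_pos mass_cube_pos[OF aO, of "lev a"] by (simp add: phi_def)
    next
      case False
      have ly: "lev y = lev a" using lev_cong[OF aO y(2)] by simp
      have "\<not> nr (Suc (lev a)) y b"
      proof
        assume n: "nr (Suc (lev a)) y b"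
        have "lev b \<le> Suc (lev a)" "proper b"
          using lev_comparable[OF y(1) bO, unfolded ly, OF ln n] by auto
        then have "near y b" using mono[OF n, of "lev b"] ln y(1) by (auto simp: near_def)
        with False show False ..
      qed
      then show ?thesis
        using size[OF y(1) bO ln y(3)] cube_eq[OF y(2)] False by (simp add: phi_def)
    qed
    have "\<bar>phi a b - phi x b\<bar> \<le> \<bar>phi a b\<bar> + \<bar>phi x b\<bar>" by simp
    also have "\<dots> \<le> C / mass (cube (lev a) a) + C / mass (cube (lev a) a)"
      using sz[OF aO self_in_cube[OF aO] True] sz[OF xO x] xc[of "lev a"] True by (intro add_mono) auto
    also have "\<dots> = 2 * C * th ^ (lev a - lev a) / mass (cube (lev a) a)" by simp
    finally show ?thesis using kl True by (intro single[of "lev a"]) auto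
  next
    case False
    then obtain l where l: "k \<le> l" "l < lev a" "nr l a b" "\<not> nr (Suc l) a b"
      using nr_separation_level[OF kl nr_NN_QQ[OF a b]] by blast
    have same: "near a b \<longleftrightarrow> near x b"
    proof (cases "lev b \<le> l")
      case True then show ?thesis using xc[of "lev b"] l by (simp add: near_def)
    next
      case False
      have "\<not> nr (lev b) a b" using mono[of "lev b" a "Suc l"] False l lev_le[of b] aO by auto
      moreover have "\<not> nr (lev b) x b"
        using mono[of "lev b" x "Suc l"] False l lev_le[of b] xO xc[of "Suc l"] by auto
      ultimately show ?thesis by (simp add: near_def)
    qed
    have "\<bar>phi a b - phi x b\<bar> \<le> \<bar>tau a b - tau x b\<bar>" using same by (simp add: phi_def)
    also have "\<dots> \<le> C * th ^ (lev a - l) / mass (cube l a)"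
      using smooth1[OF aO xO bO l(2) lev_le l(3,4) e] by simp
    also have "\<dots> \<le> 2 * C * th ^ (lev a - l) / mass (cube l a)"
      using C_pos th_pos mass_cube_pos[OF aO, of l] by (intro divide_right_mono mult_right_mono) auto
    finally show ?thesis using l by (intro single[of l]) auto
  qed
qed

text \<open>\<open>g\<close> is bounded by \<open>al * Lf\<close>, so the kernel is summed against
  masses of neighbourhoods only, and \<open>Ph\<close> oscillates by at most \<open>K\<close> on
  each Whitney cube. \<open>massN_le\<close> then turns \<open>Vs * Lf\<close> into
  \<open>Lv * Fs\<close> at the cost of a factor \<open>D\<close>.\<close>

lemma E2: "\<bar>E (\<lambda>a. v a - h a) g\<bar> \<le> 2 * C * D\<^sup>2 * al / (1 - th) * Lv * Fs"
proof -
  define Ph where "Ph a = (\<Sum>b\<in>QQ. g b * mu b * phi a b)" for a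
  define K where "K = 2 * C * D * al / (1 - th) * Lf"
  have K0: "0 \<le> K" using C_pos D_pos al_pos Lf_pos th_lt_1 by (simp add: K_def)
  have osc: "\<bar>Ph a - Ph x\<bar> \<le> K" if a: "a \<in> NN" and x: "x \<in> cube (lev a) a" for a x
  proof (cases "lev a < n")
    case False
    have aO: "a \<in> Om" using a NN_sub by auto
    have "x = a" using x False lev_le[of a] cube_bot[OF aO] by simp
    then show ?thesis using K0 by simp
  next
    case True
    have aO: "a \<in> Om" using a NN_sub by auto
    have "Ph a - Ph x = (\<Sum>b\<in>QQ. g b * mu b * (phi a b - phi x b))"
      by (simp add: Ph_def sum_subtractf right_diff_distrib)
    then have "\<bar>Ph a - Ph x\<bar> = \<bar>\<Sum>b\<in>QQ. g b * mu b * (phi a b - phi x b)\<bar>" by (simp only:)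
    also have "\<dots> \<le> (\<Sum>b\<in>QQ. \<bar>g b * mu b * (phi a b - phi x b)\<bar>)" by (rule sum_abs)
    also have "\<dots> \<le> (\<Sum>b\<in>QQ. al * Lf * mu b * (\<Sum>l\<in>{k..lev a}. if nr l a b then 2 * C * th ^ (lev a - l) / mass (cube l a) else 0))"
    proof (rule sum_mono)
      fix b assume b: "b \<in> QQ"
      then have m: "0 < mu b" using QQ_sub mu_pos by blast
      have "\<bar>g b * mu b * (phi a b - phi x b)\<bar> = \<bar>g b\<bar> * mu b * \<bar>phi a b - phi x b\<bar>"
        using m by (simp add: abs_mult)
      also have "\<dots> \<le> (al * Lf * mu b) * (\<Sum>l\<in>{k..lev a}. if nr l a b then 2 * C * th ^ (lev a - l) / mass (cube l a) else 0)"
      proof (rule mult_mono[OF _ phi_osc1[OF a b x True]])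
        show "\<bar>g b\<bar> * mu b \<le> al * Lf * mu b" using g_bound[of b] m by simp
      qed (use al_pos Lf_pos m in simp_all)
      finally show "\<bar>g b * mu b * (phi a b - phi x b)\<bar> \<le> (al * Lf * mu b) * (\<Sum>l\<in>{k..lev a}. if nr l a b then 2 * C * th ^ (lev a - l) / mass (cube l a) else 0)" .
    qed
    also have "\<dots> = (\<Sum>l\<in>{k..lev a}. al * Lf * (2 * C * th ^ (lev a - l) / mass (cube l a)) * (\<Sum>b\<in>QQ. if nr l a b then mu b else 0))"
      unfolding sum_distrib_left by (subst sum.swap) (intro sum.cong refl, simp)
    also have "\<dots> \<le> (\<Sum>l\<in>{k..lev a}. al * Lf * (2 * C * th ^ (lev a - l) / mass (cube l a)) * (D * mass (cube l a)))"
    proof (intro sum_mono mult_left_mono)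
      fix l assume l: "l \<in> {k..lev a}"
      have "(\<Sum>b\<in>QQ. if nr l a b then mu b else 0) = mass {b\<in>QQ. nr l a b}"
        by (simp add: sum.inter_filter mass_def)
      also have "\<dots> \<le> mass (nbh l a)" using QQ_sub by (intro mass_mono) (auto simp: nbh_def)
      also have "\<dots> \<le> D * mass (cube l a)" using l lev_le[of a] by (intro mass_nbh_le aO) auto
      finally show "(\<Sum>b\<in>QQ. if nr l a b then mu b else 0) \<le> D * mass (cube l a)" .
      show "0 \<le> al * Lf * (2 * C * th ^ (lev a - l) / mass (cube l a))"
        using al_pos Lf_pos C_pos th_pos mass_cube_pos[OF aO, of l] by simp
    qed
    also have "\<dots> = (\<Sum>l\<in>{k..lev a}. 2 * C * D * al * Lf * th ^ (lev a - l))"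
    proof (intro sum.cong refl)
      fix l show "al * Lf * (2 * C * th ^ (lev a - l) / mass (cube l a)) * (D * mass (cube l a)) = 2 * C * D * al * Lf * th ^ (lev a - l)"
        using mass_cube_pos[OF aO, of l] by simp
    qed
    also have "\<dots> = 2 * C * D * al * Lf * (\<Sum>l\<in>{k..lev a}. th ^ (lev a - l))"
      by (simp add: sum_distrib_left)
    also have "\<dots> \<le> 2 * C * D * al * Lf * (1 / (1 - th))"
      using C_pos D_pos al_pos Lf_pos by (intro mult_left_mono geo) auto
    also have "\<dots> = K" by (simp add: K_def)
    finally show ?thesis .
  qed
  have "E (\<lambda>a. v a - h a) g = (\<Sum>a\<in>NN. v a * Ph a * mu a) - (\<Sum>a\<in>NN. av v a * Ph a * mu a)"
    unfolding E_def Ph_def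
    unfolding sum_subtractf[symmetric] sum_distrib_left sum_distrib_right
    by (intro sum.cong refl) (simp add: h_def algebra_simps)
  also have "\<dots> = (\<Sum>a\<in>NN. v a * Ph a * mu a) - (\<Sum>a\<in>NN. v a * av Ph a * mu a)"
    by (subst av_swap[OF NN_sub levcube_NN]) auto
  also have "\<dots> = (\<Sum>a\<in>NN. v a * mu a * (Ph a - av Ph a))"
    unfolding sum_subtractf[symmetric] by (intro sum.cong refl) (simp add: algebra_simps)
  finally have "\<bar>E (\<lambda>a. v a - h a) g\<bar> = \<bar>\<Sum>a\<in>NN. v a * mu a * (Ph a - av Ph a)\<bar>" by (simp only:)
  also have "\<dots> \<le> (\<Sum>a\<in>NN. \<bar>v a * mu a * (Ph a - av Ph a)\<bar>)" by (rule sum_abs)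
  also have "\<dots> \<le> (\<Sum>a\<in>NN. \<bar>v a\<bar> * mu a * K)"
  proof (rule sum_mono)
    fix a assume a: "a \<in> NN"
    then have aO: "a \<in> Om" using NN_sub by auto
    have "\<bar>Ph a - av Ph a\<bar> \<le> K" using osc[OF a] by (intro av_diff[OF aO])
    then have "\<bar>v a\<bar> * mu a * \<bar>Ph a - av Ph a\<bar> \<le> \<bar>v a\<bar> * mu a * K"
      using mu_pos[OF aO] by (intro mult_left_mono) auto
    then show "\<bar>v a * mu a * (Ph a - av Ph a)\<bar> \<le> \<bar>v a\<bar> * mu a * K"
      using mu_pos[OF aO] by (simp add: abs_mult)
  qed
  also have "\<dots> = (\<Sum>a\<in>NN. \<bar>v a\<bar> * mu a) * K" by (simp only: sum_distrib_right)
  also have "\<dots> \<le> Vs * K" using K0 by (intro mult_right_mono sum_v_le NN_sub)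
  also have "\<dots> = Lv * mass NN * K" using massN by (simp add: Lv_def)
  also have "\<dots> \<le> Lv * (D * mass QQ) * K"
    using massN_le Lv_pos K0 by (intro mult_right_mono mult_left_mono) auto
  also have "\<dots> = 2 * C * D\<^sup>2 * al / (1 - th) * Lv * (Lf * mass QQ)"
    by (simp add: K_def power2_eq_square)
  also have "Lf * mass QQ = Fs" using massQ by (simp add: Lf_def)
  finally show ?thesis .
qed

lemma Ch_cubes: "Ch \<subseteq> cubes"
  using QQ_sub lev_le unfolding Ch_def cubes_def by fastforce

lemma finite_Ch: "finite Ch"
  unfolding Ch_def by (rule finite_image_set) simp

lemma Ch_D:
  assumes "P \<in> Ch" "x \<in> snd P"
  shows "P = (lev x, cube (lev x) x)" "x \<in> QQ" "proper x"
proof -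
  obtain b where b: "P = (lev b, cube (lev b) b)" "b \<in> QQ" "proper b" using assms(1) by (auto simp: Ch_def)
  have x: "x \<in> cube (lev b) b" using assms(2) b by simp
  have bO: "b \<in> Om" using b QQ_sub by auto
  show "P = (lev x, cube (lev x) x)" "proper x" using lev_cong[OF bO x] b by auto
  show "x \<in> QQ" using levcube_QQ[OF b(2)] x by auto
qed

lemma Ch_disjoint: "P \<in> Ch \<Longrightarrow> P' \<in> Ch \<Longrightarrow> P \<noteq> P' \<Longrightarrow> snd P \<inter> snd P' = {}"
  using Ch_D(1) by blast

lemma Ch_level: "P \<in> Ch \<Longrightarrow> k < fst P \<and> snd P \<subseteq> QQ \<and> snd P \<noteq> {}"
  using k_lev QQ_NN QQ_sub levcube_QQ self_in_cube unfolding Ch_def by fastforce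

lemma Ch_nbh: "P \<in> Ch \<Longrightarrow> cube_nbh P \<subseteq> NN"
proof
  fix a assume P: "P \<in> Ch" and a: "a \<in> cube_nbh P"
  obtain b where b: "P = (lev b, cube (lev b) b)" "b \<in> QQ" using P by (auto simp: Ch_def)
  have bO: "b \<in> Om" and bk: "k < lev b" using b QQ_sub QQ_NN k_lev by auto
  have "a \<in> nbh (lev b) b" using a b cube_nbh_eq[OF bO lev_le] by simp
  then have aO: "a \<in> Om" and "nr k b a" using nr_le[OF bO _ _ lev_le, of a k b] bk by (auto simp: nbh_def)
  then show "a \<in> NN" using nr_cong[of b a0 a k] a0 b(2) k_less by (auto simp: NN_def QQ_def nbh_def cube_def)
qed

lemma Ch_union_mass: "mass (\<Union>P\<in>Ch. snd P) \<le> mass QQ / 4"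
proof -
  have "(\<Union>P\<in>Ch. snd P) \<subseteq> Bad"
  proof
    fix x assume "x \<in> (\<Union>P\<in>Ch. snd P)"
    then obtain P where "P \<in> Ch" "x \<in> snd P" by blast
    from Ch_D[OF this] have "proper x" "x \<in> Om" using QQ_sub by auto
    then show "x \<in> Bad" using nr_refl[of x "lev x"] lev_le[of x] by (auto simp: proper_def nbh_def)
  qed
  then have "mass (\<Union>P\<in>Ch. snd P) \<le> mass Bad" using Bad_sub by (intro mass_mono)
  also note mass_Bad
  also have "mass QQ / (8 * D) \<le> mass QQ / 4"
    using massQ D_ge_1 by (intro divide_left_mono) auto
  finally show ?thesis .
qed

text \<open>Every near pair belongs to exactly one child, the Whitney cube of \<open>b\<close>. A
  child has the shape of the original problem: the second function lives on a cube, the first one on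
  its neighbourhood.\<close>

lemma form_split:
  assumes w: "\<And>a. a \<notin> NN \<Longrightarrow> w a = 0" and p: "\<And>b. b \<notin> QQ \<Longrightarrow> p b = 0"
  shows "form w p = (\<Sum>P\<in>Ch. form (res (cube_nbh P) w) (res (snd P) p)) + E w p"
proof -
  define t where "t a b = w a * p b * mu a * mu b * tau a b" for a b
  define psi where "psi b = (\<Sum>a\<in>Om. if nr (lev b) a b then t a b else 0)" for b
  have "form w p = (\<Sum>a\<in>NN. \<Sum>b\<in>QQ. t a b)"
    unfolding form_def t_def[symmetric]
    using NN_sub QQ_sub w p by (intro sum.mono_neutral_cong_right) (auto simp: t_def intro!: sum.neutral sum.mono_neutral_cong_right)
  also have "\<dots> = (\<Sum>a\<in>NN. \<Sum>b\<in>QQ. if near a b then t a b else 0) + E w p"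
    unfolding E_def sum.distrib[symmetric] by (intro sum.cong refl) (simp add: phi_def t_def)
  also have "(\<Sum>a\<in>NN. \<Sum>b\<in>QQ. if near a b then t a b else 0) = (\<Sum>b\<in>QQ. \<Sum>a\<in>NN. if near a b then t a b else 0)"
    by (rule sum.swap)
  also have "\<dots> = (\<Sum>b\<in>{b\<in>QQ. proper b}. psi b)"
  proof -
    have "(\<Sum>a\<in>NN. if near a b then t a b else 0) = (if proper b then psi b else 0)" for b
      unfolding psi_def using NN_sub w
      by (auto simp: near_def t_def intro!: sum.mono_neutral_left)
    then show ?thesis by (simp add: sum.inter_filter)
  qed
  also have "{b\<in>QQ. proper b} = (\<Union>P\<in>Ch. snd P)"
  proof
    show "{b\<in>QQ. proper b} \<subseteq> (\<Union>P\<in>Ch. snd P)"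
      using QQ_sub self_in_cube by (fastforce simp: Ch_def)
    show "(\<Union>P\<in>Ch. snd P) \<subseteq> {b\<in>QQ. proper b}" using Ch_D(2,3) by blast
  qed
  also have "(\<Sum>b\<in>(\<Union>P\<in>Ch. snd P). psi b) = (\<Sum>P\<in>Ch. \<Sum>b\<in>snd P. psi b)"
    using Ch_level QQ_sub finite_Ch Ch_disjoint finite_subset[OF _ finQ] by (intro sum.UNION_disjoint) blast+
  also have "\<dots> = (\<Sum>P\<in>Ch. form (res (cube_nbh P) w) (res (snd P) p))"
  proof (rule sum.cong[OF refl])
    fix P assume P: "P \<in> Ch"
    have sub: "snd P \<subseteq> Om" using Ch_level[OF P] QQ_sub by auto
    have nb: "a \<in> cube_nbh P \<longleftrightarrow> nr (lev b) a b" if a: "a \<in> Om" and b: "b \<in> snd P" for a b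
    proof -
      have bO: "b \<in> Om" using b sub by auto
      have "cube_nbh P = nbh (lev b) b" using Ch_D(1)[OF P b] cube_nbh_eq[OF bO lev_le] by metis
      then show ?thesis using nr_sym[OF a bO lev_le] nr_sym[OF bO a lev_le] a by (auto simp: nbh_def)
    qed
    have "form (res (cube_nbh P) w) (res (snd P) p) = (\<Sum>b\<in>Om. \<Sum>a\<in>Om. res (cube_nbh P) w a * res (snd P) p b * mu a * mu b * tau a b)"
      unfolding form_def by (rule sum.swap)
    also have "\<dots> = (\<Sum>b\<in>snd P. psi b)"
      using sub by (intro sum.mono_neutral_cong_right)
        (auto simp: res_def psi_def t_def nb intro!: sum.cong)
    finally show "(\<Sum>b\<in>snd P. psi b) = form (res (cube_nbh P) w) (res (snd P) p)" by simp
  qed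
  finally show ?thesis .
qed

text \<open>Here no kernel estimate is needed: \<open>form_split\<close> writes \<open>E h g\<close>
  as a combination of forms of bounded functions, to which the L^2 bound applies. The children are
  disjoint, so their masses add up to at most \<open>mass QQ\<close>.\<close>

lemma E3: "\<bar>E h g\<bar> \<le> 2 * C * D * al\<^sup>2 * Lv * Fs"
proof -
  have g0: "g b = 0" if "b \<notin> QQ" for b using that by (simp add: g_def)
  have h0: "h b = 0" if "b \<notin> NN" for b using that by (simp add: h_def)
  have pos: "0 \<le> al * Lv" "0 \<le> al * Lf" using al_pos Lv_pos Lf_pos by auto
  have hg: "res NN h = h" "res QQ g = g" using g0 h0 by (auto simp: res_def)
  have 1: "\<bar>form h g\<bar> \<le> C * (al * Lv) * (al * Lf) * D * mass QQ"
  proof -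
    have "\<bar>form (res NN h) (res QQ g)\<bar> \<le> C * (al * Lv) * (al * Lf) * D * mass QQ"
      by (rule form_bounded[OF NN_sub QQ_sub _ _ pos massN_le]) (rule h_bound, rule g_bound)
    then show ?thesis by (simp only: hg)
  qed
  have 2: "\<bar>form (res (cube_nbh P) h) (res (snd P) g)\<bar> \<le> C * (al * Lv) * (al * Lf) * D * mass (snd P)"
    if P: "P \<in> Ch" for P
  proof (rule form_bounded[OF _ _ _ _ pos])
    show "\<bar>h b\<bar> \<le> al * Lv" "\<bar>g b\<bar> \<le> al * Lf" for b by (rule h_bound, rule g_bound)
    show "cube_nbh P \<subseteq> Om" "snd P \<subseteq> Om" using Ch_nbh[OF P] NN_sub Ch_level[OF P] QQ_sub by auto
    obtain b where b: "P = (lev b, cube (lev b) b)" "b \<in> Om" using P QQ_sub by (auto simp: Ch_def)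
    show "mass (cube_nbh P) \<le> D * mass (snd P)"
      using mass_nbh_le[OF b(2) lev_le] cube_nbh_eq[OF b(2) lev_le] b(1) by simp
  qed
  have sumCh: "(\<Sum>P\<in>Ch. mass (snd P)) \<le> mass QQ"
  proof -
    have "(\<Sum>P\<in>Ch. mass (snd P)) = mass (\<Union>P\<in>Ch. snd P)"
      unfolding mass_def using Ch_level finite_Ch Ch_disjoint finite_subset[OF _ finQ]
      by (intro sum.UNION_disjoint[symmetric]) blast+
    also have "\<dots> \<le> mass QQ" using Ch_union_mass massQ by simp
    finally show ?thesis .
  qed
  have "E h g = form h g - (\<Sum>P\<in>Ch. form (res (cube_nbh P) h) (res (snd P) g))"
    using form_split[OF h0 g0] by simp
  then have "\<bar>E h g\<bar> = \<bar>form h g - (\<Sum>P\<in>Ch. form (res (cube_nbh P) h) (res (snd P) g))\<bar>" by (simp only:)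
  also have "\<dots> \<le> \<bar>form h g\<bar> + (\<Sum>P\<in>Ch. \<bar>form (res (cube_nbh P) h) (res (snd P) g)\<bar>)"
    by (intro order_trans[OF abs_triangle_ineq4] add_left_mono sum_abs)
  also have "\<dots> \<le> C * (al * Lv) * (al * Lf) * D * mass QQ + (\<Sum>P\<in>Ch. C * (al * Lv) * (al * Lf) * D * mass (snd P))"
    by (intro add_mono 1 sum_mono 2)
  also have "\<dots> = C * (al * Lv) * (al * Lf) * D * (mass QQ + (\<Sum>P\<in>Ch. mass (snd P)))"
    by (simp only: distrib_left sum_distrib_left)
  also have "\<dots> \<le> C * (al * Lv) * (al * Lf) * D * (2 * mass QQ)"
    using sumCh C_pos pos D_pos by (intro mult_left_mono) auto
  also have "\<dots> = 2 * C * D * al\<^sup>2 * Lv * (Lf * mass QQ)" by (simp add: power2_eq_square)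
  also have "Lf * mass QQ = Fs" using massQ by (simp add: Lf_def)
  finally show ?thesis .
qed

lemma one_step:
  "\<bar>form v f\<bar> \<le> (\<Sum>P\<in>Ch. \<bar>form (res (cube_nbh P) v) (res (snd P) f)\<bar>)
     + (C * D * al / (1 - th) + 2 * C * D\<^sup>2 * al / (1 - th) + 2 * C * D * al\<^sup>2) * Lv * Fs"
proof -
  have "E v f = E v (\<lambda>b. f b - g b) + E (\<lambda>a. v a - h a) g + E h g"
    unfolding E_def sum.distrib[symmetric] by (intro sum.cong refl) (simp add: algebra_simps)
  then have "\<bar>E v f\<bar> \<le> \<bar>E v (\<lambda>b. f b - g b)\<bar> + \<bar>E (\<lambda>a. v a - h a) g\<bar> + \<bar>E h g\<bar>" by linarith
  also have "\<dots> \<le> (C * D * al / (1 - th) + 2 * C * D\<^sup>2 * al / (1 - th) + 2 * C * D * al\<^sup>2) * Lv * Fs"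
    using E1 E2 E3 by (simp only: distrib_right)
  finally have "\<bar>E v f\<bar> \<le> \<dots>" .
  moreover have "form v f = (\<Sum>P\<in>Ch. form (res (cube_nbh P) v) (res (snd P) f)) + E v f"
    using v_supp f_supp by (intro form_split) (auto simp: NN_def QQ_def)
  ultimately show ?thesis
    using sum_abs[of "\<lambda>P. form (res (cube_nbh P) v) (res (snd P) f)" Ch] by linarith
qed

end

section \<open>Iteration to a sparse family\<close>

context cz_matrix
begin

text \<open>It is the union of all finer cubes inside \<open>R\<close> that is measured, so the rest
  of \<open>R\<close> keeps three quarters of its mass. A quarter rather than a half leaves room for
  the factor 2 by which averages vary within a shell (\<open>shell_bounds\<close>).\<close>

definition sparse :: "(nat \<times> 'a set) set \<Rightarrow> bool" where
  "sparse S \<longleftrightarrow> (\<forall>R\<in>S. mass (\<Union>R'\<in>{R'\<in>S. fst R < fst R' \<and> snd R' \<subseteq> snd R}. snd R') \<le> mass (snd R) / 4)"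

definition pairing :: "('a \<Rightarrow> real) \<Rightarrow> ('a \<Rightarrow> real) \<Rightarrow> nat \<times> 'a set \<Rightarrow> real" where
  "pairing v f R = (\<Sum>a\<in>cube_nbh R. \<bar>v a\<bar> * mu a) / mass (cube_nbh R) * (\<Sum>b\<in>snd R. \<bar>f b\<bar> * mu b)"

text \<open>The errors of \<open>one_step\<close> with \<open>al\<close> written out, and the
  constant of \<open>sparse_bound_finest\<close>.\<close>

definition sparse_const :: real where
  "sparse_const = C * D * (D ^ 3 * (16 * D ^ 3)) / (1 - th) + 2 * C * D\<^sup>2 * (D ^ 3 * (16 * D ^ 3)) / (1 - th)
     + 2 * C * D * (D ^ 3 * (16 * D ^ 3))\<^sup>2 + C * D ^ 3"

lemma cubes_nonempty: "R \<in> cubes \<Longrightarrow> snd R \<noteq> {} \<and> snd R \<subseteq> Om"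
  using self_in_cube cube_subset by (fastforce simp: cubes_def)

lemma pairing_nonneg: "R \<in> cubes \<Longrightarrow> 0 \<le> pairing v f R"
  unfolding pairing_def using cubes_nonempty[of R]
  by (intro mult_nonneg_nonneg divide_nonneg_nonneg sum_nonneg mass_nonneg)
     (auto simp: cube_nbh_def intro!: less_imp_le[OF mu_pos])

lemma res_res: "A \<subseteq> B \<Longrightarrow> res A (res B f) = res A f"
  by (rule ext) (auto simp: res_def)

lemma sum_res: "A \<subseteq> Om \<Longrightarrow> (\<Sum>a\<in>Om. \<bar>res A f a\<bar> * mu a) = (\<Sum>a\<in>A. \<bar>f a\<bar> * mu a)"
  by (intro sum.mono_neutral_cong_right) (auto simp: res_def)

text \<open>Covers the case of a vanishing stopping threshold, which \<open>cz_step\<close>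
  excludes.\<close>

lemma form_zero:
  assumes "A \<subseteq> Om" "B \<subseteq> Om" "(\<Sum>a\<in>A. \<bar>v a\<bar> * mu a) = 0 \<or> (\<Sum>b\<in>B. \<bar>f b\<bar> * mu b) = 0"
  shows "form (res A v) (res B f) = 0"
proof -
  have z: "\<And>a. a \<in> A \<Longrightarrow> w a = 0" if "A \<subseteq> Om" "(\<Sum>a\<in>A. \<bar>w a\<bar> * mu a) = 0" for A and w :: "'a \<Rightarrow> real"
  proof -
    fix a assume a: "a \<in> A"
    have "\<And>x. x \<in> A \<Longrightarrow> 0 \<le> \<bar>w x\<bar> * mu x"
      using that(1) by (auto intro!: mult_nonneg_nonneg less_imp_le[OF mu_pos])
    then have "\<bar>w a\<bar> * mu a = 0"
      using that(2) a sum_nonneg_eq_0_iff[OF finite_subset[OF that(1) finite_Om], of "\<lambda>x. \<bar>w x\<bar> * mu x"] by blast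
    then show "w a = 0" using mu_pos[of a] a that(1) by auto
  qed
  from assms(3) show ?thesis
  proof
    assume "(\<Sum>a\<in>A. \<bar>v a\<bar> * mu a) = 0"
    then have "res A v a = 0" for a using z[OF assms(1)] by (auto simp: res_def)
    then show ?thesis by (simp add: form_def)
  next
    assume "(\<Sum>b\<in>B. \<bar>f b\<bar> * mu b) = 0"
    then have "res B f a = 0" for a using z[OF assms(2)] by (auto simp: res_def)
    then show ?thesis by (simp add: form_def)
  qed
qed

text \<open>Neighbouring cells of the finest level have comparable masses, so there \<open>v\<close>
  is bounded pointwise by a multiple of its average and the L^2 bound suffices.\<close>

lemma sparse_bound_finest:
  assumes a0: "a0 \<in> Om"
  shows "\<bar>form (res (nbh n a0) v) (res (cube n a0) f)\<bar> \<le> C * D ^ 3 * pairing v f (n, cube n a0)"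
proof -
  define V where "V = (\<Sum>a\<in>nbh n a0. \<bar>v a\<bar> * mu a)"
  have m: "0 < mu a0" and mc: "mass (cube n a0) = mu a0" using mu_pos[OF a0] cube_bot[OF a0] by (auto simp: mass_def)
  have V0: "0 \<le> V" unfolding V_def using nbh_subset[of n a0] by (intro sum_nonneg) (auto intro!: mult_nonneg_nonneg less_imp_le[OF mu_pos])
  have D0: "0 < D" using D_ge_1 by simp
  have vb: "\<bar>v a\<bar> \<le> D * V / mu a0" if a: "a \<in> nbh n a0" for a
  proof -
    have aO: "a \<in> Om" "nr n a a0" using a nr_sym[OF a0] by (auto simp: nbh_def)
    have "mu a0 \<le> D * mu a"
      using mass_cube_nr_le[OF aO(1) a0 _ aO(2)] cube_bot[OF a0] cube_bot[OF aO(1)] by (simp add: mass_def)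
    then have "\<bar>v a\<bar> * mu a0 \<le> D * (\<bar>v a\<bar> * mu a)"
      using mult_left_mono[of "mu a0" "D * mu a" "\<bar>v a\<bar>"] by (simp add: mult_ac)
    also have "\<dots> \<le> D * V"
      unfolding V_def using a D0 nbh_subset[of n a0]
      by (intro mult_left_mono member_le_sum) (auto intro!: mult_nonneg_nonneg less_imp_le[OF mu_pos])
    finally show ?thesis using m by (simp add: field_simps)
  qed
  have "\<bar>form (res (nbh n a0) v) (res (cube n a0) f)\<bar> \<le> C * (D * V / mu a0) * \<bar>f a0\<bar> * D * mass (cube n a0)"
    using vb cube_bot[OF a0] D0 V0 m mass_nbh_le[OF a0, of n]
    by (intro form_bounded nbh_subset cube_subset) auto
  also have "\<dots> = C * D\<^sup>2 * V * \<bar>f a0\<bar>" using m mc by (simp add: power2_eq_square)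
  also have "\<dots> = C * D ^ 3 * (V / (D * mu a0) * (\<bar>f a0\<bar> * mu a0))"
    using m D0 by (simp add: power2_eq_square power3_eq_cube)
  also have "\<dots> \<le> C * D ^ 3 * (V / mass (nbh n a0) * (\<bar>f a0\<bar> * mu a0))"
    using m D0 C_pos V0 mass_nbh_le[OF a0, of n] mass_nbh_pos[OF a0, of n] mc
    by (intro mult_left_mono mult_right_mono divide_left_mono) auto
  also have "\<dots> = C * D ^ 3 * pairing v f (n, cube n a0)"
    using cube_nbh_eq[OF a0, of n] cube_bot[OF a0] by (simp add: pairing_def V_def)
  finally show ?thesis .
qed

text \<open>The family consists of the cube itself, which pays for the error of
  \<open>one_step\<close>, and of the families of its children. Children lie at strictly finer
  levels, so the induction runs over \<open>n - k\<close>.\<close>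

lemma sparse_bound_aux:
  assumes "a0 \<in> Om" "k \<le> n"
  shows "\<exists>S. finite S \<and> S \<subseteq> cubes \<and> (\<forall>R\<in>S. k \<le> fst R \<and> snd R \<subseteq> cube k a0) \<and> sparse S \<and>
    \<bar>form (res (nbh k a0) v) (res (cube k a0) f)\<bar> \<le> sparse_const * (\<Sum>R\<in>S. pairing v f R)"
  using assms
proof (induction "n - k" arbitrary: k a0 rule: less_induct)
  case less
  note a0 = less.prems(1) and kn = less.prems(2)
  let ?N = "nbh k a0" and ?Q = "cube k a0"
  have D0: "0 < D" using D_ge_1 by simp
  consider "(\<Sum>a\<in>?N. \<bar>v a\<bar> * mu a) = 0 \<or> (\<Sum>b\<in>?Q. \<bar>f b\<bar> * mu b) = 0" | "k = n"
    | "k < n" "(\<Sum>a\<in>?N. \<bar>v a\<bar> * mu a) \<noteq> 0" "(\<Sum>b\<in>?Q. \<bar>f b\<bar> * mu b) \<noteq> 0"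
    using kn by linarith
  then show ?case
  proof cases
    case 1
    then have "form (res ?N v) (res ?Q f) = 0" by (intro form_zero nbh_subset cube_subset)
    then show ?thesis by (intro exI[of _ "{}"]) (simp add: sparse_def)
  next
    case 2
    have c: "(n, cube n a0) \<in> cubes" using a0 by (auto simp: cubes_def)
    have "C * D ^ 3 \<le> sparse_const"
      using C_pos D0 th_lt_1 by (simp add: sparse_const_def)
    then have "\<bar>form (res ?N v) (res ?Q f)\<bar> \<le> sparse_const * pairing v f (n, cube n a0)"
      using sparse_bound_finest[OF a0, of v f] pairing_nonneg[OF c, of v f] 2
      by (meson mult_right_mono order_trans)
    moreover have "sparse {(n, cube n a0)}"
      using mass_nonneg[OF cube_subset] by (simp add: sparse_def mass_def[of "{}"])
    ultimately show ?thesis using c 2 by (intro exI[of _ "{(n, cube n a0)}"]) simp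
  next
    case 3
    have pos: "0 < (\<Sum>a\<in>A. \<bar>w a\<bar> * mu a)" if "A \<subseteq> Om" "(\<Sum>a\<in>A. \<bar>w a\<bar> * mu a) \<noteq> 0" for A and w :: "'a \<Rightarrow> real"
    proof -
      have "0 \<le> (\<Sum>a\<in>A. \<bar>w a\<bar> * mu a)"
        using that(1) by (intro sum_nonneg) (auto intro!: mult_nonneg_nonneg less_imp_le[OF mu_pos])
      then show ?thesis using that(2) by simp
    qed
    interpret st: cz_step Om mu n anc nr D tau C th k a0 "res ?N v" "res ?Q f"
    proof
      show "0 < (\<Sum>a\<in>Om. \<bar>res ?N v a\<bar> * mu a)"
        unfolding sum_res[OF nbh_subset] by (rule pos[OF nbh_subset 3(2)])
      show "0 < (\<Sum>a\<in>Om. \<bar>res ?Q f a\<bar> * mu a)"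
        unfolding sum_res[OF cube_subset] by (rule pos[OF cube_subset 3(3)])
    qed (use 3 a0 in \<open>auto simp: res_def\<close>)
    have IH: "\<exists>S. finite S \<and> S \<subseteq> cubes \<and> (\<forall>R\<in>S. fst P \<le> fst R \<and> snd R \<subseteq> snd P) \<and> sparse S \<and>
      \<bar>form (res (cube_nbh P) v) (res (snd P) f)\<bar> \<le> sparse_const * (\<Sum>R\<in>S. pairing v f R)"
      if P: "P \<in> st.Ch" for P
    proof -
      obtain l b where b: "P = (l, cube l b)" "l \<le> n" "b \<in> Om" using P st.Ch_cubes unfolding cubes_def by blast
      have "k < l" using st.Ch_level[OF P] b(1) by simp
      then have "n - l < n - k" using b(2) by simp
      from less.hyps[OF this b(3,2)] show ?thesis
        using b cube_nbh_eq[OF b(3,2)] by simp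
    qed
    then obtain SS where SS: "\<And>P. P \<in> st.Ch \<Longrightarrow> finite (SS P) \<and> SS P \<subseteq> cubes \<and> (\<forall>R\<in>SS P. fst P \<le> fst R \<and> snd R \<subseteq> snd P) \<and> sparse (SS P) \<and>
      \<bar>form (res (cube_nbh P) v) (res (snd P) f)\<bar> \<le> sparse_const * (\<Sum>R\<in>SS P. pairing v f R)"
      by metis
    define T where "T = (\<Union>P\<in>st.Ch. SS P)"
    define R0 where "R0 = (k, ?Q)"
    have R0c: "R0 \<in> cubes" using a0 kn by (auto simp: R0_def cubes_def)
    have QQ: "st.QQ = ?Q" "st.NN = ?N" by (simp_all add: st.QQ_def st.NN_def)
    have Tlev: "k < fst R" "snd R \<subseteq> ?Q" "R \<in> cubes" "finite T" if RT: "R \<in> T" for R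
    proof -
      obtain P where P: "P \<in> st.Ch" "R \<in> SS P" using RT unfolding T_def by blast
      show "k < fst R" "snd R \<subseteq> ?Q" using SS[OF P(1)] P(2) st.Ch_level[OF P(1)] QQ by force+
      show "R \<in> cubes" using SS[OF P(1)] P(2) by auto
      show "finite T" unfolding T_def using SS st.finite_Ch by blast
    qed
    have finT: "finite T" unfolding T_def using SS st.finite_Ch by blast
    have R0T: "R0 \<notin> T" using Tlev(1)[of R0] by (auto simp: R0_def)
    have disj: "SS P \<inter> SS P' = {}" if "P \<in> st.Ch" "P' \<in> st.Ch" "P \<noteq> P'" for P P'
    proof (rule ccontr)
      assume "SS P \<inter> SS P' \<noteq> {}"
      then obtain R where R: "R \<in> SS P" "R \<in> SS P'" by blast
      have "snd R \<subseteq> snd P \<inter> snd P'" using SS[OF that(1)] SS[OF that(2)] R by auto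
      moreover have "snd R \<noteq> {}" using cubes_nonempty[of R] SS[OF that(1)] R by auto
      ultimately show False using st.Ch_disjoint[OF that] by auto
    qed
    have "sparse (insert R0 T)"
      unfolding sparse_def
    proof
      fix R assume R: "R \<in> insert R0 T"
      let ?X = "{R' \<in> insert R0 T. fst R < fst R' \<and> snd R' \<subseteq> snd R}"
      show "mass (\<Union>R'\<in>?X. snd R') \<le> mass (snd R) / 4"
      proof (cases "R = R0")
        case True
        have "(\<Union>R'\<in>?X. snd R') \<subseteq> (\<Union>P\<in>st.Ch. snd P)"
        proof
          fix x assume "x \<in> (\<Union>R'\<in>?X. snd R')"
          then obtain R' where R': "R' \<in> T" "x \<in> snd R'" using True by auto
          then obtain P where "P \<in> st.Ch" "R' \<in> SS P" unfolding T_def by blast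
          then show "x \<in> (\<Union>P\<in>st.Ch. snd P)" using SS R'(2) by blast
        qed
        then have "mass (\<Union>R'\<in>?X. snd R') \<le> mass (\<Union>P\<in>st.Ch. snd P)"
          using st.Ch_level st.QQ_sub by (intro mass_mono) blast+
        also have "\<dots> \<le> mass (snd R) / 4" using st.Ch_union_mass True by (simp add: R0_def QQ)
        finally show ?thesis .
      next
        case False
        then obtain P where P: "P \<in> st.Ch" "R \<in> SS P" using R unfolding T_def by blast
        have Rc: "R \<in> cubes" using SS[OF P(1)] P(2) by auto
        let ?Y = "{R' \<in> SS P. fst R < fst R' \<and> snd R' \<subseteq> snd R}"
        \<comment> \<open>A cube inside \<open>R\<close> lies in the same child as \<open>R\<close>,
          because different children are disjoint; so sparseness at \<open>R\<close> is inherited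
          from \<open>SS P\<close>.\<close>
        have "?X \<subseteq> ?Y"
        proof
          fix R' assume R': "R' \<in> ?X"
          have "k < fst R" using False R Tlev(1) by auto
          then have "R' \<in> T" using R' by (auto simp: R0_def)
          then obtain P' where P': "P' \<in> st.Ch" "R' \<in> SS P'" unfolding T_def by blast
          have "snd R \<subseteq> snd P" "snd R' \<subseteq> snd P'" "snd R' \<subseteq> snd R"
            using SS[OF P(1)] SS[OF P'(1)] P(2) P'(2) R' by blast+
          then have "snd R' \<subseteq> snd P \<inter> snd P'" by blast
          moreover have "snd R' \<noteq> {}" using cubes_nonempty[of R'] SS[OF P'(1)] P'(2) by auto
          ultimately have "P' = P" using st.Ch_disjoint[OF P(1) P'(1)] by auto
          then show "R' \<in> ?Y" using P' R' by auto
        qed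
        then have "mass (\<Union>R'\<in>?X. snd R') \<le> mass (\<Union>R'\<in>?Y. snd R')"
          using SS[OF P(1)] cubes_nonempty by (intro mass_mono) blast+
        also have "\<dots> \<le> mass (snd R) / 4"
          using SS[OF P(1)] P(2) unfolding sparse_def by blast
        finally show ?thesis .
      qed
    qed
    moreover have "\<bar>form (res ?N v) (res ?Q f)\<bar> \<le> sparse_const * (\<Sum>R\<in>insert R0 T. pairing v f R)"
    proof -
      have main: "\<bar>form (res ?N v) (res ?Q f)\<bar> \<le> (\<Sum>P\<in>st.Ch. \<bar>form (res (cube_nbh P) (res ?N v)) (res (snd P) (res ?Q f))\<bar>)
        + (C * D * st.al / (1 - th) + 2 * C * D\<^sup>2 * st.al / (1 - th) + 2 * C * D * st.al\<^sup>2) * st.Lv * st.Fs"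
        by (rule st.one_step)
      have LF: "st.Lv * st.Fs = pairing v f R0"
        unfolding st.Lv_def st.Fs_def st.Vs_def sum_res[OF nbh_subset] sum_res[OF cube_subset] QQ
        using cube_nbh_eq[OF a0 kn] by (simp add: pairing_def R0_def)
      have "(C * D * st.al / (1 - th) + 2 * C * D\<^sup>2 * st.al / (1 - th) + 2 * C * D * st.al\<^sup>2) \<le> sparse_const"
        using C_pos D0 by (simp add: sparse_const_def st.al_def st.AA_def)
      then have 2: "(C * D * st.al / (1 - th) + 2 * C * D\<^sup>2 * st.al / (1 - th) + 2 * C * D * st.al\<^sup>2) * st.Lv * st.Fs
        \<le> sparse_const * pairing v f R0"
        unfolding mult.assoc LF using pairing_nonneg[OF R0c] by (intro mult_right_mono)
      have "(\<Sum>P\<in>st.Ch. \<bar>form (res (cube_nbh P) (res ?N v)) (res (snd P) (res ?Q f))\<bar>)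
        \<le> (\<Sum>P\<in>st.Ch. sparse_const * (\<Sum>R\<in>SS P. pairing v f R))"
      proof (rule sum_mono)
        fix P assume P: "P \<in> st.Ch"
        have "cube_nbh P \<subseteq> ?N" "snd P \<subseteq> ?Q" using st.Ch_nbh[OF P] st.Ch_level[OF P] QQ by auto
        then show "\<bar>form (res (cube_nbh P) (res ?N v)) (res (snd P) (res ?Q f))\<bar> \<le> sparse_const * (\<Sum>R\<in>SS P. pairing v f R)"
          using SS[OF P] by (simp add: res_res)
      qed
      also have "\<dots> = sparse_const * (\<Sum>R\<in>T. pairing v f R)"
        unfolding T_def sum_distrib_left[symmetric]
        using SS st.finite_Ch disj by (subst sum.UNION_disjoint) auto
      finally have "\<bar>form (res ?N v) (res ?Q f)\<bar> \<le> sparse_const * (\<Sum>R\<in>T. pairing v f R) + sparse_const * pairing v f R0"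
        using main 2 by linarith
      also have "\<dots> = sparse_const * (\<Sum>R\<in>insert R0 T. pairing v f R)"
        using finT R0T by (simp add: distrib_left)
      finally show ?thesis .
    qed
    ultimately show ?thesis
      using finT Tlev(1-3) R0c by (intro exI[of _ "insert R0 T"]) (force simp: R0_def less_imp_le)
  qed
qed

theorem sparse_bound:
  obtains S where "finite S" "S \<subseteq> cubes" "sparse S" "\<bar>form v f\<bar> \<le> sparse_const * (\<Sum>R\<in>S. pairing v f R)"
proof (cases "Om = {}")
  case True
  have "form v f = 0" unfolding form_def by (simp add: True)
  then show ?thesis by (intro that[of "{}"]) (simp_all add: sparse_def)
next
  case False
  then obtain a0 where a0: "a0 \<in> Om" by blast
  have nb: "nbh 0 a0 = Om" using cube_top[OF a0] cube_subset_nbh[OF a0, of 0] nbh_subset[of 0 a0] by auto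
  have "form (res Om v) (res Om f) = form v f"
    unfolding form_def by (intro sum.cong refl) (simp add: res_def)
  then show ?thesis
    using sparse_bound_aux[OF a0, of 0 v f] nb cube_top[OF a0] that by auto
qed

end

section \<open>Weighted estimates\<close>

text \<open>Young's inequality for \<open>a i / ?a\<close> and \<open>b i / ?b\<close>, summed with
  the weights \<open>m\<close>.\<close>

lemma weighted_Holder:
  fixes a b m :: "'i \<Rightarrow> real"
  assumes fin: "finite A" and nn: "\<And>i. i \<in> A \<Longrightarrow> 0 \<le> a i" "\<And>i. i \<in> A \<Longrightarrow> 0 \<le> b i" "\<And>i. i \<in> A \<Longrightarrow> 0 \<le> m i"
    and al: "0 < al" "0 < be" "al + be = 1"
  shows "(\<Sum>i\<in>A. a i powr al * b i powr be * m i) \<le> (\<Sum>i\<in>A. a i * m i) powr al * (\<Sum>i\<in>A. b i * m i) powr be"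
proof -
  let ?a = "\<Sum>i\<in>A. a i * m i" and ?b = "\<Sum>i\<in>A. b i * m i"
  have a0: "0 \<le> ?a" and b0: "0 \<le> ?b" using nn by (auto intro!: sum_nonneg)
  show ?thesis
  proof (cases "?a = 0 \<or> ?b = 0")
    case True
    have "a i powr al * b i powr be * m i = 0" if i: "i \<in> A" for i
    proof -
      have "a i * m i = 0 \<or> b i * m i = 0"
        using True sum_nonneg_eq_0_iff[OF fin, of "\<lambda>i. a i * m i"] sum_nonneg_eq_0_iff[OF fin, of "\<lambda>i. b i * m i"] nn i
        by auto
      then show ?thesis using al by auto
    qed
    then have "(\<Sum>i\<in>A. a i powr al * b i powr be * m i) = 0" by (intro sum.neutral) blast
    then show ?thesis by simp
  next
    case False
    then have pos: "0 < ?a" "0 < ?b" using a0 b0 by linarith+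
    have young: "x powr al * y powr be \<le> al * x + be * y" if "0 \<le> x" "0 \<le> y" for x y :: real
    proof (cases "x = 0 \<or> y = 0")
      case True then show ?thesis using al that by auto
    next
      case False then show ?thesis using Youngs_inequality_0[of al be x y] al that by simp
    qed
    have "a i powr al * b i powr be * m i \<le> ?a powr al * ?b powr be * (al * (a i * m i) / ?a + be * (b i * m i) / ?b)"
      if i: "i \<in> A" for i
    proof -
      have "(a i / ?a) powr al * (b i / ?b) powr be * m i \<le> (al * (a i / ?a) + be * (b i / ?b)) * m i"
        using nn i a0 b0 by (intro mult_right_mono young) auto
      then have "?a powr al * ?b powr be * ((a i / ?a) powr al * (b i / ?b) powr be * m i) \<le> ?a powr al * ?b powr be * ((al * (a i / ?a) + be * (b i / ?b)) * m i)"
        by (intro mult_left_mono) auto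
      moreover have "?a powr al * ?b powr be * ((a i / ?a) powr al * (b i / ?b) powr be * m i) = a i powr al * b i powr be * m i"
        using nn[OF i] pos by (simp add: powr_divide)
      moreover have "(al * (a i / ?a) + be * (b i / ?b)) * m i = al * (a i * m i) / ?a + be * (b i * m i) / ?b"
        by (simp add: algebra_simps)
      ultimately show ?thesis by (simp only:)
    qed
    then have "(\<Sum>i\<in>A. a i powr al * b i powr be * m i)
      \<le> (\<Sum>i\<in>A. ?a powr al * ?b powr be * (al * (a i * m i) / ?a + be * (b i * m i) / ?b))"
      by (rule sum_mono)
    also have "\<dots> = ?a powr al * ?b powr be * (al * ?a / ?a + be * ?b / ?b)"
      by (simp only: sum_distrib_left[symmetric] sum.distrib sum_divide_distrib[symmetric])
    also have "\<dots> = ?a powr al * ?b powr be" using pos al by simp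
    finally show ?thesis .
  qed
qed

text \<open>A geometric series of ratio \<open>2 powr (- q)\<close>. The factor \<open>2 / q\<close>
  is the source of r' in the estimate of the shells, where q = 1 - 1/r.\<close>

lemma sum_dyadic_powr_le:
  fixes Z q :: real
  assumes J: "finite J" "\<And>j. j \<in> J \<Longrightarrow> 2 powr real_of_int j < Z" and q: "0 < q" "q \<le> 1" and Z: "0 < Z"
  shows "(\<Sum>j\<in>J. (2 powr real_of_int j) powr q) \<le> 2 / q * Z powr q"
proof -
  define j0 where "j0 = \<lfloor>log 2 Z\<rfloor>"
  define s where "s = (2::real) powr (- q)"
  have s: "0 < s" "s < 1" using q by (auto simp: s_def powr_less_one)
  \<comment> \<open>The weighted inequality of arithmetic and geometric means for 1 and 1/2:
    \<open>(1/2) powr q\<close> is at most \<open>1 - q / 2\<close>.\<close>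
  have "q / 2 \<le> 1 - s"
  proof -
    have "(1::real) powr (1 - q) * (1/2) powr q \<le> (1 - q) * 1 + q * (1/2)"
    proof (cases "q = 1")
      case False
      then show ?thesis using q Youngs_inequality_0[of "1 - q" q 1 "1/2"] by simp
    qed simp
    then show ?thesis by (simp add: s_def powr_minus powr_divide field_simps)
  qed
  have le: "j \<le> j0" if "j \<in> J" for j
    using J(2)[OF that] Z unfolding j0_def le_floor_iff by (simp add: less_log_iff less_imp_le)
  have "(\<Sum>j\<in>J. (2 powr real_of_int j) powr q) = (\<Sum>j\<in>J. (2 powr real_of_int j0) powr q * s ^ nat (j0 - j))"
  proof (rule sum.cong[OF refl])
    fix j assume "j \<in> J"
    then have "s ^ nat (j0 - j) = 2 powr (- q * (j0 - j))"
      using le[of j] by (simp add: s_def powr_realpow[symmetric] powr_powr)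
    then show "(2 powr real_of_int j) powr q = (2 powr real_of_int j0) powr q * s ^ nat (j0 - j)"
      by (simp add: powr_powr powr_add[symmetric] algebra_simps)
  qed
  also have "\<dots> = (2 powr real_of_int j0) powr q * (\<Sum>i\<in>(\<lambda>j. nat (j0 - j)) ` J. s ^ i)"
    using le by (subst sum.reindex) (auto simp: inj_on_def sum_distrib_left nat_eq_iff intro!: eq_nat_nat_iff[THEN iffD1])
  also have "\<dots> \<le> Z powr q * (2 / q)"
  proof (rule mult_mono)
    have "2 powr real_of_int j0 \<le> Z"
      using Z unfolding j0_def by (metis le_log_iff of_int_floor_le one_less_numeral_iff semiring_norm(76))
    then show "(2 powr real_of_int j0) powr q \<le> Z powr q" using q by (intro powr_mono2) auto
    have "(\<Sum>i\<in>(\<lambda>j. nat (j0 - j)) ` J. s ^ i) \<le> (\<Sum>i. s ^ i)"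
      using s J(1) by (intro sum_le_suminf summable_geometric) auto
    also have "\<dots> = 1 / (1 - s)" using s by (intro suminf_geometric) auto
    also have "\<dots> \<le> 1 / (q / 2)" using q \<open>q / 2 \<le> 1 - s\<close> by (intro divide_left_mono) auto
    finally show "(\<Sum>i\<in>(\<lambda>j. nat (j0 - j)) ` J. s ^ i) \<le> 2 / q" by simp
    show "0 \<le> (\<Sum>i\<in>(\<lambda>j. nat (j0 - j)) ` J. s ^ i)" using s by (intro sum_nonneg) auto
  qed simp
  finally show ?thesis by (simp add: mult.commute)
qed

lemma dyadic_int_below:
  fixes t :: real
  assumes "0 < t"
  obtains j :: int where "2 powr real_of_int j < t" "t \<le> 2 * 2 powr real_of_int j"
proof
  let ?j = "\<lceil>log 2 t\<rceil> - 1"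
  have "real_of_int ?j < log 2 t" by linarith
  then show "2 powr real_of_int ?j < t" using assms by (simp add: less_log_iff)
  have "log 2 t \<le> 1 + real_of_int ?j" by linarith
  then have "t \<le> 2 powr (1 + real_of_int ?j)" using assms by (subst (asm) log_le_iff) auto
  also have "2 powr (1 + real_of_int ?j) = 2 * 2 powr real_of_int ?j" by (simp only: powr_add) simp
  finally show "t \<le> 2 * 2 powr real_of_int ?j" .
qed

lemma dyadic_nat_shell:
  fixes t :: real
  assumes "0 < t" "t \<le> 1"
  obtains k :: nat where "(1/2) ^ Suc k < t" "t \<le> (1/2) ^ k"
proof -
  obtain m :: nat where m: "(1/2) ^ m < t" using real_arch_pow_inv[of t "1/2"] assms by auto
  define l where "l = (LEAST m. (1/2::real) ^ m < t)"
  have l: "(1/2) ^ l < t" unfolding l_def using m by (rule LeastI)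
  then obtain k where k: "l = Suc k" using assms(2) by (cases l) auto
  have "\<not> (1/2) ^ k < t" using not_less_Least[of k "\<lambda>m. (1/2::real) ^ m < t"] k unfolding l_def by simp
  then show ?thesis using that[of k] l k by simp
qed

context cube_tree
begin

definition nbh_avg :: "('c \<Rightarrow> real) \<Rightarrow> nat \<times> 'c set \<Rightarrow> real" where
  "nbh_avg y R = (\<Sum>a\<in>cube_nbh R. y a * mu a) / mass (cube_nbh R)"

lemma cubes_nbh:
  assumes "R \<in> cubes" "a \<in> snd R"
  shows "snd R = cube (fst R) a" "cube_nbh R = nbh (fst R) a" "fst R \<le> n" "a \<in> Om"
proof -
  obtain l c where R: "R = (l, cube l c)" "l \<le> n" "c \<in> Om" using assms(1) by (auto simp: cubes_def)
  show "a \<in> Om" "fst R \<le> n" using R assms(2) by (auto simp: cube_def)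
  show 1: "snd R = cube (fst R) a" using R assms(2) cube_eq by auto
  show "cube_nbh R = nbh (fst R) a"
    using R cube_nbh_eq[OF R(3,2)] nbh_eq[OF R(3,2)] assms(2) by simp
qed

text \<open>The disjoint sets \<open>E R\<close> linearise the maximal function of neighbourhood
  averages. The part of \<open>y\<close> below \<open>t / 2\<close> adds at most
  \<open>t / 2\<close> to an average, so \<open>z\<close> alone averages more than
  \<open>t / 2\<close>; by \<open>cubes_union_le\<close> it does so on a single cube of the
  neighbourhood, and \<open>large_cube_cover_mass\<close> applies.\<close>

lemma nbh_avg_maximal_weak:
  assumes T: "finite T" "T \<subseteq> cubes" and E: "\<And>R. R \<in> T \<Longrightarrow> E R \<subseteq> snd R"
    and disj: "\<And>R R'. R \<in> T \<Longrightarrow> R' \<in> T \<Longrightarrow> R \<noteq> R' \<Longrightarrow> E R \<inter> E R' = {}"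
    and y: "\<And>a. a \<in> Om \<Longrightarrow> 0 \<le> y a" and t: "0 < t" and avg: "\<And>R. R \<in> T \<Longrightarrow> t < nbh_avg y R"
  shows "(\<Sum>R\<in>T. mass (E R)) \<le> 2 * D / t * (\<Sum>a\<in>Om. if t / 2 < y a then y a * mu a else 0)"
proof -
  define z where "z a = (if t / 2 < y a then y a else 0)" for a
  define H where "H = {b\<in>Om. \<exists>l\<le>n. \<exists>c\<in>Om. t / 2 * mass (cube l c) < (\<Sum>a\<in>cube l c. z a * mu a) \<and> nr l c b}"
  have sub: "E R \<subseteq> H" if R: "R \<in> T" for R
  proof
    fix x assume "x \<in> E R"
    then have x: "x \<in> snd R" using E[OF R] by blast
    have Rc: "R \<in> cubes" using R T by blast
    define l where "l = fst R"
    note cn = cubes_nbh[OF Rc x, folded l_def]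
    have m: "0 < mass (nbh l x)" using mass_nbh_pos[OF cn(4,3)] .
    have "t * mass (nbh l x) < (\<Sum>a\<in>nbh l x. y a * mu a)"
      using avg[OF R] m unfolding nbh_avg_def cn(2) by (simp add: field_simps)
    also have "\<dots> \<le> (\<Sum>a\<in>nbh l x. z a * mu a + t / 2 * mu a)"
    proof (rule sum_mono)
      fix a assume "a \<in> nbh l x"
      then have "0 < mu a" using nbh_subset mu_pos by blast
      then show "y a * mu a \<le> z a * mu a + t / 2 * mu a"
        unfolding distrib_right[symmetric] using t by (intro mult_right_mono) (auto simp: z_def)
    qed
    also have "\<dots> = (\<Sum>a\<in>nbh l x. z a * mu a) + t / 2 * mass (nbh l x)"
      by (simp add: sum.distrib mass_def sum_distrib_left)
    finally have big: "t / 2 * mass (nbh l x) < (\<Sum>a\<in>nbh l x. z a * mu a)" by (simp add: field_simps)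
    define F where "F = {(l, cube l c) | c. c \<in> nbh l x}"
    have U: "(\<Union>Q\<in>F. snd Q) = nbh l x"
    proof
      show "(\<Union>Q\<in>F. snd Q) \<subseteq> nbh l x"
        using nr_cong2[OF cn(4) _ _ cn(3)] by (auto simp: F_def nbh_def cube_def)
      show "nbh l x \<subseteq> (\<Union>Q\<in>F. snd Q)"
        using self_in_cube nbh_subset[of l x] by (fastforce simp: F_def)
    qed
    have "\<exists>c\<in>nbh l x. t / 2 * mass (cube l c) < (\<Sum>a\<in>cube l c. z a * mu a)"
    proof (rule ccontr)
      assume no: "\<not> ?thesis"
      have "(\<Sum>a\<in>(\<Union>Q\<in>F. snd Q). z a * mu a) \<le> t / 2 * mass (\<Union>Q\<in>F. snd Q)"
      proof (rule cubes_union_le)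
        show "F \<subseteq> cubes" using nbh_subset[of l x] cn(3) unfolding F_def cubes_def by blast
        fix Q assume "Q \<in> F"
        then show "(\<Sum>a\<in>snd Q. z a * mu a) \<le> t / 2 * mass (snd Q)"
          using no by (auto simp: F_def not_less)
      qed
      then show False using big U by simp
    qed
    then obtain c where c: "c \<in> nbh l x" "t / 2 * mass (cube l c) < (\<Sum>a\<in>cube l c. z a * mu a)" by blast
    have cO: "c \<in> Om" "nr l c x" using c(1) nr_sym[OF cn(4) _ cn(3)] by (auto simp: nbh_def)
    show "x \<in> H" unfolding H_def using cn cO c(2) by blast
  qed
  have "(\<Sum>R\<in>T. mass (E R)) = mass (\<Union>R\<in>T. E R)"
    unfolding mass_def
  proof (intro sum.UNION_disjoint[symmetric] T(1) ballI impI disj)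
    fix R assume "R \<in> T"
    then show "finite (E R)" using finite_subset[OF sub[of R]] by (simp add: H_def)
  qed
  also have "\<dots> \<le> mass H" by (intro mass_mono UN_least sub) (simp_all add: H_def)
  also have "\<dots> \<le> D / (t / 2) * (\<Sum>a\<in>Om. z a * mu a)"
    unfolding H_def using y t by (intro large_cube_cover_mass) (auto simp: z_def)
  also have "(\<Sum>a\<in>Om. z a * mu a) = (\<Sum>a\<in>Om. if t / 2 < y a then y a * mu a else 0)"
    by (intro sum.cong refl) (simp add: z_def)
  finally show ?thesis by (simp add: mult.commute)
qed

text \<open>Marcinkiewicz interpolation: the averages are sorted by powers of 2, the truncated weak
  type bound is used on each class, and the sum over the powers below \<open>2 * y a\<close> gives
  the factor \<open>1 / q\<close>.\<close>

lemma nbh_avg_maximal_strong: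
  assumes T: "finite T" "T \<subseteq> cubes" and E: "\<And>R. R \<in> T \<Longrightarrow> E R \<subseteq> snd R"
    and disj: "\<And>R R'. R \<in> T \<Longrightarrow> R' \<in> T \<Longrightarrow> R \<noteq> R' \<Longrightarrow> E R \<inter> E R' = {}"
    and y: "\<And>a. a \<in> Om \<Longrightarrow> 0 \<le> y a" and avg: "\<And>R. R \<in> T \<Longrightarrow> 0 < nbh_avg y R"
    and q: "0 < q" "q \<le> 1"
  shows "(\<Sum>R\<in>T. mass (E R) * nbh_avg y R powr (1 + q)) \<le> 32 * D / q * (\<Sum>a\<in>Om. y a powr (1 + q) * mu a)"
proof -
  have "\<exists>j::int. 2 powr real_of_int j < nbh_avg y R \<and> nbh_avg y R \<le> 2 * 2 powr real_of_int j" if "R \<in> T" for R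
    using dyadic_int_below[OF avg[OF that]] by metis
  then obtain jj where jj: "\<And>R. R \<in> T \<Longrightarrow> 2 powr real_of_int (jj R) < nbh_avg y R"
    "\<And>R. R \<in> T \<Longrightarrow> nbh_avg y R \<le> 2 * 2 powr real_of_int (jj R)" by metis
  define J where "J = jj ` T"
  have finJ: "finite J" using T by (simp add: J_def)
  define P where "P j = 2 powr real_of_int j" for j :: int
  have P0: "0 < P j" for j by (simp add: P_def)
  have mE: "0 \<le> mass (E R)" if "R \<in> T" for R
  proof -
    have "snd R \<subseteq> Om" using T that cube_subset unfolding cubes_def by fastforce
    then show ?thesis using E[OF that] by (intro mass_nonneg) blast
  qed
  have "(\<Sum>R\<in>T. mass (E R) * nbh_avg y R powr (1 + q)) \<le> (\<Sum>R\<in>T. 4 * P (jj R) powr (1 + q) * mass (E R))"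
  proof (rule sum_mono)
    fix R assume R: "R \<in> T"
    have "nbh_avg y R powr (1 + q) \<le> (2 * P (jj R)) powr (1 + q)"
      using jj(2)[OF R] avg[OF R] q by (intro powr_mono2) (auto simp: P_def)
    also have "\<dots> = 2 powr (1 + q) * P (jj R) powr (1 + q)" using P0 by (simp add: powr_mult less_imp_le)
    also have "\<dots> \<le> 2 powr 2 * P (jj R) powr (1 + q)"
      using q by (intro mult_right_mono powr_mono) auto
    finally have "nbh_avg y R powr (1 + q) \<le> 4 * P (jj R) powr (1 + q)" by simp
    then show "mass (E R) * nbh_avg y R powr (1 + q) \<le> 4 * P (jj R) powr (1 + q) * mass (E R)"
      using mult_left_mono[OF _ mE[OF R]] by (metis mult.commute)
  qed
  also have "\<dots> = (\<Sum>j\<in>J. \<Sum>R\<in>{R\<in>T. jj R = j}. 4 * P (jj R) powr (1 + q) * mass (E R))"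
    unfolding J_def by (rule sum.image_gen[OF T(1)])
  also have "\<dots> = (\<Sum>j\<in>J. 4 * P j powr (1 + q) * (\<Sum>R\<in>{R\<in>T. jj R = j}. mass (E R)))"
    by (intro sum.cong refl) (simp add: sum_distrib_left)
  also have "\<dots> \<le> (\<Sum>j\<in>J. 4 * P j powr (1 + q) * (2 * D / P j * (\<Sum>a\<in>Om. if P j / 2 < y a then y a * mu a else 0)))"
  proof (intro sum_mono mult_left_mono)
    fix j
    show "(\<Sum>R\<in>{R\<in>T. jj R = j}. mass (E R)) \<le> 2 * D / P j * (\<Sum>a\<in>Om. if P j / 2 < y a then y a * mu a else 0)"
      using T E disj y jj(1) P0 by (intro nbh_avg_maximal_weak) (auto simp: P_def)
  qed simp
  also have "\<dots> = (\<Sum>j\<in>J. \<Sum>a\<in>Om. 8 * D * (if P j / 2 < y a then y a * mu a * P j powr q else 0))"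
  proof (rule sum.cong[OF refl])
    fix j
    have "P j powr (1 + q) = P j * P j powr q" using P0[of j] by (simp add: powr_add)
    then have "4 * P j powr (1 + q) * (2 * D / P j * X) = 8 * D * P j powr q * X" for X
      using P0[of j] by simp
    then show "4 * P j powr (1 + q) * (2 * D / P j * (\<Sum>a\<in>Om. if P j / 2 < y a then y a * mu a else 0))
      = (\<Sum>a\<in>Om. 8 * D * (if P j / 2 < y a then y a * mu a * P j powr q else 0))"
      unfolding sum_distrib_left by (simp only:) (intro sum.cong refl, simp)
  qed
  also have "\<dots> = (\<Sum>a\<in>Om. \<Sum>j\<in>J. 8 * D * (if P j / 2 < y a then y a * mu a * P j powr q else 0))"
    by (rule sum.swap)
  also have "\<dots> = (\<Sum>a\<in>Om. 8 * D * (y a * mu a * (\<Sum>j\<in>{j\<in>J. P j / 2 < y a}. P j powr q)))"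
    using finJ by (auto simp: sum_distrib_left sum.inter_filter intro!: sum.cong)
  also have "\<dots> \<le> (\<Sum>a\<in>Om. 8 * D * (4 / q * (y a powr (1 + q) * mu a)))"
  proof (intro sum_mono mult_left_mono)
    fix a assume a: "a \<in> Om"
    show "y a * mu a * (\<Sum>j\<in>{j\<in>J. P j / 2 < y a}. P j powr q) \<le> 4 / q * (y a powr (1 + q) * mu a)"
    proof (cases "y a = 0")
      case False
      then have ya: "0 < y a" using y[OF a] by simp
      have "(\<Sum>j\<in>{j\<in>J. P j / 2 < y a}. P j powr q) \<le> 2 / q * (2 * y a) powr q"
        unfolding P_def using finJ q ya by (intro sum_dyadic_powr_le) auto
      also have "(2 * y a) powr q = 2 powr q * y a powr q" using ya by (simp add: powr_mult)
      also have "2 / q * (2 powr q * y a powr q) \<le> 2 / q * (2 powr 1 * y a powr q)"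
        using q by (intro mult_left_mono mult_right_mono powr_mono) auto
      finally have "y a * mu a * (\<Sum>j\<in>{j\<in>J. P j / 2 < y a}. P j powr q) \<le> y a * mu a * (2 / q * (2 powr 1 * y a powr q))"
        using ya mu_pos[OF a] by (intro mult_left_mono) auto
      also have "\<dots> = 4 / q * (y a powr (1 + q) * mu a)"
        using ya by (simp add: powr_add)
      finally show ?thesis .
    qed simp
  qed (use D_ge_1 in simp)
  also have "\<dots> = 32 * D / q * (\<Sum>a\<in>Om. y a powr (1 + q) * mu a)"
    unfolding sum_distrib_left by (intro sum.cong refl) simp
  finally show ?thesis .
qed

text \<open>For the second bound, \<open>u\<close> is written as a product of two square roots, one
  of which is replaced by a power of \<open>W\<close>. Hoelder's inequality with the exponents
  \<open>1 / (2 * r)\<close> and \<open>p / 2\<close> then forces p = 2 - 1/r. As the second factor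
  averages u^(1/p), the maximal theorem for the exponent p will bound it by the integral of
  \<open>u\<close> itself, at the cost 1/(p - 1) = r'.\<close>

lemma nbh_avg_power_mean:
  assumes R: "R \<in> cubes" and r: "1 < r" and u: "\<And>a. a \<in> Om \<Longrightarrow> 0 \<le> u a" "\<And>a. a \<in> Om \<Longrightarrow> 0 \<le> W a"
    "\<And>a. a \<in> Om \<Longrightarrow> u a \<le> W a powr (1 / r)"
  shows "nbh_avg u R \<le> nbh_avg W R powr (1 / r)"
    and "nbh_avg u R \<le> (nbh_avg W R powr (1 / r)) powr (1/2)
       * (nbh_avg (\<lambda>a. u a powr (1 / (2 - 1 / r))) R powr (2 - 1 / r)) powr (1/2)"
proof -
  define A where "A = cube_nbh R"
  have AO: "A \<subseteq> Om" by (auto simp: A_def cube_nbh_def)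
  have finA: "finite A" using finite_subset[OF AO] by simp
  obtain a where a: "a \<in> snd R" using R self_in_cube unfolding cubes_def by fastforce
  have M: "0 < mass A" using mass_nbh_pos cubes_nbh[OF R a] by (simp add: A_def)
  have mu0: "\<And>i. i \<in> A \<Longrightarrow> 0 \<le> mu i" using AO mu_pos by (auto intro: less_imp_le)
  have W0: "0 \<le> (\<Sum>i\<in>A. W i * mu i)" using AO u(2) mu0 by (auto intro!: sum_nonneg)
  define p where "p = 2 - 1 / r"
  have ir: "0 < 1 / r" "1 / r < 1" using r by auto
  have p: "1 < p" "p < 2" using ir by (auto simp: p_def)
  have "(\<Sum>i\<in>A. u i * mu i) \<le> (\<Sum>i\<in>A. W i powr (1/r) * 1 powr (1 - 1/r) * mu i)"
    using u(3) mu0 AO by (auto intro!: sum_mono mult_right_mono)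
  also have "\<dots> \<le> (\<Sum>i\<in>A. W i * mu i) powr (1/r) * (\<Sum>i\<in>A. 1 * mu i) powr (1 - 1/r)"
    using finA u(2) AO mu0 ir by (intro weighted_Holder) auto
  finally have "nbh_avg u R \<le> (\<Sum>i\<in>A. W i * mu i) powr (1/r) * (mass A powr (1 - 1/r) / mass A)"
    using M by (simp add: nbh_avg_def A_def[symmetric] mass_def divide_right_mono)
  also have "mass A powr (1 - 1/r) / mass A = 1 / mass A powr (1/r)"
    using M by (simp add: powr_diff)
  also have "(\<Sum>i\<in>A. W i * mu i) powr (1/r) * (1 / mass A powr (1/r)) = nbh_avg W R powr (1/r)"
    using M W0 by (simp add: nbh_avg_def A_def[symmetric] powr_divide)
  finally show "nbh_avg u R \<le> nbh_avg W R powr (1 / r)" .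
  define Y where "Y = (\<Sum>i\<in>A. u i powr (1/p) * mu i)"
  have Y0: "0 \<le> Y" unfolding Y_def using mu0 by (auto intro!: sum_nonneg)
  have e: "1 / (2 * r) + p / 2 = 1" by (simp add: p_def field_simps)
  have "(\<Sum>i\<in>A. u i * mu i) \<le> (\<Sum>i\<in>A. W i powr (1/(2*r)) * (u i powr (1/p)) powr (p/2) * mu i)"
  proof (intro sum_mono mult_right_mono mu0)
    fix i assume "i \<in> A"
    then have iO: "i \<in> Om" using AO by blast
    have "u i = u i powr (1/2) * u i powr (1/2)" using u(1)[OF iO] by (simp add: powr_add[symmetric])
    also have "\<dots> \<le> (W i powr (1/r)) powr (1/2) * u i powr (1/2)"
      using u(1,3)[OF iO] by (intro mult_right_mono powr_mono2) auto
    also have "\<dots> = W i powr (1/(2*r)) * (u i powr (1/p)) powr (p/2)"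
      using p by (simp add: powr_powr mult.commute)
    finally show "u i \<le> W i powr (1/(2*r)) * (u i powr (1/p)) powr (p/2)" .
  qed
  also have "\<dots> \<le> (\<Sum>i\<in>A. W i * mu i) powr (1/(2*r)) * Y powr (p/2)"
    unfolding Y_def using finA u(2) AO mu0 r p e by (intro weighted_Holder) auto
  finally have "nbh_avg u R \<le> (\<Sum>i\<in>A. W i * mu i) powr (1/(2*r)) * Y powr (p/2) / mass A"
    using M by (simp add: nbh_avg_def A_def[symmetric] divide_right_mono)
  also have "mass A = mass A powr (1/(2*r)) * mass A powr (p/2)"
    using M e by (simp add: powr_add[symmetric])
  also have "(\<Sum>i\<in>A. W i * mu i) powr (1/(2*r)) * Y powr (p/2) / (mass A powr (1/(2*r)) * mass A powr (p/2))
    = nbh_avg W R powr (1/(2*r)) * (Y / mass A) powr (p/2)"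
    using M W0 Y0 by (simp add: nbh_avg_def A_def[symmetric] powr_divide)
  also have "\<dots> = (nbh_avg W R powr (1/r)) powr (1/2) * ((Y / mass A) powr p) powr (1/2)"
    by (simp add: powr_powr mult.commute)
  finally show "nbh_avg u R \<le> (nbh_avg W R powr (1 / r)) powr (1/2)
       * (nbh_avg (\<lambda>a. u a powr (1 / (2 - 1 / r))) R powr (2 - 1 / r)) powr (1/2)"
    by (simp only: nbh_avg_def A_def[symmetric] Y_def p_def)
qed

end

text \<open>The decay \<open>sqrt (1/2) ^ k\<close> beats \<open>M * x\<close> after about 2 log_2
  (M x) shells. With x = r' this is where the logarithm of the theorem comes from;
  \<open>2 * real k + 8\<close> is the coefficient that \<open>weighted_sparse\<close>
  produces.\<close>

lemma ln_shell_count: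
  fixes M :: real
  assumes M: "1 \<le> M"
  shows "\<exists>K\<ge>1. \<forall>x\<ge>1. \<exists>k. M * x * sqrt (1/2) ^ k \<le> 1 \<and> 2 * real k + 8 \<le> K * ln (exp 1 + x)"
proof -
  define K where "K = 4 * log 2 M + 4 / ln 2 + 12"
  have lM: "0 \<le> log 2 M" using M by simp
  have "\<exists>k. M * x * sqrt (1/2) ^ k \<le> 1 \<and> 2 * real k + 8 \<le> K * ln (exp 1 + x)" if x: "1 \<le> x" for x :: real
  proof -
    define k where "k = nat \<lceil>2 * log 2 (M * x)\<rceil>"
    have Mx: "1 \<le> M * x" using mult_mono[OF M x] M by simp
    then have l0: "0 \<le> log 2 (M * x)" by simp
    have k: "2 * log 2 (M * x) \<le> real k" "real k \<le> 2 * log 2 (M * x) + 1"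
      using l0 unfolding k_def by linarith+
    have s: "sqrt (1/2) = (2::real) powr (- (1/2))"
      unfolding powr_minus_divide powr_half_sqrt[OF zero_le_numeral] by (simp add: real_sqrt_divide)
    have "M * x = 2 powr log 2 (M * x)" using Mx by simp
    also have "\<dots> \<le> 2 powr (real k / 2)" using k by (intro powr_mono) auto
    finally have "M * x * sqrt (1/2) ^ k \<le> 2 powr (real k / 2) * sqrt (1/2) ^ k"
      by (intro mult_right_mono) auto
    also have "\<dots> = 1"
      unfolding s by (simp add: powr_realpow[symmetric] powr_powr powr_add[symmetric])
    finally have 1: "M * x * sqrt (1/2) ^ k \<le> 1" .
    have lx: "ln x \<le> ln (exp 1 + x)" using x by (subst ln_le_cancel_iff) (auto simp: add_pos_pos)
    have "ln (exp 1) \<le> ln (exp 1 + x)" using x by (subst ln_le_cancel_iff) (auto simp: add_pos_pos)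
    then have l1: "1 \<le> ln (exp 1 + x)" by simp
    have "2 * real k + 8 \<le> 4 * (log 2 M + log 2 x) + 10"
      using k(2) M x by (simp add: log_mult)
    also have "\<dots> = (4 * log 2 M + 10) * 1 + 4 / ln 2 * ln x" by (simp add: log_def)
    also have "\<dots> \<le> (4 * log 2 M + 10) * ln (exp 1 + x) + 4 / ln 2 * ln (exp 1 + x)"
      using l1 lx lM by (intro add_mono mult_left_mono) auto
    also have "\<dots> \<le> K * ln (exp 1 + x)"
      unfolding distrib_right[symmetric] K_def using l1 by (intro mult_right_mono) auto
    finally show ?thesis using 1 by blast
  qed
  moreover have "1 \<le> K" using lM by (simp add: K_def add_nonneg_pos)
  ultimately show ?thesis by blast
qed

lemma sum_sqrt_half_tail: "(\<Sum>k\<in>{k0..<m}. sqrt (1/2) ^ k) \<le> 4 * sqrt (1/2) ^ k0"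
proof -
  have s: "sqrt (1/2) \<le> (3/4::real)" by (rule real_le_lsqrt) (auto simp: power2_eq_square)
  have s0: "0 < sqrt (1/2::real)" by simp
  \<comment> \<open>The subtracted remainder carries the induction: since \<open>sqrt (1/2)\<close>
    is at most 3/4, it drops from one \<open>m\<close> to the next by at least the new
    summand.\<close>
  have "(\<Sum>k\<in>{k0..<m}. sqrt (1/2) ^ k) \<le> 4 * sqrt (1/2) ^ k0 - (if k0 \<le> m then 4 * sqrt (1/2::real) ^ m else 0)"
  proof (induction m)
    case 0 show ?case by simp
  next
    case (Suc m)
    have d: "4 * sqrt (1/2::real) ^ Suc m \<le> 3 * sqrt (1/2) ^ m" using s by simp
    show ?case
    proof (cases "k0 \<le> m")
      case True
      then have "(\<Sum>k\<in>{k0..<Suc m}. sqrt (1/2) ^ k) \<le> 4 * sqrt (1/2) ^ k0 - 4 * sqrt (1/2) ^ m + sqrt (1/2) ^ m"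
        using Suc by simp
      also have "\<dots> \<le> 4 * sqrt (1/2) ^ k0 - 4 * sqrt (1/2::real) ^ Suc m" using d by linarith
      finally show ?thesis using True by simp
    next
      case False
      then show ?thesis using Suc by (cases "k0 = Suc m") auto
    qed
  qed
  also have "\<dots> \<le> 4 * sqrt (1/2) ^ k0" using s0 by auto
  finally show ?thesis .
qed

section \<open>Shells of a sparse family\<close>

context cz_matrix
begin

lemma cubes_nested:
  assumes "R \<in> cubes" "R' \<in> cubes" "x \<in> snd R" "x \<in> snd R'" "fst R \<le> fst R'"
  shows "snd R' \<subseteq> snd R" "fst R = fst R' \<Longrightarrow> R = R'"
proof -
  note c = cubes_nbh[OF assms(1,3)] cubes_nbh[OF assms(2,4)]
  show "snd R' \<subseteq> snd R" using c cube_mono[of x "fst R" "fst R'"] assms(5) by simp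
  show "fst R = fst R' \<Longrightarrow> R = R'" using c by (simp add: prod_eq_iff)
qed

text \<open>Within a shell the averages of \<open>ph\<close> agree up to a factor 2, so the disjoint
  sets \<open>E R\<close> carry at least half of the integral of \<open>ph\<close> over
  \<open>R\<close>, and not just half of the mass. This can fail for a whole sparse family and is
  the reason for the splitting. \<open>?A\<close> uses the power mean inequality alone;
  \<open>?B\<close> spends one square root of \<open>(1/2) ^ k\<close> on the maximal
  theorem.\<close>

lemma shell_bounds:
  assumes T: "finite T" "T \<subseteq> cubes" and sp: "sparse T"
    and ph: "\<And>a. a \<in> Om \<Longrightarrow> 0 \<le> ph a" and u: "\<And>a. a \<in> Om \<Longrightarrow> 0 \<le> u a"
    and W: "\<And>a. a \<in> Om \<Longrightarrow> 0 \<le> W a" "\<And>a. a \<in> Om \<Longrightarrow> u a \<le> W a powr (1 / r)" and r: "1 < r"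
    and G: "\<And>a l. a \<in> Om \<Longrightarrow> l \<le> n \<Longrightarrow> nbh_avg W (l, cube l a) powr (1 / r) \<le> G a"
    and upos: "\<And>R. R \<in> T \<Longrightarrow> 0 < nbh_avg u R"
    and shell: "\<And>R. R \<in> T \<Longrightarrow> (1/2) ^ Suc k * mass (snd R) < (\<Sum>a\<in>snd R. ph a * mu a)"
      "\<And>R. R \<in> T \<Longrightarrow> (\<Sum>a\<in>snd R. ph a * mu a) \<le> (1/2) ^ k * mass (snd R)"
  shows "(\<Sum>R\<in>T. nbh_avg u R * (\<Sum>a\<in>snd R. ph a * mu a)) \<le> 2 * (\<Sum>a\<in>Om. ph a * mu a * G a)" (is ?A)
    and "(\<Sum>R\<in>T. nbh_avg u R * (\<Sum>a\<in>snd R. ph a * mu a))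
      \<le> sqrt (1/2) ^ k * (2 * (\<Sum>a\<in>Om. ph a * mu a * G a) + 64 * D / (1 - 1 / r) * (\<Sum>a\<in>Om. u a * mu a))" (is ?B)
proof -
  define q where "q = 1 - 1 / r"
  have q: "0 < q" "q \<le> 1" using r by (auto simp: q_def)
  define F where "F A = (\<Sum>a\<in>A. ph a * mu a)" for A
  define X where "X R = (\<Union>R'\<in>{R'\<in>T. fst R < fst R' \<and> snd R' \<subseteq> snd R}. snd R')" for R :: "nat \<times> 'a set"
  define E where "E R = snd R - X R" for R
  define y where "y a = u a powr (1 / (2 - 1 / r))" for a
  define Y where "Y R = nbh_avg y R powr (2 - 1 / r)" for R
  have sub: "snd R \<subseteq> Om" "snd R \<noteq> {}" if "R \<in> T" for R
    using T(2) that cubes_nonempty[of R] by blast+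
  have Xsub: "X R \<subseteq> snd R" for R unfolding X_def by auto
  have EO: "E R \<subseteq> snd R" for R unfolding E_def by auto
  have finR: "finite (snd R)" if "R \<in> T" for R using finite_subset[OF sub(1)[OF that]] by simp
  have ph0: "0 \<le> ph a * mu a" if "a \<in> Om" for a using ph[OF that] mu_pos[OF that] by simp
  have G0: "0 \<le> G a" if "a \<in> Om" for a
    using G[OF that, of 0] powr_ge_zero[of "nbh_avg W (0, cube 0 a)" "1 / r"] by linarith
  have disj: "E R \<inter> E R' = {}" if "R \<in> T" "R' \<in> T" "R \<noteq> R'" for R R'
  proof -
    have *: False if "R \<in> T" "R' \<in> T" "R \<noteq> R'" "x \<in> E R" "x \<in> E R'" "fst R \<le> fst R'" for R R' x
    proof -
      have c: "R \<in> cubes" "R' \<in> cubes" "x \<in> snd R" "x \<in> snd R'" using that T(2) EO by blast+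
      have "fst R < fst R'" "snd R' \<subseteq> snd R" using cubes_nested[OF c that(6)] that(3,6) by (auto simp: le_less)
      then have "x \<in> X R" using that(2) c(4) unfolding X_def by blast
      then show False using that(4) by (simp add: E_def)
    qed
    show ?thesis using *[OF that] *[OF that(2,1)] that(3) by (metis disjoint_iff linear)
  qed
  have massE: "mass (snd R) \<le> 2 * mass (E R)" if R: "R \<in> T" for R
  proof -
    have "mass (X R) \<le> mass (snd R) / 4" using sp R unfolding sparse_def X_def by blast
    moreover have "mass (E R) = mass (snd R) - mass (X R)"
      unfolding E_def mass_def using finR[OF R] Xsub by (intro sum_diff) auto
    ultimately show ?thesis using mass_nonneg[OF sub(1)[OF R]] by linarith
  qed
  \<comment> \<open>On the finer cubes \<open>ph\<close> averages at most \<open>(1/2) ^ k\<close>,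
    and they fill at most a quarter of \<open>R\<close>, whereas the average over \<open>R\<close>
    exceeds half of \<open>(1/2) ^ k\<close>.\<close>
  have FE: "F (snd R) \<le> 2 * F (E R)" if R: "R \<in> T" for R
  proof -
    have "F (X R) \<le> (1/2) ^ k * mass (X R)"
      unfolding F_def X_def using T(2) shell(2) by (intro cubes_union_le) auto
    also have "\<dots> \<le> (1/2) ^ k * (mass (snd R) / 4)"
      using sp R unfolding sparse_def X_def by (intro mult_left_mono) auto
    also have "\<dots> = (1/2) ^ Suc k * mass (snd R) / 2" by simp
    also have "\<dots> \<le> F (snd R) / 2"
      using less_imp_le[OF shell(1)[OF R]] unfolding F_def by (rule divide_right_mono) simp
    finally have "F (X R) \<le> F (snd R) / 2" .
    moreover have "F (E R) = F (snd R) - F (X R)"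
      unfolding E_def F_def using finR[OF R] Xsub by (intro sum_diff) auto
    ultimately show ?thesis by linarith
  qed
  have avgG: "nbh_avg W R powr (1 / r) \<le> G a" if "R \<in> T" "a \<in> snd R" for R a
  proof -
    have c: "R \<in> cubes" using T(2) that by auto
    note cn = cubes_nbh[OF c that(2)]
    have "R = (fst R, cube (fst R) a)" using cn(1) by (simp add: prod_eq_iff)
    then show ?thesis using G[OF cn(4,3)] by simp
  qed
  have sumFG: "(\<Sum>R\<in>T. \<Sum>a\<in>E R. ph a * mu a * G a) \<le> (\<Sum>a\<in>Om. ph a * mu a * G a)"
  proof -
    have "(\<Sum>R\<in>T. \<Sum>a\<in>E R. ph a * mu a * G a) = (\<Sum>a\<in>(\<Union>R\<in>T. E R). ph a * mu a * G a)"
      using T(1) disj finR finite_subset[OF EO] by (intro sum.UNION_disjoint[symmetric]) blast+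
    also have "\<dots> \<le> (\<Sum>a\<in>Om. ph a * mu a * G a)"
    proof (intro sum_mono2 finite_Om)
      show "(\<Union>R\<in>T. E R) \<subseteq> Om" using EO sub by blast
      fix a assume "a \<in> Om - (\<Union>R\<in>T. E R)"
      then show "0 \<le> ph a * mu a * G a" using ph0 G0 by auto
    qed
    finally show ?thesis .
  qed
  have EOm: "a \<in> Om" if "R \<in> T" "a \<in> E R" for R a using that EO sub(1) by blast
  have pm1: "nbh_avg u R \<le> nbh_avg W R powr (1 / r)" if "R \<in> cubes" for R
    by (rule nbh_avg_power_mean(1)[OF that r u W])
  have pm2: "nbh_avg u R \<le> (nbh_avg W R powr (1 / r)) powr (1/2) * Y R powr (1/2)" if "R \<in> cubes" for R
    unfolding Y_def y_def by (rule nbh_avg_power_mean(2)[OF that r u W])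
  show ?A
  proof -
    have "(\<Sum>R\<in>T. nbh_avg u R * F (snd R)) \<le> (\<Sum>R\<in>T. 2 * (\<Sum>a\<in>E R. ph a * mu a * G a))"
    proof (rule sum_mono)
      fix R assume R: "R \<in> T"
      have c: "R \<in> cubes" using R T by auto
      have "nbh_avg u R * F (snd R) \<le> nbh_avg u R * (2 * F (E R))"
        using FE[OF R] upos[OF R] by (intro mult_left_mono) auto
      also have "\<dots> = 2 * (\<Sum>a\<in>E R. ph a * mu a * nbh_avg u R)"
        unfolding F_def sum_distrib_left by (intro sum.cong refl) (simp add: mult_ac)
      also have "\<dots> \<le> 2 * (\<Sum>a\<in>E R. ph a * mu a * G a)"
      proof (intro mult_left_mono sum_mono)
        fix a assume a: "a \<in> E R"
        show "nbh_avg u R \<le> G a"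
          using pm1[OF c] avgG[OF R] a EO by (meson order_trans subsetD)
        show "0 \<le> ph a * mu a" using ph0 EOm[OF R a] by simp
      qed simp
      finally show "nbh_avg u R * F (snd R) \<le> 2 * (\<Sum>a\<in>E R. ph a * mu a * G a)" .
    qed
    also have "\<dots> = 2 * (\<Sum>R\<in>T. \<Sum>a\<in>E R. ph a * mu a * G a)" by (simp add: sum_distrib_left)
    finally show ?thesis using sumFG unfolding F_def by linarith
  qed
  show ?B
  proof -
    \<comment> \<open>\<open>be\<close> is the square root of the size of \<open>ph\<close> on the
      shell. The geometric mean in \<open>pm2\<close> is split with this weight:
      \<open>be * g\<close> is summed as in \<open>?A\<close>, and in the term with
      \<open>Y R / be\<close> the integral of \<open>ph\<close> contributes
      \<open>be * be\<close>.\<close>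
    define be where "be = sqrt (1/2::real) ^ k"
    have be: "0 < be" by (simp add: be_def)
    have be2: "be * be = (1/2) ^ k" by (simp add: be_def power_mult_distrib[symmetric])
    have single: "nbh_avg u R * F (snd R) \<le> be * (2 * (\<Sum>a\<in>E R. ph a * mu a * G a)) + be * (2 * (mass (E R) * Y R))"
      if R: "R \<in> T" for R
    proof -
      have c: "R \<in> cubes" using R T by auto
      define g where "g = nbh_avg W R powr (1 / r)"
      have g0: "0 \<le> g" "0 \<le> Y R" by (auto simp: g_def Y_def)
      have "nbh_avg u R \<le> g powr (1/2) * Y R powr (1/2)"
        unfolding g_def by (rule pm2[OF c])
      also have "\<dots> = sqrt (be * g) * sqrt (Y R / be)"
        using be g0 by (simp add: powr_half_sqrt real_sqrt_mult[symmetric])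
      also have "\<dots> \<le> be * g + Y R / be"
      proof -
        have nn: "0 \<le> be * g" "0 \<le> Y R / be" using be g0 by auto
        have "sqrt (be * g * (Y R / be)) \<le> (be * g + Y R / be) / 2" by (rule arith_geo_mean_sqrt[OF nn])
        also have "\<dots> \<le> be * g + Y R / be"
        proof -
          have "x / 2 \<le> x" if "0 \<le> x" for x :: real using that by simp
          then show ?thesis using add_nonneg_nonneg[OF nn] .
        qed
        finally show ?thesis by (simp only: real_sqrt_mult)
      qed
      finally have "nbh_avg u R * F (snd R) \<le> (be * g + Y R / be) * F (snd R)"
        using ph0 sub(1)[OF R] by (intro mult_right_mono) (auto simp: F_def intro!: sum_nonneg)
      also have "\<dots> = be * (g * F (snd R)) + Y R / be * F (snd R)" by (simp add: algebra_simps)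
      also have "\<dots> \<le> be * (2 * (\<Sum>a\<in>E R. ph a * mu a * G a)) + be * (2 * (mass (E R) * Y R))"
      proof (rule add_mono)
        have "g * F (snd R) \<le> g * (2 * F (E R))" using FE[OF R] g0 by (intro mult_left_mono)
        also have "\<dots> = 2 * (\<Sum>a\<in>E R. ph a * mu a * g)"
          unfolding F_def sum_distrib_left by (intro sum.cong refl) (simp add: mult_ac)
        also have "\<dots> \<le> 2 * (\<Sum>a\<in>E R. ph a * mu a * G a)"
        proof (intro mult_left_mono sum_mono)
          fix a assume a: "a \<in> E R"
          show "g \<le> G a" unfolding g_def using avgG[OF R] a EO by blast
          show "0 \<le> ph a * mu a" using ph0 EOm[OF R a] by simp
        qed simp
        finally show "be * (g * F (snd R)) \<le> be * (2 * (\<Sum>a\<in>E R. ph a * mu a * G a))"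
          using be by simp
        have "F (snd R) \<le> be * be * (2 * mass (E R))"
          unfolding F_def be2
          by (rule order_trans[OF shell(2)[OF R] mult_left_mono[OF massE[OF R]]]) simp
        then have "Y R / be * F (snd R) \<le> Y R / be * (be * be * (2 * mass (E R)))"
          using be g0 by (intro mult_left_mono) auto
        also have "\<dots> = be * (2 * (mass (E R) * Y R))" using be by simp
        finally show "Y R / be * F (snd R) \<le> be * (2 * (mass (E R) * Y R))" .
      qed
      finally show ?thesis .
    qed
    have p: "1 + q = 2 - 1 / r" by (simp add: q_def)
    \<comment> \<open>Sorting the averages of \<open>y\<close> by powers of 2 requires them to be
      positive; by \<open>pm2\<close> they inherit this from \<open>nbh_avg u R\<close>.\<close>
    have yp: "0 < nbh_avg y R" if R: "R \<in> T" for R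
    proof -
      have c: "R \<in> cubes" using R T by auto
      have "0 \<le> nbh_avg y R"
        unfolding nbh_avg_def y_def by (intro divide_nonneg_nonneg sum_nonneg mass_nonneg)
          (auto simp: cube_nbh_def less_imp_le[OF mu_pos])
      moreover have "nbh_avg y R \<noteq> 0"
      proof
        assume "nbh_avg y R = 0"
        then have "nbh_avg u R \<le> 0" using pm2[OF c] by (simp add: Y_def)
        then show False using upos[OF R] by simp
      qed
      ultimately show ?thesis by simp
    qed
    have "(\<Sum>R\<in>T. mass (E R) * Y R) \<le> 32 * D / q * (\<Sum>a\<in>Om. y a powr (1 + q) * mu a)"
      unfolding Y_def p[symmetric]
      using EO by (intro nbh_avg_maximal_strong T disj yp q) (auto simp: y_def)
    also have "(\<Sum>a\<in>Om. y a powr (1 + q) * mu a) = (\<Sum>a\<in>Om. u a * mu a)"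
    proof (intro sum.cong refl)
      fix a assume a: "a \<in> Om"
      have "2 - 1 / r \<noteq> 0" using q p by linarith
      then have "y a powr (1 + q) = u a" unfolding p y_def powr_powr using u[OF a] by simp
      then show "y a powr (1 + q) * mu a = u a * mu a" by simp
    qed
    finally have mx: "(\<Sum>R\<in>T. mass (E R) * Y R) \<le> 32 * D / q * (\<Sum>a\<in>Om. u a * mu a)" .
    have "(\<Sum>R\<in>T. nbh_avg u R * F (snd R))
      \<le> (\<Sum>R\<in>T. be * (2 * (\<Sum>a\<in>E R. ph a * mu a * G a)) + be * (2 * (mass (E R) * Y R)))"
      by (rule sum_mono) (rule single)
    also have "\<dots> = be * (2 * (\<Sum>R\<in>T. \<Sum>a\<in>E R. ph a * mu a * G a) + 2 * (\<Sum>R\<in>T. mass (E R) * Y R))"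
      by (simp add: sum.distrib sum_distrib_left distrib_left)
    also have "\<dots> \<le> be * (2 * (\<Sum>a\<in>Om. ph a * mu a * G a) + 2 * (32 * D / q * (\<Sum>a\<in>Om. u a * mu a)))"
      using sumFG mx be by (intro mult_left_mono add_mono) auto
    also have "2 * (32 * D / q * (\<Sum>a\<in>Om. u a * mu a)) = 64 * D / q * (\<Sum>a\<in>Om. u a * mu a)" by simp
    finally show ?thesis by (simp only: F_def be_def q_def)
  qed
qed

lemma sparse_subset: "sparse S \<Longrightarrow> S \<subseteq> cubes \<Longrightarrow> T \<subseteq> S \<Longrightarrow> sparse T"
proof -
  assume S: "sparse S" "S \<subseteq> cubes" "T \<subseteq> S"
  show "sparse T"
    unfolding sparse_def
  proof
    fix R assume R: "R \<in> T"
    have "mass (\<Union>R'\<in>{R'\<in>T. fst R < fst R' \<and> snd R' \<subseteq> snd R}. snd R')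
      \<le> mass (\<Union>R'\<in>{R'\<in>S. fst R < fst R' \<and> snd R' \<subseteq> snd R}. snd R')"
      using S(2,3) cubes_nonempty by (intro mass_mono) blast+
    also have "\<dots> \<le> mass (snd R) / 4" using S R unfolding sparse_def by blast
    finally show "mass (\<Union>R'\<in>{R'\<in>T. fst R < fst R' \<and> snd R' \<subseteq> snd R}. snd R') \<le> mass (snd R) / 4" .
  qed
qed

text \<open>The hypothesis \<open>small\<close> concerns only cubes whose neighbourhood carries some
  of \<open>u\<close>; removing the bad cells from the level set will achieve just this.
  \<open>k0\<close> stays free and is matched to r' in \<open>weighted_form_bound\<close>.\<close>

lemma weighted_sparse:
  assumes S: "finite S" "S \<subseteq> cubes" "sparse S"
    and ph: "\<And>a. a \<in> Om \<Longrightarrow> 0 \<le> ph a" and u: "\<And>a. a \<in> Om \<Longrightarrow> 0 \<le> u a"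
    and W: "\<And>a. a \<in> Om \<Longrightarrow> 0 \<le> W a" "\<And>a. a \<in> Om \<Longrightarrow> u a \<le> W a powr (1 / r)" and r: "1 < r"
    and G: "\<And>a l. a \<in> Om \<Longrightarrow> l \<le> n \<Longrightarrow> nbh_avg W (l, cube l a) powr (1 / r) \<le> G a"
    and small: "\<And>R. R \<in> S \<Longrightarrow> 0 < nbh_avg u R \<Longrightarrow> (\<Sum>a\<in>snd R. ph a * mu a) \<le> mass (snd R)"
  shows "(\<Sum>R\<in>S. nbh_avg u R * (\<Sum>a\<in>snd R. ph a * mu a))
    \<le> (2 * real k0 + 8) * (\<Sum>a\<in>Om. ph a * mu a * G a)
      + 256 * D / (1 - 1 / r) * sqrt (1/2) ^ k0 * (\<Sum>a\<in>Om. u a * mu a)"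
proof -
  define I where "I = (\<Sum>a\<in>Om. ph a * mu a * G a)"
  define U where "U = (\<Sum>a\<in>Om. u a * mu a)"
  define F where "F A = (\<Sum>a\<in>A. ph a * mu a)" for A
  define T where "T = {R\<in>S. 0 < nbh_avg u R \<and> 0 < F (snd R)}"
  have F0: "0 \<le> F (snd R)" "0 \<le> nbh_avg u R" if "R \<in> S" for R
  proof -
    have "snd R \<subseteq> Om" using S that cubes_nonempty by blast
    then show "0 \<le> F (snd R)"
      unfolding F_def using ph mu_pos by (intro sum_nonneg mult_nonneg_nonneg) (auto intro: less_imp_le)
    show "0 \<le> nbh_avg u R"
      unfolding nbh_avg_def using u mu_pos
      by (intro divide_nonneg_nonneg sum_nonneg mult_nonneg_nonneg mass_nonneg) (auto simp: cube_nbh_def intro: less_imp_le)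
  qed
  have G0: "0 \<le> G a" if "a \<in> Om" for a
    using G[OF that, of 0] powr_ge_zero[of "nbh_avg W (0, cube 0 a)" "1 / r"] by linarith
  have I0: "0 \<le> I"
    unfolding I_def using ph mu_pos G0 by (intro sum_nonneg mult_nonneg_nonneg) (auto intro: less_imp_le)
  have U0: "0 \<le> U"
    unfolding U_def using u mu_pos by (intro sum_nonneg mult_nonneg_nonneg) (auto intro: less_imp_le)
  have ir: "0 < 1 - 1 / r" using r by simp
  have Tsub: "T \<subseteq> S" and finT: "finite T" using S by (auto simp: T_def)
  have mpos: "0 < mass (snd R)" if "R \<in> S" for R
    using S that mass_cube_pos unfolding cubes_def by fastforce
  have "\<exists>k. (1/2) ^ Suc k * mass (snd R) < F (snd R) \<and> F (snd R) \<le> (1/2) ^ k * mass (snd R)" if R: "R \<in> T" for R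
  proof -
    have RS: "R \<in> S" using R Tsub by blast
    have t: "0 < F (snd R) / mass (snd R)" "F (snd R) / mass (snd R) \<le> 1"
      using mpos[OF RS] small[OF RS] R by (auto simp: T_def F_def)
    obtain k where "(1/2) ^ Suc k < F (snd R) / mass (snd R)" "F (snd R) / mass (snd R) \<le> (1/2) ^ k"
      using dyadic_nat_shell[OF t] .
    then show ?thesis using mpos[OF RS] by (intro exI[of _ k]) (auto simp: field_simps)
  qed
  then obtain kk where kk: "\<And>R. R \<in> T \<Longrightarrow> (1/2) ^ Suc (kk R) * mass (snd R) < F (snd R)"
    "\<And>R. R \<in> T \<Longrightarrow> F (snd R) \<le> (1/2) ^ kk R * mass (snd R)" by metis
  define Sk where "Sk k = (\<Sum>R\<in>{R\<in>T. kk R = k}. nbh_avg u R * F (snd R))" for k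
  have Sk: "Sk k \<le> 2 * I" "Sk k \<le> sqrt (1/2) ^ k * (2 * I + 64 * D / (1 - 1 / r) * U)" for k
  proof -
    let ?T = "{R\<in>T. kk R = k}"
    have sp: "sparse ?T" by (rule sparse_subset[OF S(3,2)]) (use Tsub in auto)
    have fT: "finite ?T" "?T \<subseteq> cubes" using finT Tsub S by auto
    have up: "\<And>R. R \<in> ?T \<Longrightarrow> 0 < nbh_avg u R" by (simp add: T_def)
    have sh: "\<And>R. R \<in> ?T \<Longrightarrow> (1/2) ^ Suc k * mass (snd R) < (\<Sum>a\<in>snd R. ph a * mu a)"
      "\<And>R. R \<in> ?T \<Longrightarrow> (\<Sum>a\<in>snd R. ph a * mu a) \<le> (1/2) ^ k * mass (snd R)"
      using kk unfolding F_def by auto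
    show "Sk k \<le> 2 * I" "Sk k \<le> sqrt (1/2) ^ k * (2 * I + 64 * D / (1 - 1 / r) * U)"
      unfolding Sk_def F_def I_def U_def
      by (rule shell_bounds[where T = ?T, OF fT sp ph u W r G up sh]; assumption)+
  qed
  define m where "m = Suc (k0 + (\<Sum>R\<in>T. kk R))"
  have km: "kk R < m" if "R \<in> T" for R
    using member_le_sum[of R T kk] that finT by (simp add: m_def)
  have "(\<Sum>R\<in>S. nbh_avg u R * F (snd R)) = (\<Sum>R\<in>T. nbh_avg u R * F (snd R))"
    using F0 S(1) by (intro sum.mono_neutral_right) (auto simp: T_def order.order_iff_strict)
  also have "\<dots> = (\<Sum>k\<in>{..<m}. Sk k)"
    unfolding Sk_def using finT km by (intro sum.group[symmetric]) auto
  also have "\<dots> = (\<Sum>k\<in>{..<k0}. Sk k) + (\<Sum>k\<in>{k0..<m}. Sk k)"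
    unfolding lessThan_atLeast0 by (rule sum.atLeastLessThan_concat[symmetric]) (simp_all add: m_def)
  also have "\<dots> \<le> (\<Sum>k\<in>{..<k0}. 2 * I) + (\<Sum>k\<in>{k0..<m}. sqrt (1/2) ^ k * (2 * I + 64 * D / (1 - 1 / r) * U))"
    by (intro add_mono sum_mono Sk)
  also have "\<dots> = 2 * real k0 * I + (\<Sum>k\<in>{k0..<m}. sqrt (1/2) ^ k) * (2 * I + 64 * D / (1 - 1 / r) * U)"
    by (simp add: sum_distrib_right)
  also have "\<dots> \<le> 2 * real k0 * I + 4 * sqrt (1/2) ^ k0 * (2 * I + 64 * D / (1 - 1 / r) * U)"
    using I0 U0 ir D_ge_1 by (intro add_left_mono mult_right_mono sum_sqrt_half_tail) auto
  also have "\<dots> = 2 * real k0 * I + 8 * (sqrt (1/2) ^ k0 * I) + 256 * D / (1 - 1 / r) * sqrt (1/2) ^ k0 * U"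
    by (simp add: algebra_simps)
  also have "\<dots> \<le> 2 * real k0 * I + 8 * (1 * I) + 256 * D / (1 - 1 / r) * sqrt (1/2) ^ k0 * U"
    using mult_right_mono[OF power_le_one[of "sqrt (1/2)" k0] I0] by simp
  also have "\<dots> = (2 * real k0 + 8) * I + 256 * D / (1 - 1 / r) * sqrt (1/2) ^ k0 * U"
    by (simp add: algebra_simps)
  finally show ?thesis by (simp add: F_def I_def U_def)
qed

end

text \<open>\<open>K\<close> is chosen before the model, the functions and \<open>r\<close>, so that
  it is the same for all grids. For this reason \<open>sc\<close> writes out
  \<open>sparse_const\<close> in terms of \<open>D\<close>, \<open>C\<close> and \<open>th\<close>
  alone.\<close>

lemma weighted_form_bound:
  fixes D C th :: real
  assumes D: "1 \<le> D" and C: "0 < C" and th: "0 < th" "th < 1"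
  shows "\<exists>K>0. \<forall>(Om :: 'a set) mu n (anc :: nat \<Rightarrow> 'a \<Rightarrow> 'a) nr tau v f ph u W G r.
    cz_matrix Om mu n anc nr D tau C th \<longrightarrow> 1 < r \<longrightarrow>
    (\<forall>a\<in>Om. \<bar>f a\<bar> \<le> ph a \<and> \<bar>v a\<bar> \<le> u a \<and> 0 \<le> W a \<and> u a \<le> W a powr (1 / r)) \<longrightarrow>
    (\<forall>a\<in>Om. \<forall>l\<le>n. ((\<Sum>b\<in>{b\<in>Om. nr l a b}. W b * mu b) / (\<Sum>b\<in>{b\<in>Om. nr l a b}. mu b)) powr (1 / r) \<le> G a) \<longrightarrow>
    (\<forall>a\<in>Om. \<forall>l\<le>n. 0 < (\<Sum>b\<in>{b\<in>Om. nr l a b}. u b * mu b) \<longrightarrow>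
      (\<Sum>b\<in>{b\<in>Om. anc l b = anc l a}. ph b * mu b) \<le> (\<Sum>b\<in>{b\<in>Om. anc l b = anc l a}. mu b)) \<longrightarrow>
    \<bar>\<Sum>a\<in>Om. \<Sum>b\<in>Om. v a * f b * mu a * mu b * tau a b\<bar>
      \<le> K * ln (exp 1 + r / (r - 1)) * (\<Sum>a\<in>Om. ph a * mu a * G a) + (\<Sum>a\<in>Om. u a * mu a) / 2"
proof -
  define sc where "sc = C * D * (D ^ 3 * (16 * D ^ 3)) / (1 - th) + 2 * C * D\<^sup>2 * (D ^ 3 * (16 * D ^ 3)) / (1 - th)
     + 2 * C * D * (D ^ 3 * (16 * D ^ 3))\<^sup>2 + C * D ^ 3"
  have sc: "0 < sc" unfolding sc_def using D C th by (intro add_nonneg_pos add_nonneg_nonneg) auto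
  \<comment> \<open>After multiplication by \<open>sc\<close>, the coefficient
    \<open>256 * D * x * sqrt (1/2) ^ k0\<close> of the term with \<open>u\<close> has to be at most
    1/2 to be absorbed later; hence \<open>512 * D * sc\<close>.\<close>
  obtain K where K: "1 \<le> K" "\<And>x. 1 \<le> x \<Longrightarrow>
     \<exists>k. max 1 (512 * D * sc) * x * sqrt (1/2) ^ k \<le> 1 \<and> 2 * real k + 8 \<le> K * ln (exp 1 + x)"
    using ln_shell_count[of "max 1 (512 * D * sc)"] by auto
  show ?thesis
  proof (intro exI[of _ "sc * K"] conjI allI impI)
    show "0 < sc * K" using sc K(1) by simp
    fix Om :: "'a set" and mu n and anc :: "nat \<Rightarrow> 'a \<Rightarrow> 'a" and nr tau v f ph u W G and r :: real
    assume cz: "cz_matrix Om mu n anc nr D tau C th" and r: "1 < r"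
      and pt: "\<forall>a\<in>Om. \<bar>f a\<bar> \<le> ph a \<and> \<bar>v a\<bar> \<le> u a \<and> 0 \<le> W a \<and> u a \<le> W a powr (1 / r)"
      and G: "\<forall>a\<in>Om. \<forall>l\<le>n. ((\<Sum>b\<in>{b\<in>Om. nr l a b}. W b * mu b) / (\<Sum>b\<in>{b\<in>Om. nr l a b}. mu b)) powr (1 / r) \<le> G a"
      and small: "\<forall>a\<in>Om. \<forall>l\<le>n. 0 < (\<Sum>b\<in>{b\<in>Om. nr l a b}. u b * mu b) \<longrightarrow>
      (\<Sum>b\<in>{b\<in>Om. anc l b = anc l a}. ph b * mu b) \<le> (\<Sum>b\<in>{b\<in>Om. anc l b = anc l a}. mu b)"
    interpret cz_matrix Om mu n anc nr D tau C th by (rule cz)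
    have sceq: "sparse_const = sc" by (simp add: sparse_const_def sc_def)
    note G' = G[folded nbh_def mass_def] and small' = small[folded nbh_def cube_def mass_def]
    have ph0: "\<And>a. a \<in> Om \<Longrightarrow> 0 \<le> ph a" and u0: "\<And>a. a \<in> Om \<Longrightarrow> 0 \<le> u a"
      using pt by (force intro: order_trans[OF abs_ge_zero])+
    have W0: "\<And>a. a \<in> Om \<Longrightarrow> 0 \<le> W a" "\<And>a. a \<in> Om \<Longrightarrow> u a \<le> W a powr (1 / r)" using pt by auto
    obtain S where S: "finite S" "S \<subseteq> cubes" "sparse S" "\<bar>form v f\<bar> \<le> sparse_const * (\<Sum>R\<in>S. pairing v f R)"
      by (rule sparse_bound)
    have "pairing v f R \<le> nbh_avg u R * (\<Sum>a\<in>snd R. ph a * mu a)" if R: "R \<in> S" for R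
    proof -
      have RO: "snd R \<subseteq> Om" "cube_nbh R \<subseteq> Om" using R S cubes_nonempty[of R] unfolding cube_nbh_def by blast+
      show ?thesis
        unfolding pairing_def nbh_avg_def
      proof (rule mult_mono[OF divide_right_mono])
        show "(\<Sum>a\<in>cube_nbh R. \<bar>v a\<bar> * mu a) \<le> (\<Sum>a\<in>cube_nbh R. u a * mu a)"
          using RO(2) pt by (intro sum_mono mult_right_mono less_imp_le[OF mu_pos]) auto
        show "(\<Sum>a\<in>snd R. \<bar>f a\<bar> * mu a) \<le> (\<Sum>a\<in>snd R. ph a * mu a)"
          using RO(1) pt by (intro sum_mono mult_right_mono less_imp_le[OF mu_pos]) auto
        show "0 \<le> (\<Sum>a\<in>cube_nbh R. u a * mu a) / mass (cube_nbh R)"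
          using RO(2) u0 by (intro divide_nonneg_nonneg sum_nonneg mult_nonneg_nonneg mass_nonneg less_imp_le[OF mu_pos]) auto
        show "0 \<le> (\<Sum>a\<in>snd R. \<bar>f a\<bar> * mu a)"
          using RO(1) by (intro sum_nonneg mult_nonneg_nonneg less_imp_le[OF mu_pos]) auto
      qed (rule mass_nonneg[OF RO(2)])
    qed
    then have "\<bar>form v f\<bar> \<le> sc * (\<Sum>R\<in>S. nbh_avg u R * (\<Sum>a\<in>snd R. ph a * mu a))"
      using S(4) sc unfolding sceq by (meson mult_left_mono sum_mono order_trans less_imp_le)
    also have "\<dots> \<le> sc * (K * ln (exp 1 + r / (r - 1)) * (\<Sum>a\<in>Om. ph a * mu a * G a) + (\<Sum>a\<in>Om. u a * mu a) / (2 * sc))"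
    proof (rule mult_left_mono)
      define x where "x = r / (r - 1)"
      have x: "1 \<le> x" "1 / (1 - 1 / r) = x" using r by (auto simp: x_def field_simps)
      obtain k0 where k0: "max 1 (512 * D * sc) * x * sqrt (1/2) ^ k0 \<le> 1" "2 * real k0 + 8 \<le> K * ln (exp 1 + x)"
        using K(2)[OF x(1)] by blast
      have G0: "0 \<le> G a" if "a \<in> Om" for a
        using G'[rule_format, OF that, of 0] powr_ge_zero order_trans by blast
      have I0: "0 \<le> (\<Sum>a\<in>Om. ph a * mu a * G a)" "0 \<le> (\<Sum>a\<in>Om. u a * mu a)"
        using ph0 u0 G0 mu_pos by (auto intro!: sum_nonneg mult_nonneg_nonneg intro: less_imp_le)
      have "(\<Sum>R\<in>S. nbh_avg u R * (\<Sum>a\<in>snd R. ph a * mu a))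
        \<le> (2 * real k0 + 8) * (\<Sum>a\<in>Om. ph a * mu a * G a)
          + 256 * D / (1 - 1 / r) * sqrt (1/2) ^ k0 * (\<Sum>a\<in>Om. u a * mu a)"
      proof (rule weighted_sparse[OF S(1-3) ph0 u0 W0 r])
        fix a l assume a: "a \<in> Om" "l \<le> n"
        show "nbh_avg W (l, cube l a) powr (1 / r) \<le> G a"
          unfolding nbh_avg_def cube_nbh_eq[OF a] using G' a by blast
      next
        fix R assume R: "R \<in> S" "0 < nbh_avg u R"
        obtain l a where la: "R = (l, cube l a)" "l \<le> n" "a \<in> Om" using R S unfolding cubes_def by blast
        have "0 < (\<Sum>b\<in>nbh l a. u b * mu b)"
          using R(2) mass_nbh_pos[OF la(3,2)] unfolding nbh_avg_def la(1) cube_nbh_eq[OF la(3,2)]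
          by (simp add: zero_less_divide_iff)
        then show "(\<Sum>a\<in>snd R. ph a * mu a) \<le> mass (snd R)" using small' la by simp
      qed
      also have "\<dots> \<le> K * ln (exp 1 + x) * (\<Sum>a\<in>Om. ph a * mu a * G a) + 1 / (2 * sc) * (\<Sum>a\<in>Om. u a * mu a)"
      proof (intro add_mono mult_right_mono k0(2) I0)
        have "512 * D * sc * x * sqrt (1/2) ^ k0 \<le> max 1 (512 * D * sc) * x * sqrt (1/2) ^ k0"
          using x(1) by (intro mult_right_mono) auto
        then have "512 * D * sc * x * sqrt (1/2) ^ k0 \<le> 1" using k0(1) by linarith
        moreover have "256 * D / (1 - 1 / r) * sqrt (1/2) ^ k0 = 256 * D * x * sqrt (1/2) ^ k0"
          unfolding x(2)[symmetric] by simp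
        ultimately show "256 * D / (1 - 1 / r) * sqrt (1/2) ^ k0 \<le> 1 / (2 * sc)"
          using sc by (simp add: field_simps)
      qed
      finally show "(\<Sum>R\<in>S. nbh_avg u R * (\<Sum>a\<in>snd R. ph a * mu a))
        \<le> K * ln (exp 1 + r / (r - 1)) * (\<Sum>a\<in>Om. ph a * mu a * G a) + (\<Sum>a\<in>Om. u a * mu a) / (2 * sc)"
        by (simp add: x_def)
    qed (use sc in simp)
    also have "\<dots> = sc * K * ln (exp 1 + r / (r - 1)) * (\<Sum>a\<in>Om. ph a * mu a * G a) + (\<Sum>a\<in>Om. u a * mu a) / 2"
      using sc by (simp add: field_simps)
    finally show "\<bar>\<Sum>a\<in>Om. \<Sum>b\<in>Om. v a * f b * mu a * mu b * tau a b\<bar>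
      \<le> sc * K * ln (exp 1 + r / (r - 1)) * (\<Sum>a\<in>Om. ph a * mu a * G a) + (\<Sum>a\<in>Om. u a * mu a) / 2"
      by (simp only: form_def)
  qed
qed

section \<open>Spaces of homogeneous type\<close>

text \<open>The constants are parameters, normalised to be at least 1, so that whatever is derived
  from them is visibly independent of the grids built later.\<close>

locale homogeneous_space =
  fixes M :: "'a measure" and \<rho> :: "'a \<Rightarrow> 'a \<Rightarrow> real" and \<kappa> Dm :: real
  assumes rho_nonneg: "x \<in> space M \<Longrightarrow> y \<in> space M \<Longrightarrow> 0 \<le> \<rho> x y"
    and rho_zero: "x \<in> space M \<Longrightarrow> y \<in> space M \<Longrightarrow> \<rho> x y = 0 \<longleftrightarrow> x = y"
    and rho_sym: "x \<in> space M \<Longrightarrow> y \<in> space M \<Longrightarrow> \<rho> x y = \<rho> y x"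
    and rho_tri: "x \<in> space M \<Longrightarrow> y \<in> space M \<Longrightarrow> z \<in> space M \<Longrightarrow> \<rho> x z \<le> \<kappa> * (\<rho> x y + \<rho> y z)"
    and kappa_ge_1: "1 \<le> \<kappa>"
    and Dm_ge_1: "1 \<le> Dm"
    and ball_sets': "x \<in> space M \<Longrightarrow> 0 < r \<Longrightarrow> qball (space M) \<rho> x r \<in> sets M"
    and ball_emeasure: "x \<in> space M \<Longrightarrow> 0 < r \<Longrightarrow> 0 < emeasure M (qball (space M) \<rho> x r) \<and> emeasure M (qball (space M) \<rho> x r) < \<infinity>"
    and ball_doubling: "x \<in> space M \<Longrightarrow> 0 < r \<Longrightarrow>
      measure M (qball (space M) \<rho> x (2 * r)) \<le> Dm * measure M (qball (space M) \<rho> x r)"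
    and regular: "qborel_regular M \<rho>"

lemma homogeneous_type_spaceE:
  assumes "homogeneous_type_space M \<rho>"
  obtains \<kappa> Dm where "homogeneous_space M \<rho> \<kappa> Dm"
proof -
  have q: "quasimetric_on (space M) \<rho>" and reg: "qborel_regular M \<rho>" and db: "doubling_measure M \<rho>"
    using assms by (auto simp: homogeneous_type_space_def)
  obtain k0 where k0: "0 < k0" "\<forall>x\<in>space M. \<forall>y\<in>space M. \<forall>z\<in>space M. \<rho> x z \<le> k0 * (\<rho> x y + \<rho> y z)"
    using q by (auto simp: quasimetric_on_def)
  obtain D where D: "\<And>x r. x \<in> space M \<Longrightarrow> 0 < r \<Longrightarrow> 0 < emeasure M (qball (space M) \<rho> x (2 * r)) \<and>
        emeasure M (qball (space M) \<rho> x (2 * r)) \<le> ennreal D * emeasure M (qball (space M) \<rho> x r) \<and>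
        ennreal D * emeasure M (qball (space M) \<rho> x r) < \<infinity>"
    and bs: "qballs (space M) \<rho> \<subseteq> sets M"
    using db by (auto simp: doubling_measure_def)
  \<comment> \<open>Positivity and finiteness at radius \<open>r\<close> are both read off the
    doubling condition at radius \<open>r / 2\<close>.\<close>
  have em: "0 < emeasure M (qball (space M) \<rho> x r) \<and> emeasure M (qball (space M) \<rho> x r) < \<infinity>"
    if "x \<in> space M" "0 < r" for x r
    using D[OF that(1), of "r / 2"] that(2) by auto
  show ?thesis
  proof (rule that[of "max 1 k0" "max 1 D"], unfold_locales)
    fix x y z assume xyz: "x \<in> space M" "y \<in> space M" "z \<in> space M"
    have "0 \<le> \<rho> x y + \<rho> y z" using q xyz by (simp add: quasimetric_on_def)
    then have "k0 * (\<rho> x y + \<rho> y z) \<le> max 1 k0 * (\<rho> x y + \<rho> y z)" by (intro mult_right_mono) auto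
    then show "\<rho> x z \<le> max 1 k0 * (\<rho> x y + \<rho> y z)" using k0(2) xyz by (meson order_trans)
  next
    fix x and r :: real assume xr: "x \<in> space M" "0 < r"
    show "qball (space M) \<rho> x r \<in> sets M" using bs xr by (auto simp: qballs_def)
    show "0 < emeasure M (qball (space M) \<rho> x r) \<and> emeasure M (qball (space M) \<rho> x r) < \<infinity>" using em[OF xr] .
    have f: "emeasure M (qball (space M) \<rho> x r) = ennreal (measure M (qball (space M) \<rho> x r))"
      "emeasure M (qball (space M) \<rho> x (2 * r)) = ennreal (measure M (qball (space M) \<rho> x (2 * r)))"
      using em[OF xr] em[of x "2 * r"] xr by (auto intro!: emeasure_eq_ennreal_measure)
    have "ennreal (measure M (qball (space M) \<rho> x (2 * r))) \<le> ennreal (max 1 D) * ennreal (measure M (qball (space M) \<rho> x r))"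
      unfolding f[symmetric] using D[OF xr]
      by (meson order_trans mult_right_mono ennreal_leI max.cobounded2 zero_le)
    then show "measure M (qball (space M) \<rho> x (2 * r)) \<le> max 1 D * measure M (qball (space M) \<rho> x r)"
      by (simp add: ennreal_mult[symmetric])
  qed (use q reg in \<open>auto simp: quasimetric_on_def\<close>)
qed

context homogeneous_space
begin

abbreviation "X \<equiv> space M"
abbreviation "B \<equiv> qball (space M) \<rho>"

lemma kappa_pos: "0 < \<kappa>" using kappa_ge_1 by simp

lemma B_sub: "B x r \<subseteq> X" by (auto simp: qball_def)

lemma B_mono: "r \<le> s \<Longrightarrow> B x r \<subseteq> B x s" by (auto simp: qball_def)

lemma B_empty: "x \<in> X \<Longrightarrow> r \<le> 0 \<Longrightarrow> B x r = {}"
  using rho_nonneg[of x] by (force simp: qball_def)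

lemma B_sets [measurable]: "x \<in> X \<Longrightarrow> B x r \<in> sets M"
  using ball_sets'[of x r] B_empty[of x r] by (cases "0 < r") auto

lemma B_fin: "x \<in> X \<Longrightarrow> emeasure M (B x r) < \<infinity>"
  using ball_emeasure[of x r] B_empty[of x r] by (cases "0 < r") auto

lemma B_fmeasurable: "x \<in> X \<Longrightarrow> B x r \<in> fmeasurable M"
  using B_sets B_fin by (simp add: fmeasurable_def)

lemma B_pos: "x \<in> X \<Longrightarrow> 0 < r \<Longrightarrow> 0 < measure M (B x r)"
  using ball_emeasure[of x r] B_fin[of x r]
  by (simp add: measure_def enn2real_positive_iff top.not_eq_extremum)

lemma B_center: "x \<in> X \<Longrightarrow> 0 < r \<Longrightarrow> x \<in> B x r"
  using rho_zero[of x x] by (simp add: qball_def)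

lemma rho_self: "x \<in> X \<Longrightarrow> \<rho> x x = 0" using rho_zero[of x x] by simp

lemma rho_tri_less:
  assumes "x \<in> X" "y \<in> X" "z \<in> X" "\<rho> x y < a" "\<rho> y z < b"
  shows "\<rho> x z < \<kappa> * (a + b)"
proof -
  have "\<rho> x z \<le> \<kappa> * (\<rho> x y + \<rho> y z)" using rho_tri assms by blast
  also have "\<dots> < \<kappa> * (a + b)" using assms kappa_pos by simp
  finally show ?thesis .
qed

lemma B_shift: "x \<in> X \<Longrightarrow> y \<in> X \<Longrightarrow> \<rho> x y \<le> a \<Longrightarrow> B y r \<subseteq> B x (\<kappa> * (a + r))"
proof
  fix z assume a: "x \<in> X" "y \<in> X" "\<rho> x y \<le> a" and "z \<in> B y r"
  then have z: "z \<in> X" "\<rho> y z < r" by (auto simp: qball_def)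
  have "\<rho> x z \<le> \<kappa> * (\<rho> x y + \<rho> y z)" using rho_tri a z by blast
  also have "\<dots> < \<kappa> * (a + r)" using a z kappa_pos by simp
  finally show "z \<in> B x (\<kappa> * (a + r))" using z by (simp add: qball_def)
qed

definition dc :: "real \<Rightarrow> real" where "dc t = Dm ^ nat \<lceil>log 2 (max 1 t)\<rceil>"

lemma dc_ge_1: "1 \<le> dc t" using Dm_ge_1 by (simp add: dc_def one_le_power)

lemma dc_pos: "0 < dc t" using dc_ge_1[of t] by simp

lemma B_pow_doubling: "x \<in> X \<Longrightarrow> 0 < r \<Longrightarrow> measure M (B x (2 ^ k * r)) \<le> Dm ^ k * measure M (B x r)"
proof (induction k)
  case 0 then show ?case by simp
next
  case (Suc k)
  have "measure M (B x (2 * (2 ^ k * r))) \<le> Dm * measure M (B x (2 ^ k * r))"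
    using Suc.prems by (intro ball_doubling) auto
  also have "\<dots> \<le> Dm * (Dm ^ k * measure M (B x r))"
    using Suc Dm_ge_1 by (intro mult_left_mono) auto
  finally show ?case by (simp add: mult.assoc)
qed

lemma B_scale: "x \<in> X \<Longrightarrow> 0 < r \<Longrightarrow> measure M (B x (t * r)) \<le> dc t * measure M (B x r)"
proof -
  assume x: "x \<in> X" "0 < r"
  define k where "k = nat \<lceil>log 2 (max 1 t)\<rceil>"
  have "log 2 (max 1 t) \<le> real k" unfolding k_def by linarith
  then have "max 1 t \<le> 2 powr real k" by (subst (asm) log_le_iff) auto
  then have "t * r \<le> 2 ^ k * r" using x by (simp add: powr_realpow)
  then have "measure M (B x (t * r)) \<le> measure M (B x (2 ^ k * r))"
    using x by (intro measure_mono_fmeasurable B_mono B_fmeasurable B_sets)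
  also have "\<dots> \<le> dc t * measure M (B x r)" unfolding dc_def k_def[symmetric] using x by (rule B_pow_doubling)
  finally show ?thesis .
qed

text \<open>All radii are multiples of one scale \<open>s\<close>, so the constant is the same on
  every level of a grid.\<close>

lemma B_compare:
  assumes "x \<in> X" "y \<in> X" "\<rho> x y \<le> a * s" "0 < c" "0 < s"
  shows "measure M (B y (b * s)) \<le> dc (\<kappa> * (a + b) / c) * measure M (B x (c * s))"
proof -
  have "B y (b * s) \<subseteq> B x (\<kappa> * (a * s + b * s))" using assms by (intro B_shift)
  also have "\<kappa> * (a * s + b * s) = \<kappa> * (a + b) / c * (c * s)" using assms by (simp add: field_simps)
  finally have "measure M (B y (b * s)) \<le> measure M (B x (\<kappa> * (a + b) / c * (c * s)))"
    using assms by (intro measure_mono_fmeasurable B_fmeasurable B_sets)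
  also have "\<dots> \<le> dc (\<kappa> * (a + b) / c) * measure M (B x (c * s))" using assms by (intro B_scale) auto
  finally show ?thesis .
qed

section \<open>Nets and their cells\<close>

definition separated :: "real \<Rightarrow> 'a set \<Rightarrow> bool" where
  "separated s N \<longleftrightarrow> N \<subseteq> X \<and> (\<forall>z\<in>N. \<forall>z'\<in>N. z \<noteq> z' \<longrightarrow> s \<le> \<rho> z z')"

lemma separated_unique:
  assumes "separated s N" "z \<in> N" "z' \<in> N" "x \<in> X" "\<rho> x z < s / (2 * \<kappa>)" "\<rho> x z' < s / (2 * \<kappa>)"
  shows "z = z'"
proof (rule ccontr)
  assume ne: "z \<noteq> z'"
  have X: "z \<in> X" "z' \<in> X" using assms by (auto simp: separated_def)
  have "\<rho> z z' < \<kappa> * (s / (2 * \<kappa>) + s / (2 * \<kappa>))"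
    using assms X rho_sym by (intro rho_tri_less[of z x z']) auto
  also have "\<dots> = s" using kappa_pos by simp
  finally have "\<rho> z z' < s" .
  moreover have "s \<le> \<rho> z z'" using assms(1-3) ne unfolding separated_def by blast
  ultimately show False by simp
qed

text \<open>Packing: the balls of radius \<open>s / (2 * \<kappa>)\<close> about the points are
  disjoint, lie in one ball, and by doubling have measures bounded below by
  \<open>b\<close>.\<close>

lemma separated_finite:
  assumes sep: "separated s N" and s: "0 < s" and x: "x \<in> X"
  shows "finite {z\<in>N. \<rho> x z < R}"
proof (cases "0 < R")
  case False
  then have "{z\<in>N. \<rho> x z < R} = {}"
    using rho_nonneg[OF x] sep by (force simp: separated_def)
  then show ?thesis by (simp only: finite.emptyI)
next
  case True
  define t where "t = s / (2 * \<kappa>)"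
  have t: "0 < t" using s kappa_pos by (simp add: t_def)
  define b where "b = measure M (B x R) / dc (\<kappa> * (R + R) / t)"
  have b: "0 < b" using B_pos[OF x True] dc_pos by (simp add: b_def)
  define V where "V = measure M (B x (\<kappa> * (R + t)))"
  show ?thesis
  proof (rule finite_if_finite_subsets_card_bdd[THEN conjunct1])
    fix F assume F: "F \<subseteq> {z\<in>N. \<rho> x z < R}" "finite F"
    have FX: "z \<in> X" "z \<in> N" "\<rho> x z < R" if "z \<in> F" for z using that F sep by (auto simp: separated_def)
    have "real (card F) * b \<le> (\<Sum>z\<in>F. measure M (B z t))"
    proof -
      have "b \<le> measure M (B z t)" if z: "z \<in> F" for z
      proof -
        have "measure M (B x (R * 1)) \<le> dc (\<kappa> * (R + R) / t) * measure M (B z (t * 1))"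
          using FX[OF z] x t rho_sym by (intro B_compare) auto
        then show ?thesis using dc_pos[of "\<kappa> * (R + R) / t"] by (simp add: b_def divide_le_eq mult.commute)
      qed
      then show ?thesis using sum_bounded_below[of F b "\<lambda>z. measure M (B z t)"] by simp
    qed
    also have "\<dots> = measure M (\<Union>z\<in>F. B z t)"
    proof (rule measure_UNION'[symmetric])
      show "finite F" by fact
      show "B z t \<in> fmeasurable M" if "z \<in> F" for z using B_fmeasurable FX that by auto
      show "pairwise (\<lambda>x y. disjnt (B x t) (B y t)) F"
      proof (intro pairwiseI)
        fix z z' assume z: "z \<in> F" "z' \<in> F" "z \<noteq> z'"
        show "disjnt (B z t) (B z' t)"
        proof (rule ccontr)
          assume "\<not> disjnt (B z t) (B z' t)"
          then obtain y where y: "y \<in> B z t" "y \<in> B z' t" by (auto simp: disjnt_def)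
          have "y \<in> X" "\<rho> y z < t" "\<rho> y z' < t" using y FX[OF z(1)] FX[OF z(2)] rho_sym by (auto simp: qball_def)
          then have "z = z'" using separated_unique[OF sep FX(2)[OF z(1)] FX(2)[OF z(2)]] by (simp add: t_def)
          then show False using z by simp
        qed
      qed
    qed
    also have "\<dots> \<le> V"
      unfolding V_def
    proof (intro measure_mono_fmeasurable B_fmeasurable x)
      show "(\<Union>z\<in>F. B z t) \<subseteq> B x (\<kappa> * (R + t))"
      proof (rule UN_least)
        fix z assume z: "z \<in> F"
        show "B z t \<subseteq> B x (\<kappa> * (R + t))" using FX[OF z] x by (intro B_shift less_imp_le)
      qed
      show "(\<Union>z\<in>F. B z t) \<in> sets M" using F(2) FX(1) by (intro sets.finite_UN B_sets) auto
    qed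
    finally have "real (card F) \<le> V / b" using b by (simp add: field_simps)
    then show "card F \<le> nat \<lceil>V / b\<rceil>" by linarith
  qed
qed

lemma separated_countable:
  assumes "separated s N" "0 < s"
  shows "countable N"
proof (cases "X = {}")
  case True then show ?thesis using assms by (simp add: separated_def)
next
  case False
  then obtain x where x: "x \<in> X" by blast
  have "N \<subseteq> (\<Union>k::nat. {z\<in>N. \<rho> x z < real k})" using reals_Archimedean2 by auto
  moreover have "countable (\<Union>k::nat. {z\<in>N. \<rho> x z < real k})"
    using separated_finite[OF assms x] by (intro countable_UN) (auto intro: countable_finite)
  ultimately show ?thesis by (rule countable_subset)
qed

lemma maximal_net:
  assumes x0: "x0 \<in> X" and s: "0 < s"
  shows "\<exists>N. separated s N \<and> x0 \<in> N \<and> (\<forall>x\<in>X. \<exists>z\<in>N. \<rho> x z < s)"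
proof -
  define A where "A = {N. separated s N \<and> x0 \<in> N}"
  have ne: "A \<noteq> {}" using x0 by (auto simp: A_def separated_def intro!: exI[of _ "{x0}"])
  have chain: "\<Union>\<C> \<in> A" if C: "\<C> \<noteq> {}" "subset.chain A \<C>" for \<C>
  proof -
    have CA: "N \<in> A" if "N \<in> \<C>" for N using C that by (auto simp: subset.chain_def)
    have "s \<le> \<rho> z z'" if z: "z \<in> \<Union>\<C>" "z' \<in> \<Union>\<C>" "z \<noteq> z'" for z z'
    proof -
      obtain N N' where N: "N \<in> \<C>" "z \<in> N" "N' \<in> \<C>" "z' \<in> N'" using z by blast
      then have "N \<subseteq> N' \<or> N' \<subseteq> N" using C(2) by (auto simp: subset.chain_def)
      then have "z \<in> N \<and> z' \<in> N \<or> z \<in> N' \<and> z' \<in> N'" using N by blast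
      then show ?thesis using CA[OF N(1)] CA[OF N(3)] z(3) unfolding A_def separated_def by blast
    qed
    then show ?thesis using CA C(1) unfolding A_def separated_def by blast
  qed
  obtain N where N: "N \<in> A" "\<And>N'. N' \<in> A \<Longrightarrow> N \<subseteq> N' \<Longrightarrow> N' = N"
    using subset_Zorn_nonempty[OF ne chain] by metis
  have sep: "separated s N" "x0 \<in> N" using N(1) by (auto simp: A_def)
  have "\<exists>z\<in>N. \<rho> x z < s" if x: "x \<in> X" for x
  proof (rule ccontr)
    assume "\<not> ?thesis"
    then have far: "\<forall>z\<in>N. s \<le> \<rho> x z" by (auto simp: not_less)
    have "separated s (insert x N)"
    proof -
      have NX: "N \<subseteq> X" using sep(1) by (simp add: separated_def)
      have "s \<le> \<rho> z z'" if z: "z \<in> insert x N" "z' \<in> insert x N" "z \<noteq> z'" for z z'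
      proof -
        consider "z \<in> N" "z' \<in> N" | "z = x" "z' \<in> N" | "z' = x" "z \<in> N" using z by blast
        then show ?thesis
        proof cases
          case 1 then show ?thesis using sep(1) z(3) unfolding separated_def by blast
        next
          case 2 then show ?thesis using far by blast
        next
          case 3
          then have "\<rho> z z' = \<rho> x z" using rho_sym[OF x] NX by auto
          then show ?thesis using far 3 by simp
        qed
      qed
      then show ?thesis using NX x unfolding separated_def by blast
    qed
    then have "insert x N \<in> A" using sep by (simp add: A_def)
    then have "x \<in> N" using N(2)[of "insert x N"] by blast
    then show False using far s rho_self[OF x] by force
  qed
  then show ?thesis using sep by blast
qed

text \<open>A point within \<open>s / (2 * \<kappa>)\<close> of a centre goes to that centre, which
  is unique by separation; any other point goes to the first centre, in an enumeration of
  \<open>N\<close>, at distance less than \<open>s\<close>. The cells thus contain an inner ball and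
  are countable combinations of balls, which keeps them measurable although balls need not be
  Borel.\<close>

lemma net_projection:
  assumes x0: "x0 \<in> X" and s: "0 < s"
  shows "\<exists>N p. N \<subseteq> X \<and> x0 \<in> N \<and> (\<forall>x\<in>X. p x \<in> N \<and> \<rho> x (p x) < s) \<and>
    (\<forall>z\<in>N. \<forall>x\<in>X. \<rho> x z < s / (2 * \<kappa>) \<longrightarrow> p x = z) \<and> (\<forall>z. {x\<in>X. p x = z} \<in> sets M) \<and>
    (\<forall>x\<in>X. \<forall>R. finite {z\<in>N. \<rho> x z < R})"
proof -
  obtain N where N: "separated s N" "x0 \<in> N" "\<And>x. x \<in> X \<Longrightarrow> \<exists>z\<in>N. \<rho> x z < s"
    using maximal_net[OF x0 s] by blast
  have NX: "N \<subseteq> X" using N(1) by (simp add: separated_def)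
  have cN: "countable N" using separated_countable[OF N(1) s] .
  define t where "t = s / (2 * \<kappa>)"
  have ts: "t \<le> s" "0 < t" using s kappa_ge_1 by (auto simp: t_def field_simps)
  define idx where "idx = to_nat_on N"
  have inj: "inj_on idx N" unfolding idx_def using cN by (rule inj_on_to_nat_on)
  define good where "good x z \<longleftrightarrow> z \<in> N \<and> (\<rho> x z < t \<or> (\<rho> x z < s \<and> (\<forall>z'\<in>N. \<not> \<rho> x z' < t) \<and> (\<forall>z'\<in>N. idx z' < idx z \<longrightarrow> \<not> \<rho> x z' < s)))" for x z
  have ex: "\<exists>!z. good x z" if x: "x \<in> X" for x
  proof (cases "\<exists>z\<in>N. \<rho> x z < t")
    case True
    then obtain z where z: "z \<in> N" "\<rho> x z < t" by blast
    show ?thesis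
    proof (rule ex1I[of _ z])
      show "good x z" using z by (simp add: good_def)
      fix y assume "good x y"
      then have "y \<in> N" "\<rho> x y < t" using z by (auto simp: good_def)
      then show "y = z" using separated_unique[OF N(1) _ z(1) x] z(2) by (simp add: t_def)
    qed
  next
    case False
    define P where "P k \<longleftrightarrow> (\<exists>z\<in>N. \<rho> x z < s \<and> idx z = k)" for k
    obtain k where k: "P k" using N(3)[OF x] by (auto simp: P_def)
    define k0 where "k0 = (LEAST k. P k)"
    have k0: "P k0" "\<And>j. P j \<Longrightarrow> k0 \<le> j" unfolding k0_def using k by (auto intro: LeastI Least_le)
    obtain z where z: "z \<in> N" "\<rho> x z < s" "idx z = k0" using k0(1) by (auto simp: P_def)
    show ?thesis
    proof (rule ex1I[of _ z])
      have "\<not> \<rho> x z' < s" if "z' \<in> N" "idx z' < idx z" for z'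
        using k0(2)[of "idx z'"] that z(3) by (force simp: P_def)
      then show "good x z" using z False unfolding good_def by blast
      fix y assume g: "good x y"
      then have y: "y \<in> N" "\<rho> x y < s" "\<And>z'. z' \<in> N \<Longrightarrow> idx z' < idx y \<Longrightarrow> \<not> \<rho> x z' < s"
        using False by (auto simp: good_def)
      have "k0 \<le> idx y" using k0(2)[of "idx y"] y by (auto simp: P_def)
      moreover have "idx y \<le> k0" using y(3)[OF z(1)] z by (meson not_le)
      ultimately have "idx y = idx z" using z by simp
      then show "y = z" using inj y(1) z(1) by (auto dest: inj_onD)
    qed
  qed
  define p where "p x = (THE z. good x z)" for x
  have gp: "good x (p x)" if "x \<in> X" for x unfolding p_def by (rule theI'[OF ex[OF that]])
  have pz: "p x = z" if "x \<in> X" "good x z" for x z using ex[OF that(1)] gp[OF that(1)] that(2) by blast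
  have meas: "{x\<in>X. p x = z} \<in> sets M" for z
  proof (cases "z \<in> N")
    case False
    then have "{x\<in>X. p x = z} = {}" using gp by (auto simp: good_def)
    then show ?thesis by (simp only: sets.empty_sets)
  next
    case True
    have "{x\<in>X. p x = z} = {x\<in>X. good x z}" using gp pz by blast
    also have "\<dots> = B z t \<union> (B z s - (\<Union>z'\<in>N. B z' t) - (\<Union>z'\<in>{z'\<in>N. idx z' < idx z}. B z' s))"
      using True NX rho_sym unfolding good_def qball_def by (auto simp: subset_iff)
    also have "\<dots> \<in> sets M"
    proof (intro sets.Un sets.Diff sets.countable_UN' B_sets)
      show "countable N" "countable {z'\<in>N. idx z' < idx z}"
        using cN by (auto intro: countable_subset)
    qed (use True NX in auto)
    finally show ?thesis .
  qed
  show ?thesis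
  proof (intro exI[of _ N] exI[of _ p] conjI ballI allI impI)
    show "N \<subseteq> X" "x0 \<in> N" by fact+
    fix x assume x: "x \<in> X"
    show "p x \<in> N" "\<rho> x (p x) < s" using gp[OF x] ts by (auto simp: good_def)
    show "finite {z\<in>N. \<rho> x z < R}" for R using separated_finite[OF N(1) s x] .
  next
    fix z x assume "z \<in> N" "x \<in> X" "\<rho> x z < s / (2 * \<kappa>)"
    then show "p x = z" by (intro pz) (auto simp: good_def t_def)
  next
    fix z show "{x\<in>X. p x = z} \<in> sets M" by (rule meas)
  qed
qed

end

section \<open>Dyadic grids\<close>

text \<open>The ratio \<open>1 / (8 * \<kappa> ^ 3)\<close> makes the neighbour radius
  \<open>8 * \<kappa> ^ 3 * el (Suc m)\<close> equal to \<open>el m\<close>, which leaves room for a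
  few triangle inequalities. The nets of different levels are unrelated, except that all contain
  \<open>x0\<close>, so that \<open>x0\<close> is the centre of a cube of level 0.\<close>

locale dyadic_grid = homogeneous_space +
  fixes x0 :: 'a and L :: real and N :: "nat \<Rightarrow> 'a set" and p :: "nat \<Rightarrow> 'a \<Rightarrow> 'a"
  assumes x0: "x0 \<in> space M" and L_pos: "0 < L"
    and N_sub: "N m \<subseteq> space M" and x0_N: "x0 \<in> N m"
    and p_N: "x \<in> space M \<Longrightarrow> p m x \<in> N m"
    and p_dist: "x \<in> space M \<Longrightarrow> \<rho> x (p m x) < L * (1 / (8 * \<kappa> ^ 3)) ^ m"
    and p_inner: "z \<in> N m \<Longrightarrow> x \<in> space M \<Longrightarrow> \<rho> x z < L * (1 / (8 * \<kappa> ^ 3)) ^ m / (2 * \<kappa>) \<Longrightarrow> p m x = z"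
    and p_sets: "{x\<in>space M. p m x = z} \<in> sets M"
    and N_finite: "x \<in> space M \<Longrightarrow> finite {z\<in>N m. \<rho> x z < R}"

lemma (in homogeneous_space) dyadic_grid_exists:
  assumes x0: "x0 \<in> X" and L: "0 < L"
  shows "\<exists>N p. dyadic_grid M \<rho> \<kappa> Dm x0 L N p"
proof -
  let ?e = "\<lambda>m. L * (1 / (8 * \<kappa> ^ 3)) ^ m"
  have e: "0 < ?e m" for m using L kappa_pos by simp
  define Q where "Q m N p \<longleftrightarrow> N \<subseteq> X \<and> x0 \<in> N \<and> (\<forall>x\<in>X. p x \<in> N \<and> \<rho> x (p x) < ?e m) \<and>
    (\<forall>z\<in>N. \<forall>x\<in>X. \<rho> x z < ?e m / (2 * \<kappa>) \<longrightarrow> p x = z) \<and> (\<forall>z. {x\<in>X. p x = z} \<in> sets M) \<and>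
    (\<forall>x\<in>X. \<forall>R. finite {z\<in>N. \<rho> x z < R})" for m N p
  have "\<forall>m. \<exists>N p. Q m N p"
    unfolding Q_def by (intro allI net_projection[OF x0 e])
  then obtain N p where *: "\<And>m. Q m (N m) (p m)"
    by metis
  have "dyadic_grid M \<rho> \<kappa> Dm x0 L N p"
    by unfold_locales (use *[unfolded Q_def] x0 L in blast)+
  then show ?thesis by blast
qed

context dyadic_grid
begin

definition del :: real where "del = 1 / (8 * \<kappa> ^ 3)"
definition el :: "nat \<Rightarrow> real" where "el m = L * del ^ m"

primrec pj :: "nat \<Rightarrow> nat \<Rightarrow> 'a \<Rightarrow> 'a" where
  "pj n 0 x = p n x"
| "pj n (Suc j) x = p (n - Suc j) (pj n j x)"

text \<open>The centre of the cube of level \<open>m\<close> containing \<open>x\<close>; the cubes are built up from the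
  cells of the finest level \<open>n\<close>.\<close>

definition Pr :: "nat \<Rightarrow> nat \<Rightarrow> 'a \<Rightarrow> 'a" where "Pr n m x = pj n (n - m) x"

definition cells :: "nat \<Rightarrow> 'a set" where "cells n = {z\<in>N n. Pr n 0 z = x0}"
definition cell :: "nat \<Rightarrow> 'a \<Rightarrow> 'a set" where "cell n z = {x\<in>X. p n x = z}"
definition cmu :: "nat \<Rightarrow> 'a \<Rightarrow> real" where "cmu n z = measure M (cell n z)"
definition region :: "nat \<Rightarrow> nat \<Rightarrow> 'a \<Rightarrow> 'a set" where "region n m a = {x\<in>X. Pr n m x = Pr n m a}"
definition gnr :: "nat \<Rightarrow> nat \<Rightarrow> 'a \<Rightarrow> 'a \<Rightarrow> bool" where
  "gnr n m a b \<longleftrightarrow> \<rho> (Pr n m a) (Pr n m b) < 8 * \<kappa> ^ 3 * el m"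
text \<open>The two entries serve \<open>nbh_ball_measure\<close> and
  \<open>region_child_measure\<close>. Neither the centre \<open>x0\<close> nor the size
  \<open>L\<close> of the grid enters, so one constant serves grids of all sizes.\<close>

definition Dt :: real where
  "Dt = max (dc (\<kappa> * (0 + \<kappa> * (8 * \<kappa> ^ 3 + 2 * \<kappa>)) / (1 / (4 * \<kappa>\<^sup>2)))) (dc (\<kappa> * (1 + 2 * \<kappa>) / (del / (4 * \<kappa>\<^sup>2))))"

lemma del: "0 < del" "del < 1" "8 * \<kappa> ^ 3 * del = 1"
proof -
  have "1 \<le> \<kappa> ^ 3" using one_le_power[OF kappa_ge_1] .
  then have "0 < 8 * \<kappa> ^ 3" "1 < 8 * \<kappa> ^ 3" by linarith+
  then show "0 < del" "del < 1" "8 * \<kappa> ^ 3 * del = 1" by (auto simp: del_def)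
qed

lemma el_pos: "0 < el m" using L_pos del by (simp add: el_def)

lemma el_Suc: "el (Suc m) = del * el m" by (simp add: el_def)

lemmas p_dist' = p_dist[folded del_def el_def]
lemmas p_inner' = p_inner[folded del_def el_def]

lemma Pr_top: "Pr n n x = p n x" by (simp add: Pr_def)

lemma Pr_Suc: "m < n \<Longrightarrow> Pr n m x = p m (Pr n (Suc m) x)"
proof -
  assume "m < n"
  then have "n - m = Suc (n - Suc m)" "n - Suc (n - Suc m) = m" by auto
  then show ?thesis by (simp add: Pr_def)
qed

lemma downward_induct [consumes 1, case_names top step]:
  assumes "m \<le> n" "P n" "\<And>m. m < n \<Longrightarrow> P (Suc m) \<Longrightarrow> P m"
  shows "P (m::nat)"
  using assms(1) by (induction rule: inc_induct) (use assms in auto)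

lemma Pr_N: "m \<le> n \<Longrightarrow> x \<in> X \<Longrightarrow> Pr n m x \<in> N m"
proof (induction rule: downward_induct)
  case top then show ?case using p_N by (simp add: Pr_top)
next
  case (step m)
  then show ?case using p_N N_sub by (auto simp: Pr_Suc)
qed

lemma Pr_X: "m \<le> n \<Longrightarrow> x \<in> X \<Longrightarrow> Pr n m x \<in> X"
  using Pr_N N_sub by blast

lemma Pr_step: "m < n \<Longrightarrow> x \<in> X \<Longrightarrow> \<rho> (Pr n (Suc m) x) (Pr n m x) < el m"
  using p_dist'[of "Pr n (Suc m) x" m] Pr_X[of "Suc m" n x] by (simp add: Pr_Suc)

lemma kappa_powers: "\<kappa> \<le> \<kappa>\<^sup>2" "\<kappa>\<^sup>2 \<le> \<kappa> ^ 3" "1 \<le> \<kappa>\<^sup>2" "1 \<le> \<kappa> ^ 3"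
  using kappa_ge_1 power_increasing[OF _ kappa_ge_1, of 1 2] power_increasing[OF _ kappa_ge_1, of 2 3]
  by (simp_all add: one_le_power)

text \<open>The errors of the levels decrease geometrically, with a ratio that beats the factor
  \<open>\<kappa>\<close> of each triangle inequality: \<open>2 * \<kappa>\<^sup>2 * del\<close> is
  at most 1, so the constant \<open>2 * \<kappa>\<close> reproduces itself from level to
  level.\<close>

lemma Pr_dist: "m \<le> n \<Longrightarrow> x \<in> X \<Longrightarrow> \<rho> x (Pr n m x) < 2 * \<kappa> * el m"
proof (induction rule: downward_induct)
  case top
  have "\<rho> x (p n x) < el n" using p_dist' top by simp
  also have "el n \<le> 2 * \<kappa> * el n" using kappa_ge_1 el_pos[of n] by simp
  finally show ?case by (simp add: Pr_top)
next
  case (step m)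
  have "\<rho> x (Pr n m x) < \<kappa> * (2 * \<kappa> * el (Suc m) + el m)"
    using step Pr_step[of m n x] Pr_X by (intro rho_tri_less[of x "Pr n (Suc m) x"]) auto
  also have "\<kappa> * (2 * \<kappa> * el (Suc m) + el m) = (2 * \<kappa>\<^sup>2 * del + \<kappa>) * el m"
    by (simp add: el_Suc power2_eq_square algebra_simps)
  also have "\<dots> \<le> 2 * \<kappa> * el m"
  proof (intro mult_right_mono)
    have "2 * \<kappa>\<^sup>2 * del \<le> 8 * \<kappa> ^ 3 * del"
      using kappa_powers del by (intro mult_right_mono) auto
    then show "2 * \<kappa>\<^sup>2 * del + \<kappa> \<le> 2 * \<kappa>" using del(3) kappa_ge_1 by linarith
  qed (use el_pos[of m] in simp)
  finally show ?case .
qed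

text \<open>Cubes are assembled from the finest cells, so a point near \<open>z\<close> reaches
  level \<open>m\<close> only after drifting to its centre of level \<open>Suc m\<close>. Shrinking
  the inner ball of the net by the factor \<open>2 * \<kappa>\<close> makes up for the
  drift.\<close>

lemma Pr_inner: "m \<le> n \<Longrightarrow> x \<in> X \<Longrightarrow> z \<in> N m \<Longrightarrow> \<rho> x z < el m / (4 * \<kappa>\<^sup>2) \<Longrightarrow> Pr n m x = z"
proof (cases "m = n")
  case True
  assume a: "x \<in> X" "z \<in> N m" "\<rho> x z < el m / (4 * \<kappa>\<^sup>2)"
  have "el m / (4 * \<kappa>\<^sup>2) \<le> el m / (2 * \<kappa>)"
    using el_pos[of m] kappa_powers kappa_pos by (intro divide_left_mono) auto
  then show ?thesis using p_inner'[OF a(2,1)] a True by (simp add: Pr_top)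
next
  case False
  assume a: "m \<le> n" "x \<in> X" "z \<in> N m" "\<rho> x z < el m / (4 * \<kappa>\<^sup>2)"
  have mn: "m < n" using False a by simp
  have zX: "z \<in> X" using a N_sub by blast
  have PX: "Pr n (Suc m) x \<in> X" using Pr_X mn a by simp
  have "\<rho> (Pr n (Suc m) x) z < \<kappa> * (2 * \<kappa> * el (Suc m) + el m / (4 * \<kappa>\<^sup>2))"
    using Pr_dist[of "Suc m" n x] mn a rho_sym[OF a(2) PX] zX PX by (intro rho_tri_less[of _ x]) auto
  also have "\<dots> = (8 * \<kappa> ^ 3 * del) / (4 * \<kappa>) * el m + el m / (4 * \<kappa>)"
    using kappa_pos by (simp add: el_Suc power2_eq_square power3_eq_cube field_simps)
  also have "\<dots> = el m / (2 * \<kappa>)" unfolding del(3) using kappa_pos by (simp add: field_simps)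
  finally show ?thesis using p_inner'[OF a(3) PX] mn by (simp add: Pr_Suc)
qed

lemma p_idem: "z \<in> N m \<Longrightarrow> p m z = z"
proof -
  assume z: "z \<in> N m"
  then have zX: "z \<in> X" using N_sub by blast
  show ?thesis using p_inner'[OF z zX] rho_self[OF zX] el_pos[of m] kappa_pos by simp
qed

lemma Pr_p: "m \<le> n \<Longrightarrow> x \<in> X \<Longrightarrow> Pr n m (p n x) = Pr n m x"
proof (induction rule: downward_induct)
  case top then show ?case using p_idem p_N by (simp add: Pr_top)
next
  case (step m) then show ?case by (simp add: Pr_Suc)
qed

lemma Pr_anc: "m \<le> n \<Longrightarrow> l \<le> m \<Longrightarrow> Pr n m x = Pr n m y \<Longrightarrow> Pr n l x = Pr n l y"
proof (induction m)
  case 0 then show ?case by simp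
next
  case (Suc m)
  then have "Pr n m x = Pr n m y" by (simp add: Pr_Suc)
  then show ?case using Suc by (cases "l = Suc m") auto
qed

lemma cells_N: "a \<in> cells n \<Longrightarrow> a \<in> N n" and cells_X: "a \<in> cells n \<Longrightarrow> a \<in> X"
  using N_sub unfolding cells_def by blast+

lemma cell_Pr: "a \<in> cells n \<Longrightarrow> x \<in> cell n a \<Longrightarrow> m \<le> n \<Longrightarrow> Pr n m x = Pr n m a"
  using Pr_p[of m n x] by (auto simp: cell_def)

lemma cell_sets [measurable]: "cell n z \<in> sets M" using p_sets by (simp add: cell_def)

lemma cell_X: "cell n z \<subseteq> X" by (auto simp: cell_def)

lemma finite_cells [simp]: "finite (cells n)"
proof (rule finite_subset)
  show "cells n \<subseteq> {z\<in>N n. \<rho> x0 z < 2 * \<kappa> * el 0}"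
  proof
    fix z assume z: "z \<in> cells n"
    have "\<rho> z (Pr n 0 z) < 2 * \<kappa> * el 0" using Pr_dist cells_X[OF z] by simp
    then show "z \<in> {z\<in>N n. \<rho> x0 z < 2 * \<kappa> * el 0}"
      using z rho_sym[OF x0 cells_X[OF z]] by (auto simp: cells_def)
  qed
  show "finite {z\<in>N n. \<rho> x0 z < 2 * \<kappa> * el 0}" using N_finite x0 by blast
qed

lemma region_sub: "m \<le> n \<Longrightarrow> a \<in> X \<Longrightarrow> region n m a \<subseteq> B (Pr n m a) (2 * \<kappa> * el m)"
proof
  fix x assume a: "m \<le> n" "a \<in> X" and "x \<in> region n m a"
  then have x: "x \<in> X" "Pr n m x = Pr n m a" by (auto simp: region_def)
  show "x \<in> B (Pr n m a) (2 * \<kappa> * el m)"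
    using Pr_dist[OF a(1) x(1)] rho_sym[OF x(1) Pr_X[OF a]] x by (simp add: qball_def)
qed

lemma region_sup: "m \<le> n \<Longrightarrow> a \<in> X \<Longrightarrow> B (Pr n m a) (1 / (4 * \<kappa>\<^sup>2) * el m) \<subseteq> region n m a"
proof
  fix x assume a: "m \<le> n" "a \<in> X" and "x \<in> B (Pr n m a) (1 / (4 * \<kappa>\<^sup>2) * el m)"
  then have x: "x \<in> X" "\<rho> (Pr n m a) x < el m / (4 * \<kappa>\<^sup>2)" by (auto simp: qball_def)
  have "Pr n m x = Pr n m a"
    using Pr_inner[OF a(1) x(1) Pr_N[OF a]] x(2) rho_sym[OF Pr_X[OF a] x(1)] by simp
  then show "x \<in> region n m a" using x(1) by (simp add: region_def)
qed

lemma region_cells: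
  assumes "m \<le> n" "a \<in> cells n"
  shows "region n m a = (\<Union>b\<in>{b\<in>cells n. Pr n m b = Pr n m a}. cell n b)"
proof
  show "region n m a \<subseteq> (\<Union>b\<in>{b\<in>cells n. Pr n m b = Pr n m a}. cell n b)"
  proof
    fix x assume x: "x \<in> region n m a"
    then have xX: "x \<in> X" and e: "Pr n m x = Pr n m a" by (auto simp: region_def)
    have "Pr n 0 (p n x) = Pr n 0 x" "Pr n m (p n x) = Pr n m x" using Pr_p xX assms by auto
    moreover have "Pr n 0 x = Pr n 0 a" using Pr_anc[OF assms(1) _ e] by simp
    ultimately have "p n x \<in> {b\<in>cells n. Pr n m b = Pr n m a}"
      using assms e p_N[OF xX] by (auto simp: cells_def)
    moreover have "x \<in> cell n (p n x)" using xX by (simp add: cell_def)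
    ultimately show "x \<in> (\<Union>b\<in>{b\<in>cells n. Pr n m b = Pr n m a}. cell n b)" by blast
  qed
  show "(\<Union>b\<in>{b\<in>cells n. Pr n m b = Pr n m a}. cell n b) \<subseteq> region n m a"
    using cell_Pr assms cell_X by (fastforce simp: region_def)
qed

lemma region_sets: "m \<le> n \<Longrightarrow> a \<in> cells n \<Longrightarrow> region n m a \<in> sets M"
  unfolding region_cells by (intro sets.finite_UN cell_sets) auto

lemma cell_fmeasurable: "a \<in> cells n \<Longrightarrow> cell n a \<in> fmeasurable M"
proof -
  assume a: "a \<in> cells n"
  have "cell n a \<subseteq> region n 0 a" using cell_Pr[OF a] cell_X[of n a] by (auto simp: region_def)
  also have "\<dots> \<subseteq> B (Pr n 0 a) (2 * \<kappa> * el 0)" using region_sub cells_X[OF a] by simp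
  finally show ?thesis using B_fmeasurable Pr_X cells_X[OF a] by (meson cell_sets fmeasurableI2 le0)
qed

lemma cell_disjoint: "a \<noteq> b \<Longrightarrow> cell n a \<inter> cell n b = {}"
  by (auto simp: cell_def)

lemma sum_cmu:
  assumes "A \<subseteq> cells n"
  shows "(\<Sum>b\<in>A. cmu n b) = measure M (\<Union>b\<in>A. cell n b)"
  unfolding cmu_def
proof (rule measure_UNION'[symmetric])
  show "finite A" using finite_subset[OF assms] by simp
  show "cell n b \<in> fmeasurable M" if "b \<in> A" for b using cell_fmeasurable assms that by blast
  show "pairwise (\<lambda>x y. disjnt (cell n x) (cell n y)) A"
    using cell_disjoint by (auto simp: pairwise_def disjnt_def)
qed

lemma sum_cmu_region: "m \<le> n \<Longrightarrow> a \<in> cells n \<Longrightarrow>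
    (\<Sum>b\<in>{b\<in>cells n. Pr n m b = Pr n m a}. cmu n b) = measure M (region n m a)"
  using sum_cmu[of "{b\<in>cells n. Pr n m b = Pr n m a}" n] region_cells[of m n a] by simp

lemma cmu_pos: "a \<in> cells n \<Longrightarrow> 0 < cmu n a"
proof -
  assume a: "a \<in> cells n"
  have "B a (el n / (2 * \<kappa>)) \<subseteq> cell n a"
    using p_inner'[OF cells_N[OF a]] rho_sym[OF cells_X[OF a]] by (auto simp: cell_def qball_def)
  then have "measure M (B a (el n / (2 * \<kappa>))) \<le> cmu n a"
    unfolding cmu_def using cell_fmeasurable[OF a] cells_X[OF a] B_sets by (intro measure_mono_fmeasurable)
  moreover have "0 < measure M (B a (el n / (2 * \<kappa>)))"
    using el_pos kappa_pos cells_X[OF a] by (intro B_pos) auto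
  ultimately show ?thesis by simp
qed

lemma region_pos: "m \<le> n \<Longrightarrow> a \<in> cells n \<Longrightarrow> 0 < measure M (region n m a)"
  unfolding sum_cmu_region[symmetric]
  using cmu_pos by (intro sum_pos) auto

lemma region_mono_measure: "m \<le> n \<Longrightarrow> a \<in> cells n \<Longrightarrow> measure M (region n m a) \<le> measure M (B (Pr n m a) (2 * \<kappa> * el m))"
proof -
  assume a: "m \<le> n" "a \<in> cells n"
  then have "a \<in> X" "Pr n m a \<in> X" using cells_X Pr_X by blast+
  then show ?thesis using a by (intro measure_mono_fmeasurable region_sub region_sets B_fmeasurable)
qed

lemma region_ge: "m \<le> n \<Longrightarrow> a \<in> cells n \<Longrightarrow> measure M (B (Pr n m a) (1 / (4 * \<kappa>\<^sup>2) * el m)) \<le> measure M (region n m a)"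
proof -
  assume a: "m \<le> n" "a \<in> cells n"
  have "region n m a \<in> fmeasurable M"
    by (rule fmeasurableI2[OF B_fmeasurable[OF Pr_X[OF a(1) cells_X[OF a(2)]]] region_sub[OF a(1) cells_X[OF a(2)]] region_sets[OF a]])
  moreover have "a \<in> X" "Pr n m a \<in> X" using a cells_X Pr_X by blast+
  ultimately show ?thesis using a by (intro measure_mono_fmeasurable region_sup B_sets)
qed

lemma nbh_cell_ball:
  assumes "m \<le> n" "a \<in> cells n" "b \<in> cells n" "gnr n m a b"
  shows "cell n b \<subseteq> B (Pr n m a) (\<kappa> * (8 * \<kappa> ^ 3 + 2 * \<kappa>) * el m)"
proof
  fix x assume x: "x \<in> cell n b"
  then have xX: "x \<in> X" using cell_X by blast
  have P: "Pr n m a \<in> X" "Pr n m b \<in> X" using Pr_X assms cells_X by auto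
  have "\<rho> (Pr n m b) x < 2 * \<kappa> * el m"
    using Pr_dist[OF assms(1) xX] cell_Pr[OF assms(3) x assms(1)] rho_sym[OF xX P(2)] by simp
  then have "\<rho> (Pr n m a) x < \<kappa> * (8 * \<kappa> ^ 3 * el m + 2 * \<kappa> * el m)"
    using assms(4) P xX by (intro rho_tri_less[of _ "Pr n m b"]) (auto simp: gnr_def)
  then show "x \<in> B (Pr n m a) (\<kappa> * (8 * \<kappa> ^ 3 + 2 * \<kappa>) * el m)"
    using xX by (simp add: qball_def algebra_simps)
qed

lemma nbh_ball_measure:
  assumes "m \<le> n" "a \<in> cells n"
  shows "measure M (B (Pr n m a) (\<kappa> * (8 * \<kappa> ^ 3 + 2 * \<kappa>) * el m)) \<le> Dt * measure M (region n m a)"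
proof -
  have P: "Pr n m a \<in> X" using Pr_X assms cells_X by auto
  have "measure M (B (Pr n m a) (\<kappa> * (8 * \<kappa> ^ 3 + 2 * \<kappa>) * el m))
    \<le> dc (\<kappa> * (0 + \<kappa> * (8 * \<kappa> ^ 3 + 2 * \<kappa>)) / (1 / (4 * \<kappa>\<^sup>2))) * measure M (B (Pr n m a) (1 / (4 * \<kappa>\<^sup>2) * el m))"
    using P rho_self el_pos kappa_pos by (intro B_compare) auto
  also have "\<dots> \<le> Dt * measure M (region n m a)"
    using region_ge[OF assms] dc_pos by (intro mult_mono) (auto simp: Dt_def less_imp_le le_max_iff_disj)
  finally show ?thesis .
qed

lemma region_child_measure:
  assumes "m < n" "a \<in> cells n"
  shows "measure M (region n m a) \<le> Dt * measure M (region n (Suc m) a)"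
proof -
  have aX: "a \<in> X" using assms cells_X by auto
  have P: "Pr n m a \<in> X" "Pr n (Suc m) a \<in> X" using Pr_X assms aX by auto
  have "measure M (region n m a) \<le> measure M (B (Pr n m a) (2 * \<kappa> * el m))"
    using region_mono_measure assms by simp
  also have "\<dots> \<le> dc (\<kappa> * (1 + 2 * \<kappa>) / (del / (4 * \<kappa>\<^sup>2))) * measure M (B (Pr n (Suc m) a) (del / (4 * \<kappa>\<^sup>2) * el m))"
    using P Pr_step[OF assms(1) aX] el_pos kappa_pos del by (intro B_compare) auto
  also have "\<dots> \<le> Dt * measure M (region n (Suc m) a)"
    using region_ge[of "Suc m" n a] assms dc_pos
    by (intro mult_mono) (auto simp: Dt_def el_Suc less_imp_le le_max_iff_disj)
  finally show ?thesis .
qed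

lemma Dt_ge_1: "1 \<le> Dt" using dc_ge_1 by (simp add: Dt_def le_max_iff_disj)

text \<open>Centres of neighbours at level \<open>Suc m\<close> are closer than \<open>el m\<close>,
  because \<open>8 * \<kappa> ^ 3 * del = 1\<close>. The triangle inequalities then add up to
  (\<kappa> + \<kappa>^2 + 2 \<kappa>^3) \<open>el m\<close>, which is below the neighbour
  radius.\<close>

lemma gnr_comp:
  assumes "a \<in> X" "b \<in> X" "c \<in> X" "m < n" "gnr n (Suc m) a b" "gnr n (Suc m) b c"
  shows "gnr n m a c"
proof -
  let ?K = "8 * \<kappa> ^ 3 * el (Suc m)"
  have K: "?K = el m" using del(3) by (simp add: el_Suc)
  have P: "Pr n i y \<in> X" if "i \<le> n" "y \<in> X" for i y using Pr_X that by auto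
  have 1: "\<rho> (Pr n (Suc m) a) (Pr n (Suc m) c) < \<kappa> * (el m + el m)"
    using assms(5,6) unfolding gnr_def K by (rule rho_tri_less[rotated 3]) (use P assms in auto)
  have 2: "\<rho> (Pr n (Suc m) a) (Pr n m c) < \<kappa> * (\<kappa> * (el m + el m) + el m)"
    using 1 Pr_step[OF assms(4,3)] by (rule rho_tri_less[rotated 3]) (use P assms in auto)
  have 3: "\<rho> (Pr n m a) (Pr n (Suc m) a) < el m"
    using Pr_step[OF assms(4,1)] rho_sym P assms by simp
  have "\<rho> (Pr n m a) (Pr n m c) < \<kappa> * (el m + \<kappa> * (\<kappa> * (el m + el m) + el m))"
    using 3 2 by (rule rho_tri_less[rotated 3]) (use P assms in auto)
  also have "\<dots> = (\<kappa> + \<kappa>\<^sup>2 + 2 * \<kappa> ^ 3) * el m"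
    by (simp add: power2_eq_square power3_eq_cube algebra_simps)
  also have "\<dots> \<le> 8 * \<kappa> ^ 3 * el m"
    using kappa_powers el_pos[of m] by (intro mult_right_mono) auto
  finally show ?thesis by (simp add: gnr_def)
qed

lemma grid_cube_tree: "cube_tree (cells n) (cmu n) n (Pr n) (gnr n) Dt"
proof
  show "finite (cells n)" "1 \<le> Dt" by (simp_all add: Dt_ge_1)
  show "0 < cmu n a" if "a \<in> cells n" for a using cmu_pos that .
  show "a = b" if "a \<in> cells n" "b \<in> cells n" "Pr n n a = Pr n n b" for a b
    using that p_idem[OF cells_N] by (simp add: Pr_top)
  show "Pr n m a = Pr n m b" if "m < n" "Pr n (Suc m) a = Pr n (Suc m) b" for a b m
    using that by (simp add: Pr_Suc)
  show "Pr n 0 a = Pr n 0 b" if "a \<in> cells n" "b \<in> cells n" for a b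
    using that by (simp add: cells_def)
  show "gnr n m a a" if "a \<in> cells n" "m \<le> n" for a m
    using rho_self[OF Pr_X[OF that(2) cells_X[OF that(1)]]] el_pos[of m] kappa_pos by (simp add: gnr_def)
  show "gnr n m b a" if "a \<in> cells n" "b \<in> cells n" "m \<le> n" "gnr n m a b" for a b m
    using that rho_sym[OF Pr_X Pr_X] cells_X by (simp add: gnr_def)
  show "gnr n m a' b" if "Pr n m a = Pr n m a'" "gnr n m a b" for a a' b m
    using that by (simp add: gnr_def)
  show "gnr n m a c" if "a \<in> cells n" "b \<in> cells n" "c \<in> cells n" "m < n" "gnr n (Suc m) a b" "gnr n (Suc m) b c" for a b c m
    using gnr_comp[OF cells_X cells_X cells_X] that by blast
  show "(\<Sum>b\<in>{b\<in>cells n. gnr n m a b}. cmu n b) \<le> Dt * (\<Sum>b\<in>{b\<in>cells n. Pr n m b = Pr n m a}. cmu n b)"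
    if a: "a \<in> cells n" "m \<le> n" for a m
  proof -
    have "(\<Sum>b\<in>{b\<in>cells n. gnr n m a b}. cmu n b) = measure M (\<Union>b\<in>{b\<in>cells n. gnr n m a b}. cell n b)"
      by (rule sum_cmu) auto
    also have "\<dots> \<le> measure M (B (Pr n m a) (\<kappa> * (8 * \<kappa> ^ 3 + 2 * \<kappa>) * el m))"
      using nbh_cell_ball a Pr_X cells_X
      by (intro measure_mono_fmeasurable B_fmeasurable sets.finite_UN cell_sets UN_least) auto
    also have "\<dots> \<le> Dt * measure M (region n m a)" using nbh_ball_measure a by simp
    finally show ?thesis using a by (simp add: sum_cmu_region)
  qed
  show "(\<Sum>b\<in>{b\<in>cells n. Pr n m b = Pr n m a}. cmu n b) \<le> Dt * (\<Sum>b\<in>{b\<in>cells n. Pr n (Suc m) b = Pr n (Suc m) a}. cmu n b)"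
    if a: "a \<in> cells n" "m < n" for a m
    using region_child_measure a by (simp add: sum_cmu_region)
qed

text \<open>The ball does not depend on \<open>n\<close>: functions supported in it are seen
  entirely by the cells of every level, so nothing is lost at the boundary of the grid.\<close>

lemma root_ball: "B x0 (L / (4 * \<kappa>\<^sup>2)) \<subseteq> (\<Union>a\<in>cells n. cell n a)"
proof
  fix x assume "x \<in> B x0 (L / (4 * \<kappa>\<^sup>2))"
  then have x: "x \<in> X" "\<rho> x x0 < el 0 / (4 * \<kappa>\<^sup>2)" using rho_sym[OF x0] by (auto simp: qball_def el_def)
  have "Pr n 0 x = x0" using Pr_inner[OF _ x(1) x0_N x(2)] by simp
  then have "p n x \<in> cells n" using Pr_p[OF _ x(1), of 0] p_N[OF x(1)] by (simp add: cells_def)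
  then show "x \<in> (\<Union>a\<in>cells n. cell n a)" using x(1) by (auto simp: cell_def)
qed

lemma cells_in_ball: "a \<in> cells n \<Longrightarrow> cell n a \<subseteq> B x0 (2 * \<kappa> * L)"
proof
  fix x assume a: "a \<in> cells n" "x \<in> cell n a"
  have x: "x \<in> X" using a cell_X by blast
  have "Pr n 0 x = x0" using cell_Pr[OF a] a(1) by (simp add: cells_def)
  then have "\<rho> x x0 < 2 * \<kappa> * L" using Pr_dist[OF _ x, of 0 n] by (simp add: el_def)
  then show "x \<in> B x0 (2 * \<kappa> * L)" using rho_sym[OF x x0] x by (simp add: qball_def)
qed

lemma cell_small: "a \<in> cells n \<Longrightarrow> x \<in> cell n a \<Longrightarrow> cell n a \<subseteq> B x (2 * \<kappa> * el n)"
proof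
  fix y assume a: "a \<in> cells n" "x \<in> cell n a" "y \<in> cell n a"
  then have X: "x \<in> X" "y \<in> X" "a \<in> X" using cell_X cells_X by auto
  have d: "\<rho> x a < el n" "\<rho> y a < el n" using a p_dist'[OF X(1), of n] p_dist'[OF X(2), of n] by (auto simp: cell_def)
  have "\<rho> x y < \<kappa> * (el n + el n)" using X d rho_sym by (intro rho_tri_less[of _ a]) auto
  then show "y \<in> B x (2 * \<kappa> * el n)" using X by (simp add: qball_def algebra_simps)
qed

end

section \<open>Calderon-Zygmund operators\<close>

lemma L2_functions_measurable: "f \<in> L2_functions M \<Longrightarrow> f \<in> borel_measurable M"
  and L2_functions_integrable: "f \<in> L2_functions M \<Longrightarrow> integrable M (\<lambda>x. (f x)\<^sup>2)"
  by (auto simp: L2_functions_def)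

lemma L2_functions_mult_integrable:
  assumes "f \<in> L2_functions M" "g \<in> L2_functions M"
  shows "integrable M (\<lambda>x. f x * g x)"
proof (rule Bochner_Integration.integrable_bound[where f = "\<lambda>x. (f x)\<^sup>2 + (g x)\<^sup>2"])
  show "integrable M (\<lambda>x. (f x)\<^sup>2 + (g x)\<^sup>2)"
    using assms by (intro Bochner_Integration.integrable_add L2_functions_integrable)
  show "(\<lambda>x. f x * g x) \<in> borel_measurable M"
    using assms by (intro borel_measurable_times L2_functions_measurable)
  have "\<bar>a * b\<bar> \<le> a\<^sup>2 + b\<^sup>2" for a b :: real
    using sum_squares_bound[of "\<bar>a\<bar>" "\<bar>b\<bar>"] mult_nonneg_nonneg[OF abs_ge_zero abs_ge_zero, of a b]
    unfolding abs_mult power2_abs by linarith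
  then show "AE x in M. norm (f x * g x) \<le> norm ((f x)\<^sup>2 + (g x)\<^sup>2)" by simp
qed

lemma L2_functions_indicator: "A \<in> fmeasurable M \<Longrightarrow> (indicator A :: 'a \<Rightarrow> real) \<in> L2_functions M"
proof -
  assume A: "A \<in> fmeasurable M"
  have "(\<lambda>x. (indicator A x :: real)\<^sup>2) = indicator A" by (auto simp: indicator_def)
  then show ?thesis
    using A integrable_real_indicator[of A M] borel_measurable_indicator[of A M]
    unfolding L2_functions_def fmeasurable_def by simp
qed

lemma L2_functions_lincomb:
  assumes "f \<in> L2_functions M" "g \<in> L2_functions M"
  shows "(\<lambda>x. a * f x + b * g x) \<in> L2_functions M"
proof -
  have "integrable M (\<lambda>x. a\<^sup>2 * (f x)\<^sup>2 + 2 * a * b * (f x * g x) + b\<^sup>2 * (g x)\<^sup>2)"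
    using assms by (intro Bochner_Integration.integrable_add integrable_mult_right L2_functions_integrable L2_functions_mult_integrable)
  also have "(\<lambda>x. a\<^sup>2 * (f x)\<^sup>2 + 2 * a * b * (f x * g x) + b\<^sup>2 * (g x)\<^sup>2) = (\<lambda>x. (a * f x + b * g x)\<^sup>2)"
    by (rule ext) (simp add: power2_eq_square algebra_simps)
  finally show ?thesis using assms by (auto simp: L2_functions_def)
qed

lemma L2_functions_zero: "(\<lambda>x. 0) \<in> L2_functions M"
  by (simp add: L2_functions_def)

lemma L2_functions_sum:
  assumes "\<And>i. i \<in> I \<Longrightarrow> f i \<in> L2_functions M"
  shows "(\<lambda>x. \<Sum>i\<in>I. c i * f i x) \<in> L2_functions M"
proof (cases "finite I")
  case True
  then show ?thesis using assms
  proof (induction I rule: finite_induct)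
    case empty show ?case by (simp add: L2_functions_zero)
  next
    case (insert i I)
    have "(\<lambda>x. c i * f i x + 1 * (\<Sum>i\<in>I. c i * f i x)) \<in> L2_functions M"
      using insert by (intro L2_functions_lincomb) auto
    then show ?case using insert by simp
  qed
qed (simp add: L2_functions_zero)

lemma L2_norm_nonneg: "0 \<le> L2_norm_of M f"
  by (simp add: L2_norm_of_def)

lemma L2_Cauchy_Schwarz:
  assumes f: "f \<in> L2_functions M" and g: "g \<in> L2_functions M"
  shows "\<bar>LINT x|M. f x * g x\<bar> \<le> L2_norm_of M f * L2_norm_of M g"
proof -
  define a where "a = (LINT x|M. (f x)\<^sup>2)"
  define b where "b = (LINT x|M. (g x)\<^sup>2)"
  have ab: "0 \<le> a" "0 \<le> b" by (auto simp: a_def b_def)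
  have zero: "(LINT x|M. h x * k x) = 0" if "h \<in> L2_functions M" "(LINT x|M. (h x)\<^sup>2) = 0" for h k :: "'a \<Rightarrow> real"
  proof -
    have "AE x in M. (h x)\<^sup>2 = 0"
      using that(2) integral_nonneg_eq_0_iff_AE[OF L2_functions_integrable[OF that(1)]] by simp
    then have "AE x in M. h x * k x = 0" by eventually_elim simp
    then show ?thesis by (rule integral_eq_zero_AE)
  qed
  show ?thesis
  proof (cases "a = 0 \<or> b = 0")
    case True
    have "(LINT x|M. f x * g x) = 0"
      using zero[OF f, of g] zero[OF g, of f] True by (auto simp: a_def b_def mult.commute)
    then show ?thesis using L2_norm_nonneg[of M f] L2_norm_nonneg[of M g] by simp
  next
    case False
    then have pos: "0 < a" "0 < b" using ab by auto
    define s where "s = sqrt b / sqrt a"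
    have s: "0 < s" using pos by (simp add: s_def)
    have pt: "\<bar>u * w\<bar> \<le> (s * u\<^sup>2 + w\<^sup>2 / s) / 2" for u w :: real
    proof -
      have "0 \<le> (s * \<bar>u\<bar> - \<bar>w\<bar>)\<^sup>2" by simp
      then have "2 * s * (\<bar>u\<bar> * \<bar>w\<bar>) \<le> s * s * u\<^sup>2 + w\<^sup>2"
        by (simp add: power2_eq_square algebra_simps)
      then show ?thesis using s by (simp add: field_simps abs_mult power2_eq_square)
    qed
    have "\<bar>LINT x|M. f x * g x\<bar> \<le> (LINT x|M. \<bar>f x * g x\<bar>)" by (rule integral_abs_bound)
    also have "\<dots> \<le> (LINT x|M. (s * (f x)\<^sup>2 + (g x)\<^sup>2 / s) / 2)"
      using f g pt by (intro integral_mono) (auto intro!: integrable_abs L2_functions_mult_integrable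
        Bochner_Integration.integrable_add integrable_mult_right integrable_divide L2_functions_integrable)
    also have "\<dots> = (s * a + b / s) / 2"
      unfolding a_def b_def using L2_functions_integrable[OF f] L2_functions_integrable[OF g]
      by simp
    also have "\<dots> = sqrt a * sqrt b"
    proof -
      have gen: "y / x * (x * x) = y * x" "y * y / (y / x) = x * y" if "0 < x" "0 < y" for x y :: real
        using that by (simp_all add: field_simps)
      have "s * a = sqrt b / sqrt a * (sqrt a * sqrt a)" "b / s = sqrt b * sqrt b / (sqrt b / sqrt a)"
        using pos by (simp_all add: s_def)
      then have "s * a = sqrt b * sqrt a" "b / s = sqrt a * sqrt b"
        using gen[of "sqrt a" "sqrt b"] pos by simp_all
      then show ?thesis by simp
    qed
    finally show ?thesis by (simp add: L2_norm_of_def a_def b_def)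
  qed
qed

lemma average_approx:
  fixes g :: "'a \<Rightarrow> real"
  assumes A: "A \<in> fmeasurable M" "0 < measure M A" and g: "integrable M (\<lambda>x. g x * indicator A x)"
    and le: "AE x in M. x \<in> A \<longrightarrow> \<bar>g x - c\<bar> \<le> e"
  shows "\<bar>(LINT x|M. g x * indicator A x) / measure M A - c\<bar> \<le> e"
proof -
  have iA: "integrable M (\<lambda>x. k * indicator A x :: real)" for k
    using A by (intro integrable_mult_right integrable_real_indicator) (auto simp: fmeasurable_def)
  have "(LINT x|M. g x * indicator A x) - c * measure M A = (LINT x|M. g x * indicator A x - c * indicator A x)"
    using g iA[of c] A by (simp add: fmeasurable_def sets.sets_into_space Int_absorb2)
  then have "\<bar>(LINT x|M. g x * indicator A x) - c * measure M A\<bar> \<le> (LINT x|M. \<bar>g x * indicator A x - c * indicator A x\<bar>)"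
    using integral_abs_bound by metis
  also have "\<dots> \<le> (LINT x|M. e * indicator A x)"
  proof (rule integral_mono_AE)
    show "integrable M (\<lambda>x. \<bar>g x * indicator A x - c * indicator A x\<bar>)"
      using g iA by (intro integrable_abs Bochner_Integration.integrable_diff)
    show "AE x in M. \<bar>g x * indicator A x - c * indicator A x\<bar> \<le> e * indicator A x"
      using le by eventually_elim (auto simp: indicator_def)
  qed (rule iA)
  also have "\<dots> = e * measure M A"
    using A by (simp add: fmeasurable_def sets.sets_into_space Int_absorb2)
  finally have "\<bar>(LINT x|M. g x * indicator A x) - c * measure M A\<bar> / measure M A \<le> e"
    using A(2) by (simp add: divide_le_eq)
  moreover have "(LINT x|M. g x * indicator A x) / measure M A - c = ((LINT x|M. g x * indicator A x) - c * measure M A) / measure M A"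
    using A(2) by (simp add: field_simps)
  ultimately show ?thesis using A(2) by (simp add: abs_divide)
qed

locale cz_operator = homogeneous_space +
  fixes T :: "('a \<Rightarrow> real) \<Rightarrow> 'a \<Rightarrow> real" and K :: "'a \<Rightarrow> 'a \<Rightarrow> real" and \<eta> CK A :: real
  assumes eta: "0 < \<eta>" and CK: "0 \<le> CK" and A_nonneg: "0 \<le> A"
    and K_size: "x \<in> space M \<Longrightarrow> y \<in> space M \<Longrightarrow> x \<noteq> y \<Longrightarrow>
      \<bar>K x y\<bar> \<le> CK / measure M (qball (space M) \<rho> x (\<rho> x y))"
    and K_smooth1: "x \<in> space M \<Longrightarrow> y \<in> space M \<Longrightarrow> x' \<in> space M \<Longrightarrow> x \<noteq> y \<Longrightarrow> x' \<noteq> y \<Longrightarrow>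
      \<rho> x x' \<le> \<eta> * \<rho> x y \<Longrightarrow>
      \<bar>K x' y - K x y\<bar> \<le> (\<rho> x' x / \<rho> x y) powr \<eta> * (1 / measure M (qball (space M) \<rho> x (\<rho> x y)))"
    and K_smooth2: "x \<in> space M \<Longrightarrow> y \<in> space M \<Longrightarrow> x' \<in> space M \<Longrightarrow> x \<noteq> y \<Longrightarrow> x' \<noteq> y \<Longrightarrow>
      \<rho> x x' \<le> \<eta> * \<rho> x y \<Longrightarrow>
      \<bar>K y x' - K y x\<bar> \<le> (\<rho> x' x / \<rho> x y) powr \<eta> * (1 / measure M (qball (space M) \<rho> x (\<rho> x y)))"
    and T_L2: "f \<in> L2_functions M \<Longrightarrow> T f \<in> L2_functions M"
    and T_linear: "f \<in> L2_functions M \<Longrightarrow> g \<in> L2_functions M \<Longrightarrow>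
      AE x in M. T (\<lambda>y. a * f y + b * g y) x = a * T f x + b * T g x"
    and T_bounded: "f \<in> L2_functions M \<Longrightarrow> L2_norm_of M (T f) \<le> A * L2_norm_of M f"
    and T_kernel: "f \<in> L2_functions M \<Longrightarrow>
      AE x in M. x \<notin> ess_support M \<rho> f \<longrightarrow> T f x = (LINT y|M. K x y * f y)"

lemma (in homogeneous_space) cz_operator_exists:
  assumes "calderon_zygmund_operator M \<rho> T"
  shows "\<exists>K \<eta> CK A. cz_operator M \<rho> \<kappa> Dm T K \<eta> CK A"
proof -
  obtain K A where K: "calderon_zygmund_kernel M \<rho> K"
    and TK: "\<forall>f\<in>L2_functions M. AE x in M. x \<notin> ess_support M \<rho> f \<longrightarrow> T f x = (LINT y|M. K x y * f y)"
    and A: "\<forall>f\<in>L2_functions M. L2_norm_of M (T f) \<le> A * L2_norm_of M f"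
    and T: "\<forall>f\<in>L2_functions M. T f \<in> L2_functions M"
      "\<forall>f\<in>L2_functions M. \<forall>g\<in>L2_functions M. \<forall>a b. AE x in M. T (\<lambda>y. a * f y + b * g y) x = a * T f x + b * T g x"
    using assms unfolding calderon_zygmund_operator_def by blast
  obtain \<eta> C where eta: "0 < \<eta>" and C: "\<forall>x0\<in>X. \<forall>y\<in>X. x0 \<noteq> y \<longrightarrow>
        \<bar>K x0 y\<bar> \<le> C / measure M (B x0 (\<rho> x0 y)) \<and>
        (\<forall>x\<in>X. x \<noteq> y \<and> \<rho> x0 x \<le> \<eta> * \<rho> x0 y \<longrightarrow>
           \<bar>K x y - K x0 y\<bar> \<le> (\<rho> x x0 / \<rho> x0 y) powr \<eta> * (1 / measure M (B x0 (\<rho> x0 y))) \<and>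
           \<bar>K y x - K y x0\<bar> \<le> (\<rho> x x0 / \<rho> x0 y) powr \<eta> * (1 / measure M (B x0 (\<rho> x0 y))))"
    using K[unfolded calderon_zygmund_kernel_def] by (elim exE conjE) (rule that)
  have "cz_operator M \<rho> \<kappa> Dm T K \<eta> \<bar>C\<bar> \<bar>A\<bar>"
  proof unfold_locales
    show "0 < \<eta>" "0 \<le> \<bar>C\<bar>" "0 \<le> \<bar>A\<bar>" using eta by auto
    show "T f \<in> L2_functions M" if "f \<in> L2_functions M" for f using T(1) that by blast
    show "AE x in M. T (\<lambda>y. a * f y + b * g y) x = a * T f x + b * T g x"
      if "f \<in> L2_functions M" "g \<in> L2_functions M" for f g a b using T(2) that by blast
    show "AE x in M. x \<notin> ess_support M \<rho> f \<longrightarrow> T f x = (LINT y|M. K x y * f y)"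
      if "f \<in> L2_functions M" for f using TK that by blast
    fix x y x' assume a: "x \<in> X" "y \<in> X" "x' \<in> X" "x \<noteq> y" "x' \<noteq> y" "\<rho> x x' \<le> \<eta> * \<rho> x y"
    note Cx = C[rule_format, OF a(1,2,4)]
    show "\<bar>K x' y - K x y\<bar> \<le> (\<rho> x' x / \<rho> x y) powr \<eta> * (1 / measure M (B x (\<rho> x y)))"
      "\<bar>K y x' - K y x\<bar> \<le> (\<rho> x' x / \<rho> x y) powr \<eta> * (1 / measure M (B x (\<rho> x y)))"
      using Cx[THEN conjunct2, rule_format, OF a(3)] a(5,6) by simp_all
  next
    fix x y assume "x \<in> X" "y \<in> X" "x \<noteq> y"
    then have "\<bar>K x y\<bar> \<le> C / measure M (B x (\<rho> x y))" using C by blast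
    also have "\<dots> \<le> \<bar>C\<bar> / measure M (B x (\<rho> x y))" by (intro divide_right_mono) auto
    finally show "\<bar>K x y\<bar> \<le> \<bar>C\<bar> / measure M (B x (\<rho> x y))" .
  next
    fix f assume "f \<in> L2_functions M"
    then have "L2_norm_of M (T f) \<le> A * L2_norm_of M f" using A by blast
    also have "\<dots> \<le> \<bar>A\<bar> * L2_norm_of M f" by (intro mult_right_mono L2_norm_nonneg) simp
    finally show "L2_norm_of M (T f) \<le> \<bar>A\<bar> * L2_norm_of M f" .
  qed
  then show ?thesis by blast
qed

lemma (in homogeneous_space) qopen_sets: "qopen M' \<rho> U \<Longrightarrow> M' = X \<Longrightarrow> U \<in> sets M"
  using regular unfolding qborel_regular_def qborel_sets_def by (auto intro: sigma_sets.Basic)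

context cz_operator
begin

text \<open>Smoothness makes \<open>K x\<close> continuous off the diagonal, so its superlevel sets
  there are open and hence measurable. The point \<open>x\<close> is the complement of a countable
  union of them.\<close>

lemma K_measurable:
  assumes x: "x \<in> X"
  shows "(\<lambda>y. if y = x then 0 else K x y) \<in> borel_measurable M"
proof -
  have op: "{y\<in>X. y \<noteq> x \<and> c < K x y} \<in> sets M" for c
  proof (rule qopen_sets[OF _ refl])
    show "qopen X \<rho> {y\<in>X. y \<noteq> x \<and> c < K x y}"
      unfolding qopen_def
    proof (intro conjI ballI)
      fix y assume "y \<in> {y\<in>X. y \<noteq> x \<and> c < K x y}"
      then have y: "y \<in> X" "y \<noteq> x" "c < K x y" by auto
      define d where "d = \<rho> y x"
      have d: "0 < d" using rho_nonneg[OF y(1) x] rho_zero[OF y(1) x] y(2) by (simp add: d_def)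
      define m where "m = measure M (B y d)"
      have m: "0 < m" using B_pos[OF y(1) d] by (simp add: m_def)
      \<comment> \<open>The three bounds keep the ball away from \<open>x\<close>, put it into the
        range of the smoothness condition, and make the resulting error smaller than the gap
        \<open>K x y - c\<close>.\<close>
      define r where "r = min (min d (\<eta> * d)) (d * ((K x y - c) * m) powr (1 / \<eta>))"
      have r: "0 < r" "r \<le> d" "r \<le> \<eta> * d" "r \<le> d * ((K x y - c) * m) powr (1 / \<eta>)"
        using d eta y(3) m by (auto simp: r_def)
      have "B y r \<subseteq> {y\<in>X. y \<noteq> x \<and> c < K x y}"
      proof
        fix y' assume "y' \<in> B y r"
        then have y': "y' \<in> X" "\<rho> y y' < r" by (auto simp: qball_def)
        have ne: "y' \<noteq> x" using y' r(2) by (auto simp: d_def)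
        have "\<bar>K x y' - K x y\<bar> \<le> (\<rho> y' y / d) powr \<eta> * (1 / m)"
          unfolding d_def m_def using K_smooth2[OF y(1) x y'(1) y(2) ne] y'(2) r(3) by (simp add: d_def)
        also have "\<dots> < K x y - c"
        proof -
          have "\<rho> y' y / d < ((K x y - c) * m) powr (1 / \<eta>)"
            using y'(2) r(4) d rho_sym[OF y'(1) y(1)] by (simp add: divide_less_eq mult.commute)
          then have "(\<rho> y' y / d) powr \<eta> < (((K x y - c) * m) powr (1 / \<eta>)) powr \<eta>"
            using eta d rho_nonneg[OF y'(1) y(1)] by (intro powr_less_mono2) auto
          also have "\<dots> = (K x y - c) * m" using eta y(3) m by (simp add: powr_powr)
          finally show ?thesis using m by (simp add: divide_less_eq)
        qed
        finally show "y' \<in> {y\<in>X. y \<noteq> x \<and> c < K x y}" using y' ne by auto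
      qed
      then show "\<exists>r>0. B y r \<subseteq> {y\<in>X. y \<noteq> x \<and> c < K x y}" using r(1) by blast
    qed auto
  qed
  have "{x} = X - (\<Union>k::nat. {y\<in>X. y \<noteq> x \<and> - real k < K x y})"
  proof
    show "{x} \<subseteq> X - (\<Union>k::nat. {y\<in>X. y \<noteq> x \<and> - real k < K x y})" using x by auto
    show "X - (\<Union>k::nat. {y\<in>X. y \<noteq> x \<and> - real k < K x y}) \<subseteq> {x}"
    proof
      fix y assume y: "y \<in> X - (\<Union>k::nat. {y\<in>X. y \<noteq> x \<and> - real k < K x y})"
      obtain k :: nat where "- K x y < real k" using reals_Archimedean2 by blast
      then have "- real k < K x y" by simp
      then show "y \<in> {x}" using y by blast
    qed
  qed
  also have "\<dots> \<in> sets M"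
    by (intro sets.Diff sets.top sets.countable_UN) (auto intro: op)
  finally have sx: "{x} \<in> sets M" .
  show ?thesis
    unfolding borel_measurable_iff_greater
  proof
    fix c
    have "{y\<in>X. c < (if y = x then 0 else K x y)} = {y\<in>X. y \<noteq> x \<and> c < K x y} \<union> (if c < 0 then {x} else {})"
      using x by auto
    also have "\<dots> \<in> sets M" using op[of c] sx by (intro sets.Un) auto
    finally show "{y\<in>X. c < (if y = x then 0 else K x y)} \<in> sets M" .
  qed
qed

end

section \<open>Step functions and the operator on a grid\<close>

context dyadic_grid
begin

definition ind :: "nat \<Rightarrow> 'a \<Rightarrow> 'a \<Rightarrow> real" where "ind n b = indicator (cell n b)"

lemma ind_L2: "b \<in> cells n \<Longrightarrow> ind n b \<in> L2_functions M"
  unfolding ind_def by (rule L2_functions_indicator[OF cell_fmeasurable])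

lemma cell_self: "a \<in> cells n \<Longrightarrow> a \<in> cell n a"
  using p_idem[OF cells_N] cells_X by (simp add: cell_def)

lemma cell_meas_pos: "a \<in> cells n \<Longrightarrow> 0 < measure M (cell n a)"
  using cmu_pos by (simp add: cmu_def)

definition step :: "nat \<Rightarrow> ('a \<Rightarrow> real) \<Rightarrow> 'a \<Rightarrow> real" where
  "step n f x = (\<Sum>b\<in>cells n. f b * ind n b x)"

lemma step_L2: "step n f \<in> L2_functions M"
  unfolding step_def[abs_def] by (intro L2_functions_sum ind_L2)

lemma step_cell: "b \<in> cells n \<Longrightarrow> x \<in> cell n b \<Longrightarrow> step n f x = f b"
proof -
  assume b: "b \<in> cells n" "x \<in> cell n b"
  have "step n f x = (\<Sum>c\<in>{b}. f c * ind n c x)"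
    unfolding step_def using b by (intro sum.mono_neutral_right) (auto simp: ind_def cell_def)
  then show ?thesis using b by (simp add: ind_def)
qed

lemma step_outside: "x \<notin> (\<Union>b\<in>cells n. cell n b) \<Longrightarrow> step n f x = 0"
  unfolding step_def by (intro sum.neutral) (auto simp: ind_def)

lemma integral_ind: "b \<in> cells n \<Longrightarrow> (LINT x|M. ind n b x) = cmu n b" "b \<in> cells n \<Longrightarrow> integrable M (ind n b)"
  using cell_fmeasurable[of b n] by (simp_all add: ind_def cmu_def fmeasurable_def sets.sets_into_space Int_absorb2)

lemma step_square: "(step n f x)\<^sup>2 = step n (\<lambda>b. (f b)\<^sup>2) x"
  by (cases "x \<in> (\<Union>b\<in>cells n. cell n b)") (auto simp: step_cell step_outside)

lemma step_integral: "(LINT x|M. step n f x) = (\<Sum>b\<in>cells n. f b * cmu n b)"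
  unfolding step_def using integral_ind by (subst Bochner_Integration.integral_sum) auto

lemma step_L2_norm: "L2_norm_of M (step n f) = sqrt (\<Sum>b\<in>cells n. (f b)\<^sup>2 * cmu n b)"
  by (simp add: L2_norm_of_def step_square step_integral)

end

locale cz_grid = dyadic_grid + cz_operator
begin

text \<open>Compares a cube with balls whose radius is at least the separation distance, about
  points of it or of a neighbour (\<open>ball_region\<close>). Like \<open>Dt\<close>, none of the
  constants here involves \<open>x0\<close> or \<open>L\<close>.\<close>

definition c1 :: real where "c1 = dc (\<kappa> * (\<kappa> * (2 * \<kappa> + 8 * \<kappa> ^ 3) + 2 * \<kappa>) / (4 * \<kappa> * del))"
definition S0 :: real where "S0 = CK * c1"
text \<open>The first summand is for displacements of at most \<open>\<eta>\<close> times the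
  distance, where smoothness applies; the second is for larger ones, where the size bound is used
  for both values (\<open>smooth_combine\<close>).\<close>

definition S1 :: real where "S1 = c1 * (\<kappa> / del) powr \<eta> + 2 * S0 * (\<kappa> / (\<eta> * del)) powr \<eta>"
text \<open>One generation shrinks displacements by \<open>del\<close>, hence differences of the
  kernel by \<open>del powr \<eta>\<close>.\<close>

definition th :: real where "th = del powr \<eta>"
definition Cst :: real where "Cst = S0 + 2 * S1 + A + 1"

lemma c1_pos: "0 < c1" by (simp add: c1_def dc_pos)
lemma S0_nonneg: "0 \<le> S0" using CK c1_pos by (simp add: S0_def)
lemma S1_nonneg: "0 \<le> S1" using S0_nonneg c1_pos by (simp add: S1_def)
lemma th: "0 < th" "th < 1"
  using del eta powr_less_mono2[of \<eta> del 1] by (auto simp: th_def)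

lemma th_power: "(c * del ^ j) powr \<eta> = c powr \<eta> * th ^ j" if "0 \<le> c"
  using that del by (simp add: powr_mult th_def powr_realpow[symmetric] powr_powr mult.commute)

text \<open>Otherwise the two centres would be within (2 \<kappa>^2 + 6 \<kappa>^3)
  \<open>el m\<close> of each other, which is at most the neighbour radius.\<close>

lemma far:
  assumes a: "a \<in> cells n" "b \<in> cells n" "m \<le> n" "\<not> gnr n m a b" and x: "x \<in> cell n a" and y: "y \<in> cell n b"
  shows "4 * \<kappa> * el m \<le> \<rho> x y"
proof -
  have X: "x \<in> X" "y \<in> X" using x y cell_X by auto
  have Px: "Pr n m x = Pr n m a" "Pr n m y = Pr n m b" using cell_Pr a x y by auto
  have PX: "Pr n m x \<in> X" "Pr n m y \<in> X" using Pr_X[OF a(3)] X by auto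
  have d: "\<rho> (Pr n m x) x < 2 * \<kappa> * el m" "\<rho> y (Pr n m y) < 2 * \<kappa> * el m"
    using Pr_dist[OF a(3) X(1)] Pr_dist[OF a(3) X(2)] rho_sym X PX by auto
  show ?thesis
  proof (rule ccontr)
    assume "\<not> ?thesis"
    then have "\<rho> x y < 4 * \<kappa> * el m" by simp
    then have 1: "\<rho> x (Pr n m y) < \<kappa> * (4 * \<kappa> * el m + 2 * \<kappa> * el m)"
      using d(2) by (rule rho_tri_less[rotated 3]) (use X PX in auto)
    have "\<rho> (Pr n m x) (Pr n m y) < \<kappa> * (2 * \<kappa> * el m + \<kappa> * (4 * \<kappa> * el m + 2 * \<kappa> * el m))"
      using d(1) 1 by (rule rho_tri_less[rotated 3]) (use X PX in auto)
    also have "\<dots> = (2 * \<kappa>\<^sup>2 + 6 * \<kappa> ^ 3) * el m"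
      by (simp add: power2_eq_square power3_eq_cube algebra_simps)
    also have "\<dots> \<le> 8 * \<kappa> ^ 3 * el m"
      using kappa_powers el_pos[of m] by (intro mult_right_mono) auto
    finally show False using a(4) Px by (simp add: gnr_def)
  qed
qed

text \<open>The hypothesis on \<open>z\<close> admits points of the cube and of its neighbours
  (\<open>near_center\<close>), so that both variables of the kernel can serve as the centre of the
  ball.\<close>

lemma ball_region:
  assumes "m \<le> n" "a \<in> cells n" "z \<in> X" "\<rho> z (Pr n m a) \<le> \<kappa> * (2 * \<kappa> + 8 * \<kappa> ^ 3) * el m" "4 * \<kappa> * (del * el m) \<le> d"
  shows "1 / measure M (B z d) \<le> c1 / measure M (region n m a)"
proof -
  have P: "Pr n m a \<in> X" using Pr_X assms cells_X by auto
  have "measure M (region n m a) \<le> measure M (B (Pr n m a) (2 * \<kappa> * el m))"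
    using region_mono_measure assms by simp
  also have "\<dots> \<le> c1 * measure M (B z (4 * \<kappa> * del * el m))"
    unfolding c1_def using assms P el_pos kappa_pos del by (intro B_compare) auto
  also have "\<dots> \<le> c1 * measure M (B z d)"
    using assms c1_pos by (intro mult_left_mono measure_mono_fmeasurable B_mono B_fmeasurable B_sets) auto
  finally have "measure M (region n m a) \<le> c1 * measure M (B z d)" .
  moreover have "0 < 4 * \<kappa> * (del * el m)" using kappa_pos del el_pos by simp
  then have "0 < measure M (B z d)" using assms by (intro B_pos) auto
  ultimately show ?thesis using region_pos[OF assms(1,2)] by (simp add: field_simps)
qed

lemma near_center:
  assumes "m \<le> n" "a \<in> cells n" "b \<in> cells n" "gnr n m a b"
  shows "x \<in> cell n a \<Longrightarrow> \<rho> x (Pr n m a) \<le> \<kappa> * (2 * \<kappa> + 8 * \<kappa> ^ 3) * el m"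
    and "y \<in> cell n b \<Longrightarrow> \<rho> y (Pr n m a) \<le> \<kappa> * (2 * \<kappa> + 8 * \<kappa> ^ 3) * el m"
proof -
  have P: "Pr n m a \<in> X" "Pr n m b \<in> X" using Pr_X assms cells_X by auto
  {
    assume x: "x \<in> cell n a"
    then have xX: "x \<in> X" using cell_X by blast
    have "\<rho> x (Pr n m a) < 2 * \<kappa> * el m" using Pr_dist[OF assms(1) xX] cell_Pr[OF assms(2) x assms(1)] by simp
    also have "\<dots> \<le> \<kappa> * (2 * \<kappa> + 8 * \<kappa> ^ 3) * el m"
    proof (intro mult_right_mono)
      have "2 * \<kappa> \<le> 1 * (2 * \<kappa> + 8 * \<kappa> ^ 3)" using kappa_pos by simp
      also have "\<dots> \<le> \<kappa> * (2 * \<kappa> + 8 * \<kappa> ^ 3)"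
        using kappa_ge_1 kappa_pos by (intro mult_right_mono) auto
      finally show "2 * \<kappa> \<le> \<kappa> * (2 * \<kappa> + 8 * \<kappa> ^ 3)" .
    qed (use el_pos[of m] in simp)
    finally show "\<rho> x (Pr n m a) \<le> \<kappa> * (2 * \<kappa> + 8 * \<kappa> ^ 3) * el m" by simp
  next
    assume y: "y \<in> cell n b"
    then have yX: "y \<in> X" using cell_X by blast
    have 1: "\<rho> y (Pr n m b) < 2 * \<kappa> * el m" using Pr_dist[OF assms(1) yX] cell_Pr[OF assms(3) y assms(1)] by simp
    have 2: "\<rho> (Pr n m b) (Pr n m a) < 8 * \<kappa> ^ 3 * el m" using assms(4) rho_sym[OF P] by (simp add: gnr_def)
    have "\<rho> y (Pr n m a) < \<kappa> * (2 * \<kappa> * el m + 8 * \<kappa> ^ 3 * el m)"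
      using 1 2 by (rule rho_tri_less[rotated 3]) (use P yX in auto)
    also have "\<dots> = \<kappa> * (2 * \<kappa> + 8 * \<kappa> ^ 3) * el m" by (simp add: algebra_simps)
    finally show "\<rho> y (Pr n m a) \<le> \<kappa> * (2 * \<kappa> + 8 * \<kappa> ^ 3) * el m" by simp
  }
qed

definition sep :: "nat \<Rightarrow> nat \<Rightarrow> 'a \<Rightarrow> 'a \<Rightarrow> bool" where
  "sep n m a b \<longleftrightarrow> a \<in> cells n \<and> b \<in> cells n \<and> m < n \<and> gnr n m a b \<and> \<not> gnr n (Suc m) a b"

lemma sep_far:
  assumes "sep n m a b" "x \<in> cell n a" "y \<in> cell n b"
  shows "4 * \<kappa> * (del * el m) \<le> \<rho> x y" "x \<noteq> y" "x \<in> X" "y \<in> X" "0 < \<rho> x y"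
proof -
  show 1: "4 * \<kappa> * (del * el m) \<le> \<rho> x y"
    using far[of a n b "Suc m" x y] assms by (simp add: sep_def el_Suc)
  show X: "x \<in> X" "y \<in> X" using assms cell_X by auto
  have "0 < 4 * \<kappa> * (del * el m)" using kappa_pos del el_pos by simp
  then show "0 < \<rho> x y" using 1 by linarith
  then show "x \<noteq> y" using rho_self X by auto
qed

lemma K_cell_size:
  assumes s: "sep n m a b" and x: "x \<in> cell n a" and y: "y \<in> cell n b"
  shows "\<bar>K x y\<bar> \<le> S0 / measure M (region n m a)"
proof -
  note f = sep_far[OF s x y]
  have s': "a \<in> cells n" "b \<in> cells n" "m \<le> n" "gnr n m a b" using s by (auto simp: sep_def)
  have "\<bar>K x y\<bar> \<le> CK * (1 / measure M (B x (\<rho> x y)))" using K_size[OF f(3,4,2)] by simp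
  also have "\<dots> \<le> CK * (c1 / measure M (region n m a))"
    using ball_region[OF s'(3,1) f(3) near_center(1)[OF s'(3,1,2,4) x] f(1)] CK by (intro mult_left_mono)
  finally show ?thesis by (simp add: S0_def)
qed

lemma smooth_numeric:
  assumes i: "m < i" and d: "4 * \<kappa> * (del * el m) \<le> d" and t: "0 \<le> t" "t < 4 * \<kappa>\<^sup>2 * el i"
  shows "(t / d) powr \<eta> \<le> (\<kappa> / del) powr \<eta> * th ^ (i - m)"
    and "\<eta> * d < t \<Longrightarrow> 1 \<le> (\<kappa> / (\<eta> * del)) powr \<eta> * th ^ (i - m)"
proof -
  have d0: "0 < 4 * \<kappa> * (del * el m)" using kappa_pos del el_pos by simp
  have el: "el i = el m * del ^ (i - m)"
    using i by (simp add: el_def power_add[symmetric])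
  have td: "t / d \<le> \<kappa> / del * del ^ (i - m)"
  proof -
    have "t / d \<le> 4 * \<kappa>\<^sup>2 * el i / (4 * \<kappa> * (del * el m))"
      using t d d0 el_pos[of i] by (intro frac_le) auto
    also have "\<dots> = \<kappa> / del * del ^ (i - m)"
      using kappa_pos del el_pos[of m] by (simp add: el power2_eq_square)
    finally show ?thesis .
  qed
  have td0: "0 \<le> t / d" using t d d0 by simp
  have "(t / d) powr \<eta> \<le> (\<kappa> / del * del ^ (i - m)) powr \<eta>"
    using td td0 eta by (intro powr_mono2) auto
  also have "\<dots> = (\<kappa> / del) powr \<eta> * th ^ (i - m)" using kappa_pos del by (intro th_power) auto
  finally show "(t / d) powr \<eta> \<le> (\<kappa> / del) powr \<eta> * th ^ (i - m)" .
  assume big: "\<eta> * d < t"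
  have "\<eta> < t / d" using big d d0 by (simp add: less_divide_eq)
  then have "1 \<le> (t / d) / \<eta>" using eta unfolding le_divide_eq_1_pos[OF eta] by simp
  also have "\<dots> \<le> \<kappa> / del * del ^ (i - m) / \<eta>" using td eta by (intro divide_right_mono) auto
  finally have "1 \<le> \<kappa> / (\<eta> * del) * del ^ (i - m)" by (simp add: field_simps)
  then have "1 powr \<eta> \<le> (\<kappa> / (\<eta> * del) * del ^ (i - m)) powr \<eta>"
    using eta by (intro powr_mono2) auto
  also have "\<dots> = (\<kappa> / (\<eta> * del)) powr \<eta> * th ^ (i - m)" using kappa_pos del eta by (intro th_power) auto
  finally show "1 \<le> (\<kappa> / (\<eta> * del)) powr \<eta> * th ^ (i - m)" by simp
qed

lemma same_cube_dist:
  assumes "i \<le> n" "b \<in> cells n" "b' \<in> cells n" "Pr n i b = Pr n i b'" "y \<in> cell n b" "y' \<in> cell n b'"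
  shows "\<rho> y y' < 4 * \<kappa>\<^sup>2 * el i"
proof -
  have X: "y \<in> X" "y' \<in> X" using assms cell_X by auto
  have P: "Pr n i y = Pr n i y'" "Pr n i y \<in> X"
    using cell_Pr[OF assms(2,5,1)] cell_Pr[OF assms(3,6,1)] assms(4) Pr_X[OF assms(1) X(1)] by auto
  have "\<rho> y y' < \<kappa> * (2 * \<kappa> * el i + 2 * \<kappa> * el i)"
    using Pr_dist[OF assms(1) X(1)] Pr_dist[OF assms(1) X(2)] rho_sym[OF X(2) P(2)] P X
    by (intro rho_tri_less[of y "Pr n i y" y']) auto
  then show ?thesis by (simp add: power2_eq_square algebra_simps)
qed

text \<open>The smoothness condition is available only for displacements up to
  \<open>\<eta> * d\<close>. A larger displacement inside a cube of level \<open>i\<close> forces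
  \<open>i - m\<close> to be bounded, so \<open>th ^ (i - m)\<close> is bounded below and the size
  estimate is good enough.\<close>

lemma smooth_combine:
  assumes m: "m < i" and reg: "0 < R"
    and small: "t \<le> \<eta> * d \<Longrightarrow> e \<le> (t / d) powr \<eta> * (1 / v)" and v: "0 < v" "1 / v \<le> c1 / R"
    and d: "4 * \<kappa> * (del * el m) \<le> d" and t: "0 \<le> t" "t < 4 * \<kappa>\<^sup>2 * el i" and size: "e \<le> S0 / R + S0 / R"
  shows "e \<le> S1 * th ^ (i - m) / R"
proof (cases "t \<le> \<eta> * d")
  case True
  have "e \<le> (t / d) powr \<eta> * (1 / v)" using small True .
  also have "\<dots> \<le> ((\<kappa> / del) powr \<eta> * th ^ (i - m)) * (c1 / R)"
    using smooth_numeric(1)[OF m d t] v th by (intro mult_mono) auto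
  also have "\<dots> = c1 * (\<kappa> / del) powr \<eta> * th ^ (i - m) / R" by simp
  also have "\<dots> \<le> S1 * th ^ (i - m) / R"
    using reg th S0_nonneg by (intro divide_right_mono mult_right_mono) (auto simp: S1_def)
  finally show ?thesis .
next
  case False
  then have 1: "1 \<le> (\<kappa> / (\<eta> * del)) powr \<eta> * th ^ (i - m)" using smooth_numeric(2)[OF m d t] by simp
  have "e \<le> 2 * S0 / R * 1" using size by simp
  also have "\<dots> \<le> 2 * S0 / R * ((\<kappa> / (\<eta> * del)) powr \<eta> * th ^ (i - m))"
    using 1 S0_nonneg reg by (intro mult_left_mono) auto
  also have "\<dots> = 2 * S0 * (\<kappa> / (\<eta> * del)) powr \<eta> * th ^ (i - m) / R" by simp
  also have "\<dots> \<le> S1 * th ^ (i - m) / R"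
    using reg th c1_pos by (intro divide_right_mono mult_right_mono) (auto simp: S1_def)
  finally show ?thesis .
qed

lemma sep_cong:
  assumes "sep n m a b" "m < i" "i \<le> n"
  shows "b' \<in> cells n \<Longrightarrow> Pr n i b = Pr n i b' \<Longrightarrow> sep n m a b'"
    and "a' \<in> cells n \<Longrightarrow> Pr n i a = Pr n i a' \<Longrightarrow> sep n m a' b \<and> region n m a' = region n m a"
proof -
  show "sep n m a b'" if b: "b' \<in> cells n" "Pr n i b = Pr n i b'"
    using assms b Pr_anc[OF assms(3), of m b b'] Pr_anc[OF assms(3), of "Suc m" b b'] by (simp add: sep_def gnr_def)
  show "sep n m a' b \<and> region n m a' = region n m a" if a: "a' \<in> cells n" "Pr n i a = Pr n i a'"
    using assms a Pr_anc[OF assms(3), of m a a'] Pr_anc[OF assms(3), of "Suc m" a a']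
    by (simp add: sep_def gnr_def region_def)
qed

lemma K_cell_smooth2:
  assumes s: "sep n m a b" and i: "m < i" "i \<le> n" and b': "b' \<in> cells n" "Pr n i b = Pr n i b'"
    and x: "x \<in> cell n a" and y: "y \<in> cell n b" "y' \<in> cell n b'"
  shows "\<bar>K x y' - K x y\<bar> \<le> S1 * th ^ (i - m) / measure M (region n m a)"
proof -
  have s': "a \<in> cells n" "b \<in> cells n" "m \<le> n" "gnr n m a b" using s by (auto simp: sep_def)
  note f = sep_far[OF s x y(1)] and f' = sep_far[OF sep_cong(1)[OF s i b'] x y(2)]
  show ?thesis
  proof (rule smooth_combine[where t = "\<rho> y' y" and d = "\<rho> y x" and v = "measure M (B y (\<rho> y x))"])
    show "m < i" by fact
    show "0 < measure M (region n m a)" using region_pos s' by blast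
    show "\<bar>K x y' - K x y\<bar> \<le> (\<rho> y' y / \<rho> y x) powr \<eta> * (1 / measure M (B y (\<rho> y x)))" if "\<rho> y' y \<le> \<eta> * \<rho> y x"
      using K_smooth2[OF f(4,3) f'(4)] f(2) f'(2) that rho_sym[OF f(4) f'(4)] by auto
    show "0 < measure M (B y (\<rho> y x))" using f rho_sym[OF f(3,4)] by (intro B_pos) auto
    show "1 / measure M (B y (\<rho> y x)) \<le> c1 / measure M (region n m a)"
      using ball_region[OF s'(3,1) f(4) near_center(2)[OF s'(3,1,2,4) y(1)]] f(1) rho_sym[OF f(3,4)] by simp
    show "4 * \<kappa> * (del * el m) \<le> \<rho> y x" using f(1) rho_sym[OF f(3,4)] by simp
    show "0 \<le> \<rho> y' y" using rho_nonneg f f' by blast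
    show "\<rho> y' y < 4 * \<kappa>\<^sup>2 * el i" using same_cube_dist[OF i(2) b'(1) s'(2) b'(2)[symmetric] y(2,1)] .
    show "\<bar>K x y' - K x y\<bar> \<le> S0 / measure M (region n m a) + S0 / measure M (region n m a)"
      using K_cell_size[OF s x y(1)] K_cell_size[OF sep_cong(1)[OF s i b'] x y(2)] by linarith
  qed
qed

lemma K_cell_smooth1:
  assumes s: "sep n m a b" and i: "m < i" "i \<le> n" and a': "a' \<in> cells n" "Pr n i a = Pr n i a'"
    and x: "x \<in> cell n a" "x' \<in> cell n a'" and y: "y \<in> cell n b"
  shows "\<bar>K x' y - K x y\<bar> \<le> S1 * th ^ (i - m) / measure M (region n m a)"
proof -
  have s': "a \<in> cells n" "b \<in> cells n" "m \<le> n" "gnr n m a b" using s by (auto simp: sep_def)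
  have sa': "sep n m a' b" "region n m a' = region n m a" using sep_cong(2)[OF s i a'] by auto
  note f = sep_far[OF s x(1) y] and f' = sep_far[OF sa'(1) x(2) y]
  show ?thesis
  proof (rule smooth_combine[where t = "\<rho> x' x" and d = "\<rho> x y" and v = "measure M (B x (\<rho> x y))"])
    show "m < i" by fact
    show "0 < measure M (region n m a)" using region_pos s' by blast
    show "\<bar>K x' y - K x y\<bar> \<le> (\<rho> x' x / \<rho> x y) powr \<eta> * (1 / measure M (B x (\<rho> x y)))" if "\<rho> x' x \<le> \<eta> * \<rho> x y"
      using K_smooth1[OF f(3,4) f'(3) f(2) f'(2)] that rho_sym[OF f(3) f'(3)] by auto
    show "0 < measure M (B x (\<rho> x y))" using f by (intro B_pos) auto
    show "1 / measure M (B x (\<rho> x y)) \<le> c1 / measure M (region n m a)"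
      using ball_region[OF s'(3,1) f(3) near_center(1)[OF s'(3,1,2,4) x(1)]] f(1) by simp
    show "4 * \<kappa> * (del * el m) \<le> \<rho> x y" using f(1) .
    show "0 \<le> \<rho> x' x" using rho_nonneg f f' by blast
    show "\<rho> x' x < 4 * \<kappa>\<^sup>2 * el i" using same_cube_dist[OF i(2) a'(1) s'(1) a'(2)[symmetric] x(2,1)] .
    show "\<bar>K x' y - K x y\<bar> \<le> S0 / measure M (region n m a) + S0 / measure M (region n m a)"
      using K_cell_size[OF s x(1) y] K_cell_size[OF sa'(1) x(2) y] sa'(2) by simp
  qed
qed

lemma K_cell_integrable:
  assumes s: "sep n m a b" and x: "x \<in> cell n a"
  shows "integrable M (\<lambda>y. K x y * indicator (cell n b) y)"
proof (rule Bochner_Integration.integrable_bound[where f = "\<lambda>y. S0 / measure M (region n m a) * indicator (cell n b) y"])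
  have b: "b \<in> cells n" using s by (simp add: sep_def)
  show "integrable M (\<lambda>y. S0 / measure M (region n m a) * indicator (cell n b) y)"
    using cell_fmeasurable[OF b] by (intro integrable_mult_right integrable_real_indicator) (auto simp: fmeasurable_def)
  have xX: "x \<in> X" using x cell_X by blast
  have "(\<lambda>y. (if y = x then 0 else K x y) * indicator (cell n b) y :: real) \<in> borel_measurable M"
    using K_measurable[OF xX] by (intro borel_measurable_times borel_measurable_indicator cell_sets)
  also have "(\<lambda>y. (if y = x then 0 else K x y) * indicator (cell n b) y) = (\<lambda>y. K x y * indicator (cell n b) y)"
    using sep_far(2)[OF s x] by (intro ext) (auto simp: indicator_def)
  finally show "(\<lambda>y. K x y * indicator (cell n b) y) \<in> borel_measurable M" .
  show "AE y in M. norm (K x y * indicator (cell n b) y) \<le> norm (S0 / measure M (region n m a) * indicator (cell n b) y)"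
    using K_cell_size[OF s x] S0_nonneg by (intro AE_I2) (auto simp: indicator_def)
qed

definition kavg :: "nat \<Rightarrow> 'a \<Rightarrow> 'a \<Rightarrow> real" where
  "kavg n x b = (LINT y|M. K x y * indicator (cell n b) y) / measure M (cell n b)"

text \<open>Separated cells have a positive distance, so the whole first cell avoids the essential
  support of the indicator of the second.\<close>

lemma T_cell_kernel:
  assumes s: "sep n m a b"
  shows "AE x in M. x \<in> cell n a \<longrightarrow> T (ind n b) x / cmu n b = kavg n x b"
proof -
  have b: "b \<in> cells n" using s by (simp add: sep_def)
  have ns: "x \<notin> ess_support M \<rho> (ind n b)" if x: "x \<in> cell n a" for x
  proof -
    let ?r = "4 * \<kappa> * (del * el m)"
    have "0 < ?r" using kappa_pos del el_pos by simp
    moreover have "AE y in M. y \<in> B x ?r \<longrightarrow> ind n b y = 0"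
      using sep_far(1)[OF s x] by (intro AE_I2) (force simp: ind_def indicator_def qball_def)
    ultimately show ?thesis unfolding ess_support_def by blast
  qed
  show ?thesis
    using T_kernel[OF ind_L2[OF b]]
  proof eventually_elim
    case (elim x)
    then show ?case using ns by (auto simp: kavg_def cmu_def ind_def)
  qed
qed

text \<open>Defined through \<open>T\<close> rather than as a double average of \<open>K\<close>,
  which makes it meaningful also for neighbouring cells, where \<open>K\<close> need not be
  integrable.\<close>

definition tau :: "nat \<Rightarrow> 'a \<Rightarrow> 'a \<Rightarrow> real" where
  "tau n a b = (LINT x|M. T (ind n b) x * indicator (cell n a) x) / (cmu n a * cmu n b)"

lemma T_ind_integrable: "a \<in> cells n \<Longrightarrow> b \<in> cells n \<Longrightarrow> integrable M (\<lambda>x. T (ind n b) x * indicator (cell n a) x)"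
  using L2_functions_mult_integrable[OF T_L2[OF ind_L2] ind_L2] by (simp add: ind_def)

lemma tau_average:
  assumes ab: "a \<in> cells n" "b \<in> cells n" and le: "AE x in M. x \<in> cell n a \<longrightarrow> \<bar>T (ind n b) x / cmu n b - c\<bar> \<le> e"
  shows "\<bar>tau n a b - c\<bar> \<le> e"
proof -
  have "integrable M (\<lambda>x. (T (ind n b) x / cmu n b) * indicator (cell n a) x)"
    using integrable_divide[OF T_ind_integrable[OF ab], of "cmu n b"] by simp
  from average_approx[OF cell_fmeasurable[OF ab(1)] cell_meas_pos[OF ab(1)] this le]
  show ?thesis by (simp add: tau_def cmu_def mult.commute)
qed

lemma tau_size':
  assumes s: "sep n m a b"
  shows "\<bar>tau n a b\<bar> \<le> S0 / measure M (region n m a)"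
proof -
  have ab: "a \<in> cells n" "b \<in> cells n" using s by (auto simp: sep_def)
  have "\<bar>tau n a b - 0\<bar> \<le> S0 / measure M (region n m a)"
  proof (rule tau_average[OF ab])
    show "AE x in M. x \<in> cell n a \<longrightarrow> \<bar>T (ind n b) x / cmu n b - 0\<bar> \<le> S0 / measure M (region n m a)"
      using T_cell_kernel[OF s]
    proof eventually_elim
      case (elim x)
      show ?case
      proof
        assume x: "x \<in> cell n a"
        have "\<bar>kavg n x b - 0\<bar> \<le> S0 / measure M (region n m a)"
          unfolding kavg_def using K_cell_size[OF s x]
          by (intro average_approx cell_fmeasurable cell_meas_pos ab K_cell_integrable[OF s x] AE_I2) auto
        then show "\<bar>T (ind n b) x / cmu n b - 0\<bar> \<le> S0 / measure M (region n m a)" using elim x by simp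
      qed
    qed
  qed
  then show ?thesis by simp
qed

lemma tau_smooth1':
  assumes s: "sep n m a b" and i: "m < i" "i \<le> n" and a': "a' \<in> cells n" "Pr n i a = Pr n i a'"
  shows "\<bar>tau n a b - tau n a' b\<bar> \<le> 2 * S1 * th ^ (i - m) / measure M (region n m a)"
proof -
  define e where "e = S1 * th ^ (i - m) / measure M (region n m a)"
  have ab: "a \<in> cells n" "b \<in> cells n" using s by (auto simp: sep_def)
  note aa = cell_self[OF ab(1)]
  have main: "\<bar>tau n c b - kavg n a b\<bar> \<le> e" if c: "c \<in> cells n" "Pr n i a = Pr n i c" for c
  proof (rule tau_average[OF c(1) ab(2)])
    have sc: "sep n m c b" using sep_cong(2)[OF s i c] by simp
    show "AE x in M. x \<in> cell n c \<longrightarrow> \<bar>T (ind n b) x / cmu n b - kavg n a b\<bar> \<le> e"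
      using T_cell_kernel[OF sc]
    proof eventually_elim
      case (elim x)
      show ?case
      proof
        assume x: "x \<in> cell n c"
        have int: "integrable M (\<lambda>y. (K x y - K a y) * indicator (cell n b) y)"
          using Bochner_Integration.integrable_diff[OF K_cell_integrable[OF sc x] K_cell_integrable[OF s aa]]
          by (simp add: left_diff_distrib)
        have "\<bar>(LINT y|M. (K x y - K a y) * indicator (cell n b) y) / measure M (cell n b) - 0\<bar> \<le> e"
          unfolding e_def using K_cell_smooth1[OF s i c aa x]
          by (intro average_approx cell_fmeasurable cell_meas_pos ab int AE_I2) auto
        also have "(LINT y|M. (K x y - K a y) * indicator (cell n b) y) / measure M (cell n b) - 0 = kavg n x b - kavg n a b"
          using Bochner_Integration.integral_diff[OF K_cell_integrable[OF sc x] K_cell_integrable[OF s aa]]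
          by (simp add: left_diff_distrib kavg_def diff_divide_distrib)
        finally show "\<bar>T (ind n b) x / cmu n b - kavg n a b\<bar> \<le> e" using elim x by simp
      qed
    qed
  qed
  have "\<bar>tau n a b - tau n a' b\<bar> \<le> e + e" using main[OF ab(1) refl] main[OF a'] by linarith
  then show ?thesis by (simp add: e_def)
qed

text \<open>Unlike in \<open>tau_smooth1'\<close>, the common reference value \<open>K x b\<close>
  varies with \<open>x\<close>, so the averages over the cells of \<open>b\<close> and
  \<open>b'\<close> are compared for each \<open>x\<close> before averaging over the first
  cell.\<close>

lemma tau_smooth2':
  assumes s: "sep n m a b" and i: "m < i" "i \<le> n" and b': "b' \<in> cells n" "Pr n i b = Pr n i b'"
  shows "\<bar>tau n a b - tau n a b'\<bar> \<le> 2 * S1 * th ^ (i - m) / measure M (region n m a)"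
proof -
  define e where "e = S1 * th ^ (i - m) / measure M (region n m a)"
  have ab: "a \<in> cells n" "b \<in> cells n" using s by (auto simp: sep_def)
  note s' = sep_cong(1)[OF s i b']
  have kav: "\<bar>kavg n x c - K x b\<bar> \<le> e" if c: "c \<in> cells n" "Pr n i b = Pr n i c" and x: "x \<in> cell n a" for x c
    unfolding kavg_def e_def using K_cell_smooth2[OF s i c x cell_self[OF ab(2)]]
    by (intro average_approx cell_fmeasurable cell_meas_pos c(1) K_cell_integrable[OF sep_cong(1)[OF s i c] x] AE_I2) auto
  have int: "integrable M (\<lambda>x. (T (ind n b) x / cmu n b - T (ind n b') x / cmu n b') * indicator (cell n a) x)"
    using Bochner_Integration.integrable_diff[OF integrable_divide[OF T_ind_integrable[OF ab(1,2)], of "cmu n b"]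
        integrable_divide[OF T_ind_integrable[OF ab(1) b'(1)], of "cmu n b'"]]
    by (simp add: left_diff_distrib)
  have "\<bar>(LINT x|M. (T (ind n b) x / cmu n b - T (ind n b') x / cmu n b') * indicator (cell n a) x) / measure M (cell n a) - 0\<bar> \<le> 2 * e"
  proof (rule average_approx[OF cell_fmeasurable[OF ab(1)] cell_meas_pos[OF ab(1)] int])
    show "AE x in M. x \<in> cell n a \<longrightarrow> \<bar>T (ind n b) x / cmu n b - T (ind n b') x / cmu n b' - 0\<bar> \<le> 2 * e"
      using T_cell_kernel[OF s] T_cell_kernel[OF s']
    proof eventually_elim
      case (elim x)
      show ?case
      proof
        assume x: "x \<in> cell n a"
        show "\<bar>T (ind n b) x / cmu n b - T (ind n b') x / cmu n b' - 0\<bar> \<le> 2 * e"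
          using kav[OF ab(2) refl x] kav[OF b' x] elim x by simp
      qed
    qed
  qed
  also have "(LINT x|M. (T (ind n b) x / cmu n b - T (ind n b') x / cmu n b') * indicator (cell n a) x) / measure M (cell n a) - 0
     = tau n a b - tau n a b'"
  proof -
    have "(\<lambda>x. (T (ind n b) x / cmu n b - T (ind n b') x / cmu n b') * indicator (cell n a) x)
      = (\<lambda>x. T (ind n b) x * indicator (cell n a) x / cmu n b - T (ind n b') x * indicator (cell n a) x / cmu n b')"
      by (rule ext) (simp add: left_diff_distrib)
    then have "(LINT x|M. (T (ind n b) x / cmu n b - T (ind n b') x / cmu n b') * indicator (cell n a) x)
      = (LINT x|M. T (ind n b) x * indicator (cell n a) x) / cmu n b - (LINT x|M. T (ind n b') x * indicator (cell n a) x) / cmu n b'"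
      using Bochner_Integration.integral_diff[OF integrable_divide[OF T_ind_integrable[OF ab(1,2)], of "cmu n b"]
        integrable_divide[OF T_ind_integrable[OF ab(1) b'(1)], of "cmu n b'"]]
      by (simp only: integral_divide_zero)
    then show ?thesis by (simp add: tau_def cmu_def diff_divide_distrib mult.commute)
  qed
  finally show ?thesis by (simp add: e_def)
qed

lemma T_sum:
  assumes "finite I" "\<And>i. i \<in> I \<Longrightarrow> f i \<in> L2_functions M"
  shows "AE x in M. T (\<lambda>y. \<Sum>i\<in>I. c i * f i y) x = (\<Sum>i\<in>I. c i * T (f i) x)"
  using assms
proof (induction I rule: finite_induct)
  case empty
  \<comment> \<open>Linearity with zero coefficients shows that \<open>T\<close> maps 0 to 0 almost
    everywhere.\<close>
  have "AE x in M. T (\<lambda>y. 0 * 0 + 0 * 0) x = 0 * T (\<lambda>y. 0) x + 0 * T (\<lambda>y. 0) x"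
    by (rule T_linear[of "\<lambda>y. 0" "\<lambda>y. 0" 0 0]) (simp_all add: L2_functions_zero)
  then show ?case by simp
next
  case (insert i I)
  have "AE x in M. T (\<lambda>y. c i * f i y + 1 * (\<Sum>i\<in>I. c i * f i y)) x = c i * T (f i) x + 1 * T (\<lambda>y. \<Sum>i\<in>I. c i * f i y) x"
    using insert by (intro T_linear L2_functions_sum) auto
  moreover have "AE x in M. T (\<lambda>y. \<Sum>i\<in>I. c i * f i y) x = (\<Sum>i\<in>I. c i * T (f i) x)"
    using insert by auto
  ultimately show ?case
  proof eventually_elim
    case (elim x) then show ?case using insert by simp
  qed
qed

lemma form_tau:
  "(\<Sum>a\<in>cells n. \<Sum>b\<in>cells n. v a * f b * cmu n a * cmu n b * tau n a b) = (LINT x|M. T (step n f) x * step n v x)"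
proof -
  have "(LINT x|M. T (step n f) x * step n v x) = (LINT x|M. (\<Sum>a\<in>cells n. \<Sum>b\<in>cells n. v a * f b * (T (ind n b) x * indicator (cell n a) x)))"
  proof (rule integral_cong_AE)
    show "(\<lambda>x. T (step n f) x * step n v x) \<in> borel_measurable M"
      by (intro borel_measurable_times L2_functions_measurable T_L2 step_L2)
    show "(\<lambda>x. \<Sum>a\<in>cells n. \<Sum>b\<in>cells n. v a * f b * (T (ind n b) x * indicator (cell n a) x)) \<in> borel_measurable M"
      by (intro borel_measurable_sum borel_measurable_times borel_measurable_const borel_measurable_indicator cell_sets
          L2_functions_measurable[OF T_L2[OF ind_L2]])
    have "AE x in M. T (\<lambda>y. \<Sum>b\<in>cells n. f b * ind n b y) x = (\<Sum>b\<in>cells n. f b * T (ind n b) x)"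
      by (rule T_sum) (auto intro: ind_L2)
    then show "AE x in M. T (step n f) x * step n v x = (\<Sum>a\<in>cells n. \<Sum>b\<in>cells n. v a * f b * (T (ind n b) x * indicator (cell n a) x))"
    proof eventually_elim
      case (elim x)
      then have "T (step n f) x * step n v x = (\<Sum>a\<in>cells n. v a * ind n a x) * (\<Sum>b\<in>cells n. f b * T (ind n b) x)"
        unfolding step_def[of n v] step_def[of n f, abs_def] by (simp only: mult.commute)
      also have "\<dots> = (\<Sum>a\<in>cells n. \<Sum>b\<in>cells n. v a * f b * (T (ind n b) x * indicator (cell n a) x))"
        unfolding sum_product by (intro sum.cong refl) (simp add: ind_def)
      finally show ?case .
    qed
  qed
  also have "\<dots> = (\<Sum>a\<in>cells n. \<Sum>b\<in>cells n. v a * f b * (LINT x|M. T (ind n b) x * indicator (cell n a) x))"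
    using T_ind_integrable by (subst Bochner_Integration.integral_sum, auto)+
  also have "\<dots> = (\<Sum>a\<in>cells n. \<Sum>b\<in>cells n. v a * f b * cmu n a * cmu n b * tau n a b)"
    by (intro sum.cong refl) (use cmu_pos in \<open>force simp: tau_def\<close>)
  finally show ?thesis by simp
qed

lemma Cst_pos: "0 < Cst" using S0_nonneg S1_nonneg A_nonneg by (simp add: Cst_def)

lemma grid_cz_matrix: "cz_matrix (cells n) (cmu n) n (Pr n) (gnr n) Dt (tau n) Cst th"
proof -
  interpret t: cube_tree "cells n" "cmu n" n "Pr n" "gnr n" Dt by (rule grid_cube_tree)
  have reg: "(\<Sum>x\<in>{x\<in>cells n. Pr n m x = Pr n m a}. cmu n x) = measure M (region n m a)"
    if "m < n" "a \<in> cells n" for m a using sum_cmu_region that by simp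
  have Cs: "S0 \<le> Cst" "2 * S1 \<le> Cst" "A \<le> Cst" using S0_nonneg S1_nonneg A_nonneg by (auto simp: Cst_def)
  show ?thesis
  proof
    show "0 < Cst" "0 < th" "th < 1" using Cst_pos th by auto
    fix a b m assume ab: "a \<in> cells n" "b \<in> cells n" "m < n" "gnr n m a b" "\<not> gnr n (Suc m) a b"
    then have s: "sep n m a b" by (simp add: sep_def)
    show "\<bar>tau n a b\<bar> \<le> Cst / (\<Sum>x\<in>{x\<in>cells n. Pr n m x = Pr n m a}. cmu n x)"
      unfolding reg[OF ab(3,1)] using tau_size'[OF s] Cs(1) by (meson divide_right_mono measure_nonneg order_trans)
  next
    fix a a' b m i assume a: "a \<in> cells n" "a' \<in> cells n" "b \<in> cells n" "m < i" "i \<le> n" "gnr n m a b" "\<not> gnr n (Suc m) a b" "Pr n i a = Pr n i a'"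
    then have s: "sep n m a b" by (simp add: sep_def)
    have mn: "m < n" using a by simp
    have "2 * S1 * th ^ (i - m) / measure M (region n m a) \<le> Cst * th ^ (i - m) / measure M (region n m a)"
      using Cs th by (intro divide_right_mono mult_right_mono) auto
    then show "\<bar>tau n a b - tau n a' b\<bar> \<le> Cst * th ^ (i - m) / (\<Sum>x\<in>{x\<in>cells n. Pr n m x = Pr n m a}. cmu n x)"
      unfolding reg[OF mn a(1)] using tau_smooth1'[OF s a(4,5,2,8)] by linarith
  next
    fix a b b' m i assume a: "a \<in> cells n" "b \<in> cells n" "b' \<in> cells n" "m < i" "i \<le> n" "gnr n m a b" "\<not> gnr n (Suc m) a b" "Pr n i b = Pr n i b'"
    then have s: "sep n m a b" by (simp add: sep_def)
    have mn: "m < n" using a by simp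
    have "2 * S1 * th ^ (i - m) / measure M (region n m a) \<le> Cst * th ^ (i - m) / measure M (region n m a)"
      using Cs th by (intro divide_right_mono mult_right_mono) auto
    then show "\<bar>tau n a b - tau n a b'\<bar> \<le> Cst * th ^ (i - m) / (\<Sum>x\<in>{x\<in>cells n. Pr n m x = Pr n m a}. cmu n x)"
      unfolding reg[OF mn a(1)] using tau_smooth2'[OF s a(4,5,3,8)] by linarith
  next
    fix v f
    have "\<bar>LINT x|M. T (step n f) x * step n v x\<bar> \<le> L2_norm_of M (T (step n f)) * L2_norm_of M (step n v)"
      by (intro L2_Cauchy_Schwarz T_L2 step_L2)
    also have "\<dots> \<le> (Cst * L2_norm_of M (step n f)) * L2_norm_of M (step n v)"
      using order_trans[OF T_bounded[OF step_L2] mult_right_mono[OF Cs(3) L2_norm_nonneg]]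
      by (intro mult_right_mono L2_norm_nonneg)
    finally show "\<bar>\<Sum>a\<in>cells n. \<Sum>b\<in>cells n. v a * f b * cmu n a * cmu n b * tau n a b\<bar>
      \<le> Cst * sqrt (\<Sum>a\<in>cells n. (v a)\<^sup>2 * cmu n a) * sqrt (\<Sum>b\<in>cells n. (f b)\<^sup>2 * cmu n b)"
      unfolding form_tau by (simp add: step_L2_norm mult_ac)
  qed
qed

end

section \<open>Conditional expectations\<close>

lemma tendsto_zero_squeeze:
  fixes a b :: "nat \<Rightarrow> real"
  assumes "b \<longlonglongrightarrow> 0" "\<And>n. 0 \<le> a n" "\<And>n. a n \<le> b n"
  shows "a \<longlonglongrightarrow> 0"
  using tendsto_sandwich[of "\<lambda>_. 0" a sequentially b 0] assms by simp

context dyadic_grid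
begin

definition avg :: "nat \<Rightarrow> ('a \<Rightarrow> real) \<Rightarrow> 'a \<Rightarrow> real" where
  "avg n g a = (LINT x|M. g x * ind n a x) / cmu n a"

text \<open>The L^1 distance of \<open>g\<close> to its conditional expectation, on the union of the
  cells. The finest cells for different \<open>n\<close> come from unrelated nets and need not be
  nested, so they form no filtration and martingale convergence does not apply; the limit is proved
  directly.\<close>

definition osc :: "nat \<Rightarrow> ('a \<Rightarrow> real) \<Rightarrow> real" where
  "osc n g = (\<Sum>a\<in>cells n. LINT x|M. \<bar>avg n g a - g x\<bar> * ind n a x)"

definition BB :: "'a set" where "BB = B x0 (2 * \<kappa> * L)"

lemma BB: "BB \<in> fmeasurable M" "BB \<in> sets M" "BB \<subseteq> X"
  using B_fmeasurable[OF x0] B_sets[OF x0] B_sub by (simp_all add: BB_def)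

lemma cell_BB: "a \<in> cells n \<Longrightarrow> cell n a \<subseteq> BB"
  using cells_in_ball by (simp add: BB_def)

lemma ind_bounds: "0 \<le> ind n a x" "ind n a x \<le> 1" "\<bar>ind n a x\<bar> \<le> 1"
  by (simp_all add: ind_def indicator_def)

lemma integrable_mult_ind: "integrable M g \<Longrightarrow> integrable M (\<lambda>x. g x * ind n a x)"
  unfolding ind_def using integrable_real_mult_indicator[OF cell_sets] .

lemma sum_ind_le: "(\<Sum>a\<in>cells n. ind n a x) \<le> indicator BB x"
proof (cases "x \<in> (\<Union>b\<in>cells n. cell n b)")
  case True
  then obtain b where b: "b \<in> cells n" "x \<in> cell n b" by blast
  have "(\<Sum>a\<in>cells n. ind n a x) = step n (\<lambda>_. 1) x" by (simp add: step_def)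
  also have "\<dots> = 1" using step_cell[OF b] .
  finally show ?thesis using b cell_BB by (auto simp: indicator_def)
next
  case False
  have "(\<Sum>a\<in>cells n. ind n a x) = step n (\<lambda>_. 1) x" by (simp add: step_def)
  then show ?thesis using step_outside[OF False, of "\<lambda>_. 1"] by simp
qed

lemma sum_integral_ind_le:
  assumes g: "integrable M g" "\<And>x. 0 \<le> g x"
  shows "(\<Sum>a\<in>cells n. LINT x|M. g x * ind n a x) \<le> (LINT x|M. g x * indicator BB x)"
proof -
  have "(\<Sum>a\<in>cells n. LINT x|M. g x * ind n a x) = (LINT x|M. (\<Sum>a\<in>cells n. g x * ind n a x))"
    using integrable_mult_ind[OF g(1)] by (intro Bochner_Integration.integral_sum[symmetric])
  also have "\<dots> \<le> (LINT x|M. g x * indicator BB x)"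
  proof (rule integral_mono)
    show "integrable M (\<lambda>x. \<Sum>a\<in>cells n. g x * ind n a x)"
      using integrable_mult_ind[OF g(1)] by (intro Bochner_Integration.integrable_sum)
    show "integrable M (\<lambda>x. g x * indicator BB x)" using integrable_real_mult_indicator[OF BB(2) g(1)] .
    fix x show "(\<Sum>a\<in>cells n. g x * ind n a x) \<le> g x * indicator BB x"
      using mult_left_mono[OF sum_ind_le g(2)] by (simp add: sum_distrib_left)
  qed
  finally show ?thesis .
qed

lemma avg_abs_le: "\<bar>avg n g a\<bar> \<le> avg n (\<lambda>x. \<bar>g x\<bar>) a"
proof -
  have "\<bar>LINT x|M. g x * ind n a x\<bar> \<le> (LINT x|M. \<bar>g x * ind n a x\<bar>)" by (rule integral_abs_bound)
  also have "\<dots> = (LINT x|M. \<bar>g x\<bar> * ind n a x)" by (simp add: abs_mult ind_bounds)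
  finally show ?thesis unfolding avg_def abs_divide
    by (simp add: cmu_def divide_right_mono)
qed

lemma avg_cmu: "a \<in> cells n \<Longrightarrow> avg n g a * cmu n a = (LINT x|M. g x * ind n a x)"
  using cmu_pos[of a n] by (simp add: avg_def)

lemma osc_integrable: "integrable M g \<Longrightarrow> a \<in> cells n \<Longrightarrow> integrable M (\<lambda>x. \<bar>c - g x\<bar> * ind n a x)"
proof -
  assume g: "integrable M g" "a \<in> cells n"
  have "integrable M (\<lambda>x. c * ind n a x - g x * ind n a x)"
    using integral_ind(2)[OF g(2)] integrable_mult_ind[OF g(1)] by (intro Bochner_Integration.integrable_diff integrable_mult_right)
  then have "integrable M (\<lambda>x. \<bar>c * ind n a x - g x * ind n a x\<bar>)" by (rule integrable_abs)
  also have "(\<lambda>x. \<bar>c * ind n a x - g x * ind n a x\<bar>) = (\<lambda>x. \<bar>c - g x\<bar> * ind n a x)"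
    by (rule ext) (simp add: left_diff_distrib[symmetric] abs_mult ind_bounds)
  finally show ?thesis .
qed

lemma osc_nonneg: "0 \<le> osc n g"
  unfolding osc_def by (intro sum_nonneg integral_nonneg_AE AE_I2 mult_nonneg_nonneg ind_bounds) auto

lemma avg_add: "integrable M f \<Longrightarrow> integrable M g \<Longrightarrow> avg n (\<lambda>x. f x + g x) a = avg n f a + avg n g a"
  unfolding avg_def by (simp add: distrib_right integrable_mult_ind add_divide_distrib)

lemma avg_scale: "avg n (\<lambda>x. c * f x) a = c * avg n f a"
  unfolding avg_def by (simp add: mult.assoc)

lemma osc_add:
  assumes f: "integrable M f" and g: "integrable M g"
  shows "osc n (\<lambda>x. f x + g x) \<le> osc n f + osc n g"
  unfolding osc_def sum.distrib[symmetric]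
proof (rule sum_mono)
  fix a assume a: "a \<in> cells n"
  have "(LINT x|M. \<bar>avg n (\<lambda>x. f x + g x) a - (f x + g x)\<bar> * ind n a x)
    \<le> (LINT x|M. \<bar>avg n f a - f x\<bar> * ind n a x + \<bar>avg n g a - g x\<bar> * ind n a x)"
  proof (rule integral_mono)
    fix x
    show "\<bar>avg n (\<lambda>x. f x + g x) a - (f x + g x)\<bar> * ind n a x
      \<le> \<bar>avg n f a - f x\<bar> * ind n a x + \<bar>avg n g a - g x\<bar> * ind n a x"
      unfolding distrib_right[symmetric] avg_add[OF f g] by (intro mult_right_mono ind_bounds) linarith
  qed (use osc_integrable[OF Bochner_Integration.integrable_add[OF f g] a] osc_integrable[OF f a] osc_integrable[OF g a] in auto)
  also have "\<dots> = (LINT x|M. \<bar>avg n f a - f x\<bar> * ind n a x) + (LINT x|M. \<bar>avg n g a - g x\<bar> * ind n a x)"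
    using osc_integrable[OF f a] osc_integrable[OF g a] by simp
  finally show "(LINT x|M. \<bar>avg n (\<lambda>x. f x + g x) a - (f x + g x)\<bar> * ind n a x)
    \<le> (LINT x|M. \<bar>avg n f a - f x\<bar> * ind n a x) + (LINT x|M. \<bar>avg n g a - g x\<bar> * ind n a x)" .
qed

lemma osc_scale: "osc n (\<lambda>x. c * g x) = \<bar>c\<bar> * osc n g"
proof -
  have "\<bar>avg n (\<lambda>x. c * g x) a - c * g x\<bar> * ind n a x = \<bar>c\<bar> * (\<bar>avg n g a - g x\<bar> * ind n a x)" for a x
    by (simp add: avg_scale right_diff_distrib[symmetric] abs_mult)
  then show ?thesis by (simp only: osc_def integral_mult_right_zero sum_distrib_left)
qed

lemma osc_le:
  assumes g: "integrable M g"
  shows "osc n g \<le> 2 * (LINT x|M. \<bar>g x\<bar>)"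
proof -
  have ga: "integrable M (\<lambda>x. \<bar>g x\<bar>)" using g by (rule integrable_abs)
  have "osc n g \<le> (\<Sum>a\<in>cells n. 2 * (LINT x|M. \<bar>g x\<bar> * ind n a x))"
    unfolding osc_def
  proof (rule sum_mono)
    fix a assume a: "a \<in> cells n"
    have "(LINT x|M. \<bar>avg n g a - g x\<bar> * ind n a x) \<le> (LINT x|M. \<bar>avg n g a\<bar> * ind n a x + \<bar>g x\<bar> * ind n a x)"
    proof (rule integral_mono)
      show "integrable M (\<lambda>x. \<bar>avg n g a\<bar> * ind n a x + \<bar>g x\<bar> * ind n a x)"
        by (intro Bochner_Integration.integrable_add integrable_mult_right integral_ind(2)[OF a] integrable_mult_ind[OF ga])
      show "\<bar>avg n g a - g x\<bar> * ind n a x \<le> \<bar>avg n g a\<bar> * ind n a x + \<bar>g x\<bar> * ind n a x" for x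
        unfolding distrib_right[symmetric] by (intro mult_right_mono ind_bounds abs_triangle_ineq4)
    qed (rule osc_integrable[OF g a])
    also have "\<dots> = \<bar>avg n g a\<bar> * cmu n a + (LINT x|M. \<bar>g x\<bar> * ind n a x)"
      using integral_ind[OF a] integrable_mult_ind[OF ga] by simp
    also have "\<dots> \<le> avg n (\<lambda>x. \<bar>g x\<bar>) a * cmu n a + (LINT x|M. \<bar>g x\<bar> * ind n a x)"
      using avg_abs_le cmu_pos[OF a] by (intro add_right_mono mult_right_mono) auto
    finally show "(LINT x|M. \<bar>avg n g a - g x\<bar> * ind n a x) \<le> 2 * (LINT x|M. \<bar>g x\<bar> * ind n a x)"
      unfolding avg_cmu[OF a] by simp
  qed
  also have "\<dots> = 2 * (\<Sum>a\<in>cells n. LINT x|M. \<bar>g x\<bar> * ind n a x)" by (simp add: sum_distrib_left)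
  also have "\<dots> \<le> 2 * (LINT x|M. \<bar>g x\<bar> * indicator BB x)"
    using sum_integral_ind_le[OF ga] by simp
  also have "\<dots> \<le> 2 * (LINT x|M. \<bar>g x\<bar>)"
    using integrable_real_mult_indicator[OF BB(2) ga] ga
    by (intro mult_left_mono integral_mono) (auto simp: indicator_def)
  finally show ?thesis .
qed

text \<open>Half of the oscillation of an indicator (\<open>osc_indicator\<close>). Each term
  \<open>s * (c - s) / c\<close> is symmetric under complements and subadditive in \<open>s\<close>,
  which is what an induction over a sigma-algebra asks for.\<close>

definition mix :: "nat \<Rightarrow> 'a set \<Rightarrow> real" where
  "mix n S = (\<Sum>a\<in>cells n. measure M (S \<inter> cell n a) * (cmu n a - measure M (S \<inter> cell n a)) / cmu n a)"

lemma int_cell_fmeasurable: "S \<in> sets M \<Longrightarrow> a \<in> cells n \<Longrightarrow> S \<inter> cell n a \<in> fmeasurable M"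
  using cell_fmeasurable by (intro fmeasurable_Int_fmeasurable[of "cell n a" M S, unfolded Int_commute[of _ S]])

lemma measure_cell_le: "S \<in> sets M \<Longrightarrow> a \<in> cells n \<Longrightarrow> measure M (S \<inter> cell n a) \<le> cmu n a"
  unfolding cmu_def using cell_fmeasurable by (intro measure_mono_fmeasurable) auto

lemma mix_nonneg: "S \<in> sets M \<Longrightarrow> 0 \<le> mix n S"
  unfolding mix_def using measure_cell_le cmu_pos
  by (intro sum_nonneg divide_nonneg_nonneg mult_nonneg_nonneg) (auto intro: less_imp_le)

lemma pairwise_cells: "pairwise (\<lambda>a b. disjnt (S \<inter> cell n a) (S \<inter> cell n b)) A"
  by (auto simp: pairwise_def disjnt_def cell_def)

lemma sum_measure_cells_le: "S \<in> sets M \<Longrightarrow> (\<Sum>a\<in>cells n. measure M (S \<inter> cell n a)) \<le> measure M (S \<inter> BB)"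
proof -
  assume S: "S \<in> sets M"
  have "(\<Sum>a\<in>cells n. measure M (S \<inter> cell n a)) = measure M (\<Union>a\<in>cells n. S \<inter> cell n a)"
    using int_cell_fmeasurable[OF S] by (intro measure_UNION'[symmetric] pairwise_cells) auto
  also have "\<dots> \<le> measure M (S \<inter> BB)"
    using S BB cell_BB cell_sets
    by (intro measure_mono_fmeasurable fmeasurable_Int_fmeasurable[of BB M S, unfolded Int_commute[of _ S]]
        sets.finite_UN sets.Int) auto
  finally show ?thesis .
qed

lemma mix_le:
  assumes S: "S \<in> sets M"
  shows "mix n S \<le> measure M (S \<inter> BB)"
proof -
  have "mix n S \<le> (\<Sum>a\<in>cells n. measure M (S \<inter> cell n a))"
    unfolding mix_def
  proof (rule sum_mono)
    fix a assume a: "a \<in> cells n"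
    have "measure M (S \<inter> cell n a) * (cmu n a - measure M (S \<inter> cell n a)) \<le> measure M (S \<inter> cell n a) * cmu n a"
      by (intro mult_left_mono) auto
    then show "measure M (S \<inter> cell n a) * (cmu n a - measure M (S \<inter> cell n a)) / cmu n a \<le> measure M (S \<inter> cell n a)"
      using cmu_pos[OF a] by (simp add: divide_le_eq)
  qed
  then show ?thesis using sum_measure_cells_le[OF S, of n] by linarith
qed

lemma mix_Un:
  assumes S: "S \<in> sets M" "S' \<in> sets M" "S \<inter> S' = {}"
  shows "mix n (S \<union> S') \<le> mix n S + mix n S'"
  unfolding mix_def sum.distrib[symmetric]
proof (rule sum_mono)
  fix a assume a: "a \<in> cells n"
  have u: "measure M ((S \<union> S') \<inter> cell n a) = measure M (S \<inter> cell n a) + measure M (S' \<inter> cell n a)"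
    unfolding Int_Un_distrib2 using int_cell_fmeasurable[OF S(1) a] int_cell_fmeasurable[OF S(2) a] S(3)
    by (intro measure_Un_AE) auto
  have "(x + y) * (c - (x + y)) / c \<le> x * (c - x) / c + y * (c - y) / c" if "0 \<le> x" "0 \<le> y" "0 < c" for x y c :: real
  proof -
    have "(x + y) * (c - (x + y)) \<le> x * (c - x) + y * (c - y)"
      using mult_nonneg_nonneg[OF that(1,2)] by (simp add: algebra_simps)
    then show ?thesis using that(3) by (simp add: add_divide_distrib[symmetric] divide_right_mono)
  qed
  then show "measure M ((S \<union> S') \<inter> cell n a) * (cmu n a - measure M ((S \<union> S') \<inter> cell n a)) / cmu n a
    \<le> measure M (S \<inter> cell n a) * (cmu n a - measure M (S \<inter> cell n a)) / cmu n a
     + measure M (S' \<inter> cell n a) * (cmu n a - measure M (S' \<inter> cell n a)) / cmu n a"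
    unfolding u using cmu_pos[OF a] by simp
qed

lemma mix_compl:
  assumes S: "S \<in> sets M"
  shows "mix n (X - S) = mix n S"
  unfolding mix_def
proof (rule sum.cong[OF refl])
  fix a assume a: "a \<in> cells n"
  have "(X - S) \<inter> cell n a = cell n a - (S \<inter> cell n a)" using cell_X by blast
  then have "measure M ((X - S) \<inter> cell n a) = cmu n a - measure M (S \<inter> cell n a)"
    unfolding cmu_def using int_cell_fmeasurable[OF S a] cell_fmeasurable[OF a]
    by (simp add: measurable_measure_Diff fmeasurableD)
  then show "measure M ((X - S) \<inter> cell n a) * (cmu n a - measure M ((X - S) \<inter> cell n a)) / cmu n a
    = measure M (S \<inter> cell n a) * (cmu n a - measure M (S \<inter> cell n a)) / cmu n a" by simp
qed

lemma el_tendsto: "el \<longlonglongrightarrow> 0"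
  unfolding el_def[abs_def] using del by (intro tendsto_mult_right_zero LIMSEQ_power_zero) auto

lemma tendsto_dominated_sets:
  assumes H: "\<And>n. H n \<in> sets M" "\<And>n. H n \<subseteq> BB" and ev: "\<And>x. x \<in> X \<Longrightarrow> \<forall>\<^sub>F n in sequentially. x \<notin> H n"
  shows "(\<lambda>n. measure M (H n)) \<longlonglongrightarrow> 0"
proof -
  have "(\<lambda>n. LINT x|M. indicator (H n) x :: real) \<longlonglongrightarrow> (LINT x|M. 0 :: real)"
  proof (rule integral_dominated_convergence[where w = "indicator BB"])
    show "integrable M (indicator BB :: 'a \<Rightarrow> real)" using BB by (intro integrable_real_indicator) (auto simp: fmeasurable_def)
    show "AE x in M. (\<lambda>n. indicator (H n) x :: real) \<longlonglongrightarrow> 0"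
    proof (rule AE_I2)
      fix x assume "x \<in> X"
      from ev[OF this] have "\<forall>\<^sub>F n in sequentially. indicator (H n) x = (0::real)"
        by eventually_elim simp
      then show "(\<lambda>n. indicator (H n) x :: real) \<longlonglongrightarrow> 0" by (rule tendsto_eventually)
    qed
    show "AE x in M. norm (indicator (H n) x :: real) \<le> indicator BB x" for n
      using H(2)[of n] by (intro AE_I2) (auto simp: indicator_def)
  qed (use H in auto)
  then show ?thesis using H(1) by (simp add: sets.sets_into_space Int_absorb2)
qed

text \<open>Only cells that meet \<open>U\<close> without lying in it contribute. A point of
  \<open>U\<close> leaves them for good once \<open>2 * \<kappa> * el n\<close> is below the radius
  of a ball inside \<open>U\<close>, and dominated convergence applies within
  \<open>BB\<close>.\<close>

lemma mix_open:
  assumes U: "qopen X \<rho> U"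
  shows "(\<lambda>n. mix n U) \<longlonglongrightarrow> 0"
proof -
  have US: "U \<in> sets M" using qopen_sets[OF U refl] .
  define H where "H n = (\<Union>a\<in>{a\<in>cells n. \<not> cell n a \<subseteq> U}. U \<inter> cell n a)" for n
  have Hs: "H n \<in> sets M" "H n \<subseteq> BB" for n
    unfolding H_def using US cell_sets cell_BB by (auto intro!: sets.finite_UN)
  have "(\<lambda>n. measure M (H n)) \<longlonglongrightarrow> 0"
  proof (rule tendsto_dominated_sets[OF Hs])
    fix x assume x: "x \<in> X"
    show "\<forall>\<^sub>F n in sequentially. x \<notin> H n"
    proof (cases "x \<in> U")
      case False then show ?thesis by (simp add: H_def)
    next
      case True
      then obtain r where r: "0 < r" "B x r \<subseteq> U" using U by (auto simp: qopen_def)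
      have "\<forall>\<^sub>F n in sequentially. el n < r / (2 * \<kappa>)"
        using order_tendstoD(2)[OF el_tendsto, of "r / (2 * \<kappa>)"] r kappa_pos by simp
      then show ?thesis
      proof eventually_elim
        case (elim n)
        have "2 * \<kappa> * el n \<le> r" using elim kappa_pos by (simp add: field_simps)
        then have "cell n a \<subseteq> U" if "a \<in> cells n" "x \<in> cell n a" for a
          using cell_small[OF that] B_mono[of "2 * \<kappa> * el n" r x] r(2) by blast
        then show ?case by (auto simp: H_def)
      qed
    qed
  qed
  moreover have "mix n U \<le> measure M (H n)" for n
  proof -
    have "mix n U = (\<Sum>a\<in>{a\<in>cells n. \<not> cell n a \<subseteq> U}. measure M (U \<inter> cell n a) * (cmu n a - measure M (U \<inter> cell n a)) / cmu n a)"
      unfolding mix_def by (intro sum.mono_neutral_right) (auto simp: Int_absorb1 cmu_def)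
    also have "\<dots> \<le> (\<Sum>a\<in>{a\<in>cells n. \<not> cell n a \<subseteq> U}. measure M (U \<inter> cell n a))"
    proof (rule sum_mono)
      fix a assume "a \<in> {a\<in>cells n. \<not> cell n a \<subseteq> U}"
      then have a: "a \<in> cells n" by simp
      have "measure M (U \<inter> cell n a) * (cmu n a - measure M (U \<inter> cell n a)) \<le> measure M (U \<inter> cell n a) * cmu n a"
        by (intro mult_left_mono) auto
      then show "measure M (U \<inter> cell n a) * (cmu n a - measure M (U \<inter> cell n a)) / cmu n a \<le> measure M (U \<inter> cell n a)"
        using cmu_pos[OF a] by (simp add: divide_le_eq)
    qed
    also have "\<dots> = measure M (H n)"
      unfolding H_def using int_cell_fmeasurable[OF US]
      by (intro measure_UNION'[symmetric] pairwise_cells) auto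
    finally show ?thesis .
  qed
  ultimately show ?thesis
    by (rule tendsto_zero_squeeze[OF _ mix_nonneg[OF US]])
qed

lemma qborel_sets_sub: "qborel_sets X \<rho> \<subseteq> sets M"
  using regular by (simp add: qborel_regular_def)

text \<open>\<open>mix_le\<close> bounds the tail of the union by its measure in \<open>BB\<close>,
  uniformly in \<open>n\<close>; the remaining finite union is handled by
  \<open>mix_Un\<close>.\<close>

lemma mix_disjoint_union:
  assumes S: "\<And>i. S i \<in> sets M" "disjoint_family S" and lim: "\<And>i::nat. (\<lambda>n. mix n (S i)) \<longlonglongrightarrow> 0"
  shows "(\<lambda>n. mix n (\<Union>i. S i)) \<longlonglongrightarrow> 0"
proof -
  define R where "R k = (\<Union>i\<in>{k..}. S i)" for k :: nat
  have dj: "S i \<inter> S j = {}" if "i \<noteq> j" for i j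
    using S(2) that by (simp add: disjoint_family_on_def)
  have Rs: "R k \<in> sets M" for k unfolding R_def using S(1) by (intro sets.countable_UN') auto
  have Rlim: "(\<lambda>k. measure M (R k \<inter> BB)) \<longlonglongrightarrow> 0"
  proof (rule tendsto_dominated_sets)
    show "R k \<inter> BB \<in> sets M" "R k \<inter> BB \<subseteq> BB" for k using Rs BB by auto
    fix x assume "x \<in> X"
    show "\<forall>\<^sub>F k in sequentially. x \<notin> R k \<inter> BB"
    proof (cases "\<exists>i. x \<in> S i")
      case False then show ?thesis by (simp add: R_def)
    next
      case True
      then obtain i where i: "x \<in> S i" by blast
      have "x \<notin> R k" if "Suc i \<le> k" for k
      proof
        assume "x \<in> R k"
        then obtain j where "k \<le> j" "x \<in> S j" by (auto simp: R_def)
        then show False using dj[of i j] i that by auto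
      qed
      then show ?thesis unfolding eventually_sequentially by blast
    qed
  qed
  have fin: "mix n (\<Union>i. S i) \<le> (\<Sum>i<k. mix n (S i)) + measure M (R k \<inter> BB)" for n k
  proof -
    have "mix n ((\<Union>i\<in>{..<k}. S i) \<union> R k) \<le> (\<Sum>i<k. mix n (S i)) + measure M (R k \<inter> BB)"
    proof -
      have "mix n (\<Union>i\<in>{..<k}. S i) \<le> (\<Sum>i<k. mix n (S i))"
      proof (induction k)
        case 0 show ?case by (simp add: mix_def)
      next
        case (Suc k)
        have "mix n ((\<Union>i\<in>{..<k}. S i) \<union> S k) \<le> mix n (\<Union>i\<in>{..<k}. S i) + mix n (S k)"
        proof (rule mix_Un)
          have "S i \<inter> S k = {}" if "i < k" for i using dj[of i k] that by simp
          then show "(\<Union>i\<in>{..<k}. S i) \<inter> S k = {}" by blast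
        qed (use S in auto)
        then show ?case using Suc by (simp add: lessThan_Suc Un_commute)
      qed
      moreover have "mix n ((\<Union>i\<in>{..<k}. S i) \<union> R k) \<le> mix n (\<Union>i\<in>{..<k}. S i) + mix n (R k)"
      proof (rule mix_Un)
        show "(\<Union>i\<in>{..<k}. S i) \<inter> R k = {}"
        proof -
          have "S i \<inter> S j = {}" if "i < k" "k \<le> j" for i j using dj[of i j] that by simp
          then show ?thesis unfolding R_def by blast
        qed
      qed (use S Rs in auto)
      ultimately show ?thesis using mix_le[OF Rs, of n k] by linarith
    qed
    also have "(\<Union>i\<in>{..<k}. S i) \<union> R k = (\<Union>i. S i)"
    proof -
      have "{..<k} \<union> {k..} = UNIV" by auto
      then show ?thesis unfolding R_def by (metis UN_Un)
    qed
    finally show ?thesis .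
  qed
  have Us: "(\<Union>i. S i) \<in> sets M" using S(1) by auto
  show ?thesis
  proof (rule LIMSEQ_I)
    fix e :: real assume e: "0 < e"
    obtain k where k: "measure M (R k \<inter> BB) < e / 2"
      using order_tendstoD(2)[OF Rlim, of "e / 2"] e by (auto simp: eventually_sequentially)
    have "(\<lambda>n. \<Sum>i<k. mix n (S i)) \<longlonglongrightarrow> (\<Sum>i<k. 0)" using lim by (intro tendsto_sum)
    then have "\<forall>\<^sub>F n in sequentially. (\<Sum>i<k. mix n (S i)) < e / 2"
      using order_tendstoD(2)[of _ 0 _ "e / 2"] e by simp
    then obtain n0 where n0: "\<And>n. n0 \<le> n \<Longrightarrow> (\<Sum>i<k. mix n (S i)) < e / 2"
      by (auto simp: eventually_sequentially)
    show "\<exists>n0. \<forall>n\<ge>n0. norm (mix n (\<Union>i. S i) - 0) < e"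
    proof (intro exI[of _ n0] allI impI)
      fix n assume "n0 \<le> n"
      then have "mix n (\<Union>i. S i) < e" using n0[of n] fin[of n k] k by linarith
      then show "norm (mix n (\<Union>i. S i) - 0) < e" using mix_nonneg[OF Us, of n] by simp
    qed
  qed
qed

lemma mix_borel:
  assumes "S \<in> qborel_sets X \<rho>"
  shows "(\<lambda>n. mix n S) \<longlonglongrightarrow> 0"
proof -
  have int: "Int_stable {U. qopen X \<rho> U}"
  proof (rule Int_stableI)
    fix U V assume "U \<in> {U. qopen X \<rho> U}" "V \<in> {U. qopen X \<rho> U}"
    then have UV: "qopen X \<rho> U" "qopen X \<rho> V" by auto
    have "\<exists>r>0. B x r \<subseteq> U \<inter> V" if x: "x \<in> U \<inter> V" for x
    proof -
      obtain r s where "0 < r" "B x r \<subseteq> U" "0 < s" "B x s \<subseteq> V"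
        using UV x unfolding qopen_def by blast
      then show ?thesis using B_mono[of "min r s" r x] B_mono[of "min r s" s x] by (intro exI[of _ "min r s"]) auto
    qed
    then show "U \<inter> V \<in> {U. qopen X \<rho> U}" using UV unfolding qopen_def by blast
  qed
  have pow: "{U. qopen X \<rho> U} \<subseteq> Pow X" by (auto simp: qopen_def)
  have sub: "T \<in> sets M" if "T \<in> sigma_sets X {U. qopen X \<rho> U}" for T
    using qborel_sets_sub that by (auto simp: qborel_sets_def)
  from assms have "S \<in> sigma_sets X {U. qopen X \<rho> U}" by (simp add: qborel_sets_def)
  from int pow this show ?thesis
  proof (induction rule: sigma_sets_induct_disjoint)
    case (basic A) then show ?case using mix_open by simp
  next
    case empty show ?case by (simp add: mix_def)
  next
    case (compl A) then show ?case using mix_compl[OF sub] by simp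
  next
    case (union A)
    show ?case using union sub by (intro mix_disjoint_union) auto
  qed
qed

text \<open>Borel regularity leads from Borel sets to measurable ones: a Borel hull of equal measure
  has the same \<open>mix\<close>. The intersection with \<open>BB\<close> makes the measure finite,
  so that the hull adds only a null set.\<close>

lemma mix_tendsto:
  assumes S: "S \<in> sets M"
  shows "(\<lambda>n. mix n S) \<longlonglongrightarrow> 0"
proof -
  have SB: "S \<inter> BB \<in> sets M" using S BB by auto
  obtain Q where Q: "Q \<in> qborel_sets X \<rho>" "S \<inter> BB \<subseteq> Q" "emeasure M Q = emeasure M (S \<inter> BB)"
    using regular SB unfolding qborel_regular_def by blast
  have Qs: "Q \<in> sets M" using Q(1) qborel_sets_sub by blast
  have fin: "emeasure M (S \<inter> BB) < \<infinity>"
    using emeasure_mono[of "S \<inter> BB" BB M] BB by (auto simp: fmeasurable_def)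
  have null: "emeasure M (Q - (S \<inter> BB)) = 0"
    using emeasure_Diff[OF _ Qs SB Q(2)] fin Q(3) by simp
  have "measure M (S \<inter> cell n a) = measure M (Q \<inter> cell n a)" if a: "a \<in> cells n" for n a
  proof -
    have "AE x in M. x \<notin> Q - (S \<inter> BB)" using null Qs SB by (intro AE_not_in null_setsI) auto
    then have "AE x in M. x \<in> S \<inter> cell n a \<longleftrightarrow> x \<in> Q \<inter> cell n a"
      by eventually_elim (use Q(2) cell_BB[OF a] in auto)
    then have "emeasure M (S \<inter> cell n a) = emeasure M (Q \<inter> cell n a)"
      using S Qs by (intro emeasure_eq_AE) auto
    then show ?thesis by (simp add: measure_def)
  qed
  then have "mix n S = mix n Q" for n by (simp add: mix_def)
  then show ?thesis using mix_borel[OF Q(1)] by simp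
qed

lemma osc_indicator:
  assumes S: "S \<in> sets M"
  shows "osc n (indicator S) = 2 * mix n S"
  unfolding osc_def mix_def sum_distrib_left
proof (rule sum.cong[OF refl])
  fix a assume a: "a \<in> cells n"
  define s where "s = measure M (S \<inter> cell n a)"
  have f: "S \<inter> cell n a \<in> fmeasurable M" using int_cell_fmeasurable[OF S a] .
  have s: "0 \<le> s" "s \<le> cmu n a" using measure_cell_le[OF S a] by (auto simp: s_def)
  have prod: "indicator S x * ind n a x = indicator (S \<inter> cell n a) x" for x :: 'a
    by (simp add: ind_def indicator_def)
  have int: "(LINT x|M. indicator (S \<inter> cell n a) x :: real) = s" "integrable M (indicator (S \<inter> cell n a) :: 'a \<Rightarrow> real)"
    using f by (simp_all add: s_def fmeasurable_def sets.sets_into_space Int_absorb2)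
  have av: "avg n (indicator S) a = s / cmu n a" unfolding avg_def prod int ..
  have av01: "0 \<le> s / cmu n a" "s / cmu n a \<le> 1" using s cmu_pos[OF a] by auto
  have "\<bar>avg n (indicator S) a - indicator S x\<bar> * ind n a x
    = (1 - 2 * (s / cmu n a)) * indicator (S \<inter> cell n a) x + s / cmu n a * ind n a x" for x
  proof -
    have "\<bar>s / cmu n a\<bar> = s / cmu n a" "\<bar>s / cmu n a - 1\<bar> = 1 - s / cmu n a" using av01 by linarith+
    then show ?thesis unfolding av by (simp add: ind_def indicator_def del: abs_divide)
  qed
  then have "(LINT x|M. \<bar>avg n (indicator S) a - indicator S x\<bar> * ind n a x) = (1 - 2 * (s / cmu n a)) * s + s / cmu n a * cmu n a"
    using int integral_ind[OF a] by simp
  also have "\<dots> = 2 * (s * (cmu n a - s) / cmu n a)"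
    using cmu_pos[OF a] by (simp add: field_simps)
  finally show "(LINT x|M. \<bar>avg n (indicator S) a - indicator S x\<bar> * ind n a x)
    = 2 * (measure M (S \<inter> cell n a) * (cmu n a - measure M (S \<inter> cell n a)) / cmu n a)"
    by (simp add: s_def)
qed

text \<open>Indicators are settled by \<open>mix_tendsto\<close>. Since \<open>osc n\<close> is
  subadditive and at most twice the L^1 norm for every \<open>n\<close>, approximation by simple
  functions does the rest.\<close>

theorem osc_tendsto:
  assumes "integrable M g"
  shows "(\<lambda>n. osc n g) \<longlonglongrightarrow> 0"
  using assms
proof (induction rule: integrable_induct)
  case (base S c)
  have "osc n (\<lambda>x. indicator S x *\<^sub>R c) = \<bar>c\<bar> * (2 * mix n S)" for n
    using osc_scale[of n c "indicator S"] osc_indicator[OF base(1)] by (simp add: mult.commute)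
  then show ?case using tendsto_mult_right_zero[OF tendsto_mult_right_zero[OF mix_tendsto[OF base(1)]], of "\<bar>c\<bar>" 2] by simp
next
  case (add f g)
  have "(\<lambda>n. osc n f + osc n g) \<longlonglongrightarrow> 0" using tendsto_add[OF add(3,4)] by simp
  then show ?case
    by (rule tendsto_zero_squeeze) (use osc_add[OF add(1,2)] osc_nonneg in auto)
next
  case (lim f s)
  have sf: "integrable M (\<lambda>x. f x - s i x)" for i using lim.hyps by (intro Bochner_Integration.integrable_diff)
  have L1: "(\<lambda>i. LINT x|M. \<bar>f x - s i x\<bar>) \<longlonglongrightarrow> (LINT x|M. 0)"
  proof (rule integral_dominated_convergence[where w = "\<lambda>x. 3 * \<bar>f x\<bar>"])
    show "integrable M (\<lambda>x. 3 * \<bar>f x\<bar>)" using lim.hyps(4) by (intro integrable_mult_right integrable_abs)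
    show "AE x in M. (\<lambda>i. \<bar>f x - s i x\<bar>) \<longlonglongrightarrow> 0"
    proof (rule AE_I2)
      fix x assume "x \<in> X"
      have "(\<lambda>i. \<bar>f x - s i x\<bar>) \<longlonglongrightarrow> \<bar>f x - f x\<bar>"
        using lim.hyps(2)[OF \<open>x \<in> X\<close>] by (intro tendsto_rabs tendsto_diff tendsto_const)
      then show "(\<lambda>i. \<bar>f x - s i x\<bar>) \<longlonglongrightarrow> 0" by simp
    qed
    show "AE x in M. norm \<bar>f x - s i x\<bar> \<le> 3 * \<bar>f x\<bar>" for i
    proof (rule AE_I2)
      fix x assume "x \<in> X"
      have "\<bar>s i x\<bar> \<le> 2 * \<bar>f x\<bar>" using lim.hyps(3)[OF \<open>x \<in> X\<close>, of i] by simp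
      then show "norm \<bar>f x - s i x\<bar> \<le> 3 * \<bar>f x\<bar>" by simp
    qed
  qed (use sf in auto)
  show ?case
  proof (rule LIMSEQ_I)
    fix e :: real assume e: "0 < e"
    obtain i where i: "(LINT x|M. \<bar>f x - s i x\<bar>) < e / 4"
      using order_tendstoD(2)[OF L1, of "e / 4"] e by (auto simp: eventually_sequentially)
    obtain n0 where n0: "\<And>n. n0 \<le> n \<Longrightarrow> osc n (s i) < e / 2"
      using order_tendstoD(2)[OF lim.IH[of i], of "e / 2"] e by (auto simp: eventually_sequentially)
    show "\<exists>n0. \<forall>n\<ge>n0. norm (osc n f - 0) < e"
    proof (intro exI[of _ n0] allI impI)
      fix n assume n: "n0 \<le> n"
      have "osc n f = osc n (\<lambda>x. s i x + (f x - s i x))" by simp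
      also have "\<dots> \<le> osc n (s i) + osc n (\<lambda>x. f x - s i x)" by (rule osc_add[OF lim.hyps(1) sf])
      also have "\<dots> < e" using n0[OF n] osc_le[OF sf, of n i] i by linarith
      finally show "norm (osc n f - 0) < e" using osc_nonneg[of n f] by simp
    qed
  qed
qed

end

section \<open>Cell averages of weights and the passage to the limit\<close>

context dyadic_grid
begin

lemma integrable_bounded_supported:
  fixes g :: "'a \<Rightarrow> real"
  assumes "g \<in> borel_measurable M" "S \<in> fmeasurable M" "\<And>x. \<bar>g x\<bar> \<le> c * indicator S x"
  shows "integrable M g"
proof (rule Bochner_Integration.integrable_bound[where f = "\<lambda>x. c * indicator S x"])
  show "integrable M (\<lambda>x. c * indicator S x)"
    using assms(2) by (intro integrable_mult_right integrable_real_indicator) (auto simp: fmeasurable_def)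
  show "AE x in M. norm (g x) \<le> norm (c * indicator S x)"
    using assms(3) by (intro AE_I2) (simp add: order_trans[OF _ abs_ge_self])
qed (rule assms(1))

lemma avg_mono_zero: "(\<And>x. x \<in> cell n a \<Longrightarrow> g x = 0) \<Longrightarrow> avg n g a = 0"
proof -
  assume "\<And>x. x \<in> cell n a \<Longrightarrow> g x = 0"
  then have "(\<lambda>x. g x * ind n a x) = (\<lambda>x. 0)" by (intro ext) (auto simp: ind_def indicator_def)
  then show ?thesis by (simp add: avg_def)
qed

lemma avg_nonneg: "(\<And>x. 0 \<le> g x) \<Longrightarrow> 0 \<le> avg n g a"
  unfolding avg_def cmu_def by (intro divide_nonneg_nonneg integral_nonneg_AE AE_I2 mult_nonneg_nonneg ind_bounds) auto

lemma integral_cells: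
  assumes g: "integrable M g" "\<And>x. x \<notin> (\<Union>a\<in>cells n. cell n a) \<Longrightarrow> g x = 0"
  shows "(LINT x|M. g x) = (\<Sum>a\<in>cells n. LINT x|M. g x * ind n a x)"
proof -
  have "g x = (\<Sum>a\<in>cells n. g x * ind n a x)" for x
  proof (cases "x \<in> (\<Union>a\<in>cells n. cell n a)")
    case True
    then obtain b where b: "b \<in> cells n" "x \<in> cell n b" by blast
    have "(\<Sum>a\<in>cells n. ind n a x) = step n (\<lambda>_. 1) x" by (simp add: step_def)
    then show ?thesis using step_cell[OF b, of "\<lambda>_. 1"] by (simp add: sum_distrib_left[symmetric])
  qed (simp add: g(2))
  then have "(LINT x|M. g x) = (LINT x|M. (\<Sum>a\<in>cells n. g x * ind n a x))" by simp
  also have "\<dots> = (\<Sum>a\<in>cells n. LINT x|M. g x * ind n a x)"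
    using integrable_mult_ind[OF g(1)] by (intro Bochner_Integration.integral_sum)
  finally show ?thesis .
qed

text \<open>Young's inequality with a free parameter \<open>t\<close>, integrated over the cell. The
  optimal value is \<open>t = W powr (1 / r)\<close>; for \<open>W = 0\<close> all positive
  \<open>t\<close> are used.\<close>

lemma avg_power_mean:
  assumes a: "a \<in> cells n" and r: "1 < r" and w: "\<And>x. 0 \<le> w x" and F: "F \<subseteq> BB"
    and int: "integrable M (\<lambda>x. w x * indicator F x)" "integrable M (\<lambda>x. w x powr r * indicator BB x)"
  shows "avg n (\<lambda>x. w x * indicator F x) a \<le> avg n (\<lambda>x. w x powr r * indicator BB x) a powr (1 / r)"
proof -
  define W where "W = avg n (\<lambda>x. w x powr r * indicator BB x) a"
  define u where "u = avg n (\<lambda>x. w x * indicator F x) a"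
  have W0: "0 \<le> W" unfolding W_def by (intro avg_nonneg mult_nonneg_nonneg) auto
  have c0: "0 < cmu n a" using cmu_pos[OF a] .
  have young: "u \<le> t powr (1 - r) / r * W + (1 - 1 / r) * t" if t: "0 < t" for t
  proof -
    have pt: "w x * indicator F x * ind n a x
      \<le> t powr (1 - r) / r * (w x powr r * indicator BB x * ind n a x) + (1 - 1 / r) * t * ind n a x" for x
    proof (cases "x \<in> F \<and> x \<in> cell n a \<and> w x \<noteq> 0")
      case False
      then show ?thesis using t r ind_bounds[of n a x]
        by (auto simp: ind_def indicator_def intro!: add_nonneg_nonneg mult_nonneg_nonneg divide_nonneg_nonneg)
    next
      case True
      then have wx: "0 < w x" and xB: "x \<in> BB" using w[of x] F by auto
      have "(w x powr r * t powr (1 - r)) powr (1 / r) * t powr (1 - 1 / r) \<le> 1 / r * (w x powr r * t powr (1 - r)) + (1 - 1 / r) * t"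
        using r wx t by (intro Youngs_inequality_0) auto
      moreover have "(w x powr r * t powr (1 - r)) powr (1 / r) * t powr (1 - 1 / r) = w x"
      proof -
        have "(w x powr r * t powr (1 - r)) powr (1 / r) * t powr (1 - 1 / r)
          = w x powr (r * (1 / r)) * (t powr ((1 - r) * (1 / r)) * t powr (1 - 1 / r))"
          using wx t by (simp add: powr_mult powr_powr)
        also have "\<dots> = w x * t powr ((1 - r) * (1 / r) + (1 - 1 / r))"
          using r wx by (simp add: powr_add[symmetric])
        also have "(1 - r) * (1 / r) + (1 - 1 / r) = 0" using r by (simp add: field_simps)
        finally show ?thesis using t by simp
      qed
      ultimately show ?thesis using True xB by (simp add: ind_def mult_ac)
    qed
    have "(LINT x|M. w x * indicator F x * ind n a x)
      \<le> (LINT x|M. t powr (1 - r) / r * (w x powr r * indicator BB x * ind n a x) + (1 - 1 / r) * t * ind n a x)"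
      using integrable_mult_ind[OF int(1)] integrable_mult_ind[OF int(2)] integral_ind(2)[OF a] pt
      by (intro integral_mono Bochner_Integration.integrable_add integrable_mult_right)
    also have "\<dots> = t powr (1 - r) / r * (LINT x|M. w x powr r * indicator BB x * ind n a x) + (1 - 1 / r) * t * cmu n a"
      using integrable_mult_ind[OF int(2)] integral_ind[OF a] by simp
    also have "\<dots> = (t powr (1 - r) / r * W + (1 - 1 / r) * t) * cmu n a"
      using c0 by (simp add: W_def avg_def distrib_right)
    finally show ?thesis using c0 by (simp add: u_def avg_def divide_le_eq)
  qed
  show ?thesis
  proof (cases "W = 0")
    case True
    have "u \<le> 0 + e" if e: "0 < e" for e
    proof -
      have "u \<le> (1 - 1 / r) * e" using young[OF e] True by simp
      also have "\<dots> \<le> 1 * e" using e r by (intro mult_right_mono) auto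
      finally show ?thesis by simp
    qed
    then have "u \<le> 0" by (rule field_le_epsilon)
    then show ?thesis unfolding u_def[symmetric] W_def[symmetric] using powr_ge_zero[of W "1 / r"] by linarith
  next
    case False
    then have Wp: "0 < W" using W0 by simp
    define t where "t = W powr (1 / r)"
    have t: "0 < t" using Wp by (simp add: t_def)
    have "W = t powr r" using Wp r by (simp add: t_def powr_powr)
    then have "t powr (1 - r) * W = t" using t by (simp add: powr_add[symmetric])
    then have "t powr (1 - r) / r * W + (1 - 1 / r) * t = t"
      using r by (simp add: field_simps)
    then show ?thesis using young[OF t] unfolding u_def W_def t_def by simp
  qed
qed

text \<open>The neighbourhood lies in the ball \<open>Bl\<close>, which contains \<open>x\<close>
  and has measure at most \<open>Dt\<close> times the mass of the neighbourhood. The bound holds at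
  every point of the cell, so no question of measurability of the maximal function arises.\<close>

lemma nbh_average_le_maximal:
  assumes a: "a \<in> cells n" and l: "l \<le> n" and x: "x \<in> cell n a" and r: "1 < r"
    and w: "w \<in> borel_measurable M" "\<And>x. 0 \<le> w x" and int: "integrable M (\<lambda>x. w x powr r * indicator BB x)"
  shows "ennreal (((\<Sum>b\<in>{b\<in>cells n. gnr n l a b}. avg n (\<lambda>x. w x powr r * indicator BB x) b * cmu n b)
      / (\<Sum>b\<in>{b\<in>cells n. gnr n l a b}. cmu n b)) powr (1 / r))
    \<le> ennreal Dt * hl_maximal_pow M \<rho> r w x"
proof -
  let ?N = "{b\<in>cells n. gnr n l a b}"
  define W where "W y = w y powr r" for y
  have Weq: "W = (\<lambda>y. w y powr r)" by (rule ext) (simp add: W_def)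
  have Wm: "W \<in> borel_measurable M" unfolding W_def using w(1) by simp
  define Bl where "Bl = B (Pr n l a) (\<kappa> * (8 * \<kappa> ^ 3 + 2 * \<kappa>) * el l)"
  have P: "Pr n l a \<in> X" using Pr_X l cells_X[OF a] by blast
  have rp: "0 < \<kappa> * (8 * \<kappa> ^ 3 + 2 * \<kappa>) * el l" using kappa_pos el_pos by (simp add: add_pos_pos)
  have Bs: "Bl \<in> sets M" "Bl \<in> fmeasurable M" "0 < measure M Bl"
    using B_sets[OF P] B_fmeasurable[OF P] B_pos[OF P rp] by (auto simp: Bl_def)
  interpret t: cube_tree "cells n" "cmu n" n "Pr n" "gnr n" Dt by (rule grid_cube_tree)
  have aN: "a \<in> ?N" using t.nr_refl[OF a l] a by simp
  have sub: "cell n b \<subseteq> Bl" if "b \<in> ?N" for b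
    unfolding Bl_def using nbh_cell_ball[OF l a] that by blast
  have den: "measure M Bl \<le> Dt * (\<Sum>b\<in>?N. cmu n b)"
  proof -
    have "measure M (region n l a) \<le> (\<Sum>b\<in>?N. cmu n b)"
      unfolding sum_cmu_region[OF l a, symmetric]
      using t.nr_refl[OF a l] t.nr_cong2[OF a a _ l] cmu_pos by (intro sum_mono2) (auto intro: less_imp_le)
    then have "Dt * measure M (region n l a) \<le> Dt * (\<Sum>b\<in>?N. cmu n b)"
      using Dt_ge_1 by (intro mult_left_mono) auto
    then show ?thesis using nbh_ball_measure[OF l a] unfolding Bl_def by linarith
  qed
  define num where "num = (\<Sum>b\<in>?N. avg n (\<lambda>x. W x * indicator BB x) b * cmu n b)"
  have num0: "0 \<le> num" unfolding num_def W_def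
    by (intro sum_nonneg mult_nonneg_nonneg avg_nonneg) (auto simp: cmu_def)
  have denp: "0 < (\<Sum>b\<in>?N. cmu n b)" using aN cmu_pos by (intro sum_pos) auto
  have numI: "ennreal num \<le> (\<integral>\<^sup>+y\<in>Bl. ennreal \<bar>W y\<bar> \<partial>M)"
  proof -
    have "num = (\<Sum>b\<in>?N. LINT x|M. W x * indicator BB x * ind n b x)"
      unfolding num_def by (intro sum.cong refl avg_cmu) auto
    also have "\<dots> = (LINT x|M. (\<Sum>b\<in>?N. W x * indicator BB x * ind n b x))"
      using integrable_mult_ind[OF int] by (intro Bochner_Integration.integral_sum[symmetric]) (simp add: W_def)
    finally have "ennreal num = ennreal (LINT x|M. (\<Sum>b\<in>?N. W x * indicator BB x * ind n b x))" by (simp only:)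
    also have "\<dots> = (\<integral>\<^sup>+x. ennreal (\<Sum>b\<in>?N. W x * indicator BB x * ind n b x) \<partial>M)"
    proof (rule nn_integral_eq_integral[symmetric])
      show "integrable M (\<lambda>x. \<Sum>b\<in>?N. W x * indicator BB x * ind n b x)"
        using integrable_mult_ind[OF int] by (intro Bochner_Integration.integrable_sum) (simp add: W_def)
      show "AE x in M. 0 \<le> (\<Sum>b\<in>?N. W x * indicator BB x * ind n b x)"
        by (intro AE_I2 sum_nonneg mult_nonneg_nonneg ind_bounds) (auto simp: W_def)
    qed
    also have "\<dots> \<le> (\<integral>\<^sup>+y\<in>Bl. ennreal \<bar>W y\<bar> \<partial>M)"
    proof (rule nn_integral_mono)
      fix y
      have "(\<Sum>b\<in>?N. W y * indicator BB y * ind n b y) \<le> W y * indicator Bl y"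
      proof (cases "y \<in> Bl")
        case False
        have z: "ind n b y = 0" if b: "b \<in> ?N" for b
        proof -
          have "y \<notin> cell n b" using sub[OF b] False by (rule contra_subsetD)
          then show ?thesis by (simp add: ind_def)
        qed
        have "(\<Sum>b\<in>?N. W y * indicator BB y * ind n b y) = 0"
          by (rule sum.neutral, rule ballI) (simp only: z mult_zero_right)
        then show ?thesis using False by simp
      next
        case True
        have "(\<Sum>b\<in>?N. ind n b y) \<le> (\<Sum>b\<in>cells n. ind n b y)" using ind_bounds by (intro sum_mono2) auto
        also have "\<dots> \<le> 1" by (rule order_trans[OF sum_ind_le indicator_le_1])
        finally have s1: "(\<Sum>b\<in>?N. ind n b y) \<le> 1" .
        have "(\<Sum>b\<in>?N. W y * indicator BB y * ind n b y) = W y * indicator BB y * (\<Sum>b\<in>?N. ind n b y)"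
          by (simp add: sum_distrib_left)
        also have "\<dots> \<le> W y * 1 * 1"
          using s1 ind_bounds by (intro mult_mono sum_nonneg) (auto simp: W_def indicator_def)
        finally show ?thesis using True by simp
      qed
      then have "ennreal (\<Sum>b\<in>?N. W y * indicator BB y * ind n b y) \<le> ennreal (W y * indicator Bl y)" by (rule ennreal_leI)
      also have "\<dots> = ennreal \<bar>W y\<bar> * indicator Bl y" by (simp add: W_def indicator_def)
      finally show "ennreal (\<Sum>b\<in>?N. W y * indicator BB y * ind n b y) \<le> ennreal \<bar>W y\<bar> * indicator Bl y" .
    qed
    finally show ?thesis .
  qed
  have hl: "ennreal num / emeasure M Bl \<le> hl_maximal M \<rho> W x"
  proof -
    have "Bl \<in> {B \<in> qballs X \<rho>. x \<in> B}"
    proof -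
      have "x \<in> Bl" using sub[OF aN] x by (rule subsetD)
      moreover have "Bl \<in> qballs X \<rho>" unfolding Bl_def qballs_def using P rp by blast
      ultimately show ?thesis by simp
    qed
    then have "(\<integral>\<^sup>+y\<in>Bl. ennreal \<bar>W y\<bar> \<partial>M) / emeasure M Bl \<le> hl_maximal M \<rho> W x"
      unfolding hl_maximal_def by (rule SUP_upper)
    then show ?thesis using divide_right_mono_ennreal[OF numI] order_trans by blast
  qed
  show ?thesis
  proof (cases "hl_maximal M \<rho> W x = \<infinity>")
    case True
    then have "hl_maximal_pow M \<rho> r w x = \<infinity>" unfolding hl_maximal_pow_def ennreal_powr_def Weq by simp
    then show ?thesis using Dt_ge_1 by (simp add: ennreal_mult_top)
  next
    case False
    then obtain h where h: "hl_maximal M \<rho> W x = ennreal h" "0 \<le> h"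
      by (cases "hl_maximal M \<rho> W x" rule: ennreal_cases) auto
    have "emeasure M Bl = ennreal (measure M Bl)" using Bs by (intro emeasure_eq_ennreal_measure) (auto simp: fmeasurable_def)
    then have "ennreal (num / measure M Bl) \<le> ennreal h" using hl h num0 Bs by (simp add: divide_ennreal)
    then have "num / measure M Bl \<le> h" using h(2) by simp
    then have "num \<le> h * measure M Bl" using Bs by (simp add: divide_le_eq)
    also have "\<dots> \<le> h * (Dt * (\<Sum>b\<in>?N. cmu n b))" using den h(2) by (intro mult_left_mono)
    finally have q: "num / (\<Sum>b\<in>?N. cmu n b) \<le> Dt * h" using denp by (simp add: divide_le_eq mult_ac)
    have "(num / (\<Sum>b\<in>?N. cmu n b)) powr (1 / r) \<le> (Dt * h) powr (1 / r)"
      using q num0 denp r by (intro powr_mono2) auto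
    also have "\<dots> = Dt powr (1 / r) * h powr (1 / r)" using Dt_ge_1 h(2) by (simp add: powr_mult)
    also have "\<dots> \<le> Dt powr 1 * h powr (1 / r)" using Dt_ge_1 r by (intro mult_right_mono powr_mono) auto
    finally have "(num / (\<Sum>b\<in>?N. cmu n b)) powr (1 / r) \<le> Dt * h powr (1 / r)" using Dt_ge_1 by simp
    then have "ennreal ((num / (\<Sum>b\<in>?N. cmu n b)) powr (1 / r)) \<le> ennreal (Dt * h powr (1 / r))" by (rule ennreal_leI)
    also have "\<dots> = ennreal Dt * ennreal (h powr (1 / r))" using Dt_ge_1 by (simp add: ennreal_mult)
    also have "ennreal (h powr (1 / r)) = hl_maximal_pow M \<rho> r w x"
      using h by (simp add: hl_maximal_pow_def ennreal_powr_def Weq[symmetric])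
    finally show ?thesis by (simp only: num_def W_def)
  qed
qed

end

context cz_grid
begin

lemma L2_bounded_supported:
  fixes g :: "'a \<Rightarrow> real"
  assumes g: "g \<in> borel_measurable M" "S \<in> fmeasurable M" "\<And>x. \<bar>g x\<bar> \<le> c * indicator S x"
  shows "g \<in> L2_functions M"
  unfolding L2_functions_def
proof (intro CollectI conjI g(1) integrable_bounded_supported[OF _ g(2)])
  show "(\<lambda>x. (g x)\<^sup>2) \<in> borel_measurable M" using g(1) by simp
  show "\<bar>(g x)\<^sup>2\<bar> \<le> c\<^sup>2 * indicator S x" for x
    using g(3)[of x] power_mono[OF g(3)[of x] abs_ge_zero, of 2] by (cases "x \<in> S") auto
qed

text \<open>The error \<open>e\<close> must not depend on \<open>v\<close>, which will change with
  \<open>n\<close> when the bad cells of level \<open>n\<close> are removed; only the bound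
  \<open>c\<close> enters. For \<open>v\<close>, the averaging is moved onto \<open>g\<close>, the
  restriction of \<open>T f\<close> to \<open>BB\<close>, whose oscillation tends to 0. For
  \<open>f\<close>, boundedness turns L^1 convergence of the averages into L^2 convergence: the
  squared difference is at most \<open>2 * b\<close> times the absolute difference.\<close>

lemma form_tendsto:
  assumes f: "f \<in> borel_measurable M" "\<And>x. \<bar>f x\<bar> \<le> b * indicator (B x0 (L / (4 * \<kappa>\<^sup>2))) x"
  shows "\<exists>e. e \<longlonglongrightarrow> 0 \<and> (\<forall>n v. v \<in> borel_measurable M \<longrightarrow>
      (\<forall>x. \<bar>v x\<bar> \<le> c * indicator (B x0 (L / (4 * \<kappa>\<^sup>2))) x) \<longrightarrow>
      \<bar>(LINT x|M. T f x * v x) - (LINT x|M. T (step n (avg n f)) x * step n (avg n v) x)\<bar> \<le> e n)"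
proof -
  define B0 where "B0 = B x0 (L / (4 * \<kappa>\<^sup>2))"
  have B0: "B0 \<in> fmeasurable M" "x0 \<in> B0"
    unfolding B0_def using B_fmeasurable[OF x0] B_center[OF x0] L_pos kappa_pos by auto
  have b0: "0 \<le> b" using order_trans[OF abs_ge_zero f(2)[of x0]] B0(2) by (simp add: B0_def)
  have f_out: "f x = 0" if "x \<notin> (\<Union>a\<in>cells n. cell n a)" for x n
  proof -
    have "x \<notin> B x0 (L / (4 * \<kappa>\<^sup>2))" using root_ball[of n] that by (rule contra_subsetD)
    then show ?thesis using f(2)[of x] by simp
  qed
  have f2: "\<bar>f x\<bar> \<le> b * indicator B0 x" for x using f(2)[of x] by (simp only: B0_def)
  have fint: "integrable M f" by (rule integrable_bounded_supported[OF f(1) B0(1) f2])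
  have fL2: "f \<in> L2_functions M" by (rule L2_bounded_supported[OF f(1) B0(1) f2])
  have TfL2: "T f \<in> L2_functions M" by (rule T_L2[OF fL2])
  have BL2: "(indicator BB :: 'a \<Rightarrow> real) \<in> L2_functions M" using BB by (intro L2_functions_indicator)
  define g where "g x = T f x * indicator BB x" for x
  have gint: "integrable M g" unfolding g_def[abs_def] by (rule L2_functions_mult_integrable[OF TfL2 BL2])
  define cc where "cc = max c 0"
  define e where "e n = cc * osc n g + A * sqrt (2 * b * osc n f) * (cc * sqrt (measure M BB))" for n
  have "e \<longlonglongrightarrow> cc * 0 + A * sqrt (2 * b * 0) * (cc * sqrt (measure M BB))"
    unfolding e_def by (intro tendsto_intros osc_tendsto gint fint)
  then have elim: "e \<longlonglongrightarrow> 0" by simp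
  have main: "\<bar>(LINT x|M. T f x * v x) - (LINT x|M. T (step n (avg n f)) x * step n (avg n v) x)\<bar> \<le> e n"
    if v: "v \<in> borel_measurable M" "\<And>x. \<bar>v x\<bar> \<le> c * indicator B0 x" for n v
  proof -
    have c0: "cc = c" using order_trans[OF abs_ge_zero v(2)[of x0]] B0(2) by (simp add: cc_def)
    have c1: "0 \<le> c" using c0 by (simp add: cc_def)
    have v_out: "v x = 0" if "x \<notin> (\<Union>a\<in>cells n. cell n a)" for x
    proof -
      have "x \<notin> B0" unfolding B0_def using root_ball[of n] that by (rule contra_subsetD)
      then show ?thesis using v(2)[of x] by simp
    qed
    have vint: "integrable M v" using integrable_bounded_supported[OF v(1) B0(1) v(2)] .
    have v_le: "\<bar>v x\<bar> \<le> c" for x using v(2)[of x] c1 by (cases "x \<in> B0") auto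
    have vL2: "v \<in> L2_functions M" by (rule L2_bounded_supported[OF v(1) B0(1) v(2)])
    define Ef where "Ef = step n (avg n f)"
    define Ev where "Ev = step n (avg n v)"
    have EL2: "Ef \<in> L2_functions M" "Ev \<in> L2_functions M" by (simp_all add: Ef_def Ev_def step_L2)
    have avb: "\<bar>avg n v a\<bar> \<le> c" if a: "a \<in> cells n" for a
    proof -
      have "\<bar>LINT x|M. v x * ind n a x\<bar> \<le> (LINT x|M. \<bar>v x * ind n a x\<bar>)" by (rule integral_abs_bound)
      also have "\<dots> \<le> (LINT x|M. c * ind n a x)"
        using integrable_mult_ind[OF vint] integral_ind(2)[OF a] v_le
        by (intro integral_mono integrable_abs integrable_mult_right) (auto simp: abs_mult ind_bounds intro!: mult_right_mono)
      also have "\<dots> = c * cmu n a" using integral_ind[OF a] by simp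
      finally show ?thesis using cmu_pos[OF a] by (simp add: avg_def divide_le_eq)
    qed
    have Ev_norm: "L2_norm_of M Ev \<le> c * sqrt (measure M BB)"
    proof -
      have "(\<Sum>a\<in>cells n. (avg n v a)\<^sup>2 * cmu n a) \<le> (\<Sum>a\<in>cells n. c\<^sup>2 * cmu n a)"
      proof (intro sum_mono mult_right_mono)
        fix a assume a: "a \<in> cells n"
        show "(avg n v a)\<^sup>2 \<le> c\<^sup>2" using power_mono[OF avb[OF a] abs_ge_zero, of 2] by simp
        show "0 \<le> cmu n a" using cmu_pos[OF a] by simp
      qed
      also have "\<dots> = c\<^sup>2 * (\<Sum>a\<in>cells n. cmu n a)" by (simp add: sum_distrib_left)
      also have "\<dots> \<le> c\<^sup>2 * measure M BB"
      proof (rule mult_left_mono)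
        have "(\<Sum>a\<in>cells n. cmu n a) = (\<Sum>a\<in>cells n. measure M (X \<inter> cell n a))"
          by (intro sum.cong refl) (simp add: cmu_def Int_absorb1 cell_X)
        also have "\<dots> \<le> measure M (X \<inter> BB)" by (rule sum_measure_cells_le) simp
        finally show "(\<Sum>a\<in>cells n. cmu n a) \<le> measure M BB" using BB(3) by (simp add: Int_absorb1)
      qed simp
      finally have "L2_norm_of M Ev \<le> sqrt (c\<^sup>2 * measure M BB)"
        unfolding Ev_def step_L2_norm by (rule real_sqrt_le_mono)
      then show ?thesis using c1 by (simp add: real_sqrt_mult)
    qed
    have fb: "\<bar>f x\<bar> \<le> b" for x using f2[of x] b0 by (cases "x \<in> B0") auto
    have afb: "\<bar>avg n f a\<bar> \<le> b" if a: "a \<in> cells n" for a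
    proof -
      have "\<bar>LINT x|M. f x * ind n a x\<bar> \<le> (LINT x|M. \<bar>f x * ind n a x\<bar>)" by (rule integral_abs_bound)
      also have "\<dots> \<le> (LINT x|M. b * ind n a x)"
        using integrable_mult_ind[OF fint] integral_ind(2)[OF a] fb
        by (intro integral_mono integrable_abs integrable_mult_right) (auto simp: abs_mult ind_bounds intro!: mult_right_mono)
      also have "\<dots> = b * cmu n a" using integral_ind[OF a] by simp
      finally show ?thesis using cmu_pos[OF a] by (simp add: avg_def divide_le_eq)
    qed
    define d where "d x = 1 * f x + (- 1) * Ef x" for x
    have dL2: "d \<in> L2_functions M" unfolding d_def[abs_def] by (rule L2_functions_lincomb[OF fL2 EL2(1)])
    have d_out: "d x = 0" if "x \<notin> (\<Union>a\<in>cells n. cell n a)" for x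
      using f_out[OF that] step_outside[OF that] by (simp add: d_def Ef_def)
    have d_cell: "d x = f x - avg n f a" if "a \<in> cells n" "x \<in> cell n a" for x a
      using step_cell[OF that] by (simp add: d_def Ef_def)
    have d_norm: "L2_norm_of M d \<le> sqrt (2 * b * osc n f)"
    proof -
      have "(LINT x|M. (d x)\<^sup>2) = (\<Sum>a\<in>cells n. LINT x|M. (d x)\<^sup>2 * ind n a x)"
        using d_out by (intro integral_cells L2_functions_integrable[OF dL2]) auto
      also have "\<dots> \<le> (\<Sum>a\<in>cells n. LINT x|M. 2 * b * (\<bar>avg n f a - f x\<bar> * ind n a x))"
      proof (rule sum_mono)
        fix a assume a: "a \<in> cells n"
        show "(LINT x|M. (d x)\<^sup>2 * ind n a x) \<le> (LINT x|M. 2 * b * (\<bar>avg n f a - f x\<bar> * ind n a x))"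
        proof (rule integral_mono)
          show "integrable M (\<lambda>x. (d x)\<^sup>2 * ind n a x)" by (rule integrable_mult_ind[OF L2_functions_integrable[OF dL2]])
          show "integrable M (\<lambda>x. 2 * b * (\<bar>avg n f a - f x\<bar> * ind n a x))"
            by (rule integrable_mult_right[OF osc_integrable[OF fint a]])
          fix x
          show "(d x)\<^sup>2 * ind n a x \<le> 2 * b * (\<bar>avg n f a - f x\<bar> * ind n a x)"
          proof (cases "x \<in> cell n a")
            case True
            have "(d x)\<^sup>2 = \<bar>avg n f a - f x\<bar> * \<bar>avg n f a - f x\<bar>"
              unfolding d_cell[OF a True] by (simp add: power2_eq_square abs_mult_self_eq algebra_simps)
            also have "\<dots> \<le> 2 * b * \<bar>avg n f a - f x\<bar>"
              using fb[of x] afb[OF a] by (intro mult_right_mono) auto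
            finally show ?thesis using True by (simp add: ind_def)
          qed (simp add: ind_def)
        qed
      qed
      also have "\<dots> = 2 * b * osc n f" by (simp add: osc_def sum_distrib_left)
      finally show ?thesis unfolding L2_norm_of_def by (rule real_sqrt_le_mono)
    qed
    have Td: "AE x in M. T d x = T f x - T Ef x"
      using T_linear[OF fL2 EL2(1), of 1 "- 1"] unfolding d_def[abs_def] by simp
    have int_fv: "integrable M (\<lambda>x. T f x * v x)" "integrable M (\<lambda>x. T f x * Ev x)" "integrable M (\<lambda>x. T Ef x * Ev x)"
      using TfL2 vL2 EL2 T_L2[OF EL2(1)] by (auto intro: L2_functions_mult_integrable)
    have t2: "\<bar>(LINT x|M. T f x * Ev x) - (LINT x|M. T Ef x * Ev x)\<bar> \<le> A * sqrt (2 * b * osc n f) * (c * sqrt (measure M BB))"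
    proof -
      have "(LINT x|M. T f x * Ev x) - (LINT x|M. T Ef x * Ev x) = (LINT x|M. T f x * Ev x - T Ef x * Ev x)"
        using int_fv by simp
      also have "\<dots> = (LINT x|M. T d x * Ev x)"
      proof (rule integral_cong_AE)
        show "AE x in M. T f x * Ev x - T Ef x * Ev x = T d x * Ev x"
          using Td by eventually_elim (simp add: left_diff_distrib)
      qed (use int_fv L2_functions_mult_integrable[OF T_L2[OF dL2] EL2(2)] in auto)
      finally have "\<bar>(LINT x|M. T f x * Ev x) - (LINT x|M. T Ef x * Ev x)\<bar> = \<bar>LINT x|M. T d x * Ev x\<bar>" by (simp only:)
      also have "\<dots> \<le> L2_norm_of M (T d) * L2_norm_of M Ev"
        by (rule L2_Cauchy_Schwarz[OF T_L2[OF dL2] EL2(2)])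
      also have "\<dots> \<le> (A * sqrt (2 * b * osc n f)) * (c * sqrt (measure M BB))"
        using order_trans[OF T_bounded[OF dL2] mult_left_mono[OF d_norm A_nonneg]] Ev_norm A_nonneg b0 osc_nonneg
        by (intro mult_mono L2_norm_nonneg) auto
      finally show ?thesis .
    qed
    have avg_g: "avg n g a = (LINT x|M. T f x * ind n a x) / cmu n a" if a: "a \<in> cells n" for a
    proof -
      have "g x * ind n a x = T f x * ind n a x" for x
        using cell_BB[OF a] by (auto simp: g_def ind_def indicator_def)
      then show ?thesis unfolding avg_def by (simp only:)
    qed
    have Tind: "integrable M (\<lambda>x. T f x * ind n a x)" if a: "a \<in> cells n" for a
      using L2_functions_mult_integrable[OF TfL2 ind_L2[OF a]] .
    have t1: "\<bar>(LINT x|M. T f x * v x) - (LINT x|M. T f x * Ev x)\<bar> \<le> c * osc n g"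
    proof -
      have e1: "(LINT x|M. T f x * v x) = (\<Sum>a\<in>cells n. LINT x|M. g x * v x * ind n a x)"
      proof -
        have "(LINT x|M. T f x * v x) = (\<Sum>a\<in>cells n. LINT x|M. T f x * v x * ind n a x)"
          using v_out by (intro integral_cells int_fv) auto
        also have "\<dots> = (\<Sum>a\<in>cells n. LINT x|M. g x * v x * ind n a x)"
          using cell_BB by (intro sum.cong refl Bochner_Integration.integral_cong) (auto simp: g_def ind_def indicator_def)
        finally show ?thesis .
      qed
      have e2: "(LINT x|M. T f x * Ev x) = (\<Sum>a\<in>cells n. LINT x|M. avg n g a * (v x * ind n a x))"
      proof -
        have "(LINT x|M. T f x * Ev x) = (LINT x|M. (\<Sum>a\<in>cells n. avg n v a * (T f x * ind n a x)))"
          unfolding Ev_def step_def by (simp add: sum_distrib_left mult_ac)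
        also have "\<dots> = (\<Sum>a\<in>cells n. LINT x|M. avg n v a * (T f x * ind n a x))"
          using Tind by (intro Bochner_Integration.integral_sum integrable_mult_right)
        also have "\<dots> = (\<Sum>a\<in>cells n. LINT x|M. avg n g a * (v x * ind n a x))"
        proof (rule sum.cong[OF refl])
          fix a assume a: "a \<in> cells n"
          show "(LINT x|M. avg n v a * (T f x * ind n a x)) = (LINT x|M. avg n g a * (v x * ind n a x))"
            unfolding integral_mult_right_zero avg_g[OF a] by (simp add: avg_def)
        qed
        finally show ?thesis .
      qed
      have gv: "integrable M (\<lambda>x. g x * v x * ind n a x)" for a
      proof -
        have "integrable M (\<lambda>x. T f x * v x * indicator BB x)"
          using integrable_real_mult_indicator[OF BB(2) int_fv(1)] .
        then have "integrable M (\<lambda>x. g x * v x)" by (simp add: g_def mult_ac)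
        then show ?thesis by (rule integrable_mult_ind)
      qed
      have "(LINT x|M. T f x * v x) - (LINT x|M. T f x * Ev x)
        = (\<Sum>a\<in>cells n. LINT x|M. g x * v x * ind n a x - avg n g a * (v x * ind n a x))"
        unfolding e1 e2 sum_subtractf[symmetric]
        using gv integrable_mult_ind[OF vint] by (intro sum.cong refl Bochner_Integration.integral_diff[symmetric] integrable_mult_right)
      then have "\<bar>(LINT x|M. T f x * v x) - (LINT x|M. T f x * Ev x)\<bar>
        = \<bar>\<Sum>a\<in>cells n. LINT x|M. g x * v x * ind n a x - avg n g a * (v x * ind n a x)\<bar>" by (simp only:)
      also have "\<dots> \<le> (\<Sum>a\<in>cells n. \<bar>LINT x|M. g x * v x * ind n a x - avg n g a * (v x * ind n a x)\<bar>)" by (rule sum_abs)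
      also have "\<dots> \<le> (\<Sum>a\<in>cells n. c * (LINT x|M. \<bar>avg n g a - g x\<bar> * ind n a x))"
      proof (rule sum_mono)
        fix a assume a: "a \<in> cells n"
        have "\<bar>LINT x|M. g x * v x * ind n a x - avg n g a * (v x * ind n a x)\<bar>
          \<le> (LINT x|M. \<bar>g x * v x * ind n a x - avg n g a * (v x * ind n a x)\<bar>)" by (rule integral_abs_bound)
        also have "\<dots> \<le> (LINT x|M. c * (\<bar>avg n g a - g x\<bar> * ind n a x))"
        proof (rule integral_mono)
          show "integrable M (\<lambda>x. \<bar>g x * v x * ind n a x - avg n g a * (v x * ind n a x)\<bar>)"
            using gv integrable_mult_ind[OF vint] by (intro integrable_abs Bochner_Integration.integrable_diff integrable_mult_right)
          show "integrable M (\<lambda>x. c * (\<bar>avg n g a - g x\<bar> * ind n a x))"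
            by (rule integrable_mult_right[OF osc_integrable[OF gint a]])
          fix x
          have "g x * v x * ind n a x - avg n g a * (v x * ind n a x) = - (v x * ((avg n g a - g x) * ind n a x))"
            by (simp add: algebra_simps)
          then have "\<bar>g x * v x * ind n a x - avg n g a * (v x * ind n a x)\<bar> = \<bar>v x\<bar> * (\<bar>avg n g a - g x\<bar> * ind n a x)"
            by (simp only: abs_minus_cancel abs_mult abs_of_nonneg[OF ind_bounds(1)])
          also have "\<dots> \<le> c * (\<bar>avg n g a - g x\<bar> * ind n a x)"
            using v_le by (intro mult_right_mono mult_nonneg_nonneg ind_bounds) auto
          finally show "\<bar>g x * v x * ind n a x - avg n g a * (v x * ind n a x)\<bar> \<le> c * (\<bar>avg n g a - g x\<bar> * ind n a x)" .
        qed
        finally show "\<bar>LINT x|M. g x * v x * ind n a x - avg n g a * (v x * ind n a x)\<bar> \<le> c * (LINT x|M. \<bar>avg n g a - g x\<bar> * ind n a x)"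
          by simp
      qed
      also have "\<dots> = c * osc n g" by (simp add: osc_def sum_distrib_left)
      finally show ?thesis .
    qed
    show ?thesis using t1 t2 unfolding e_def c0 Ef_def[symmetric] Ev_def[symmetric] by linarith
  qed
  show ?thesis
  proof (intro exI[of _ e] conjI elim allI impI)
    fix n v assume "v \<in> borel_measurable M" "\<forall>x. \<bar>v x\<bar> \<le> c * indicator (B x0 (L / (4 * \<kappa>\<^sup>2))) x"
    then show "\<bar>(LINT x|M. T f x * v x) - (LINT x|M. T (step n (avg n f)) x * step n (avg n v) x)\<bar> \<le> e n"
      by (intro main) (auto simp: B0_def)
  qed
qed

end

section \<open>The weak type inequality\<close>

context cz_grid
begin

text \<open>The discrete counterpart of \<open>hl_maximal_pow\<close>, bounded by it up to the
  factor \<open>Dt\<close> throughout each cell.\<close>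

definition grid_max :: "nat \<Rightarrow> real \<Rightarrow> ('a \<Rightarrow> real) \<Rightarrow> 'a \<Rightarrow> real" where
  "grid_max n r w a = Max ((\<lambda>l. ((\<Sum>b\<in>{b\<in>cells n. gnr n l a b}. avg n (\<lambda>x. w x powr r * indicator BB x) b * cmu n b)
      / (\<Sum>b\<in>{b\<in>cells n. gnr n l a b}. cmu n b)) powr (1 / r)) ` {..n})"

lemma grid_max_ge:
  "l \<le> n \<Longrightarrow> ((\<Sum>b\<in>{b\<in>cells n. gnr n l a b}. avg n (\<lambda>x. w x powr r * indicator BB x) b * cmu n b)
      / (\<Sum>b\<in>{b\<in>cells n. gnr n l a b}. cmu n b)) powr (1 / r) \<le> grid_max n r w a"
  unfolding grid_max_def by (rule Max_ge) auto

lemma grid_max_nonneg: "0 \<le> grid_max n r w a"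
  by (rule order_trans[OF powr_ge_zero grid_max_ge[of 0 n]]) simp

lemma grid_max_le_maximal:
  assumes a: "a \<in> cells n" "x \<in> cell n a" and r: "1 < r"
    and w: "w \<in> borel_measurable M" "\<And>x. 0 \<le> w x" and int: "integrable M (\<lambda>x. w x powr r * indicator BB x)"
  shows "ennreal (grid_max n r w a / Dt) \<le> hl_maximal_pow M \<rho> r w x"
proof -
  have "grid_max n r w a \<in> (\<lambda>l. ((\<Sum>b\<in>{b\<in>cells n. gnr n l a b}. avg n (\<lambda>x. w x powr r * indicator BB x) b * cmu n b)
      / (\<Sum>b\<in>{b\<in>cells n. gnr n l a b}. cmu n b)) powr (1 / r)) ` {..n}"
    unfolding grid_max_def by (rule Max_in) auto
  then obtain l where l: "l \<le> n"
    and eq: "grid_max n r w a = ((\<Sum>b\<in>{b\<in>cells n. gnr n l a b}. avg n (\<lambda>x. w x powr r * indicator BB x) b * cmu n b)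
      / (\<Sum>b\<in>{b\<in>cells n. gnr n l a b}. cmu n b)) powr (1 / r)" by auto
  have le: "ennreal (grid_max n r w a) \<le> ennreal Dt * hl_maximal_pow M \<rho> r w x"
    unfolding eq by (rule nbh_average_le_maximal[OF a(1) l a(2) r w int])
  show ?thesis
  proof (cases "hl_maximal_pow M \<rho> r w x" rule: ennreal_cases)
    case (real h)
    have "ennreal (grid_max n r w a) \<le> ennreal (Dt * h)"
      using le Dt_ge_1 unfolding real(2) by (simp add: ennreal_mult real(1))
    then have "grid_max n r w a \<le> Dt * h" using Dt_ge_1 real(1) by simp
    then show ?thesis unfolding real(2) using Dt_ge_1 by (intro ennreal_leI) (simp add: divide_le_eq mult.commute)
  qed simp
qed

text \<open>The left side is the integral of \<open>g\<close> times a step function, so a pointwise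
  comparison of the integrands is enough, whether or not \<open>hl_maximal_pow\<close> is
  measurable.\<close>

lemma sum_grid_max_le:
  assumes r: "1 < r" and g: "integrable M g" "\<And>x. 0 \<le> g x"
    and w: "w \<in> borel_measurable M" "\<And>x. 0 \<le> w x" and int: "integrable M (\<lambda>x. w x powr r * indicator BB x)"
  shows "ennreal ((\<Sum>a\<in>cells n. avg n g a * cmu n a * grid_max n r w a) / Dt)
    \<le> (\<integral>\<^sup>+x. ennreal (g x) * hl_maximal_pow M \<rho> r w x \<partial>M)"
proof -
  define G where "G a = grid_max n r w a / Dt" for a
  have G0: "0 \<le> G a" for a using grid_max_nonneg Dt_ge_1 by (simp add: G_def)
  have "(\<Sum>a\<in>cells n. avg n g a * cmu n a * grid_max n r w a) / Dt = (\<Sum>a\<in>cells n. G a * (LINT x|M. g x * ind n a x))"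
    unfolding sum_divide_distrib by (intro sum.cong refl) (simp add: avg_cmu G_def)
  also have "\<dots> = (LINT x|M. (\<Sum>a\<in>cells n. G a * (g x * ind n a x)))"
    using integrable_mult_ind[OF g(1)] by simp
  finally have "ennreal ((\<Sum>a\<in>cells n. avg n g a * cmu n a * grid_max n r w a) / Dt)
    = ennreal (LINT x|M. (\<Sum>a\<in>cells n. G a * (g x * ind n a x)))" by (simp only:)
  also have "\<dots> = (\<integral>\<^sup>+x. ennreal (\<Sum>a\<in>cells n. G a * (g x * ind n a x)) \<partial>M)"
  proof (rule nn_integral_eq_integral[symmetric])
    show "integrable M (\<lambda>x. \<Sum>a\<in>cells n. G a * (g x * ind n a x))"
      using integrable_mult_ind[OF g(1)] by (intro Bochner_Integration.integrable_sum integrable_mult_right)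
    show "AE x in M. 0 \<le> (\<Sum>a\<in>cells n. G a * (g x * ind n a x))"
      by (intro AE_I2 sum_nonneg mult_nonneg_nonneg ind_bounds g(2) G0)
  qed
  also have "\<dots> \<le> (\<integral>\<^sup>+x. ennreal (g x) * hl_maximal_pow M \<rho> r w x \<partial>M)"
  proof (rule nn_integral_mono)
    fix x
    have eq: "(\<Sum>a\<in>cells n. G a * (g x * ind n a x)) = g x * step n G x"
      by (simp add: step_def sum_distrib_left mult_ac)
    show "ennreal (\<Sum>a\<in>cells n. G a * (g x * ind n a x)) \<le> ennreal (g x) * hl_maximal_pow M \<rho> r w x"
    proof (cases "x \<in> (\<Union>a\<in>cells n. cell n a)")
      case True
      then obtain a where a: "a \<in> cells n" "x \<in> cell n a" by blast
      have "ennreal (g x * G a) = ennreal (g x) * ennreal (G a)" by (rule ennreal_mult[OF g(2) G0])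
      also have "\<dots> \<le> ennreal (g x) * hl_maximal_pow M \<rho> r w x"
        unfolding G_def by (intro mult_left_mono grid_max_le_maximal[OF a r w int]) simp
      finally show ?thesis unfolding eq step_cell[OF a] .
    next
      case False
      show ?thesis unfolding eq step_outside[OF False] by simp
    qed
  qed
  finally show ?thesis .
qed

text \<open>The cells near a cube on which the average of \<open>f\<close> exceeds the level \<open>1\<close>; they play the
  role of a dilate of the set where the dyadic maximal function is large.\<close>

definition bad_cells :: "nat \<Rightarrow> ('a \<Rightarrow> real) \<Rightarrow> 'a set" where
  "bad_cells n ph = {b\<in>cells n. \<exists>l\<le>n. \<exists>c\<in>cells n. (\<Sum>a\<in>{a\<in>cells n. Pr n l a = Pr n l c}. cmu n a)
     < (\<Sum>a\<in>{a\<in>cells n. Pr n l a = Pr n l c}. ph a * cmu n a) \<and> gnr n l c b}"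

text \<open>This is \<open>large_cube_cover\<close> at level 1. Its hypothesis on the averages of
  the weight over neighbourhoods is the power mean inequality followed by
  \<open>grid_max_ge\<close>.\<close>

lemma bad_cells_weight:
  assumes r: "1 < r" and ph: "\<And>a. 0 \<le> ph a" and w: "\<And>x. 0 \<le> w x" and F: "F \<subseteq> BB"
    and int: "integrable M (\<lambda>x. w x * indicator F x)" "integrable M (\<lambda>x. w x powr r * indicator BB x)"
  shows "(\<Sum>b\<in>bad_cells n ph. avg n (\<lambda>x. w x * indicator F x) b * cmu n b)
    \<le> Dt * (\<Sum>a\<in>cells n. ph a * cmu n a * grid_max n r w a)"
proof -
  interpret t: cube_tree "cells n" "cmu n" n "Pr n" "gnr n" Dt by (rule grid_cube_tree)
  define u where "u = avg n (\<lambda>x. w x * indicator F x)"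
  define W where "W = avg n (\<lambda>x. w x powr r * indicator BB x)"
  have u0: "0 \<le> u a" for a unfolding u_def by (intro avg_nonneg mult_nonneg_nonneg w) simp
  have W0: "0 \<le> W a" for a unfolding W_def by (intro avg_nonneg mult_nonneg_nonneg) simp_all
  have uW: "u a \<le> W a powr (1 / r)" if "a \<in> cells n" for a
    unfolding u_def W_def by (rule avg_power_mean[OF that r w F int])
  have "(\<Sum>b\<in>{b\<in>cells n. \<exists>l\<le>n. \<exists>c\<in>cells n. 1 * t.mass (t.cube l c) < (\<Sum>a\<in>t.cube l c. ph a * cmu n a) \<and> gnr n l c b}. u b * cmu n b)
    \<le> Dt / 1 * (\<Sum>a\<in>cells n. ph a * cmu n a * grid_max n r w a)"
  proof (rule t.large_cube_cover)
    fix a l assume a: "a \<in> cells n" "l \<le> n"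
    have R: "(l, t.cube l a) \<in> t.cubes" unfolding t.cubes_def using a by blast
    have "t.nbh_avg u (l, t.cube l a) \<le> t.nbh_avg W (l, t.cube l a) powr (1 / r)"
      by (rule t.nbh_avg_power_mean(1)[OF R r u0 W0 uW])
    then have "(\<Sum>b\<in>t.nbh l a. u b * cmu n b) / t.mass (t.nbh l a) \<le> ((\<Sum>b\<in>t.nbh l a. W b * cmu n b) / t.mass (t.nbh l a)) powr (1 / r)"
      unfolding t.nbh_avg_def t.cube_nbh_eq[OF a] .
    also have "\<dots> \<le> grid_max n r w a"
      unfolding t.nbh_def t.mass_def W_def by (rule grid_max_ge[OF a(2)])
    finally have "(\<Sum>b\<in>t.nbh l a. u b * cmu n b) / t.mass (t.nbh l a) \<le> grid_max n r w a" .
    moreover have "0 < t.mass (t.nbh l a)"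
      unfolding t.mass_def t.nbh_def using t.nr_refl[OF a] a cmu_pos by (intro sum_pos) auto
    ultimately show "(\<Sum>b\<in>t.nbh l a. u b * cmu n b) \<le> grid_max n r w a * t.mass (t.nbh l a)"
      by (simp add: divide_le_eq)
  qed (use ph u0 in auto)
  then show ?thesis unfolding u_def bad_cells_def t.cube_def t.mass_def by simp
qed

lemma sum_avg_cmu:
  assumes g: "integrable M g" "\<And>x. x \<notin> B x0 (L / (4 * \<kappa>\<^sup>2)) \<Longrightarrow> g x = 0"
  shows "(LINT x|M. g x) = (\<Sum>a\<in>cells n. avg n g a * cmu n a)"
proof -
  have "(LINT x|M. g x) = (\<Sum>a\<in>cells n. LINT x|M. g x * ind n a x)"
    by (rule integral_cells[OF g(1)], rule g(2), rule contra_subsetD[OF root_ball])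
  then show ?thesis using avg_cmu by simp
qed

text \<open>The set \<open>F0\<close> lies in a ball and \<open>w\<close> is at most
  \<open>c\<close> on it, so its weight is finite and half of it can be absorbed. The assumption
  \<open>K\<close> is the conclusion of \<open>weighted_form_bound\<close> for this grid, with
  \<open>Kr\<close> standing for the constant times the logarithm.\<close>

lemma level_bound:
  defines "B0 \<equiv> B x0 (L / (4 * \<kappa>\<^sup>2))"
  assumes r: "1 < r" and Kr: "0 \<le> Kr"
    and K: "\<And>v f ph u W G.
      (\<forall>a\<in>cells n. \<bar>f a\<bar> \<le> ph a \<and> \<bar>v a\<bar> \<le> u a \<and> 0 \<le> W a \<and> u a \<le> W a powr (1 / r)) \<Longrightarrow>
      (\<forall>a\<in>cells n. \<forall>l\<le>n. ((\<Sum>b\<in>{b\<in>cells n. gnr n l a b}. W b * cmu n b) / (\<Sum>b\<in>{b\<in>cells n. gnr n l a b}. cmu n b)) powr (1 / r) \<le> G a) \<Longrightarrow>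
      (\<forall>a\<in>cells n. \<forall>l\<le>n. 0 < (\<Sum>b\<in>{b\<in>cells n. gnr n l a b}. u b * cmu n b) \<longrightarrow>
        (\<Sum>b\<in>{b\<in>cells n. Pr n l b = Pr n l a}. ph b * cmu n b) \<le> (\<Sum>b\<in>{b\<in>cells n. Pr n l b = Pr n l a}. cmu n b)) \<Longrightarrow>
      \<bar>LINT x|M. T (step n f) x * step n v x\<bar>
        \<le> Kr * (\<Sum>a\<in>cells n. ph a * cmu n a * G a) + (\<Sum>a\<in>cells n. u a * cmu n a) / 2"
    and f: "f \<in> borel_measurable M" "\<And>x. \<bar>f x\<bar> \<le> b * indicator B0 x"
    and w: "w \<in> borel_measurable M" "\<And>x. 0 \<le> w x" and int: "integrable M (\<lambda>x. w x powr r * indicator BB x)"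
    and F0: "F0 \<in> sets M" "F0 \<subseteq> B0" and c: "0 \<le> c" and F0c: "\<And>x. x \<in> F0 \<Longrightarrow> 1 < \<bar>T f x\<bar> \<and> w x \<le> c"
    and e: "\<And>v. v \<in> borel_measurable M \<Longrightarrow> (\<And>x. \<bar>v x\<bar> \<le> c * indicator B0 x) \<Longrightarrow>
      \<bar>(LINT x|M. T f x * v x) - (LINT x|M. T (step n (avg n f)) x * step n (avg n v) x)\<bar> \<le> e"
  shows "(LINT x|M. w x * indicator F0 x)
    \<le> (2 * Kr + Dt) * (\<Sum>a\<in>cells n. avg n (\<lambda>x. \<bar>f x\<bar>) a * cmu n a * grid_max n r w a) + 2 * e"
proof -
  have B0: "B0 \<in> fmeasurable M" "B0 \<subseteq> BB"
    using B_fmeasurable[OF x0] root_ball[of n] cell_BB unfolding B0_def by blast+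
  have fL2: "f \<in> L2_functions M" by (rule L2_bounded_supported[OF f(1) B0(1) f(2)])
  note Tfm [measurable] = L2_functions_measurable[OF T_L2[OF fL2]]
  note [measurable] = w(1) F0(1)
  define ph where "ph = avg n (\<lambda>x. \<bar>f x\<bar>)"
  define W where "W = avg n (\<lambda>x. w x powr r * indicator BB x)"
  define G where "G = grid_max n r w"
  define J where "J = (\<Sum>a\<in>cells n. ph a * cmu n a * G a)"
  define H where "H = (\<Union>a\<in>bad_cells n ph. cell n a)"
  define F where "F = F0 - H"
  have bad_sub: "bad_cells n ph \<subseteq> cells n" by (auto simp: bad_cells_def)
  have fin_bad: "finite (bad_cells n ph)" by (rule finite_subset[OF bad_sub]) simp
  have Hs [measurable]: "H \<in> sets M" unfolding H_def by (intro sets.finite_UN fin_bad cell_sets)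
  have Fs [measurable]: "F \<in> sets M" unfolding F_def by (rule sets.Diff[OF F0(1) Hs])
  have FF0: "F \<subseteq> F0" by (auto simp: F_def)
  have FBB: "F \<subseteq> BB" using FF0 F0(2) B0(2) by blast
  have ph0: "0 \<le> ph a" for a unfolding ph_def by (rule avg_nonneg) simp
  have W0: "0 \<le> W a" for a unfolding W_def by (intro avg_nonneg mult_nonneg_nonneg) simp_all
  have ind_le: "\<bar>w x * indicator S x\<bar> \<le> c * indicator B0 x" if "S \<subseteq> F0" for S x
  proof (cases "x \<in> S")
    case True
    then have "x \<in> F0" using that by blast
    then have "x \<in> B0" "w x \<le> c" using F0(2) F0c by auto
    then show ?thesis using True w(2)[of x] by simp
  qed (simp add: c)
  have w_int: "integrable M (\<lambda>x. w x * indicator S x)" if "S \<subseteq> F0" "S \<in> sets M" for S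
  proof (rule integrable_bounded_supported[OF _ B0(1) ind_le[OF that(1)]])
    note [measurable] = that(2)
    show "(\<lambda>x. w x * indicator S x) \<in> borel_measurable M" by measurable
  qed
  define u where "u = avg n (\<lambda>x. w x * indicator F x)"
  define v where "v x = sgn (T f x) * (w x * indicator F x)" for x
  have vm: "v \<in> borel_measurable M" unfolding v_def[abs_def] by measurable
  have absv: "\<bar>v x\<bar> = w x * indicator F x" for x
  proof (cases "x \<in> F")
    case True
    then have "T f x \<noteq> 0" using F0c[of x] FF0 by auto
    then show ?thesis using True w(2)[of x] by (simp add: v_def abs_mult abs_sgn_eq)
  qed (simp add: v_def)
  have v_le: "\<bar>v x\<bar> \<le> c * indicator B0 x" for x
    unfolding absv using ind_le[OF FF0, of x] by linarith
  have vL2: "v \<in> L2_functions M" by (rule L2_bounded_supported[OF vm B0(1) v_le])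
  have uW: "u a \<le> W a powr (1 / r)" if "a \<in> cells n" for a
    unfolding u_def W_def by (rule avg_power_mean[OF that r w(2) FBB w_int[OF FF0 Fs] int])
  have u_zero: "u b = 0" if "b \<in> bad_cells n ph" for b
    unfolding u_def
  proof (rule avg_mono_zero)
    fix x assume "x \<in> cell n b"
    then have "x \<notin> F" using that by (auto simp: F_def H_def)
    then show "w x * indicator F x = 0" by simp
  qed
  have form: "\<bar>LINT x|M. T (step n (avg n f)) x * step n (avg n v) x\<bar> \<le> Kr * J + (\<Sum>a\<in>cells n. u a * cmu n a) / 2"
    unfolding J_def
  proof (rule K[where W = W])
    show "\<forall>a\<in>cells n. \<bar>avg n f a\<bar> \<le> ph a \<and> \<bar>avg n v a\<bar> \<le> u a \<and> 0 \<le> W a \<and> u a \<le> W a powr (1 / r)"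
    proof (intro ballI conjI W0 uW)
      fix a
      show "\<bar>avg n f a\<bar> \<le> ph a" unfolding ph_def by (rule avg_abs_le)
      show "\<bar>avg n v a\<bar> \<le> u a" using avg_abs_le[of n v a] unfolding u_def absv .
    qed
    show "\<forall>a\<in>cells n. \<forall>l\<le>n. ((\<Sum>b\<in>{b\<in>cells n. gnr n l a b}. W b * cmu n b)
        / (\<Sum>b\<in>{b\<in>cells n. gnr n l a b}. cmu n b)) powr (1 / r) \<le> G a"
      unfolding W_def G_def using grid_max_ge by blast
    show "\<forall>a\<in>cells n. \<forall>l\<le>n. 0 < (\<Sum>b\<in>{b\<in>cells n. gnr n l a b}. u b * cmu n b) \<longrightarrow>
        (\<Sum>b\<in>{b\<in>cells n. Pr n l b = Pr n l a}. ph b * cmu n b) \<le> (\<Sum>b\<in>{b\<in>cells n. Pr n l b = Pr n l a}. cmu n b)"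
    proof (intro ballI allI impI)
      fix a l assume a: "a \<in> cells n" "l \<le> n" and pos: "0 < (\<Sum>b\<in>{b\<in>cells n. gnr n l a b}. u b * cmu n b)"
      show "(\<Sum>b\<in>{b\<in>cells n. Pr n l b = Pr n l a}. ph b * cmu n b) \<le> (\<Sum>b\<in>{b\<in>cells n. Pr n l b = Pr n l a}. cmu n b)"
      proof (rule ccontr)
        \<comment> \<open>If \<open>ph\<close> averaged more than 1 on this cube, all cells of its
          neighbourhood would be bad, and \<open>u\<close> would vanish on them.\<close>
        assume neg: "\<not> ?thesis"
        have "u b * cmu n b = 0" if "b \<in> {b\<in>cells n. gnr n l a b}" for b
        proof -
          have "b \<in> bad_cells n ph" unfolding bad_cells_def using that a neg by (auto simp: not_le)
          then show ?thesis using u_zero by simp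
        qed
        then have "(\<Sum>b\<in>{b\<in>cells n. gnr n l a b}. u b * cmu n b) = 0" by (rule sum.neutral[OF ballI])
        then show False using pos by simp
      qed
    qed
  qed
  have U: "(LINT x|M. w x * indicator F x) = (\<Sum>a\<in>cells n. u a * cmu n a)"
    unfolding u_def
  proof (rule sum_avg_cmu[OF w_int[OF FF0 Fs]])
    fix x assume "x \<notin> B x0 (L / (4 * \<kappa>\<^sup>2))"
    then have "x \<notin> F" using FF0 F0(2) by (auto simp: B0_def)
    then show "w x * indicator F x = 0" by simp
  qed
  have "(LINT x|M. w x * indicator F x) \<le> (LINT x|M. T f x * v x)"
  proof (rule integral_mono[OF w_int[OF FF0 Fs] L2_functions_mult_integrable[OF T_L2[OF fL2] vL2]])
    fix x
    show "w x * indicator F x \<le> T f x * v x"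
    proof (cases "x \<in> F")
      case True
      then have "1 * w x \<le> \<bar>T f x\<bar> * w x" using F0c[of x] FF0 w(2)[of x] by (intro mult_right_mono) auto
      then show ?thesis using True by (simp add: v_def abs_sgn mult_ac)
    qed (simp add: v_def)
  qed
  \<comment> \<open>Absorption: the integral is at most \<open>Kr * J + e\<close> plus half of
    itself, since by \<open>U\<close> the sum in \<open>form\<close> is this very integral.\<close>
  then have good: "(LINT x|M. w x * indicator F x) \<le> 2 * Kr * J + 2 * e"
    using form e[OF vm v_le] unfolding U by (simp add: abs_le_iff)
  have F0BB: "F0 \<subseteq> BB" using F0(2) B0(2) by blast
  have HF: "F0 \<inter> H \<subseteq> F0" "F0 \<inter> H \<in> sets M" using F0(1) Hs by auto
  have "(LINT x|M. w x * indicator (F0 \<inter> H) x) = (\<Sum>a\<in>cells n. avg n (\<lambda>x. w x * indicator (F0 \<inter> H) x) a * cmu n a)"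
  proof (rule sum_avg_cmu[OF w_int[OF HF]])
    fix x assume "x \<notin> B x0 (L / (4 * \<kappa>\<^sup>2))"
    then have "x \<notin> F0 \<inter> H" using F0(2) by (auto simp: B0_def)
    then show "w x * indicator (F0 \<inter> H) x = 0" by simp
  qed
  also have "\<dots> = (\<Sum>a\<in>bad_cells n ph. avg n (\<lambda>x. w x * indicator F0 x) a * cmu n a)"
  proof (rule sum.mono_neutral_cong_right)
    show "\<forall>a\<in>cells n - bad_cells n ph. avg n (\<lambda>x. w x * indicator (F0 \<inter> H) x) a * cmu n a = 0"
    proof
      fix a assume a: "a \<in> cells n - bad_cells n ph"
      have "w x * indicator (F0 \<inter> H) x = 0" if x: "x \<in> cell n a" for x
      proof -
        have "x \<notin> H" unfolding H_def using a x by (auto simp: cell_def)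
        then show ?thesis by simp
      qed
      then have "avg n (\<lambda>x. w x * indicator (F0 \<inter> H) x) a = 0" by (rule avg_mono_zero)
      then show "avg n (\<lambda>x. w x * indicator (F0 \<inter> H) x) a * cmu n a = 0" by simp
    qed
    fix a assume a: "a \<in> bad_cells n ph"
    have "w x * indicator (F0 \<inter> H) x * ind n a x = w x * indicator F0 x * ind n a x" for x
      using a by (cases "x \<in> cell n a") (auto simp: H_def ind_def indicator_def)
    then show "avg n (\<lambda>x. w x * indicator (F0 \<inter> H) x) a * cmu n a = avg n (\<lambda>x. w x * indicator F0 x) a * cmu n a"
      unfolding avg_def by (simp only:)
  qed (use bad_sub in auto)
  also have "\<dots> \<le> Dt * J"
    unfolding J_def G_def by (rule bad_cells_weight[OF r ph0 w(2) F0BB w_int[OF order_refl F0(1)] int])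
  finally have bad: "(LINT x|M. w x * indicator (F0 \<inter> H) x) \<le> Dt * J" .
  have "(LINT x|M. w x * indicator F0 x) = (LINT x|M. w x * indicator F x + w x * indicator (F0 \<inter> H) x)"
    by (rule Bochner_Integration.integral_cong[OF refl]) (auto simp: F_def indicator_def)
  also have "\<dots> = (LINT x|M. w x * indicator F x) + (LINT x|M. w x * indicator (F0 \<inter> H) x)"
    by (rule Bochner_Integration.integral_add[OF w_int[OF FF0 Fs] w_int[OF HF]])
  also have "\<dots> \<le> (2 * Kr + Dt) * J + 2 * e" using good bad by (simp add: distrib_right)
  finally show ?thesis unfolding J_def ph_def G_def .
qed

text \<open>The limit in \<open>n\<close>: the bound by \<open>sum_grid_max_le\<close> and the left
  side are the same for all \<open>n\<close>, and the errors \<open>e n\<close> tend to 0.\<close>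

lemma local_weak_type:
  defines "B0 \<equiv> B x0 (L / (4 * \<kappa>\<^sup>2))"
  assumes r: "1 < r" and Kr: "0 \<le> Kr"
    and K: "\<And>n v f ph u W G.
      (\<forall>a\<in>cells n. \<bar>f a\<bar> \<le> ph a \<and> \<bar>v a\<bar> \<le> u a \<and> 0 \<le> W a \<and> u a \<le> W a powr (1 / r)) \<Longrightarrow>
      (\<forall>a\<in>cells n. \<forall>l\<le>n. ((\<Sum>b\<in>{b\<in>cells n. gnr n l a b}. W b * cmu n b) / (\<Sum>b\<in>{b\<in>cells n. gnr n l a b}. cmu n b)) powr (1 / r) \<le> G a) \<Longrightarrow>
      (\<forall>a\<in>cells n. \<forall>l\<le>n. 0 < (\<Sum>b\<in>{b\<in>cells n. gnr n l a b}. u b * cmu n b) \<longrightarrow>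
        (\<Sum>b\<in>{b\<in>cells n. Pr n l b = Pr n l a}. ph b * cmu n b) \<le> (\<Sum>b\<in>{b\<in>cells n. Pr n l b = Pr n l a}. cmu n b)) \<Longrightarrow>
      \<bar>LINT x|M. T (step n f) x * step n v x\<bar>
        \<le> Kr * (\<Sum>a\<in>cells n. ph a * cmu n a * G a) + (\<Sum>a\<in>cells n. u a * cmu n a) / 2"
    and f: "f \<in> borel_measurable M" "\<And>x. \<bar>f x\<bar> \<le> b * indicator B0 x"
    and w: "w \<in> borel_measurable M" "\<And>x. 0 \<le> w x" and int: "integrable M (\<lambda>x. w x powr r * indicator BB x)"
    and F0: "F0 \<in> sets M" "F0 \<subseteq> B0" and c: "0 \<le> c" and F0c: "\<And>x. x \<in> F0 \<Longrightarrow> 1 < \<bar>T f x\<bar> \<and> w x \<le> c"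
  shows "ennreal (LINT x|M. w x * indicator F0 x)
    \<le> ennreal ((2 * Kr + Dt) * Dt) * (\<integral>\<^sup>+x. ennreal \<bar>f x\<bar> * hl_maximal_pow M \<rho> r w x \<partial>M)"
proof -
  have B0: "B0 \<in> fmeasurable M" using B_fmeasurable[OF x0] unfolding B0_def .
  have fint: "integrable M (\<lambda>x. \<bar>f x\<bar>)" by (rule integrable_abs[OF integrable_bounded_supported[OF f(1) B0(1) f(2)]])
  obtain e where e: "e \<longlonglongrightarrow> 0" "\<And>n v. v \<in> borel_measurable M \<Longrightarrow> (\<And>x. \<bar>v x\<bar> \<le> c * indicator B0 x) \<Longrightarrow>
      \<bar>(LINT x|M. T f x * v x) - (LINT x|M. T (step n (avg n f)) x * step n (avg n v) x)\<bar> \<le> e n"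
    using form_tendsto[OF f(1), of b c] f(2) unfolding B0_def by blast
  define U where "U = (LINT x|M. w x * indicator F0 x)"
  define Cn where "Cn = (2 * Kr + Dt) * Dt"
  have Cn: "0 < Cn" unfolding Cn_def using Kr Dt_ge_1 by (intro mult_pos_pos) auto
  show ?thesis
  proof (cases "\<integral>\<^sup>+x. ennreal \<bar>f x\<bar> * hl_maximal_pow M \<rho> r w x \<partial>M" rule: ennreal_cases)
    case (real q)
    have "U \<le> Cn * q + 2 * e n" for n
    proof -
      define J where "J = (\<Sum>a\<in>cells n. avg n (\<lambda>x. \<bar>f x\<bar>) a * cmu n a * grid_max n r w a)"
      have "ennreal (J / Dt) \<le> ennreal q"
        unfolding J_def real(2)[symmetric] by (rule sum_grid_max_le[OF r fint _ w int]) simp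
      then have "J / Dt \<le> q" using real(1) by simp
      then have "J \<le> Dt * q" using Dt_ge_1 by (simp add: divide_le_eq mult.commute)
      then have "(2 * Kr + Dt) * J \<le> (2 * Kr + Dt) * (Dt * q)" using Kr Dt_ge_1 by (intro mult_left_mono) auto
      moreover have "U \<le> (2 * Kr + Dt) * J + 2 * e n"
        unfolding U_def J_def
        by (rule level_bound[OF r Kr K f[unfolded B0_def] w int F0[unfolded B0_def] c F0c e(2)[unfolded B0_def]])
      ultimately show ?thesis by (simp add: Cn_def)
    qed
    moreover have "(\<lambda>n. Cn * q + 2 * e n) \<longlonglongrightarrow> Cn * q + 2 * 0" by (intro tendsto_intros e)
    ultimately have "U \<le> Cn * q + 2 * 0" by (intro LIMSEQ_le_const) auto
    then have "ennreal U \<le> ennreal (Cn * q)" by (intro ennreal_leI) simp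
    also have "\<dots> = ennreal Cn * ennreal q" using Cn real(1) by (simp add: ennreal_mult)
    finally show ?thesis unfolding U_def Cn_def real(2) .
  next
    case top
    then show ?thesis using Cn unfolding Cn_def[symmetric] by (simp add: ennreal_mult_top)
  qed
qed

end

section \<open>From functions bounded on a ball to all of L^2\<close>

context cz_operator
begin

text \<open>\<open>C\<close> is fixed before the centre and the radius. This works because
  \<open>Dt\<close>, \<open>Cst\<close> and \<open>th\<close> are functions of
  \<open>\<kappa>\<close>, \<open>Dm\<close>, \<open>\<eta>\<close>, \<open>CK\<close> and
  \<open>A\<close> alone; the inequalities they satisfy are read off an arbitrary grid.\<close>

lemma weak_type_ball:
  "\<exists>C>0. \<forall>r w f x0 R b c F. 1 < r \<longrightarrow> x0 \<in> X \<longrightarrow> 0 < R \<longrightarrow> w \<in> borel_measurable M \<longrightarrow> (\<forall>x. 0 \<le> w x) \<longrightarrow>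
     (\<forall>s. integrable M (\<lambda>x. w x powr r * indicator (B x0 s) x)) \<longrightarrow>
     f \<in> borel_measurable M \<longrightarrow> (\<forall>x. \<bar>f x\<bar> \<le> b * indicator (B x0 R) x) \<longrightarrow>
     F \<in> sets M \<longrightarrow> F \<subseteq> B x0 R \<longrightarrow> 0 \<le> c \<longrightarrow> (\<forall>x\<in>F. 1 < \<bar>T f x\<bar> \<and> w x \<le> c) \<longrightarrow>
     ennreal (LINT x|M. w x * indicator F x)
       \<le> ennreal (C * ln (exp 1 + r / (r - 1))) * (\<integral>\<^sup>+x. ennreal \<bar>f x\<bar> * hl_maximal_pow M \<rho> r w x \<partial>M)"
proof (cases "X = {}")
  case True
  then show ?thesis by (intro exI[of _ 1]) auto
next
  case False
  define D where "D = dyadic_grid.Dt \<kappa> Dm"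
  define Cs where "Cs = cz_grid.Cst \<kappa> Dm \<eta> CK A"
  define t where "t = cz_grid.th \<kappa> \<eta>"
  have const: "1 \<le> D" "0 < Cs" "0 < t" "t < 1"
  proof -
    obtain y where "y \<in> X" using False by blast
    then obtain N p where g: "dyadic_grid M \<rho> \<kappa> Dm y 1 N p" using dyadic_grid_exists[of y 1] by auto
    interpret g: cz_grid M \<rho> \<kappa> Dm y 1 N p T K \<eta> CK A
      by (rule cz_grid.intro[OF g cz_operator_axioms])
    show "1 \<le> D" "0 < Cs" "0 < t" "t < 1"
      using g.Dt_ge_1 g.Cst_pos g.th by (simp_all add: D_def Cs_def t_def)
  qed
  obtain k where k: "0 < k"
    and form: "\<forall>(Om :: 'a set) mu n (anc :: nat \<Rightarrow> 'a \<Rightarrow> 'a) nr tau v f ph u W G r.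
    cz_matrix Om mu n anc nr D tau Cs t \<longrightarrow> 1 < r \<longrightarrow>
    (\<forall>a\<in>Om. \<bar>f a\<bar> \<le> ph a \<and> \<bar>v a\<bar> \<le> u a \<and> 0 \<le> W a \<and> u a \<le> W a powr (1 / r)) \<longrightarrow>
    (\<forall>a\<in>Om. \<forall>l\<le>n. ((\<Sum>b\<in>{b\<in>Om. nr l a b}. W b * mu b) / (\<Sum>b\<in>{b\<in>Om. nr l a b}. mu b)) powr (1 / r) \<le> G a) \<longrightarrow>
    (\<forall>a\<in>Om. \<forall>l\<le>n. 0 < (\<Sum>b\<in>{b\<in>Om. nr l a b}. u b * mu b) \<longrightarrow>
      (\<Sum>b\<in>{b\<in>Om. anc l b = anc l a}. ph b * mu b) \<le> (\<Sum>b\<in>{b\<in>Om. anc l b = anc l a}. mu b)) \<longrightarrow>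
    \<bar>\<Sum>a\<in>Om. \<Sum>b\<in>Om. v a * f b * mu a * mu b * tau a b\<bar>
      \<le> k * ln (exp 1 + r / (r - 1)) * (\<Sum>a\<in>Om. ph a * mu a * G a) + (\<Sum>a\<in>Om. u a * mu a) / 2"
    using weighted_form_bound[OF const, where 'a = 'a] by blast
  define C where "C = (2 * k + D) * D"
  show ?thesis
  proof (intro exI[of _ C] conjI allI impI)
    show "0 < C" using k const unfolding C_def by (intro mult_pos_pos) auto
    fix r :: real and w f x0 R b c F
    assume r: "1 < r" and x0: "x0 \<in> X" and R: "0 < R" and w: "w \<in> borel_measurable M" "\<forall>x. 0 \<le> w x"
      and int: "\<forall>s. integrable M (\<lambda>x. w x powr r * indicator (B x0 s) x)"
      and f: "f \<in> borel_measurable M" "\<forall>x. \<bar>f x\<bar> \<le> b * indicator (B x0 R) x"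
      and F: "F \<in> sets M" "F \<subseteq> B x0 R" and c: "0 \<le> c" "\<forall>x\<in>F. 1 < \<bar>T f x\<bar> \<and> w x \<le> c"
    \<comment> \<open>With this size, the ball that the root cube contains by
      \<open>root_ball\<close> has radius exactly \<open>R\<close>.\<close>
    define L where "L = 4 * \<kappa>\<^sup>2 * R"
    have L: "0 < L" "L / (4 * \<kappa>\<^sup>2) = R" using R kappa_pos by (simp_all add: L_def)
    obtain N p where g: "dyadic_grid M \<rho> \<kappa> Dm x0 L N p" using dyadic_grid_exists[OF x0 L(1)] by blast
    interpret g: cz_grid M \<rho> \<kappa> Dm x0 L N p T K \<eta> CK A
      by (rule cz_grid.intro[OF g cz_operator_axioms])
    define ll where "ll = ln (exp 1 + r / (r - 1))"
    have ll: "1 \<le> ll"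
    proof -
      have "ln (exp 1) \<le> ll" unfolding ll_def using r by (subst ln_le_cancel_iff) (auto intro: add_pos_pos)
      then show ?thesis by simp
    qed
    have main: "ennreal (LINT x|M. w x * indicator F x)
       \<le> ennreal ((2 * (k * ll) + g.Dt) * g.Dt) * (\<integral>\<^sup>+x. ennreal \<bar>f x\<bar> * hl_maximal_pow M \<rho> r w x \<partial>M)"
    proof (rule g.local_weak_type[OF r])
      show "0 \<le> k * ll" using k ll by simp
      show "integrable M (\<lambda>x. w x powr r * indicator g.BB x)" unfolding g.BB_def using int by blast
      show "\<bar>f x\<bar> \<le> b * indicator (B x0 (L / (4 * \<kappa>\<^sup>2))) x" for x unfolding L using f(2) by blast
      show "F \<subseteq> B x0 (L / (4 * \<kappa>\<^sup>2))" unfolding L by (rule F(2))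
      show "1 < \<bar>T f x\<bar> \<and> w x \<le> c" if "x \<in> F" for x using c(2) that by blast
      show "0 \<le> w x" for x using w(2) by blast
      fix n v f ph u W G
      assume 1: "\<forall>a\<in>g.cells n. \<bar>f a\<bar> \<le> ph a \<and> \<bar>v a\<bar> \<le> u a \<and> 0 \<le> W a \<and> u a \<le> W a powr (1 / r)"
        and 2: "\<forall>a\<in>g.cells n. \<forall>l\<le>n. ((\<Sum>b\<in>{b\<in>g.cells n. g.gnr n l a b}. W b * g.cmu n b) / (\<Sum>b\<in>{b\<in>g.cells n. g.gnr n l a b}. g.cmu n b)) powr (1 / r) \<le> G a"
        and 3: "\<forall>a\<in>g.cells n. \<forall>l\<le>n. 0 < (\<Sum>b\<in>{b\<in>g.cells n. g.gnr n l a b}. u b * g.cmu n b) \<longrightarrow>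
          (\<Sum>b\<in>{b\<in>g.cells n. g.Pr n l b = g.Pr n l a}. ph b * g.cmu n b) \<le> (\<Sum>b\<in>{b\<in>g.cells n. g.Pr n l b = g.Pr n l a}. g.cmu n b)"
      show "\<bar>LINT x|M. T (g.step n f) x * g.step n v x\<bar>
        \<le> k * ll * (\<Sum>a\<in>g.cells n. ph a * g.cmu n a * G a) + (\<Sum>a\<in>g.cells n. u a * g.cmu n a) / 2"
        unfolding g.form_tau[symmetric] ll_def
        by (rule form[rule_format, OF g.grid_cz_matrix[folded D_def Cs_def t_def] r 1[rule_format] 2[rule_format] 3[rule_format]])
    qed (use w f F c in auto)
    have "(2 * (k * ll) + g.Dt) * g.Dt \<le> C * ll"
    proof -
      have "2 * (k * ll) + D * 1 \<le> 2 * (k * ll) + D * ll" using ll const by (intro add_left_mono mult_left_mono) auto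
      then have "(2 * (k * ll) + D) * D \<le> (2 * (k * ll) + D * ll) * D" using const by (intro mult_right_mono) auto
      also have "\<dots> = C * ll" by (simp add: C_def algebra_simps)
      finally show ?thesis by (simp only: D_def)
    qed
    then have "ennreal ((2 * (k * ll) + g.Dt) * g.Dt) \<le> ennreal (C * ll)" by (rule ennreal_leI)
    then show "ennreal (LINT x|M. w x * indicator F x)
       \<le> ennreal (C * ln (exp 1 + r / (r - 1))) * (\<integral>\<^sup>+x. ennreal \<bar>f x\<bar> * hl_maximal_pow M \<rho> r w x \<partial>M)"
      unfolding ll_def[symmetric] by (intro order_trans[OF main] mult_right_mono) auto
  qed
qed

end

text \<open>Needed for integrands involving \<open>M\<^sub>r w\<close>, whose measurability is unclear since balls need not be
  open.\<close>

lemma nn_integral_cmult_le: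
  assumes "0 \<le> c"
  shows "ennreal c * integral\<^sup>N M f \<le> (\<integral>\<^sup>+x. ennreal c * f x \<partial>M)"
proof -
  have "ennreal c * integral\<^sup>N M f = (SUP g\<in>{g. simple_function M g \<and> g \<le> f}. ennreal c * integral\<^sup>S M g)"
    unfolding nn_integral_def by (rule SUP_mult_left_ennreal)
  also have "\<dots> \<le> (\<integral>\<^sup>+x. ennreal c * f x \<partial>M)"
  proof (rule SUP_least)
    fix g assume "g \<in> {g. simple_function M g \<and> g \<le> f}"
    then have g: "simple_function M g" "g \<le> f" by auto
    have "ennreal c * integral\<^sup>S M g = integral\<^sup>S M (\<lambda>x. ennreal c * g x)" by (rule simple_integral_mult[OF g(1), symmetric])
    also have "\<dots> = (\<integral>\<^sup>+x. ennreal c * g x \<partial>M)"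
      by (rule nn_integral_eq_simple_integral[symmetric]) (use g(1) in auto)
    also have "\<dots> \<le> (\<integral>\<^sup>+x. ennreal c * f x \<partial>M)"
      by (intro nn_integral_mono mult_left_mono le_funD[OF g(2)]) simp
    finally show "ennreal c * integral\<^sup>S M g \<le> (\<integral>\<^sup>+x. ennreal c * f x \<partial>M)" .
  qed
  finally show ?thesis .
qed

context cz_operator
begin

text \<open>Scaling to level 1. \<open>T\<close> commutes with the division by \<open>t\<close> only
  almost everywhere, so \<open>F\<close> is replaced by its part \<open>F'\<close> where the scaled
  inequality holds.\<close>

lemma weak_type_bounded:
  "\<exists>C>0. \<forall>r w f x0 R b c F t. 1 < r \<longrightarrow> x0 \<in> X \<longrightarrow> 0 < R \<longrightarrow> w \<in> borel_measurable M \<longrightarrow> (\<forall>x. 0 \<le> w x) \<longrightarrow>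
     (\<forall>s. integrable M (\<lambda>x. w x powr r * indicator (B x0 s) x)) \<longrightarrow>
     f \<in> L2_functions M \<longrightarrow> (\<forall>x. \<bar>f x\<bar> \<le> b * indicator (B x0 R) x) \<longrightarrow> 0 < t \<longrightarrow>
     F \<in> sets M \<longrightarrow> F \<subseteq> B x0 R \<longrightarrow> 0 \<le> c \<longrightarrow> (\<forall>x\<in>F. t < \<bar>T f x\<bar> \<and> w x \<le> c) \<longrightarrow>
     ennreal (t * (LINT x|M. w x * indicator F x))
       \<le> ennreal (C * ln (exp 1 + r / (r - 1))) * (\<integral>\<^sup>+x. ennreal \<bar>f x\<bar> * hl_maximal_pow M \<rho> r w x \<partial>M)"
proof -
  obtain C where C: "0 < C" and ball0: "\<forall>r w f x0 R b c F. 1 < r \<longrightarrow> x0 \<in> X \<longrightarrow> 0 < R \<longrightarrow> w \<in> borel_measurable M \<longrightarrow> (\<forall>x. 0 \<le> w x) \<longrightarrow>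
     (\<forall>s. integrable M (\<lambda>x. w x powr r * indicator (B x0 s) x)) \<longrightarrow>
     f \<in> borel_measurable M \<longrightarrow> (\<forall>x. \<bar>f x\<bar> \<le> b * indicator (B x0 R) x) \<longrightarrow>
     F \<in> sets M \<longrightarrow> F \<subseteq> B x0 R \<longrightarrow> 0 \<le> c \<longrightarrow> (\<forall>x\<in>F. 1 < \<bar>T f x\<bar> \<and> w x \<le> c) \<longrightarrow>
     ennreal (LINT x|M. w x * indicator F x)
       \<le> ennreal (C * ln (exp 1 + r / (r - 1))) * (\<integral>\<^sup>+x. ennreal \<bar>f x\<bar> * hl_maximal_pow M \<rho> r w x \<partial>M)"
    using weak_type_ball by (elim exE conjE)
  note ball = ball0[rule_format]
  show ?thesis
  proof (intro exI[of _ C] conjI C allI impI)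
    fix r :: real and w f x0 R b c F and t :: real
    assume r: "1 < r" and x0: "x0 \<in> X" and R: "0 < R" and w: "w \<in> borel_measurable M" "\<forall>x. 0 \<le> w x"
      and int: "\<forall>s. integrable M (\<lambda>x. w x powr r * indicator (B x0 s) x)"
      and f: "f \<in> L2_functions M" "\<forall>x. \<bar>f x\<bar> \<le> b * indicator (B x0 R) x" and t: "0 < t"
      and F: "F \<in> sets M" "F \<subseteq> B x0 R" and c: "0 \<le> c" "\<forall>x\<in>F. t < \<bar>T f x\<bar> \<and> w x \<le> c"
    define cl where "cl = C * ln (exp 1 + r / (r - 1))"
    \<comment> \<open>Written as a linear combination of two functions, the form in which linearity
      of \<open>T\<close> is assumed.\<close>
    define g where "g = (\<lambda>x. (1 / t) * f x + 0 * f x)"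
    have gL2: "g \<in> L2_functions M" unfolding g_def by (rule L2_functions_lincomb[OF f(1) f(1)])
    note Tgm [measurable] = L2_functions_measurable[OF T_L2[OF gL2]]
    note [measurable] = F(1) w(1)
    have Tg: "AE x in M. T g x = T f x / t"
      using T_linear[OF f(1) f(1), of "1 / t" 0] unfolding g_def[symmetric] by simp
    define F' where "F' = {x\<in>X. x \<in> F \<and> 1 < \<bar>T g x\<bar>}"
    have F's [measurable]: "F' \<in> sets M" unfolding F'_def by measurable
    have "(LINT x|M. w x * indicator F x) = (LINT x|M. w x * indicator F' x)"
    proof (rule integral_cong_AE)
      show "(\<lambda>x. w x * indicator F x) \<in> borel_measurable M" "(\<lambda>x. w x * indicator F' x) \<in> borel_measurable M" by measurable
      show "AE x in M. w x * indicator F x = w x * indicator F' x"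
        using Tg AE_space
      proof eventually_elim
        case (elim x)
        have "x \<in> F \<longleftrightarrow> x \<in> F'"
          using c(2) t elim by (auto simp: F'_def abs_divide less_divide_eq)
        then show ?case by (simp add: indicator_def)
      qed
    qed
    then have "ennreal (t * (LINT x|M. w x * indicator F x)) = ennreal t * ennreal (LINT x|M. w x * indicator F' x)"
      using t by (simp add: ennreal_mult')
    also have "\<dots> \<le> ennreal t * (ennreal cl * (\<integral>\<^sup>+x. ennreal \<bar>g x\<bar> * hl_maximal_pow M \<rho> r w x \<partial>M))"
      unfolding cl_def
    proof (intro mult_left_mono ball[where b = "b / t"])
      show "1 < r" "x0 \<in> X" "0 < R" "w \<in> borel_measurable M" "F' \<in> sets M" "0 \<le> c" by fact+
      show "g \<in> borel_measurable M" by (rule L2_functions_measurable[OF gL2])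
      show "0 \<le> w x" for x using w(2) by blast
      show "integrable M (\<lambda>x. w x powr r * indicator (B x0 s) x)" for s using int by blast
      show "\<bar>g x\<bar> \<le> b / t * indicator (B x0 R) x" for x
        using divide_right_mono[OF f(2)[rule_format, of x], of t] t by (simp add: g_def abs_divide)
      show "F' \<subseteq> B x0 R" using F(2) by (auto simp: F'_def)
      show "1 < \<bar>T g x\<bar> \<and> w x \<le> c" if "x \<in> F'" for x using that c(2) by (auto simp: F'_def)
    qed simp
    also have "\<dots> = ennreal cl * (ennreal t * (\<integral>\<^sup>+x. ennreal \<bar>g x\<bar> * hl_maximal_pow M \<rho> r w x \<partial>M))"
      by (simp only: mult.left_commute)
    also have "\<dots> \<le> ennreal cl * (\<integral>\<^sup>+x. ennreal t * (ennreal \<bar>g x\<bar> * hl_maximal_pow M \<rho> r w x) \<partial>M)"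
      using t by (intro mult_left_mono nn_integral_cmult_le) auto
    also have "(\<integral>\<^sup>+x. ennreal t * (ennreal \<bar>g x\<bar> * hl_maximal_pow M \<rho> r w x) \<partial>M)
      = (\<integral>\<^sup>+x. ennreal \<bar>f x\<bar> * hl_maximal_pow M \<rho> r w x \<partial>M)"
    proof (rule nn_integral_cong)
      fix x
      have "ennreal t * ennreal \<bar>g x\<bar> = ennreal \<bar>f x\<bar>"
        using t by (simp add: g_def ennreal_mult[symmetric] abs_divide)
      then show "ennreal t * (ennreal \<bar>g x\<bar> * hl_maximal_pow M \<rho> r w x) = ennreal \<bar>f x\<bar> * hl_maximal_pow M \<rho> r w x"
        by (simp only: mult.assoc[symmetric])
    qed
    finally show "ennreal (t * (LINT x|M. w x * indicator F x))
       \<le> ennreal (C * ln (exp 1 + r / (r - 1))) * (\<integral>\<^sup>+x. ennreal \<bar>f x\<bar> * hl_maximal_pow M \<rho> r w x \<partial>M)"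
      unfolding cl_def .
  qed
qed

end

context cz_operator
begin

lemma T_diff_L2_tendsto:
  assumes f: "f \<in> L2_functions M" and g: "\<And>j. g j \<in> L2_functions M"
    and le: "\<And>j x. \<bar>g j x\<bar> \<le> \<bar>f x\<bar>" and lim: "\<And>x. x \<in> X \<Longrightarrow> (\<lambda>j. g j x) \<longlonglongrightarrow> f x"
  shows "(\<lambda>j. LINT x|M. (T f x - T (g j) x)\<^sup>2) \<longlonglongrightarrow> 0"
proof -
  define d where "d j = (\<lambda>x. 1 * f x + (- 1) * g j x)" for j
  have dL2: "d j \<in> L2_functions M" for j unfolding d_def by (rule L2_functions_lincomb[OF f g])
  have "(\<lambda>j. LINT x|M. (d j x)\<^sup>2) \<longlonglongrightarrow> (LINT x|M. 0)"
  proof (rule integral_dominated_convergence[where w = "\<lambda>x. 4 * (f x)\<^sup>2"])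
    show "integrable M (\<lambda>x. 4 * (f x)\<^sup>2)" using L2_functions_integrable[OF f] by simp
    show "(\<lambda>x. (d j x)\<^sup>2) \<in> borel_measurable M" for j using L2_functions_measurable[OF dL2] by simp
    show "AE x in M. (\<lambda>j. (d j x)\<^sup>2) \<longlonglongrightarrow> 0"
    proof (rule AE_I2)
      fix x assume x: "x \<in> X"
      have "(\<lambda>j. (d j x)\<^sup>2) \<longlonglongrightarrow> (1 * f x + (- 1) * f x)\<^sup>2"
        unfolding d_def by (intro tendsto_intros lim x)
      then show "(\<lambda>j. (d j x)\<^sup>2) \<longlonglongrightarrow> 0" by simp
    qed
    show "AE x in M. norm ((d j x)\<^sup>2) \<le> 4 * (f x)\<^sup>2" for j
    proof (rule AE_I2)
      fix x
      have "\<bar>d j x\<bar> \<le> 2 * \<bar>f x\<bar>" using le[of j x] unfolding d_def by linarith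
      then have "\<bar>d j x\<bar>\<^sup>2 \<le> (2 * \<bar>f x\<bar>)\<^sup>2" by (rule power_mono) simp
      then show "norm ((d j x)\<^sup>2) \<le> 4 * (f x)\<^sup>2" by (simp add: power_mult_distrib)
    qed
  qed simp
  then have "(\<lambda>j. A\<^sup>2 * (LINT x|M. (d j x)\<^sup>2)) \<longlonglongrightarrow> A\<^sup>2 * 0" by (intro tendsto_mult_left) simp
  then have "(\<lambda>j. A\<^sup>2 * (LINT x|M. (d j x)\<^sup>2)) \<longlonglongrightarrow> 0" by simp
  then show ?thesis
  proof (rule tendsto_zero_squeeze)
    fix j
    show "0 \<le> (LINT x|M. (T f x - T (g j) x)\<^sup>2)" by (rule integral_nonneg_AE) simp
    have "AE x in M. T (d j) x = 1 * T f x + (- 1) * T (g j) x" unfolding d_def by (rule T_linear[OF f g])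
    then have "AE x in M. (T f x - T (g j) x)\<^sup>2 = (T (d j) x)\<^sup>2" by eventually_elim simp
    then have "(LINT x|M. (T f x - T (g j) x)\<^sup>2) = (LINT x|M. (T (d j) x)\<^sup>2)"
      using L2_functions_measurable[OF T_L2[OF f]] L2_functions_measurable[OF T_L2[OF g]] L2_functions_measurable[OF T_L2[OF dL2]]
      by (intro integral_cong_AE) auto
    also have "\<dots> = (L2_norm_of M (T (d j)))\<^sup>2" by (simp add: L2_norm_of_def)
    also have "\<dots> \<le> (A * L2_norm_of M (d j))\<^sup>2" by (intro power_mono T_bounded dL2 L2_norm_nonneg)
    also have "\<dots> = A\<^sup>2 * (LINT x|M. (d j x)\<^sup>2)" by (simp add: L2_norm_of_def power_mult_distrib)
    finally show "(LINT x|M. (T f x - T (g j) x)\<^sup>2) \<le> A\<^sup>2 * (LINT x|M. (d j x)\<^sup>2)" .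
  qed
qed

lemma T_zero_AE:
  assumes f: "f \<in> L2_functions M" and z: "AE x in M. f x = 0"
  shows "AE x in M. T f x = 0"
proof -
  have "(LINT x|M. (f x)\<^sup>2) = (LINT x|M. 0)"
    using z L2_functions_measurable[OF f] by (intro integral_cong_AE) auto
  then have "L2_norm_of M (T f) \<le> 0" using T_bounded[OF f] by (simp add: L2_norm_of_def)
  then have "(LINT x|M. (T f x)\<^sup>2) \<le> 0" by (simp add: L2_norm_of_def)
  moreover have "0 \<le> (LINT x|M. (T f x)\<^sup>2)" by (rule integral_nonneg_AE) simp
  ultimately have "(LINT x|M. (T f x)\<^sup>2) = 0" by (rule antisym)
  then have "AE x in M. (T f x)\<^sup>2 = 0"
    using L2_functions_integrable[OF T_L2[OF f]] by (subst (asm) integral_nonneg_eq_0_iff_AE) auto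
  then show ?thesis by simp
qed

text \<open>The truncations \<open>g j\<close> converge to \<open>f\<close> in L^2. On the part
  \<open>E N\<close> of the level set either \<open>T (g j)\<close> exceeds \<open>t / 2\<close> in
  absolute value or it differs from \<open>T f\<close> by at least \<open>t / 2\<close>, and the
  latter set is small by Chebyshev's inequality. Halving the level doubles the constant.\<close>

lemma weak_type_L2:
  "\<exists>C>0. \<forall>r w f x0 t. 1 < r \<longrightarrow> x0 \<in> X \<longrightarrow> w \<in> borel_measurable M \<longrightarrow> (\<forall>x. 0 \<le> w x) \<longrightarrow>
     (\<forall>s. integrable M (\<lambda>x. w x powr r * indicator (B x0 s) x)) \<longrightarrow> f \<in> L2_functions M \<longrightarrow> 0 < t \<longrightarrow>
     ennreal t * (\<integral>\<^sup>+x\<in>{x\<in>X. t < \<bar>T f x\<bar>}. ennreal (w x) \<partial>M)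
       \<le> ennreal (C * ln (exp 1 + r / (r - 1))) * (\<integral>\<^sup>+x. ennreal \<bar>f x\<bar> * hl_maximal_pow M \<rho> r w x \<partial>M)"
proof -
  obtain C where C: "0 < C" and bd0: "\<forall>r w f x0 R b c F t. 1 < r \<longrightarrow> x0 \<in> X \<longrightarrow> 0 < R \<longrightarrow> w \<in> borel_measurable M \<longrightarrow> (\<forall>x. 0 \<le> w x) \<longrightarrow>
     (\<forall>s. integrable M (\<lambda>x. w x powr r * indicator (B x0 s) x)) \<longrightarrow>
     f \<in> L2_functions M \<longrightarrow> (\<forall>x. \<bar>f x\<bar> \<le> b * indicator (B x0 R) x) \<longrightarrow> 0 < t \<longrightarrow>
     F \<in> sets M \<longrightarrow> F \<subseteq> B x0 R \<longrightarrow> 0 \<le> c \<longrightarrow> (\<forall>x\<in>F. t < \<bar>T f x\<bar> \<and> w x \<le> c) \<longrightarrow>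
     ennreal (t * (LINT x|M. w x * indicator F x))
       \<le> ennreal (C * ln (exp 1 + r / (r - 1))) * (\<integral>\<^sup>+x. ennreal \<bar>f x\<bar> * hl_maximal_pow M \<rho> r w x \<partial>M)"
    using weak_type_bounded by (elim exE conjE)
  note bd = bd0[rule_format]
  show ?thesis
  proof (intro exI[of _ "2 * C"] conjI allI impI)
    show "0 < 2 * C" using C by simp
    fix r :: real and w f x0 and t :: real
    assume r: "1 < r" and x0: "x0 \<in> X" and w: "w \<in> borel_measurable M" "\<forall>x. 0 \<le> w x"
      and int: "\<forall>s. integrable M (\<lambda>x. w x powr r * indicator (B x0 s) x)"
      and f: "f \<in> L2_functions M" and t: "0 < t"
    define cl where "cl = C * ln (exp 1 + r / (r - 1))"
    define Q where "Q = (\<integral>\<^sup>+x. ennreal \<bar>f x\<bar> * hl_maximal_pow M \<rho> r w x \<partial>M)"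
    have fm [measurable]: "f \<in> borel_measurable M" by (rule L2_functions_measurable[OF f])
    have Tfm [measurable]: "T f \<in> borel_measurable M" by (rule L2_functions_measurable[OF T_L2[OF f]])
    note [measurable] = w(1)
    have Bs [measurable]: "B x0 s \<in> sets M" for s by (rule B_sets[OF x0])
    define g where "g j x = (if x \<in> B x0 (real j) \<and> \<bar>f x\<bar> \<le> real j then f x else 0)" for j x
    have gm: "g j \<in> borel_measurable M" for j unfolding g_def[abs_def] by measurable
    have g_le: "\<bar>g j x\<bar> \<le> \<bar>f x\<bar>" for j x by (simp add: g_def)
    have gL2: "g j \<in> L2_functions M" for j
      unfolding L2_functions_def
    proof (intro CollectI conjI gm Bochner_Integration.integrable_bound[OF L2_functions_integrable[OF f]])
      show "(\<lambda>x. (g j x)\<^sup>2) \<in> borel_measurable M" using gm by simp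
      show "AE x in M. norm ((g j x)\<^sup>2) \<le> norm ((f x)\<^sup>2)"
        using power_mono[OF g_le abs_ge_zero, of j _ 2] by (intro AE_I2) simp
    qed
    have g_lim: "(\<lambda>j. g j x) \<longlonglongrightarrow> f x" if x: "x \<in> X" for x
    proof (rule tendsto_eventually)
      obtain j0 where j0: "max (\<rho> x0 x) \<bar>f x\<bar> < real j0" using reals_Archimedean2 by blast
      have "g j x = f x" if j: "j0 \<le> j" for j
      proof -
        have "real j0 \<le> real j" using j by simp
        then have "\<rho> x0 x < real j" "\<bar>f x\<bar> \<le> real j" using j0 by linarith+
        then show ?thesis using x by (simp add: g_def qball_def)
      qed
      then show "\<forall>\<^sub>F j in sequentially. g j x = f x" unfolding eventually_sequentially by blast
    qed
    define E where "E N = {x\<in>X. t < \<bar>T f x\<bar> \<and> x \<in> B x0 (real N) \<and> w x \<le> real N}" for N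
    have Es [measurable]: "E N \<in> sets M" for N unfolding E_def by measurable
    have EB: "E N \<subseteq> B x0 (real N)" for N by (auto simp: E_def)
    have w_int: "integrable M (\<lambda>x. w x * indicator S x)" if S: "S \<subseteq> E N" "S \<in> sets M" for S N
    proof (rule Bochner_Integration.integrable_bound[where f = "\<lambda>x. real N * indicator (B x0 (real N)) x"])
      note [measurable] = S(2)
      show "(\<lambda>x. w x * indicator S x) \<in> borel_measurable M" by measurable
      show "integrable M (\<lambda>x. real N * indicator (B x0 (real N)) x)"
        using B_fmeasurable[OF x0] by (intro integrable_mult_right integrable_real_indicator) (auto simp: fmeasurable_def)
      show "AE x in M. norm (w x * indicator S x) \<le> norm (real N * indicator (B x0 (real N)) x)"
      proof (rule AE_I2)
        fix x
        show "norm (w x * indicator S x) \<le> norm (real N * indicator (B x0 (real N)) x)"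
        proof (cases "x \<in> S")
          case True
          then have "x \<in> E N" using S by blast
          then have "x \<in> B x0 (real N)" "w x \<le> real N" by (auto simp: E_def)
          then show ?thesis using True w(2) by simp
        qed simp
      qed
    qed
    have cut: "ennreal t * (\<integral>\<^sup>+x. ennreal (w x) * indicator (E N) x \<partial>M) \<le> ennreal (2 * cl) * Q" for N
    proof -
      define U where "U = (LINT x|M. w x * indicator (E N) x)"
      have U0: "0 \<le> U" unfolding U_def using w(2) by (intro integral_nonneg_AE AE_I2 mult_nonneg_nonneg) auto
      have "(\<integral>\<^sup>+x. ennreal (w x) * indicator (E N) x \<partial>M) = (\<integral>\<^sup>+x. ennreal (w x * indicator (E N) x) \<partial>M)"
        by (rule nn_integral_cong) (simp add: indicator_def)
      also have "\<dots> = ennreal U"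
        unfolding U_def using w(2) by (intro nn_integral_eq_integral w_int[OF order_refl Es]) auto
      finally have nnU: "(\<integral>\<^sup>+x. ennreal (w x) * indicator (E N) x \<partial>M) = ennreal U" .
      \<comment> \<open>The Chebyshev bound for the weight of the exceptional set, as
        \<open>w\<close> is at most \<open>N\<close> on \<open>E N\<close>.\<close>
      define del where "del j = real N * (2 / t)\<^sup>2 * (LINT x|M. (T f x - T (g j) x)\<^sup>2)" for j
      have del: "del \<longlonglongrightarrow> 0"
      proof -
        have "del \<longlonglongrightarrow> real N * (2 / t)\<^sup>2 * 0" unfolding del_def by (intro tendsto_intros T_diff_L2_tendsto[OF f gL2 g_le g_lim])
        then show ?thesis by simp
      qed
      have cl0: "0 \<le> cl"
      proof -
        have "0 < r / (r - 1)" using r by simp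
        then have "1 \<le> exp 1 + r / (r - 1)" using one_le_exp_iff[of 1] by linarith
        then show ?thesis using C unfolding cl_def by (intro mult_nonneg_nonneg ln_ge_zero) auto
      qed
      have step: "ennreal (t / 2 * (U - del j)) \<le> ennreal cl * Q" if j: "max N 1 \<le> j" for j
      proof -
        have Tgm [measurable]: "T (g j) \<in> borel_measurable M" by (rule L2_functions_measurable[OF T_L2[OF gL2]])
        define F where "F = {x\<in>X. x \<in> E N \<and> t / 2 < \<bar>T (g j) x\<bar>}"
        have Fs [measurable]: "F \<in> sets M" unfolding F_def by measurable
        have FE: "F \<subseteq> E N" by (auto simp: F_def)
        have dL2: "integrable M (\<lambda>x. (T f x - T (g j) x)\<^sup>2)"
          using L2_functions_integrable[OF L2_functions_lincomb[OF T_L2[OF f] T_L2[OF gL2[of j]], of 1 "- 1"]] by simp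
        have "U \<le> (LINT x|M. w x * indicator F x + real N * (2 / t)\<^sup>2 * (T f x - T (g j) x)\<^sup>2)"
          unfolding U_def
        proof (rule integral_mono[OF w_int[OF order_refl Es]])
          show "integrable M (\<lambda>x. w x * indicator F x + real N * (2 / t)\<^sup>2 * (T f x - T (g j) x)\<^sup>2)"
            by (intro Bochner_Integration.integrable_add integrable_mult_right w_int[OF FE Fs] dL2)
          fix x
          show "w x * indicator (E N) x \<le> w x * indicator F x + real N * (2 / t)\<^sup>2 * (T f x - T (g j) x)\<^sup>2"
          proof (cases "x \<in> E N \<and> x \<notin> F")
            case True
            then have x: "t < \<bar>T f x\<bar>" "w x \<le> real N" "\<bar>T (g j) x\<bar> \<le> t / 2" by (auto simp: E_def F_def)
            then have "t / 2 \<le> \<bar>T f x - T (g j) x\<bar>" by linarith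
            then have "(t / 2)\<^sup>2 \<le> \<bar>T f x - T (g j) x\<bar>\<^sup>2" using t by (intro power_mono) auto
            then have "1 \<le> (2 / t)\<^sup>2 * (T f x - T (g j) x)\<^sup>2" using t by (simp add: field_simps)
            then have "real N * 1 \<le> real N * ((2 / t)\<^sup>2 * (T f x - T (g j) x)\<^sup>2)" by (rule mult_left_mono) simp
            then show ?thesis using True x(2) by simp
          next
            case False
            then have "w x * indicator (E N) x \<le> w x * indicator F x"
              using w(2) FE by (cases "x \<in> F") auto
            then show ?thesis by (simp add: add_increasing2)
          qed
        qed
        also have "\<dots> = (LINT x|M. w x * indicator F x) + del j"
          unfolding del_def using w_int[OF FE Fs] dL2 by simp
        finally have "t / 2 * (U - del j) \<le> t / 2 * (LINT x|M. w x * indicator F x)"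
          using t by (intro mult_left_mono) auto
        then have "ennreal (t / 2 * (U - del j)) \<le> ennreal (t / 2 * (LINT x|M. w x * indicator F x))" by (rule ennreal_leI)
        also have "\<dots> \<le> ennreal cl * (\<integral>\<^sup>+x. ennreal \<bar>g j x\<bar> * hl_maximal_pow M \<rho> r w x \<partial>M)"
          unfolding cl_def
        proof (rule bd[OF r x0 _ w(1) w(2)[rule_format] int[rule_format] gL2])
          show "0 < real j" "0 < t / 2" "0 \<le> real N" using j t by auto
          show "\<bar>g j x\<bar> \<le> real j * indicator (B x0 (real j)) x" for x by (simp add: g_def)
          show "F \<in> sets M" by (rule Fs)
          show "F \<subseteq> B x0 (real j)" using FE EB[of N] B_mono[of "real N" "real j" x0] j by auto
          show "t / 2 < \<bar>T (g j) x\<bar> \<and> w x \<le> real N" if "x \<in> F" for x using that by (auto simp: F_def E_def)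
        qed
        also have "\<dots> \<le> ennreal cl * Q"
          unfolding Q_def using g_le by (intro mult_left_mono nn_integral_mono mult_right_mono ennreal_leI) auto
        finally show ?thesis .
      qed
      show ?thesis
      proof (cases "ennreal cl * Q" rule: ennreal_cases)
        case (real q)
        have lim: "(\<lambda>j. t / 2 * (U - del j)) \<longlonglongrightarrow> t / 2 * (U - 0)" by (intro tendsto_intros del)
        have "t / 2 * (U - 0) \<le> q"
        proof (rule LIMSEQ_le_const2[OF lim], intro exI[of _ "max N 1"] allI impI)
          fix j assume "max N 1 \<le> j"
          then have "ennreal (t / 2 * (U - del j)) \<le> ennreal q" using step unfolding real(2) by blast
          then show "t / 2 * (U - del j) \<le> q" using real(1) by (simp only: ennreal_le_iff)
        qed
        then have "t * U \<le> 2 * q" by simp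
        then have "ennreal (t * U) \<le> ennreal (2 * q)" by (rule ennreal_leI)
        also have "\<dots> = 2 * (ennreal cl * Q)" unfolding real(2) using real(1) by (simp add: ennreal_mult')
        also have "\<dots> = ennreal (2 * cl) * Q" using cl0 by (simp add: ennreal_mult mult.assoc)
        finally show ?thesis unfolding nnU using t U0 by (simp add: ennreal_mult)
      next
        case top
        have "ennreal (2 * cl) * Q = 2 * (ennreal cl * Q)" using cl0 by (simp add: ennreal_mult mult.assoc)
        then show ?thesis unfolding top by (simp add: ennreal_mult_top)
      qed
    qed
    have "(\<integral>\<^sup>+x\<in>{x\<in>X. t < \<bar>T f x\<bar>}. ennreal (w x) \<partial>M) = (\<integral>\<^sup>+x. (SUP N. ennreal (w x) * indicator (E N) x) \<partial>M)"
    proof (rule nn_integral_cong)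
      fix x assume x: "x \<in> X"
      show "ennreal (w x) * indicator {x\<in>X. t < \<bar>T f x\<bar>} x = (SUP N. ennreal (w x) * indicator (E N) x)"
      proof (rule antisym)
        obtain N :: nat where N: "max (\<rho> x0 x) (w x) < real N" using reals_Archimedean2 by blast
        then have "x \<in> E N \<longleftrightarrow> t < \<bar>T f x\<bar>" using x by (auto simp: E_def qball_def)
        then have "ennreal (w x) * indicator {x\<in>X. t < \<bar>T f x\<bar>} x = ennreal (w x) * indicator (E N) x"
          using x by (simp add: indicator_def)
        also have "\<dots> \<le> (SUP N. ennreal (w x) * indicator (E N) x)" by (rule SUP_upper) simp
        finally show "ennreal (w x) * indicator {x\<in>X. t < \<bar>T f x\<bar>} x \<le> (SUP N. ennreal (w x) * indicator (E N) x)" .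
        show "(SUP N. ennreal (w x) * indicator (E N) x) \<le> ennreal (w x) * indicator {x\<in>X. t < \<bar>T f x\<bar>} x"
          by (intro SUP_least mult_left_mono) (auto simp: E_def indicator_def)
      qed
    qed
    also have "\<dots> = (SUP N. \<integral>\<^sup>+x. ennreal (w x) * indicator (E N) x \<partial>M)"
    proof (rule nn_integral_monotone_convergence_SUP)
      show "incseq (\<lambda>N x. ennreal (w x) * indicator (E N) x)"
      proof (intro incseq_SucI le_funI mult_left_mono)
        fix N x
        show "(indicator (E N) x :: ennreal) \<le> indicator (E (Suc N)) x"
          by (auto simp: E_def indicator_def qball_def)
      qed simp
    qed measurable
    finally have "ennreal t * (\<integral>\<^sup>+x\<in>{x\<in>X. t < \<bar>T f x\<bar>}. ennreal (w x) \<partial>M)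
      = (SUP N. ennreal t * (\<integral>\<^sup>+x. ennreal (w x) * indicator (E N) x \<partial>M))"
      by (simp only: SUP_mult_left_ennreal)
    also have "\<dots> \<le> ennreal (2 * cl) * Q" by (intro SUP_least cut)
    finally show "ennreal t * (\<integral>\<^sup>+x\<in>{x\<in>X. t < \<bar>T f x\<bar>}. ennreal (w x) \<partial>M)
       \<le> ennreal (2 * C * ln (exp 1 + r / (r - 1))) * (\<integral>\<^sup>+x. ennreal \<bar>f x\<bar> * hl_maximal_pow M \<rho> r w x \<partial>M)"
      unfolding Q_def cl_def by (simp only: mult.assoc)
  qed
qed

end

section \<open>Weights whose power is not locally integrable\<close>

context homogeneous_space
begin

text \<open>A large ball about \<open>x0\<close> contains both \<open>x\<close> and the given ball,
  so one ball on which \<open>w powr r\<close> is not integrable makes the maximal function infinite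
  everywhere.\<close>

lemma hl_maximal_pow_infinite:
  assumes x0: "x0 \<in> X" and w: "w \<in> borel_measurable M"
    and nint: "\<not> integrable M (\<lambda>x. w x powr r * indicator (B x0 s) x)" and x: "x \<in> X"
  shows "hl_maximal_pow M \<rho> r w x = \<infinity>"
proof -
  define R where "R = max s (\<rho> x0 x + 1)"
  have R: "0 < R" "x \<in> B x0 R" using rho_nonneg[OF x0 x] x by (auto simp: R_def qball_def)
  note [measurable] = w B_sets[OF x0]
  have "(\<lambda>x. w x powr r * indicator (B x0 s) x) \<in> borel_measurable M" by measurable
  then have "\<infinity> = (\<integral>\<^sup>+x. ennreal (norm (w x powr r * indicator (B x0 s) x)) \<partial>M)"
    using nint unfolding integrable_iff_bounded by (auto simp: less_top[symmetric])
  also have "\<dots> \<le> (\<integral>\<^sup>+y\<in>B x0 R. ennreal \<bar>w y powr r\<bar> \<partial>M)"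
  proof (rule nn_integral_mono)
    fix y
    show "ennreal (norm (w y powr r * indicator (B x0 s) y)) \<le> ennreal \<bar>w y powr r\<bar> * indicator (B x0 R) y"
      using B_mono[of s R x0] by (cases "y \<in> B x0 s") (auto simp: R_def)
  qed
  finally have top: "(\<integral>\<^sup>+y\<in>B x0 R. ennreal \<bar>w y powr r\<bar> \<partial>M) = \<infinity>" by (simp add: top_unique)
  have "(\<integral>\<^sup>+y\<in>B x0 R. ennreal \<bar>w y powr r\<bar> \<partial>M) / emeasure M (B x0 R) \<le> hl_maximal M \<rho> (\<lambda>y. w y powr r) x"
    unfolding hl_maximal_def by (rule SUP_upper) (use x0 R in \<open>auto simp: qballs_def\<close>)
  then have "hl_maximal M \<rho> (\<lambda>y. w y powr r) x = \<infinity>"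
    unfolding top using B_fin[OF x0, of R] by (simp add: ennreal_top_divide top_unique less_top[symmetric])
  then show ?thesis by (simp add: hl_maximal_pow_def ennreal_powr_def)
qed

lemma hl_maximal_pow_cong_AE:
  assumes "AE y in M. w y = w' y"
  shows "hl_maximal_pow M \<rho> r w x = hl_maximal_pow M \<rho> r w' x"
proof -
  have "(\<integral>\<^sup>+y\<in>S. ennreal \<bar>w y powr r\<bar> \<partial>M) = (\<integral>\<^sup>+y\<in>S. ennreal \<bar>w' y powr r\<bar> \<partial>M)" for S
    using assms by (intro nn_integral_cong_AE) (auto elim: eventually_mono)
  then show ?thesis unfolding hl_maximal_pow_def hl_maximal_def by simp
qed

end

theorem theorem3p3:
  fixes M :: "'a measure"
    and \<rho> :: "'a \<Rightarrow> 'a \<Rightarrow> real"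
    and T :: "('a \<Rightarrow> real) \<Rightarrow> 'a \<Rightarrow> real"
  assumes "homogeneous_type_space M \<rho>"
    and "calderon_zygmund_operator M \<rho> T"
  shows "\<exists>C::real. 0 < C \<and>
    (\<forall>(w::'a \<Rightarrow> real) (r::real) (f::'a \<Rightarrow> real).
       weight M \<rho> w \<longrightarrow> 1 < r \<longrightarrow> f \<in> L2_functions M \<longrightarrow>
       weighted_weak_L1_norm M w (T f)
         \<le> ennreal (C * ln (exp 1 + r / (r - 1)))
             * weighted_L1_norm M (hl_maximal_pow M \<rho> r w) f)"
proof -
  obtain \<kappa> Dm where hs: "homogeneous_space M \<rho> \<kappa> Dm" by (rule homogeneous_type_spaceE[OF assms(1)])
  then obtain K \<eta> CK A where "cz_operator M \<rho> \<kappa> Dm T K \<eta> CK A"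
    using homogeneous_space.cz_operator_exists[OF hs assms(2)] by blast
  then interpret cz_operator M \<rho> \<kappa> Dm T K \<eta> CK A .
  obtain C where C: "0 < C" and weak0: "\<forall>r w f x0 t. 1 < r \<longrightarrow> x0 \<in> X \<longrightarrow> w \<in> borel_measurable M \<longrightarrow> (\<forall>x. 0 \<le> w x) \<longrightarrow>
     (\<forall>s. integrable M (\<lambda>x. w x powr r * indicator (B x0 s) x)) \<longrightarrow> f \<in> L2_functions M \<longrightarrow> 0 < t \<longrightarrow>
     ennreal t * (\<integral>\<^sup>+x\<in>{x\<in>X. t < \<bar>T f x\<bar>}. ennreal (w x) \<partial>M)
       \<le> ennreal (C * ln (exp 1 + r / (r - 1))) * (\<integral>\<^sup>+x. ennreal \<bar>f x\<bar> * hl_maximal_pow M \<rho> r w x \<partial>M)"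
    using weak_type_L2 by (elim exE conjE)
  note weak = weak0[rule_format]
  show ?thesis
  proof (intro exI[of _ C] conjI C allI impI)
    fix w :: "'a \<Rightarrow> real" and r :: real and f :: "'a \<Rightarrow> real"
    assume w: "weight M \<rho> w" and r: "1 < r" and f: "f \<in> L2_functions M"
    define cl where "cl = C * ln (exp 1 + r / (r - 1))"
    have cl: "0 < cl"
    proof -
      have "0 < r / (r - 1)" using r by simp
      then have "1 < exp 1 + r / (r - 1)" using one_le_exp_iff[of 1] by linarith
      then show ?thesis using C unfolding cl_def by (intro mult_pos_pos ln_gt_zero) auto
    qed
    \<comment> \<open>A weight is positive only almost everywhere, while the estimates ask for a
      nonnegative function. Neither \<open>ennreal (w x)\<close> nor the maximal function sees the
      change.\<close>
    define w' where "w' x = max (w x) 0" for x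
    have wm [measurable]: "w \<in> borel_measurable M" using w by (simp add: weight_def)
    have w'm: "w' \<in> borel_measurable M" unfolding w'_def[abs_def] by measurable
    have "AE x in M. 0 < w x" using w by (simp add: weight_def)
    then have ww: "AE x in M. w x = w' x" by eventually_elim (simp add: w'_def)
    have ew: "ennreal (w x) = ennreal (w' x)" for x by (simp add: w'_def max_def ennreal_neg)
    have fm [measurable]: "f \<in> borel_measurable M" by (rule L2_functions_measurable[OF f])
    have level: "ennreal t * (\<integral>\<^sup>+x\<in>{x\<in>X. t < \<bar>T f x\<bar>}. ennreal (w x) \<partial>M)
       \<le> ennreal cl * (\<integral>\<^sup>+x. ennreal \<bar>f x\<bar> * hl_maximal_pow M \<rho> r w x \<partial>M)" if t: "0 < t" for t
    proof (cases "X = {}")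
      case True
      then show ?thesis by (simp add: nn_integral_empty)
    next
      case False
      then obtain x0 where x0: "x0 \<in> X" by blast
      show ?thesis
      proof (cases "\<forall>s. integrable M (\<lambda>x. w' x powr r * indicator (B x0 s) x)")
        case True
        show ?thesis unfolding ew hl_maximal_pow_cong_AE[OF ww] cl_def
          by (rule weak[OF r x0 w'm _ True[rule_format] f t]) (simp add: w'_def)
      next
        case False
        then obtain s where s: "\<not> integrable M (\<lambda>x. w' x powr r * indicator (B x0 s) x)" by blast
        have top: "hl_maximal_pow M \<rho> r w x = \<infinity>" if "x \<in> X" for x
          unfolding hl_maximal_pow_cong_AE[OF ww] by (rule hl_maximal_pow_infinite[OF x0 w'm s that])
        \<comment> \<open>\<open>M_r w\<close> is now infinite everywhere, so the right side is
          infinite unless \<open>f\<close> vanishes almost everywhere. In that case the convention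
          for \<open>0 * \<infinity>\<close> makes it 0, and the left side vanishes because
          \<open>T f\<close> does.\<close>
        show ?thesis
        proof (cases "AE x in M. f x = 0")
          case True
          have "(\<integral>\<^sup>+x\<in>{x\<in>X. t < \<bar>T f x\<bar>}. ennreal (w x) \<partial>M) = (\<integral>\<^sup>+x. 0 \<partial>M)"
          proof (rule nn_integral_cong_AE)
            show "AE x in M. ennreal (w x) * indicator {x\<in>X. t < \<bar>T f x\<bar>} x = 0"
              using T_zero_AE[OF f True] by eventually_elim (use t in simp)
          qed
          then show ?thesis by simp
        next
          case False
          have "(\<integral>\<^sup>+x. ennreal \<bar>f x\<bar> * hl_maximal_pow M \<rho> r w x \<partial>M) = (\<integral>\<^sup>+x. ennreal \<bar>f x\<bar> * \<infinity> \<partial>M)"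
            by (rule nn_integral_cong) (simp add: top)
          also have "\<dots> = (\<integral>\<^sup>+x. ennreal \<bar>f x\<bar> \<partial>M) * \<infinity>" by (rule nn_integral_multc) measurable
          also have "\<dots> = \<infinity>"
          proof -
            have "(\<integral>\<^sup>+x. ennreal \<bar>f x\<bar> \<partial>M) \<noteq> 0" using False by (subst nn_integral_0_iff_AE) auto
            then show ?thesis by (simp add: ennreal_mult_top)
          qed
          finally show ?thesis using cl by (simp add: ennreal_mult_top)
        qed
      qed
    qed
    show "weighted_weak_L1_norm M w (T f)
         \<le> ennreal (C * ln (exp 1 + r / (r - 1))) * weighted_L1_norm M (hl_maximal_pow M \<rho> r w) f"
      unfolding weighted_weak_L1_norm_def weighted_L1_norm_def cl_def[symmetric]
      by (intro SUP_least level) simp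
  qed
qed

end
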